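(* Let $0<\alpha<1$, let $\xi_\alpha$ be fractional Brownian motion with exponent $\alpha$ on $(\Omega,\mathcal{F},P)$, let $f\in L^{\frac{2}{1+\alpha}}([0,\infty))$ be a deterministic real function, and let $0<\beta<\alpha$. For a function $h$ write $$q_h(s,t)=C\alpha(\alpha+1)\int_s^t\int_s^t h(u)h(v)\frac{du\,dv}{|u-v|^{1-\alpha}}.$$ If $f\in L^{\frac{2}{1+\beta}}([0,1])$, then: 1. the process $\int_0^t f(\tau)\,d\xi_\alpha(\tau,\omega)$, $t\in[0,1]$, has a version that for a.e. $\omega$ is continuous in $t$; 2. for every real $r$ and every real $\lambda$, $P\bigl(\max_{0\le t\le1}\int_0^t f(\tau)\,d\xi_\alpha(\tau,\omega)>\lambda\bigr)$ is bounded from above by $$\int_{\lambda r/\sqrt{q_{f_+}(0,1)}}^{\infty}\sqrt{\frac{2}{\pi}}\,e^{-x^2/2}\,dx+\int_{\lambda(1-r)/\sqrt{q_{f_-}(0,1)}}^{\infty}\sqrt{\frac{2}{\pi}}\,e^{-x^2/2}\,dx,\qquad f_\pm=\frac{|f|\pm f}{2};$$ 3. for every integer $m\ge2$ and real $\lambda\ge\sqrt{1+\log m^4}$, $P\bigl(\max_{0\le t\le1}\bigl|\int_0^t f(\tau)\,d\xi_\alpha(\tau,\omega)\bigr|>\lambda\bigr)$ is bounded from above by $$\int_{\lambda/c}^{\infty}\frac52\,m^2\,e^{-x^2/2}\,dx,\qquad\text{where}\quad c=\sup_{0\le s,t\le1}\sqrt{q_f(s,t)}+(2+\sqrt2)\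int_1^\infty\sup_{|s-t|<m^{-x^2}}\sqrt{q_f(s,t)}\,dx<\infty.$$
   Context: Fractional Brownian motion $\xi_\alpha(t,\omega)$, $t\ge0$, with exponent $\alpha$ is the centered Gaussian process with stationary increments and covariance $E(\xi_\alpha(s)\xi_\alpha(t))=C(s^{1+\alpha}+t^{1+\alpha}-|s-t|^{1+\alpha})$, where $C=-\frac{\Gamma(1-\alpha)}{\alpha}\,\frac{\cos(\frac{1+\alpha}{2}\pi)}{\frac{1+\alpha}{2}\pi}>0$; this is the constant $C$ in $q_h$. For a function $\phi=\sum_{i=0}^{2^n-1}\phi(s_i^n)\chi_{[s_i^n,s_{i+1}^n]}$ with $s_i^n=\frac{i}{2^n}t$, the integral is $\int_0^t\phi\,d\xi_\alpha=\sum_i\phi(s_i^n)(\xi_\alpha(s_{i+1}^n)-\xi_\alpha(s_i^n))$; for $f\in L^{\frac{2}{1+\alpha}}([0,\infty))$, $\int_0^t f\,d\xi_\alpha$ is the $L^2(\Omega)$-limit of $\int_0^t\phi_n\,d\xi_\alpha$ for such simple functions $\phi_n\to f$ in $L^{\frac{2}{1+\alpha}}([0,t])$ (the limit does not depend on the sequence). In parts 2 and 3 the continuous version is used; in part 3 the points $s,t$ in the suprema range over $[0,1]$. If $q_{f_+}(0,1)$, $q_{f_-}(0,1)$ or $c$ vanishes, the quotient having it (or its square root) as denominator is understood as the limit as that denominator decreases to $0$ (so $0/0$ is read as $0$). *)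

theory Defs
  imports "HOL-Probability.Probability"
begin

subsection \<open>Fractional Brownian motion\<close>

text \<open>Point masses count as (degenerate) normal distributions.\<close>

definition gaussian_rv :: "'a measure \<Rightarrow> ('a \<Rightarrow> real) \<Rightarrow> bool" where
  "gaussian_rv M X \<longleftrightarrow> X \<in> borel_measurable M \<and>
     ((\<exists>\<mu> \<sigma>. 0 < \<sigma> \<and> distributed M lborel X (normal_density \<mu> \<sigma>)) \<or>
      (\<exists>\<mu>. AE \<omega> in M. X \<omega> = \<mu>))"

definition gaussian_process ::
    "'a measure \<Rightarrow> real set \<Rightarrow> (real \<Rightarrow> 'a \<Rightarrow> real) \<Rightarrow> bool" where
  "gaussian_process M T X \<longleftrightarrow>
     (\<forall>F a. finite F \<and> F \<subseteq> T \<longrightarrow> gaussian_rv M (\<lambda>\<omega>. \<Sum>t\<in>F. a t * X t \<omega>))"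

definition stationary_increments :: "'a measure \<Rightarrow> (real \<Rightarrow> 'a \<Rightarrow> real) \<Rightarrow> bool" where
  "stationary_increments M X \<longleftrightarrow>
     (\<forall>h\<ge>0. \<forall>F. finite F \<and> F \<subseteq> {0..} \<longrightarrow>
        distr M (Pi\<^sub>M F (\<lambda>_. borel)) (\<lambda>\<omega>. \<lambda>t\<in>F. X (t + h) \<omega> - X h \<omega>) =
        distr M (Pi\<^sub>M F (\<lambda>_. borel)) (\<lambda>\<omega>. \<lambda>t\<in>F. X t \<omega> - X 0 \<omega>))"

definition fbm_const :: "real \<Rightarrow> real" where
  "fbm_const \<alpha> = - (Gamma (1 - \<alpha>) / \<alpha>) * (cos ((1 + \<alpha>) / 2 * pi) / ((1 + \<alpha>) / 2 * pi))"

definition fractional_brownian_motion ::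
    "'a measure \<Rightarrow> real \<Rightarrow> (real \<Rightarrow> 'a \<Rightarrow> real) \<Rightarrow> bool" where
  "fractional_brownian_motion M \<alpha> \<xi> \<longleftrightarrow>
     gaussian_process M {0..} \<xi> \<and>
     (\<forall>t\<ge>0. (\<integral>\<omega>. \<xi> t \<omega> \<partial>M) = 0) \<and>
     stationary_increments M \<xi> \<and>
     (\<forall>s\<ge>0. \<forall>t\<ge>0. (\<integral>\<omega>. \<xi> s \<omega> * \<xi> t \<omega> \<partial>M) =
        fbm_const \<alpha> * (s powr (1 + \<alpha>) + t powr (1 + \<alpha>) - \<bar>s - t\<bar> powr (1 + \<alpha>)))"


subsection \<open>The stochastic integral of a deterministic function\<close>

definition in_Lp :: "real \<Rightarrow> real set \<Rightarrow> (real \<Rightarrow> real) \<Rightarrow> bool" where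
  "in_Lp p S f \<longleftrightarrow>
     set_borel_measurable lebesgue S f \<and> set_integrable lebesgue S (\<lambda>x. \<bar>f x\<bar> powr p)"

text \<open>The coefficient \<open>a i\<close> is the value attached to the node \<open>i / 2 ^ n * t\<close>. The closed intervals
  overlap at the nodes, so \<open>dyadic_step\<close> takes the value \<open>a i\<close> there only up to a null set; this is
  immaterial, since step functions enter only as elements of an \<open>L\<^sup>p\<close> space.\<close>

definition dyadic_step :: "real \<Rightarrow> nat \<Rightarrow> (nat \<Rightarrow> real) \<Rightarrow> real \<Rightarrow> real" where
  "dyadic_step t n a x =
     (\<Sum>i<2 ^ n. a i * indicator {real i / 2 ^ n * t .. real (Suc i) / 2 ^ n * t} x)"

definition dyadic_integral ::
    "(real \<Rightarrow> 'a \<Rightarrow> real) \<Rightarrow> real \<Rightarrow> nat \<Rightarrow> (nat \<Rightarrow> real) \<Rightarrow> 'a \<Rightarrow> real" where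
  "dyadic_integral \<xi> t n a \<omega> =
     (\<Sum>i<2 ^ n. a i * (\<xi> (real (Suc i) / 2 ^ n * t) \<omega> - \<xi> (real i / 2 ^ n * t) \<omega>))"

definition step_approx ::
    "real \<Rightarrow> real \<Rightarrow> (real \<Rightarrow> real) \<Rightarrow> (nat \<Rightarrow> nat) \<Rightarrow> (nat \<Rightarrow> nat \<Rightarrow> real) \<Rightarrow> bool" where
  "step_approx p t f N a \<longleftrightarrow>
     (\<lambda>k. \<integral>\<^sup>+x\<in>{0..t}. ennreal (\<bar>dyadic_step t (N k) (a k) x - f x\<bar> powr p) \<partial>lebesgue)
       \<longlonglongrightarrow> 0"

text \<open>\<open>has_fbm_integral M \<xi> \<alpha> f t X\<close>: the random variable \<open>X\<close> represents the element
  \<open>\<integral>\<^sub>0\<^sup>t f d\<xi>\<close> of \<open>L\<^sup>2(\<Omega>)\<close>. This determines \<open>X\<close> only up to almost sure equality, so the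
  versions of the process \<open>t \<mapsto> \<integral>\<^sub>0\<^sup>t f d\<xi>\<close> on an index set \<open>T\<close> are exactly the families \<open>Y\<close> with
  \<open>has_fbm_integral M \<xi> \<alpha> f t (Y t)\<close> for all \<open>t \<in> T\<close>.\<close>

definition has_fbm_integral ::
    "'a measure \<Rightarrow> (real \<Rightarrow> 'a \<Rightarrow> real) \<Rightarrow> real \<Rightarrow> (real \<Rightarrow> real) \<Rightarrow> real \<Rightarrow> ('a \<Rightarrow> real) \<Rightarrow> bool"
  where
  "has_fbm_integral M \<xi> \<alpha> f t X \<longleftrightarrow>
     X \<in> borel_measurable M \<and>
     (\<exists>N a. step_approx (2 / (1 + \<alpha>)) t f N a) \<and>
     (\<forall>N a. step_approx (2 / (1 + \<alpha>)) t f N a \<longrightarrow>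
        (\<lambda>k. \<integral>\<^sup>+\<omega>. ennreal ((dyadic_integral \<xi> t (N k) (a k) \<omega> - X \<omega>)\<^sup>2) \<partial>M) \<longlonglongrightarrow> 0)"

definition continuous_version ::
    "'a measure \<Rightarrow> (real \<Rightarrow> 'a \<Rightarrow> real) \<Rightarrow> real \<Rightarrow> (real \<Rightarrow> real) \<Rightarrow> (real \<Rightarrow> 'a \<Rightarrow> real) \<Rightarrow> bool"
  where
  "continuous_version M \<xi> \<alpha> f Y \<longleftrightarrow>
     (\<forall>t\<in>{0..1}. has_fbm_integral M \<xi> \<alpha> f t (Y t)) \<and>
     (AE \<omega> in M. continuous_on {0..1} (\<lambda>t. Y t \<omega>))"


subsection \<open>The quantities in the bounds\<close>

text \<open>The interval integrals are oriented, so \<open>s > t\<close> is allowed.\<close>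

definition fbm_q :: "real \<Rightarrow> (real \<Rightarrow> real) \<Rightarrow> real \<Rightarrow> real \<Rightarrow> real" where
  "fbm_q \<alpha> h s t = fbm_const \<alpha> * \<alpha> * (\<alpha> + 1) *
     (LINT v=ereal s..ereal t|lebesgue. (LINT u=ereal s..ereal t|lebesgue.
        (h u * h v / \<bar>u - v\<bar> powr (1 - \<alpha>))))"

definition pos_part :: "(real \<Rightarrow> real) \<Rightarrow> real \<Rightarrow> real" where
  "pos_part f x = (\<bar>f x\<bar> + f x) / 2"

definition neg_part :: "(real \<Rightarrow> real) \<Rightarrow> real \<Rightarrow> real" where
  "neg_part f x = (\<bar>f x\<bar> - f x) / 2"

definition fbm_c :: "real \<Rightarrow> (real \<Rightarrow> real) \<Rightarrow> nat \<Rightarrow> ennreal" where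
  "fbm_c \<alpha> f m =
     (SUP (s, t)\<in>{0..1} \<times> {0..1}. ennreal (sqrt (fbm_q \<alpha> f s t))) +
     ennreal (2 + sqrt 2) *
       (\<integral>\<^sup>+x\<in>{1..}.
          (SUP (s, t)\<in>{(s, t). s \<in> {0..1} \<and> t \<in> {0..1} \<and> \<bar>s - t\<bar> < real m powr (- (x\<^sup>2))}.
             ennreal (sqrt (fbm_q \<alpha> f s t))) \<partial>lborel)"

text \<open>\<open>P(E) \<le> b\<close>, where \<open>E\<close> is an event of the completed probability space: as paths are continuous
  only almost surely, the events involving a supremum over \<open>[0,1]\<close> are events of the completion.
  Measurability is required explicitly because \<open>measure\<close> is \<open>0\<close> off the \<open>\<sigma>\<close>-algebra.\<close>

definition prob_le :: "'a measure \<Rightarrow> ('a \<Rightarrow> bool) \<Rightarrow> real \<Rightarrow> bool" where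
  "prob_le M E b \<longleftrightarrow>
     {\<omega> \<in> space M. E \<omega>} \<in> sets (completion M) \<and>
     measure (completion M) {\<omega> \<in> space M. E \<omega>} \<le> b"

text \<open>In the bounds, quotients with a possibly vanishing denominator are formed in the extended reals,
  where \<open>x / 0\<close> is \<open>\<infinity>\<close>, \<open>0\<close> or \<open>-\<infinity>\<close> according to the sign of \<open>x\<close>. This is the limit as the
  denominator decreases to \<open>0\<close>:\<close>

lemma ereal_divide_zero:
  fixes x :: real
  shows "ereal x / ereal 0 = (if x > 0 then \<infinity> else if x = 0 then 0 else - \<infinity>)"
  by (auto simp: divide_ereal_def zero_ereal_def[symmetric])

end

theory Submission
  imports Defs "HOL-Real_Asymp.Real_Asymp"
begin

text \<open>The integral \<open>\<integral>\<^sub>0\<^sup>t f d\<xi>\<close> is a centred Gaussian variable, and jointly in \<open>t\<close> its covariances are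
\<open>\<kappa> \<integral>\<integral> f(u) f(v) \<bar>u - v\<bar>\<^sup>\<alpha>\<^sup>-\<^sup>1\<close> over \<open>[0,s] \<times> [0,t]\<close>, with \<open>\<kappa> = C \<alpha> (\<alpha> + 1)\<close> (lemma \<open>integral_family_gauss\<close>).
For indicator functions this is the covariance formula of \<open>\<xi>\<close>; it extends to \<open>L\<^sup>p\<close>, \<open>p = 2/(1+\<alpha>)\<close>, because the Riesz
form \<open>\<integral>\<integral> g(u) h(v) \<bar>u - v\<bar>\<^sup>\<alpha>\<^sup>-\<^sup>1\<close> is bounded on \<open>L\<^sup>p\<close> (the Hardy-Littlewood-Sobolev inequality, lemma \<open>hls\<close>) and
Gaussianity survives limits in \<open>L\<^sup>2(\<Omega>)\<close>. In particular \<open>q\<^sub>f(s,t)\<close> is the variance of the increment over \<open>[s,t]\<close>. If \<open>f\<close>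
is even in \<open>L\<^sup>p\<close> for the exponent belonging to \<open>\<beta>\<close>, the same inequality for \<open>\<beta>\<close> gives
\<open>q\<^sub>f(s,t) \<le> C' \<bar>s - t\<bar>\<^sup>\<alpha>\<^sup>-\<^sup>\<beta>\<close> (lemma \<open>fbm_q_modulus\<close>). Hence the increments over dyadic intervals of length \<open>2\<^sup>-\<^sup>n\<close> are
almost surely bounded by a geometric sequence, and the values at dyadic points extend to a continuous version
(lemma \<open>continuous_version_ex\<close>). The same modulus makes \<open>c\<close> finite. For continuous paths both suprema are controlled
by maxima over finite grids (lemma \<open>sup_event\<close>), so the two tail bounds are statements about Gaussian vectors.

Part 2. Write \<open>f = f\<^sub>+ - f\<^sub>-\<close>; then \<open>max \<integral> f d\<xi> > \<lambda>\<close> forces \<open>max \<integral> f\<^sub>+ d\<xi> > \<lambda>r\<close> or \<open>max (- \<integral> f\<^sub>- d\<xi>) > \<lambda>(1-r)\<close>. For a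
nonnegative integrand the increments are nonnegatively correlated, since the kernel is positive. By Slepian's
comparison such a vector of partial sums exceeds a level less often than one with independent increments and the same
variances, and for the latter Levy's reflection argument bounds the maximum by twice the tail of the last sum
(lemma \<open>gauss_max_le\<close>). Slepian's comparison is obtained by moving from one covariance matrix to the other in small
steps. A step replaces a component \<open>\<surd>w (e\<^sub>a + e\<^sub>b) Z\<close> by \<open>\<surd>w (e\<^sub>a - e\<^sub>b) Z\<close>, where \<open>Z\<close> is an independent standard
normal variable: with everything else fixed, the coordinates of the first vector are monotone in \<open>Z\<close>, so the event
that some coordinate is large is governed by a single coordinate, and that coordinate has the same law in the second
vector (lemmas \<open>gvec_column_le\<close> and \<open>slepian_regularised\<close>). A small multiple of the identity added to all matrices keeps
them positive along the way and is removed in the limit.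

Part 3. With \<open>x = \<lambda>/c\<close> and \<open>Q\<close> the standard normal tail, choose grids with \<open>N\<^sub>k\<close> points and thresholds \<open>\<tau>\<^sub>k x\<close>: if the
supremum over the \<open>n\<close>-th grid exceeds \<open>x (\<tau>\<^sub>0 \<sigma> + \<Sum> \<tau>\<^sub>k\<^sub>+\<^sub>1 d\<^sub>k)\<close>, where \<open>\<sigma>\<close> bounds the standard deviations and \<open>d\<^sub>k\<close> those of
increments shorter than the \<open>k\<close>-th mesh, then some value on the first grid or some link between neighbouring grids is
large, which has probability at most \<open>\<Sum> 2 N\<^sub>k Q(\<tau>\<^sub>k x)\<close> (lemma \<open>chain_bound\<close>). The integral in \<open>c\<close> dominates
Riemann sums \<open>\<Sum> (v\<^sub>k\<^sub>+\<^sub>1 - v\<^sub>k) d\<^sub>k\<close>, which therefore may be counted with the factor \<open>2 + \<surd>2\<close>. For \<open>x\<^sup>2 \<ge> 1 + 4 log m\<close> Fernique's choice \<open>N\<^sub>k = m\<close> to the power \<open>2\<^sup>k\<^sup>+\<^sup>1\<close>, \<open>\<tau>\<^sub>k = 2\<^sup>k\<^sup>/\<^sup>2\<close> gives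
the bound. The assumption on \<open>\<lambda>\<close> does not bound \<open>\<lambda>/c\<close> from below, so smaller \<open>x\<close> have to be treated as well. There the
asserted bound is below \<open>1\<close> only if \<open>x\<^sup>2\<close> is at least about \<open>(11/3) log m\<close>, and a slower growth with ratio \<open>6/5\<close> is used: the
even and the odd levels form two chains whose thresholds add up to at most \<open>2c\<close>, so one of the two chains stays below
\<open>c\<close>, and for both the sum of the tails is small enough (lemmas \<open>even_chain_sum\<close>, \<open>odd_chain_sum\<close>).\<close>

section \<open>The Hardy-Littlewood-Sobolev inequality on the line\<close>

text \<open>The \<open>p\<close>-th power of the \<open>L\<^sup>p\<close> norm. Without the root, sums can be handled by an elementary inequality instead of
Minkowski's.\<close>

definition Lpn :: "real \<Rightarrow> (real \<Rightarrow> real) \<Rightarrow> ennreal" where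
  "Lpn p h = (\<integral>\<^sup>+x. ennreal (\<bar>h x\<bar> powr p) \<partial>lborel)"

lemma nn_integral_abs_shift:
  fixes F :: "real \<Rightarrow> ennreal"
  assumes [measurable]: "F \<in> borel_measurable borel"
  shows "(\<integral>\<^sup>+u. F \<bar>u - v\<bar> \<partial>lborel) = 2 * (\<integral>\<^sup>+w. F w * indicator {0..} w \<partial>lborel)"
proof -
  have "(\<integral>\<^sup>+u. F \<bar>u - v\<bar> \<partial>lborel) = (\<integral>\<^sup>+w. F \<bar>w\<bar> \<partial>lborel)"
    by (subst nn_integral_real_affine[where c=1 and t=v]) auto
  also have "\<dots> = (\<integral>\<^sup>+w. F \<bar>w\<bar> * indicator {0..} w + F \<bar>w\<bar> * indicator {..<0} w \<partial>lborel)"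
    by (intro nn_integral_cong) (auto split: split_indicator)
  also have "\<dots> = (\<integral>\<^sup>+w. F \<bar>w\<bar> * indicator {0..} w \<partial>lborel) + (\<integral>\<^sup>+w. F \<bar>w\<bar> * indicator {..<0} w \<partial>lborel)"
    by (rule nn_integral_add) auto
  also have "(\<integral>\<^sup>+w. F \<bar>w\<bar> * indicator {..<0} w \<partial>lborel) = (\<integral>\<^sup>+w. F \<bar>w\<bar> * indicator {0..} w \<partial>lborel)"
  proof -
    have "(\<integral>\<^sup>+w. F \<bar>w\<bar> * indicator {..<0} w \<partial>lborel) = (\<integral>\<^sup>+w. F \<bar>w\<bar> * indicator {..<0} (- w) \<partial>lborel)"
      by (subst nn_integral_real_affine[where c="-1" and t=0]) auto
    also have "\<dots> = (\<integral>\<^sup>+w. F \<bar>w\<bar> * indicator {0..} w \<partial>lborel)"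
      using AE_lborel_singleton[of "0::real"]
      by (intro nn_integral_cong_AE) (auto elim!: eventually_mono split: split_indicator)
    finally show ?thesis .
  qed
  also have "(\<integral>\<^sup>+w. F \<bar>w\<bar> * indicator {0..} w \<partial>lborel) = (\<integral>\<^sup>+w. F w * indicator {0..} w \<partial>lborel)"
    by (intro nn_integral_cong) (auto split: split_indicator)
  finally show ?thesis by (simp add: mult_2)
qed

lemma nn_integral_powr_Icc:
  assumes "a > -1" "c \<ge> 0"
  shows "(\<integral>\<^sup>+w. ennreal (w powr a) * indicator {0..c} w \<partial>lborel) = ennreal (c powr (a + 1) / (a + 1))"
proof -
  have "((\<lambda>w. if w \<in> {0..c} then w powr a else 0) has_integral (c powr (a + 1) / (a + 1))) UNIV"
    using has_integral_powr_from_0[OF assms] by (subst has_integral_restrict_UNIV)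
  then have "(\<integral>\<^sup>+w. ennreal (if w \<in> {0..c} then w powr a else 0) \<partial>lborel) = ennreal (c powr (a + 1) / (a + 1))"
    by (intro nn_integral_has_integral_lborel) auto
  then show ?thesis
    by (subst (asm) nn_integral_cong[where v="\<lambda>w. ennreal (w powr a) * indicator {0..c} w"])
       (auto split: split_indicator)
qed

lemma nn_integral_inverse_square:
  assumes "R > (0::real)"
  shows "(\<integral>\<^sup>+w. ennreal (1 / w\<^sup>2) * indicator {R..} w \<partial>lborel) = ennreal (1 / R)"
proof -
  have "(\<integral>\<^sup>+w. ennreal (1 / w\<^sup>2) * indicator {R..} w \<partial>lborel) = ennreal (0 - (- (1 / R)))"
  proof (rule nn_integral_FTC_atLeast)
    show "((\<lambda>w. - (1 / w)) has_real_derivative 1 / w\<^sup>2) (at w)" if "R \<le> w" for w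
      using that assms by (auto intro!: derivative_eq_intros simp: power2_eq_square field_simps)
    show "((\<lambda>w::real. - (1 / w)) \<longlongrightarrow> 0) at_top"
      by real_asymp
  qed auto
  then show ?thesis by simp
qed

text \<open>The part of the fractional integral of \<open>h\<close> at \<open>v\<close> that comes from the places where \<open>h\<close> is at most \<open>l\<close>. Within the radius
\<open>R = l\<^sup>-\<^sup>p\<close> bound \<open>h\<close> by \<open>l\<close>; outside, Young's inequality splits the integrand into a multiple of \<open>h\<^sup>p\<close> and a multiple of
\<open>\<bar>u - v\<bar>\<^sup>-\<^sup>2\<close>. With this radius all three terms scale like \<open>l\<^sup>p\<^sup>-\<^sup>1\<close>.\<close>

lemma hls_one_point:
  assumes \<alpha>: "0 < \<alpha>" "\<alpha> < 1" and p: "p = 2 / (1 + \<alpha>)"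
    and [measurable]: "h \<in> borel_measurable borel" and h0: "\<And>x. 0 \<le> h x"
    and h1: "Lpn p h \<le> 1" and l: "l > 0"
  shows "(\<integral>\<^sup>+u. ennreal (if h u \<le> l then h u * \<bar>u - v\<bar> powr (\<alpha> - 1) else 0) \<partial>lborel)
     \<le> ennreal ((2 / \<alpha> + 3) * l powr (p - 1))"
proof -
  \<comment> \<open>the radius at which \<open>l R\<^sup>\<alpha>\<close> and \<open>1/(l R)\<close>, the contributions of the two regions, balance\<close>
  define R where "R = l powr (- p)"
  have R: "R > 0" using l by (simp add: R_def)
  have p1: "1 < p" "p < 2" using \<alpha> by (auto simp: p field_simps)
  define q where "q = p / (p - 1)"
  have q: "q = 2 / (1 - \<alpha>)"
  proof -
    have "p - 1 = (1 - \<alpha>) / (1 + \<alpha>)" using \<alpha> unfolding p by (simp add: field_simps)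
    then have "q = 2 / (1 + \<alpha>) / ((1 - \<alpha>) / (1 + \<alpha>))" unfolding q_def p by simp
    also have "\<dots> = 2 / (1 - \<alpha>)" using \<alpha> by (subst frac_eq_eq) auto
    finally show ?thesis .
  qed
  have q1: "q > 1" using p1 by (simp add: q_def field_simps)
  have pq: "1 / p + 1 / q = 1" using p1 by (simp add: q_def field_simps)
  have pa: "1 - p * \<alpha> = p - 1" using \<alpha> unfolding p by (simp add: field_simps)
  let ?A = "\<lambda>u. ennreal l * (ennreal (\<bar>u - v\<bar> powr (\<alpha> - 1)) * indicator {0..R} \<bar>u - v\<bar>)"
  let ?B = "\<lambda>u. ennreal (l powr (p - 1)) * ennreal (\<bar>h u\<bar> powr p)"
  let ?C = "\<lambda>u. ennreal (1 / l) * (ennreal (1 / \<bar>u - v\<bar>\<^sup>2) * indicator {R..} \<bar>u - v\<bar>)"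
  have pw: "ennreal (if h u \<le> l then h u * \<bar>u - v\<bar> powr (\<alpha> - 1) else 0) \<le> ?A u + ?B u + ?C u" for u
  proof (cases "h u \<le> l")
    case True
    show ?thesis
    proof (cases "\<bar>u - v\<bar> \<le> R")
      case near: True
      have "ennreal (h u * \<bar>u - v\<bar> powr (\<alpha> - 1)) \<le> ?A u"
        using True near l h0[of u]
        by (auto simp: ennreal_mult[symmetric] intro!: ennreal_leI mult_right_mono)
      then show ?thesis using True
        by (simp add: add.assoc add_increasing2)
    next
      case far: False
      define w where "w = \<bar>u - v\<bar>"
      have w: "w > R" "w > 0" using far R by (auto simp: w_def)
      define e where "e = (p - 1) / p"
      have "h u * w powr (\<alpha> - 1) = (h u * l powr e) * (w powr (\<alpha> - 1) * l powr (- e))"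
        using l by (simp add: powr_minus field_simps)
      also have "\<dots> \<le> (h u * l powr e) powr p / p + (w powr (\<alpha> - 1) * l powr (- e)) powr q / q"
        using p1 q1 pq h0 l by (intro Youngs_inequality) auto
      also have "\<dots> \<le> (h u * l powr e) powr p + (w powr (\<alpha> - 1) * l powr (- e)) powr q"
        using p1 q1 by (intro add_mono) (auto simp: divide_le_eq mult_le_cancel_left1)
      also have "(h u * l powr e) powr p = h u powr p * l powr (p - 1)"
        using h0 l p1 by (simp add: powr_mult powr_powr e_def)
      also have "(w powr (\<alpha> - 1) * l powr (- e)) powr q = w powr (-2) * l powr (-1)"
      proof -
        have "(\<alpha> - 1) * q = -2" using \<alpha> by (simp add: q field_simps)
        moreover have "- e * q = -1" using p1 by (simp add: e_def q_def divide_simps)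
        ultimately show ?thesis using w l by (simp add: powr_mult powr_powr)
      qed
      also have "w powr (-2) * l powr (-1) = (1 / l) * (1 / w\<^sup>2)"
        using w l by (simp add: powr_minus powr_numeral divide_simps)
      finally have "h u * w powr (\<alpha> - 1) \<le> l powr (p - 1) * h u powr p + (1 / l) * (1 / w\<^sup>2)"
        by (simp add: mult.commute)
      then have "ennreal (h u * w powr (\<alpha> - 1)) \<le> ennreal (l powr (p - 1) * h u powr p + (1 / l) * (1 / w\<^sup>2))"
        by (rule ennreal_leI)
      also have "\<dots> = ?B u + ?C u"
        using w l h0 by (simp add: w_def ennreal_plus[symmetric] ennreal_mult[symmetric] del: ennreal_plus)
      finally show ?thesis using True by (simp add: w_def add.assoc add_increasing)
    qed
  qed auto
  have "(\<integral>\<^sup>+u. ennreal (if h u \<le> l then h u * \<bar>u - v\<bar> powr (\<alpha> - 1) else 0) \<partial>lborel)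
     \<le> (\<integral>\<^sup>+u. ?A u + ?B u + ?C u \<partial>lborel)"
    by (intro nn_integral_mono pw)
  also have "\<dots> = (\<integral>\<^sup>+u. ?A u \<partial>lborel) + (\<integral>\<^sup>+u. ?B u \<partial>lborel) + (\<integral>\<^sup>+u. ?C u \<partial>lborel)"
    by (subst nn_integral_add; (subst nn_integral_add)?) auto
  finally have 1: "(\<integral>\<^sup>+u. ennreal (if h u \<le> l then h u * \<bar>u - v\<bar> powr (\<alpha> - 1) else 0) \<partial>lborel)
     \<le> (\<integral>\<^sup>+u. ?A u \<partial>lborel) + (\<integral>\<^sup>+u. ?B u \<partial>lborel) + (\<integral>\<^sup>+u. ?C u \<partial>lborel)" .
  have A: "(\<integral>\<^sup>+u. ?A u \<partial>lborel) = ennreal (2 / \<alpha> * l powr (p - 1))"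
  proof -
    have "(\<integral>\<^sup>+u. ?A u \<partial>lborel) = l * (2 * (\<integral>\<^sup>+w. (ennreal (w powr (\<alpha> - 1)) * indicator {0..R} w) * indicator {0..} w \<partial>lborel))"
      by (subst nn_integral_cmult, simp, subst nn_integral_abs_shift[symmetric]) auto
    also have "(\<integral>\<^sup>+w. (ennreal (w powr (\<alpha> - 1)) * indicator {0..R} w) * indicator {0..} w \<partial>lborel)
       = (\<integral>\<^sup>+w. ennreal (w powr (\<alpha> - 1)) * indicator {0..R} w \<partial>lborel)"
      by (intro nn_integral_cong) (auto split: split_indicator)
    also have "\<dots> = ennreal (R powr \<alpha> / \<alpha>)"
      using nn_integral_powr_Icc[of "\<alpha> - 1" R] \<alpha> R by simp
    also have "ennreal l * (2 * ennreal (R powr \<alpha> / \<alpha>)) = ennreal (l * (2 * (R powr \<alpha> / \<alpha>)))"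
      using l \<alpha> by (simp add: ennreal_mult[symmetric] flip: ennreal_numeral)
    also have "l * (2 * (R powr \<alpha> / \<alpha>)) = 2 / \<alpha> * (l powr 1 * l powr (- p * \<alpha>))"
      using l by (simp add: R_def powr_powr)
    also have "l powr 1 * l powr (- p * \<alpha>) = l powr (p - 1)"
      using pa by (subst powr_add[symmetric], intro arg_cong[where f="\<lambda>x. l powr x"]) simp
    finally show ?thesis .
  qed
  have B: "(\<integral>\<^sup>+u. ?B u \<partial>lborel) \<le> ennreal (l powr (p - 1))"
    using h1 mult_left_mono[OF h1, of "ennreal (l powr (p - 1))"]
    by (subst nn_integral_cmult) (auto simp: Lpn_def)
  have C: "(\<integral>\<^sup>+u. ?C u \<partial>lborel) = ennreal (2 * l powr (p - 1))"
  proof -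
    have "(\<integral>\<^sup>+u. ?C u \<partial>lborel) = ennreal (1 / l) * (2 * (\<integral>\<^sup>+w. (ennreal (1 / w\<^sup>2) * indicator {R..} w) * indicator {0..} w \<partial>lborel))"
      by (subst nn_integral_cmult, simp, subst nn_integral_abs_shift[symmetric]) auto
    also have "(\<integral>\<^sup>+w. (ennreal (1 / w\<^sup>2) * indicator {R..} w) * indicator {0..} w \<partial>lborel)
       = (\<integral>\<^sup>+w. ennreal (1 / w\<^sup>2) * indicator {R..} w \<partial>lborel)"
      using R by (intro nn_integral_cong) (auto split: split_indicator)
    also have "\<dots> = ennreal (1 / R)" by (rule nn_integral_inverse_square[OF R])
    also have "ennreal (1 / l) * (2 * ennreal (1 / R)) = ennreal (1 / l * (2 * (1 / R)))"
      using l R by (simp add: ennreal_mult[symmetric] flip: ennreal_numeral)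
    also have "1 / l * (2 * (1 / R)) = 2 * (l powr p * l powr (-1))"
      using l by (simp add: R_def powr_minus divide_simps)
    also have "l powr p * l powr (-1) = l powr (p - 1)"
      using powr_add[of l p "-1"] by simp
    finally show ?thesis .
  qed
  have "(2 / \<alpha> + 3) * l powr (p - 1) = 2 / \<alpha> * l powr (p - 1) + l powr (p - 1) + 2 * l powr (p - 1)"
    by (simp add: distrib_right)
  then have "ennreal ((2 / \<alpha> + 3) * l powr (p - 1)) =
      ennreal (2 / \<alpha> * l powr (p - 1)) + ennreal (l powr (p - 1)) + ennreal (2 * l powr (p - 1))"
    using \<alpha> by (simp add: ennreal_plus[symmetric] del: ennreal_plus)
  then show ?thesis
    using order_trans[OF 1 add_mono[OF add_mono[OF eq_refl[OF A] B] eq_refl[OF C]]] by simp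
qed

text \<open>By symmetry only pairs with \<open>h u \<le> h v\<close> matter, up to a factor \<open>2\<close>; apply \<open>hls_one_point\<close> with \<open>l = h v\<close>, which turns the
outer integrand into a multiple of \<open>h\<^sup>p\<close>.\<close>

lemma hls_diag:
  assumes \<alpha>: "0 < \<alpha>" "\<alpha> < 1" and p: "p = 2 / (1 + \<alpha>)"
    and [measurable]: "h \<in> borel_measurable borel" and h0: "\<And>x. 0 \<le> h x"
    and h1: "Lpn p h \<le> 1"
  shows "(\<integral>\<^sup>+v. \<integral>\<^sup>+u. ennreal (h u * h v * \<bar>u - v\<bar> powr (\<alpha> - 1)) \<partial>lborel \<partial>lborel) \<le> ennreal (4 / \<alpha> + 6)"
proof -
  define G where "G = (\<lambda>u v. ennreal (if h u \<le> h v then h u * h v * \<bar>u - v\<bar> powr (\<alpha> - 1) else 0))"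
  have [measurable]: "case_prod G \<in> borel_measurable (borel \<Otimes>\<^sub>M borel)" unfolding G_def by measurable
  have "(\<integral>\<^sup>+v. \<integral>\<^sup>+u. ennreal (h u * h v * \<bar>u - v\<bar> powr (\<alpha> - 1)) \<partial>lborel \<partial>lborel)
     \<le> (\<integral>\<^sup>+v. \<integral>\<^sup>+u. G u v + G v u \<partial>lborel \<partial>lborel)"
    by (intro nn_integral_mono) (auto simp: G_def ennreal_plus[symmetric] h0 mult_ac abs_minus_commute simp del: ennreal_plus)
  also have "\<dots> = (\<integral>\<^sup>+v. (\<integral>\<^sup>+u. G u v \<partial>lborel) + (\<integral>\<^sup>+u. G v u \<partial>lborel) \<partial>lborel)"
    by (intro nn_integral_cong nn_integral_add) auto
  also have "\<dots> = (\<integral>\<^sup>+v. \<integral>\<^sup>+u. G u v \<partial>lborel \<partial>lborel) + (\<integral>\<^sup>+v. \<integral>\<^sup>+u. G v u \<partial>lborel \<partial>lborel)"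
    by (intro nn_integral_add) auto
  also have "(\<integral>\<^sup>+v. \<integral>\<^sup>+u. G v u \<partial>lborel \<partial>lborel) = (\<integral>\<^sup>+v. \<integral>\<^sup>+u. G u v \<partial>lborel \<partial>lborel)"
    by (rule lborel_pair.Fubini') auto
  finally have 1: "(\<integral>\<^sup>+v. \<integral>\<^sup>+u. ennreal (h u * h v * \<bar>u - v\<bar> powr (\<alpha> - 1)) \<partial>lborel \<partial>lborel)
     \<le> (\<integral>\<^sup>+v. \<integral>\<^sup>+u. G u v \<partial>lborel \<partial>lborel) + (\<integral>\<^sup>+v. \<integral>\<^sup>+u. G u v \<partial>lborel \<partial>lborel)" .
  have "(\<integral>\<^sup>+v. \<integral>\<^sup>+u. G u v \<partial>lborel \<partial>lborel) \<le> (\<integral>\<^sup>+v. ennreal (2 / \<alpha> + 3) * ennreal (\<bar>h v\<bar> powr p) \<partial>lborel)"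
  proof (intro nn_integral_mono)
    fix v
    show "(\<integral>\<^sup>+u. G u v \<partial>lborel) \<le> ennreal (2 / \<alpha> + 3) * ennreal (\<bar>h v\<bar> powr p)"
    proof (cases "h v = 0")
      case True
      then show ?thesis by (simp add: G_def cong: if_cong)
    next
      case False
      then have hv: "h v > 0" using h0[of v] by simp
      have "(\<integral>\<^sup>+u. G u v \<partial>lborel) = (\<integral>\<^sup>+u. ennreal (h v) * ennreal (if h u \<le> h v then h u * \<bar>u - v\<bar> powr (\<alpha> - 1) else 0) \<partial>lborel)"
        using hv h0 by (intro nn_integral_cong) (auto simp: G_def ennreal_mult[symmetric] mult_ac)
      also have "\<dots> = ennreal (h v) * (\<integral>\<^sup>+u. ennreal (if h u \<le> h v then h u * \<bar>u - v\<bar> powr (\<alpha> - 1) else 0) \<partial>lborel)"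
        by (intro nn_integral_cmult) auto
      also have "\<dots> \<le> ennreal (h v) * ennreal ((2 / \<alpha> + 3) * h v powr (p - 1))"
        by (intro mult_left_mono hls_one_point assms hv) auto
      also have "\<dots> = ennreal ((2 / \<alpha> + 3) * (h v powr 1 * h v powr (p - 1)))"
        using hv \<alpha> by (simp add: ennreal_mult[symmetric] mult_ac)
      also have "h v powr 1 * h v powr (p - 1) = \<bar>h v\<bar> powr p" using hv powr_add[of "h v" 1 "p - 1"] by simp
      also have "ennreal ((2 / \<alpha> + 3) * \<bar>h v\<bar> powr p) = ennreal (2 / \<alpha> + 3) * ennreal (\<bar>h v\<bar> powr p)"
        using \<alpha> by (intro ennreal_mult) auto
      finally show ?thesis .
    qed
  qed
  also have "\<dots> = ennreal (2 / \<alpha> + 3) * Lpn p h"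
    unfolding Lpn_def by (rule nn_integral_cmult) auto
  also have "\<dots> \<le> ennreal (2 / \<alpha> + 3)" using mult_left_mono[OF h1, of "ennreal (2 / \<alpha> + 3)"] by simp
  finally have 2: "(\<integral>\<^sup>+v. \<integral>\<^sup>+u. G u v \<partial>lborel \<partial>lborel) \<le> ennreal (2 / \<alpha> + 3)" .
  have "ennreal (2 / \<alpha> + 3) + ennreal (2 / \<alpha> + 3) = ennreal (4 / \<alpha> + 6)"
    using \<alpha> by (subst ennreal_plus[symmetric]) auto
  then show ?thesis using order_trans[OF 1 add_mono[OF 2 2]] by simp
qed

lemma Lpn_cmult: "h \<in> borel_measurable borel \<Longrightarrow> Lpn p (\<lambda>x. c * h x) = ennreal (\<bar>c\<bar> powr p) * Lpn p h"
  unfolding Lpn_def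
  by (subst nn_integral_cmult[symmetric]) (auto simp: abs_mult powr_mult ennreal_mult)

lemma Lpn_mono: "(\<And>x. \<bar>g x\<bar> \<le> \<bar>h x\<bar>) \<Longrightarrow> 0 \<le> p \<Longrightarrow> Lpn p g \<le> Lpn p h"
  unfolding Lpn_def by (intro nn_integral_mono ennreal_leI powr_mono2) auto

lemma abs_add_powr_le:
  assumes "0 \<le> p" shows "\<bar>a + b :: real\<bar> powr p \<le> 2 powr p * (\<bar>a\<bar> powr p + \<bar>b\<bar> powr p)"
proof -
  have "\<bar>a + b\<bar> powr p \<le> (2 * max \<bar>a\<bar> \<bar>b\<bar>) powr p" using assms by (intro powr_mono2) auto
  also have "\<dots> = 2 powr p * max \<bar>a\<bar> \<bar>b\<bar> powr p" by (simp add: powr_mult)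
  also have "max \<bar>a\<bar> \<bar>b\<bar> powr p \<le> \<bar>a\<bar> powr p + \<bar>b\<bar> powr p" by (simp add: max_def)
  finally show ?thesis by simp
qed

lemma Lpn_add_le:
  assumes [measurable]: "g \<in> borel_measurable borel" "h \<in> borel_measurable borel" and "0 \<le> p"
  shows "Lpn p (\<lambda>x. g x + h x) \<le> ennreal (2 powr p) * (Lpn p g + Lpn p h)"
proof -
  have "Lpn p (\<lambda>x. g x + h x) \<le> (\<integral>\<^sup>+x. ennreal (2 powr p) * (ennreal (\<bar>g x\<bar> powr p) + ennreal (\<bar>h x\<bar> powr p)) \<partial>lborel)"
    unfolding Lpn_def using abs_add_powr_le[OF \<open>0 \<le> p\<close>]
    by (intro nn_integral_mono) (auto simp: ennreal_plus[symmetric] ennreal_mult[symmetric] simp del: ennreal_plus intro!: ennreal_leI)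
  also have "\<dots> = ennreal (2 powr p) * (Lpn p g + Lpn p h)"
    unfolding Lpn_def by (subst nn_integral_cmult, simp, subst nn_integral_add) auto
  finally show ?thesis .
qed

definition hlsK :: "real \<Rightarrow> real" where "hlsK \<alpha> = 16 * (4 / \<alpha> + 6)"

text \<open>Apply the diagonal case to \<open>\<bar>g\<bar>/4a + \<bar>h\<bar>/4b\<close>, whose \<open>p\<close>-th power integral is at most \<open>1\<close>: the mixed term of its
square contains the product sought. This costs the factor \<open>16\<close> in the constant \<open>hlsK\<close>.\<close>

lemma hls:
  assumes \<alpha>: "0 < \<alpha>" "\<alpha> < 1" and p: "p = 2 / (1 + \<alpha>)"
    and [measurable]: "g \<in> borel_measurable borel" "h \<in> borel_measurable borel"
    and ab: "a > 0" "b > 0" and g: "Lpn p g \<le> ennreal (a powr p)" and h: "Lpn p h \<le> ennreal (b powr p)"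
  shows "(\<integral>\<^sup>+v. \<integral>\<^sup>+u. ennreal (\<bar>g u\<bar> * \<bar>h v\<bar> * \<bar>u - v\<bar> powr (\<alpha> - 1)) \<partial>lborel \<partial>lborel) \<le> ennreal (hlsK \<alpha> * a * b)"
proof -
  have p1: "1 < p" "p < 2" using \<alpha> by (auto simp: p field_simps)
  define w where "w = (\<lambda>x. (1 / (4 * a)) * \<bar>g x\<bar> + (1 / (4 * b)) * \<bar>h x\<bar>)"
  have [measurable]: "w \<in> borel_measurable borel" unfolding w_def by measurable
  have w0: "0 \<le> w x" for x using ab by (simp add: w_def)
  have sc: "Lpn p (\<lambda>x. (1 / (4 * c)) * \<bar>f x\<bar>) \<le> ennreal ((1/4) powr p)"
    if "c > 0" "Lpn p f \<le> ennreal (c powr p)" and [measurable]: "f \<in> borel_measurable borel" for c f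
  proof -
    have "Lpn p (\<lambda>x. (1 / (4 * c)) * \<bar>f x\<bar>) = ennreal ((1 / (4 * c)) powr p) * Lpn p f"
      using that by (subst Lpn_cmult) (auto simp: Lpn_def)
    also have "\<dots> \<le> ennreal ((1 / (4 * c)) powr p) * ennreal (c powr p)"
      using that by (intro mult_left_mono) auto
    also have "\<dots> = ennreal (((1 / (4 * c)) * c) powr p)"
      using that by (subst powr_mult) (auto simp: ennreal_mult[symmetric])
    also have "(1 / (4 * c)) * c = 1 / 4" using that by simp
    finally show ?thesis .
  qed
  have "Lpn p w \<le> ennreal (2 powr p) * (Lpn p (\<lambda>x. (1 / (4 * a)) * \<bar>g x\<bar>) + Lpn p (\<lambda>x. (1 / (4 * b)) * \<bar>h x\<bar>))"
    unfolding w_def using p1 by (intro Lpn_add_le) auto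
  also have "\<dots> \<le> ennreal (2 powr p) * (ennreal ((1/4) powr p) + ennreal ((1/4) powr p))"
    using ab g h by (intro mult_left_mono add_mono sc) auto
  also have "\<dots> = ennreal (2 * (2 powr p * (1/4) powr p))"
    by (simp add: ennreal_plus[symmetric] ennreal_mult[symmetric] del: ennreal_plus)
  also have "2 powr p * (1/4) powr p = (1/2) powr p" by (simp add: powr_mult[symmetric])
  also have "ennreal (2 * (1/2) powr p) \<le> 1"
  proof -
    have "(1/2) powr p \<le> (1/2::real) powr 1" using p1 by (intro powr_mono') auto
    then show ?thesis by (simp add: ennreal_le_1)
  qed
  finally have w1: "Lpn p w \<le> 1" .
  have "(\<integral>\<^sup>+v. \<integral>\<^sup>+u. ennreal (\<bar>g u\<bar> * \<bar>h v\<bar> * \<bar>u - v\<bar> powr (\<alpha> - 1)) \<partial>lborel \<partial>lborel)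
    \<le> (\<integral>\<^sup>+v. \<integral>\<^sup>+u. ennreal (16 * a * b) * ennreal (w u * w v * \<bar>u - v\<bar> powr (\<alpha> - 1)) \<partial>lborel \<partial>lborel)"
  proof (intro nn_integral_mono)
    fix u v
    have "\<bar>g u\<bar> \<le> 4 * a * w u" "\<bar>h v\<bar> \<le> 4 * b * w v"
      using ab by (auto simp: w_def field_simps)
    then have "\<bar>g u\<bar> * \<bar>h v\<bar> \<le> (4 * a * w u) * (4 * b * w v)"
      using ab w0 by (intro mult_mono) auto
    then have "\<bar>g u\<bar> * \<bar>h v\<bar> * \<bar>u - v\<bar> powr (\<alpha> - 1) \<le> 16 * a * b * (w u * w v * \<bar>u - v\<bar> powr (\<alpha> - 1))"
      using mult_right_mono[of "\<bar>g u\<bar> * \<bar>h v\<bar>" "(4 * a * w u) * (4 * b * w v)" "\<bar>u - v\<bar> powr (\<alpha> - 1)"]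
      by (simp add: mult_ac)
    then show "ennreal (\<bar>g u\<bar> * \<bar>h v\<bar> * \<bar>u - v\<bar> powr (\<alpha> - 1)) \<le> ennreal (16 * a * b) * ennreal (w u * w v * \<bar>u - v\<bar> powr (\<alpha> - 1))"
      using ab w0 by (subst ennreal_mult[symmetric]) (auto intro!: ennreal_leI)
  qed
  also have "\<dots> = ennreal (16 * a * b) * (\<integral>\<^sup>+v. \<integral>\<^sup>+u. ennreal (w u * w v * \<bar>u - v\<bar> powr (\<alpha> - 1)) \<partial>lborel \<partial>lborel)"
    by (subst nn_integral_cmult[symmetric], simp, intro nn_integral_cong nn_integral_cmult) auto
  also have "\<dots> \<le> ennreal (16 * a * b) * ennreal (4 / \<alpha> + 6)"
    using hls_diag[OF \<alpha> p _ w0 w1] by (intro mult_left_mono) auto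
  also have "\<dots> = ennreal (hlsK \<alpha> * a * b)"
    using ab \<alpha> by (subst ennreal_mult[symmetric]) (auto simp: hlsK_def mult_ac)
  finally show ?thesis .
qed

section \<open>The Riesz form\<close>

definition riesz :: "real \<Rightarrow> (real \<Rightarrow> real) \<Rightarrow> (real \<Rightarrow> real) \<Rightarrow> real" where
  "riesz \<alpha> g h = (\<integral>z. g (fst z) * h (snd z) * \<bar>fst z - snd z\<bar> powr (\<alpha> - 1) \<partial>(lborel \<Otimes>\<^sub>M lborel))"

text \<open>Functions rather than classes, and Borel measurable ones, so that products of two of them are measurable on the plane.\<close>

definition Lp_fun :: "real \<Rightarrow> (real \<Rightarrow> real) set" where
  "Lp_fun p = {g. g \<in> borel_measurable borel \<and> Lpn p g < \<infinity>}"

lemma Lp_fun_zero [simp]: "(\<lambda>x. 0) \<in> Lp_fun p" by (simp add: Lp_fun_def Lpn_def)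

lemma Lp_fun_add: "g \<in> Lp_fun p \<Longrightarrow> h \<in> Lp_fun p \<Longrightarrow> 0 \<le> p \<Longrightarrow> (\<lambda>x. g x + h x) \<in> Lp_fun p"
  unfolding Lp_fun_def
  by (auto intro!: le_less_trans[OF Lpn_add_le] simp: ennreal_mult_less_top ennreal_add_less_top)

lemma Lp_fun_cmult: "g \<in> Lp_fun p \<Longrightarrow> (\<lambda>x. c * g x) \<in> Lp_fun p"
  unfolding Lp_fun_def by (auto simp: Lpn_cmult ennreal_mult_less_top)

lemma Lp_fun_diff: "g \<in> Lp_fun p \<Longrightarrow> h \<in> Lp_fun p \<Longrightarrow> 0 \<le> p \<Longrightarrow> (\<lambda>x. g x - h x) \<in> Lp_fun p"
  using Lp_fun_add[of g p "\<lambda>x. - 1 * h x"] Lp_fun_cmult[of h p "-1"] by simp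

lemma Lp_fun_sum: "finite I \<Longrightarrow> (\<And>i. i \<in> I \<Longrightarrow> g i \<in> Lp_fun p) \<Longrightarrow> 0 \<le> p \<Longrightarrow> (\<lambda>x. \<Sum>i\<in>I. g i x) \<in> Lp_fun p"
  by (induction I rule: finite_induct) (auto intro!: Lp_fun_add)

lemma Lp_fun_bounded:
  assumes [measurable]: "g \<in> borel_measurable borel" and "\<And>x. \<bar>g x\<bar> \<le> c * indicator {a..b} x" "0 < p"
  shows "g \<in> Lp_fun p"
proof -
  have c: "\<bar>g x\<bar> powr p \<le> \<bar>c\<bar> powr p * indicator {a..b} x" for x
  proof (cases "x \<in> {a..b}")
    case True
    then have "\<bar>g x\<bar> \<le> \<bar>c\<bar>" using assms(2)[of x] by auto
    then show ?thesis using True assms(3) by (auto intro!: powr_mono2)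
  next
    case False then show ?thesis using assms(2)[of x] by auto
  qed
  have "Lpn p g \<le> (\<integral>\<^sup>+x. ennreal (\<bar>c\<bar> powr p) * indicator {a..b} x \<partial>lborel)"
    unfolding Lpn_def using c
    by (intro nn_integral_mono) (auto simp: ennreal_mult[symmetric] ennreal_indicator[symmetric] simp del: ennreal_indicator intro!: ennreal_leI)
  also have "\<dots> < \<infinity>" by (subst nn_integral_cmult_indicator) (auto simp: ennreal_mult_less_top emeasure_lborel_Icc_eq)
  finally show ?thesis by (simp add: Lp_fun_def)
qed

lemma Lpn_le_powr_ex:
  assumes "Lpn p g < \<infinity>" "0 < p" shows "\<exists>a>0. Lpn p g \<le> ennreal (a powr p)"
proof (intro exI[of _ "(enn2real (Lpn p g) + 1) powr (1 / p)"] conjI)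
  have "0 < enn2real (Lpn p g) + 1" by (simp add: add_nonneg_pos)
  then show "0 < (enn2real (Lpn p g) + 1) powr (1 / p)" by simp
  have "((enn2real (Lpn p g) + 1) powr (1 / p)) powr p = enn2real (Lpn p g) + 1"
    using assms(2) by (simp add: powr_powr add_nonneg_nonneg)
  moreover have "Lpn p g = ennreal (enn2real (Lpn p g))" using assms by simp
  ultimately show "Lpn p g \<le> ennreal (((enn2real (Lpn p g) + 1) powr (1 / p)) powr p)"
    by (metis ennreal_leI le_add_same_cancel1 zero_le_one)
qed

locale riesz_exp =
  fixes \<alpha> p :: real
  assumes \<alpha>: "0 < \<alpha>" "\<alpha> < 1" and p: "p = 2 / (1 + \<alpha>)"
begin

lemma p_gt_1: "1 < p" "0 < p" "0 \<le> p" using \<alpha> by (auto simp: p field_simps)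

lemma hlsK_pos: "0 < hlsK \<alpha>" using \<alpha> by (simp add: hlsK_def add_pos_pos)

lemma riesz_nn_le:
  assumes [measurable]: "g \<in> borel_measurable borel" "h \<in> borel_measurable borel"
  assumes "a > 0" "b > 0" "Lpn p g \<le> ennreal (a powr p)" "Lpn p h \<le> ennreal (b powr p)"
  shows "(\<integral>\<^sup>+z. norm (g (fst z) * h (snd z) * \<bar>fst z - snd z\<bar> powr (\<alpha> - 1)) \<partial>(lborel \<Otimes>\<^sub>M lborel)) \<le> ennreal (hlsK \<alpha> * a * b)"
proof -
  have "(\<integral>\<^sup>+z. norm (g (fst z) * h (snd z) * \<bar>fst z - snd z\<bar> powr (\<alpha> - 1)) \<partial>(lborel \<Otimes>\<^sub>M lborel))
     = (\<integral>\<^sup>+v. \<integral>\<^sup>+u. ennreal (\<bar>g u\<bar> * \<bar>h v\<bar> * \<bar>u - v\<bar> powr (\<alpha> - 1)) \<partial>lborel \<partial>lborel)"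
    by (subst lborel_pair.nn_integral_snd[symmetric]) (auto simp: abs_mult)
  then show ?thesis using hls[OF \<alpha> p assms] by simp
qed

lemma riesz_integrable:
  assumes "g \<in> Lp_fun p" "h \<in> Lp_fun p"
  shows "integrable (lborel \<Otimes>\<^sub>M lborel) (\<lambda>z. g (fst z) * h (snd z) * \<bar>fst z - snd z\<bar> powr (\<alpha> - 1))"
proof -
  have [measurable]: "g \<in> borel_measurable borel" "h \<in> borel_measurable borel" using assms by (auto simp: Lp_fun_def)
  obtain a where a: "a > 0" "Lpn p g \<le> ennreal (a powr p)"
    using assms Lpn_le_powr_ex[of p g] p_gt_1 by (auto simp: Lp_fun_def)
  obtain b where b: "b > 0" "Lpn p h \<le> ennreal (b powr p)"
    using assms Lpn_le_powr_ex[of p h] p_gt_1 by (auto simp: Lp_fun_def)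
  from riesz_nn_le[OF _ _ a(1) b(1) a(2) b(2)] show ?thesis
    by (intro integrableI_bounded) (auto intro: le_less_trans)
qed

lemma riesz_bound:
  assumes "g \<in> borel_measurable borel" "h \<in> borel_measurable borel"
  assumes "a > 0" "b > 0" "Lpn p g \<le> ennreal (a powr p)" "Lpn p h \<le> ennreal (b powr p)"
  shows "\<bar>riesz \<alpha> g h\<bar> \<le> hlsK \<alpha> * a * b"
proof -
  have [measurable]: "g \<in> borel_measurable borel" "h \<in> borel_measurable borel" using assms by auto
  have "g \<in> Lp_fun p" "h \<in> Lp_fun p" using assms by (auto simp: Lp_fun_def intro: le_less_trans)
  from integral_norm_bound_ennreal[OF riesz_integrable[OF this]] riesz_nn_le[OF assms]
  have "ennreal (norm (riesz \<alpha> g h)) \<le> ennreal (hlsK \<alpha> * a * b)"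
    unfolding riesz_def by (rule order_trans)
  then have "ennreal \<bar>riesz \<alpha> g h\<bar> \<le> ennreal (hlsK \<alpha> * a * b)" by simp
  then show ?thesis using assms hlsK_pos by (subst (asm) ennreal_le_iff) auto
qed

lemma riesz_add_left:
  "f \<in> Lp_fun p \<Longrightarrow> g \<in> Lp_fun p \<Longrightarrow> h \<in> Lp_fun p \<Longrightarrow> riesz \<alpha> (\<lambda>x. f x + g x) h = riesz \<alpha> f h + riesz \<alpha> g h"
  unfolding riesz_def
  by (subst Bochner_Integration.integral_add[symmetric]) (auto intro!: riesz_integrable simp: distrib_left distrib_right)

lemma riesz_add_right:
  "f \<in> Lp_fun p \<Longrightarrow> g \<in> Lp_fun p \<Longrightarrow> h \<in> Lp_fun p \<Longrightarrow> riesz \<alpha> h (\<lambda>x. f x + g x) = riesz \<alpha> h f + riesz \<alpha> h g"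
  unfolding riesz_def
  by (subst Bochner_Integration.integral_add[symmetric]) (auto intro!: riesz_integrable simp: distrib_left distrib_right)

lemma riesz_cmult_left: "riesz \<alpha> (\<lambda>x. c * g x) h = c * riesz \<alpha> g h"
  unfolding riesz_def by (subst integral_mult_right_zero[symmetric]) (simp add: mult_ac)

lemma riesz_cmult_right: "riesz \<alpha> g (\<lambda>x. c * h x) = c * riesz \<alpha> g h"
  unfolding riesz_def by (subst integral_mult_right_zero[symmetric]) (simp add: mult_ac)

lemma riesz_zero [simp]: "riesz \<alpha> (\<lambda>x. 0) h = 0" "riesz \<alpha> h (\<lambda>x. 0) = 0"
  by (auto simp: riesz_def)

lemma riesz_sum_left:
  "finite I \<Longrightarrow> (\<And>i. i \<in> I \<Longrightarrow> g i \<in> Lp_fun p) \<Longrightarrow> h \<in> Lp_fun p \<Longrightarrow> riesz \<alpha> (\<lambda>x. \<Sum>i\<in>I. g i x) h = (\<Sum>i\<in>I. riesz \<alpha> (g i) h)"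
  by (induction I rule: finite_induct) (auto simp: riesz_add_left Lp_fun_sum p_gt_1)

lemma riesz_sum_right:
  "finite I \<Longrightarrow> (\<And>i. i \<in> I \<Longrightarrow> g i \<in> Lp_fun p) \<Longrightarrow> h \<in> Lp_fun p \<Longrightarrow> riesz \<alpha> h (\<lambda>x. \<Sum>i\<in>I. g i x) = (\<Sum>i\<in>I. riesz \<alpha> h (g i))"
  by (induction I rule: finite_induct) (auto simp: riesz_add_right Lp_fun_sum p_gt_1)

lemma riesz_sum_sum:
  assumes "finite I" "\<And>i. i \<in> I \<Longrightarrow> g i \<in> Lp_fun p"
  shows "riesz \<alpha> (\<lambda>x. \<Sum>i\<in>I. c i * g i x) (\<lambda>x. \<Sum>i\<in>I. c i * g i x) = (\<Sum>i\<in>I. \<Sum>j\<in>I. c i * c j * riesz \<alpha> (g i) (g j))"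
proof -
  let ?S = "\<lambda>x. \<Sum>i\<in>I. c i * g i x"
  have S: "?S \<in> Lp_fun p" using assms by (intro Lp_fun_sum Lp_fun_cmult) (auto simp: p_gt_1)
  have "riesz \<alpha> ?S ?S = (\<Sum>i\<in>I. riesz \<alpha> (\<lambda>x. c i * g i x) ?S)"
    using assms S by (intro riesz_sum_left Lp_fun_cmult) auto
  also have "\<dots> = (\<Sum>i\<in>I. \<Sum>j\<in>I. riesz \<alpha> (\<lambda>x. c i * g i x) (\<lambda>x. c j * g j x))"
    using assms by (intro sum.cong riesz_sum_right Lp_fun_cmult) auto
  finally show ?thesis by (simp add: riesz_cmult_left riesz_cmult_right mult.assoc)
qed

lemma riesz_commute:
  assumes [measurable]: "g \<in> borel_measurable borel" "h \<in> borel_measurable borel"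
  shows "riesz \<alpha> g h = riesz \<alpha> h g"
  unfolding riesz_def
  by (subst lborel_pair.integral_product_swap[symmetric]) (auto simp: case_prod_beta' abs_minus_commute mult_ac)

text \<open>A bounded bilinear form is continuous on the diagonal. The approximants are not assumed to lie in \<open>L\<^sup>p\<close>; this follows
from the convergence from some index on.\<close>

lemma riesz_tendsto:
  assumes g: "g \<in> Lp_fun p" and gk: "\<And>k. G k \<in> borel_measurable borel"
    and lim: "(\<lambda>k. Lpn p (\<lambda>x. G k x - g x)) \<longlonglongrightarrow> 0"
  shows "(\<lambda>k. riesz \<alpha> (G k) (G k)) \<longlonglongrightarrow> riesz \<alpha> g g"
proof (rule LIMSEQ_I)
  fix r :: real assume r: "r > 0"
  obtain a where a: "a > 0" "Lpn p g \<le> ennreal (a powr p)"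
    using g Lpn_le_powr_ex[of p g] p_gt_1 by (auto simp: Lp_fun_def)
  define K where "K = hlsK \<alpha>"
  have K: "K > 0" unfolding K_def by (rule hlsK_pos)
  define e where "e = min 1 (r / (2 * K * (1 + 2 * a)))"
  have e: "e > 0" using r K a by (simp add: e_def)
  have "eventually (\<lambda>k. Lpn p (\<lambda>x. G k x - g x) < ennreal (e powr p)) sequentially"
    using lim e by (intro order_tendstoD(2)[OF lim]) auto
  then obtain k0 where k0: "\<And>k. k \<ge> k0 \<Longrightarrow> Lpn p (\<lambda>x. G k x - g x) \<le> ennreal (e powr p)"
    unfolding eventually_sequentially by (meson less_imp_le)
  have "norm (riesz \<alpha> (G k) (G k) - riesz \<alpha> g g) < r" if k: "k \<ge> k0" for k
  proof -
    define d where "d = (\<lambda>x. G k x - g x)"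
    have [measurable]: "g \<in> borel_measurable borel" "G k \<in> borel_measurable borel" using g gk by (auto simp: Lp_fun_def)
    have dm [measurable]: "d \<in> borel_measurable borel" unfolding d_def by measurable
    have d: "d \<in> Lp_fun p" using k0[OF k] by (auto simp: Lp_fun_def d_def intro: le_less_trans)
    have Gk: "G k = (\<lambda>x. d x + g x)" by (auto simp: d_def)
    have "riesz \<alpha> (G k) (G k) = riesz \<alpha> d d + riesz \<alpha> d g + (riesz \<alpha> g d + riesz \<alpha> g g)"
      unfolding Gk using d g by (simp add: riesz_add_left riesz_add_right Lp_fun_add p_gt_1)
    then have "\<bar>riesz \<alpha> (G k) (G k) - riesz \<alpha> g g\<bar> \<le> \<bar>riesz \<alpha> d d\<bar> + \<bar>riesz \<alpha> d g\<bar> + \<bar>riesz \<alpha> g d\<bar>" by linarith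
    also have "\<dots> \<le> K * e * e + K * e * a + K * a * e"
      unfolding K_def using k0[OF k] a e dm
      by (intro add_mono riesz_bound) (auto simp: d_def)
    also have "\<dots> = e * (K * (e + 2 * a))" by (simp add: algebra_simps)
    also have "\<dots> \<le> e * (K * (1 + 2 * a))" using K e a by (intro mult_left_mono) (auto simp: e_def)
    also have "\<dots> \<le> r / (2 * K * (1 + 2 * a)) * (K * (1 + 2 * a))" using K a by (intro mult_right_mono) (auto simp: e_def)
    also have "\<dots> = r / 2" using K a by (simp add: divide_simps)
    also have "\<dots> < r" using r by simp
    finally show ?thesis by simp
  qed
  then show "\<exists>no. \<forall>k\<ge>no. norm (riesz \<alpha> (G k) (G k) - riesz \<alpha> g g) < r" by blast
qed

lemma riesz_eq_diag:
  assumes g: "g \<in> Lp_fun p" and h: "h \<in> borel_measurable borel" and "AE x in lborel. h x = g x"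
  shows "riesz \<alpha> h h = riesz \<alpha> g g"
proof -
  have "Lpn p (\<lambda>x. h x - g x) = (\<integral>\<^sup>+x. 0 \<partial>(lborel::real measure))"
    unfolding Lpn_def using assms(3) by (intro nn_integral_cong_AE) (auto elim!: eventually_mono)
  then have "(\<lambda>k::nat. riesz \<alpha> h h) \<longlonglongrightarrow> riesz \<alpha> g g"
    using h by (intro riesz_tendsto[OF g]) auto
  then show ?thesis by (simp add: LIMSEQ_const_iff)
qed

lemma nn_riesz_inner:
  assumes u: "0 < u" "u \<le> t"
  shows "(\<integral>\<^sup>+v. ennreal (\<bar>u - v\<bar> powr (\<alpha> - 1)) * indicator {0<..t} v \<partial>lborel) = ennreal ((u powr \<alpha> + (t - u) powr \<alpha>) / \<alpha>)"
proof -
  have I: "(\<integral>\<^sup>+w. ennreal (w powr (\<alpha> - 1)) * indicator {0..c} w \<partial>lborel) = ennreal (c powr \<alpha> / \<alpha>)" if "c \<ge> 0" for c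
    using nn_integral_powr_Icc[of "\<alpha> - 1" c] \<alpha> that by simp
  have "(\<integral>\<^sup>+v. ennreal (\<bar>u - v\<bar> powr (\<alpha> - 1)) * indicator {0<..t} v \<partial>lborel) =
     (\<integral>\<^sup>+v. ennreal (\<bar>u - v\<bar> powr (\<alpha> - 1)) * indicator {0<..u} v + ennreal (\<bar>u - v\<bar> powr (\<alpha> - 1)) * indicator {u<..t} v \<partial>lborel)"
    using u by (intro nn_integral_cong) (auto split: split_indicator)
  also have "\<dots> = (\<integral>\<^sup>+v. ennreal (\<bar>u - v\<bar> powr (\<alpha> - 1)) * indicator {0<..u} v \<partial>lborel) + (\<integral>\<^sup>+v. ennreal (\<bar>u - v\<bar> powr (\<alpha> - 1)) * indicator {u<..t} v \<partial>lborel)"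
    by (rule nn_integral_add) auto
  also have "(\<integral>\<^sup>+v. ennreal (\<bar>u - v\<bar> powr (\<alpha> - 1)) * indicator {0<..u} v \<partial>lborel) = (\<integral>\<^sup>+w. ennreal (w powr (\<alpha> - 1)) * indicator {0..u} w \<partial>lborel)"
  proof -
    have "(\<integral>\<^sup>+v. ennreal (\<bar>u - v\<bar> powr (\<alpha> - 1)) * indicator {0<..u} v \<partial>lborel) = (\<integral>\<^sup>+w. ennreal (\<bar>w\<bar> powr (\<alpha> - 1)) * indicator {0<..u} (u - w) \<partial>lborel)"
      by (subst nn_integral_real_affine[where c="-1" and t=u]) auto
    also have "\<dots> = (\<integral>\<^sup>+w. ennreal (w powr (\<alpha> - 1)) * indicator {0..u} w \<partial>lborel)"
      using AE_lborel_singleton[of u]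
      by (intro nn_integral_cong_AE) (auto elim!: eventually_mono split: split_indicator)
    finally show ?thesis .
  qed
  also have "(\<integral>\<^sup>+v. ennreal (\<bar>u - v\<bar> powr (\<alpha> - 1)) * indicator {u<..t} v \<partial>lborel) = (\<integral>\<^sup>+w. ennreal (w powr (\<alpha> - 1)) * indicator {0..t-u} w \<partial>lborel)"
  proof -
    have "(\<integral>\<^sup>+v. ennreal (\<bar>u - v\<bar> powr (\<alpha> - 1)) * indicator {u<..t} v \<partial>lborel) = (\<integral>\<^sup>+w. ennreal (\<bar>w\<bar> powr (\<alpha> - 1)) * indicator {u<..t} (u + w) \<partial>lborel)"
      by (subst nn_integral_real_affine[where c="1" and t=u]) auto
    also have "\<dots> = (\<integral>\<^sup>+w. ennreal (w powr (\<alpha> - 1)) * indicator {0..t-u} w \<partial>lborel)"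
      using AE_lborel_singleton[of "0::real"]
      by (intro nn_integral_cong_AE) (auto elim!: eventually_mono split: split_indicator)
    finally show ?thesis .
  qed
  finally show ?thesis using u \<alpha> by (simp add: I ennreal_plus[symmetric] add_divide_distrib del: ennreal_plus)
qed

lemma nn_powr_shift:
  assumes "0 \<le> s" "s \<le> t"
  shows "(\<integral>\<^sup>+u. ennreal ((t - u) powr \<alpha>) * indicator {0<..s} u \<partial>lborel) = ennreal ((t powr (\<alpha> + 1) - (t - s) powr (\<alpha> + 1)) / (\<alpha> + 1))"
proof -
  let ?X = "\<integral>\<^sup>+u. ennreal ((t - u) powr \<alpha>) * indicator {0<..s} u \<partial>lborel"
  have I: "(\<integral>\<^sup>+w. ennreal (w powr \<alpha>) * indicator {0..c} w \<partial>lborel) = ennreal (c powr (\<alpha>+1) / (\<alpha>+1))" if "c \<ge> 0" for c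
    using nn_integral_powr_Icc[of "\<alpha>" c] \<alpha> that by simp
  have "?X = (\<integral>\<^sup>+w. ennreal (w powr \<alpha>) * indicator {0<..s} (t - w) \<partial>lborel)"
    by (subst nn_integral_real_affine[where c="-1" and t=t]) auto
  also have "\<dots> = (\<integral>\<^sup>+w. ennreal (w powr \<alpha>) * indicator {t-s<..t} w \<partial>lborel)"
    using AE_lborel_singleton[of t] AE_lborel_singleton[of "t - s"]
    by (intro nn_integral_cong_AE) (auto elim!: eventually_elim2 split: split_indicator)
  finally have X: "?X = \<dots>" .
  have "ennreal (t powr (\<alpha>+1) / (\<alpha>+1)) = (\<integral>\<^sup>+w. ennreal (w powr \<alpha>) * indicator {0..t} w \<partial>lborel)" using I assms by simp
  also have "\<dots> = (\<integral>\<^sup>+w. ennreal (w powr \<alpha>) * indicator {0..t-s} w + ennreal (w powr \<alpha>) * indicator {t-s<..t} w \<partial>lborel)"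
    using assms by (intro nn_integral_cong) (auto split: split_indicator)
  also have "\<dots> = ennreal ((t - s) powr (\<alpha>+1) / (\<alpha>+1)) + ?X"
    unfolding X using assms by (subst nn_integral_add) (auto simp: I)
  finally have e: "?X + ennreal ((t - s) powr (\<alpha>+1) / (\<alpha>+1)) = ennreal (t powr (\<alpha>+1) / (\<alpha>+1))" by (simp add: add.commute)
  then have "?X = ennreal (t powr (\<alpha>+1) / (\<alpha>+1)) - ennreal ((t - s) powr (\<alpha>+1) / (\<alpha>+1))"
    by (metis ennreal_add_diff_cancel_right ennreal_neq_top)
  also have "\<dots> = ennreal ((t powr (\<alpha> + 1) - (t - s) powr (\<alpha> + 1)) / (\<alpha> + 1))"
    using \<alpha> by (subst ennreal_minus) (auto simp: diff_divide_distrib)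
  finally show ?thesis .
qed

lemma indicator_Lp_fun [simp]: "indicator {0<..t::real} \<in> Lp_fun p"
  using p_gt_1 by (intro Lp_fun_bounded[of _ 1 0 t]) (auto split: split_indicator)

lemma riesz_indicator_le:
  assumes "0 \<le> s" "s \<le> t"
  shows "riesz \<alpha> (indicator {0<..s}) (indicator {0<..t}) = (s powr (1 + \<alpha>) + t powr (1 + \<alpha>) - (t - s) powr (1 + \<alpha>)) / (\<alpha> * (\<alpha> + 1))"
proof -
  let ?r = "(s powr (1 + \<alpha>) + t powr (1 + \<alpha>) - (t - s) powr (1 + \<alpha>)) / (\<alpha> * (\<alpha> + 1))"
  let ?f = "\<lambda>z. indicator {0<..s} (fst z) * indicator {0<..t} (snd z) * \<bar>fst z - snd z\<bar> powr (\<alpha> - 1) :: real"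
  have r0: "?r \<ge> 0"
  proof -
    have "(t - s) powr (1 + \<alpha>) \<le> t powr (1 + \<alpha>)" using assms \<alpha> by (intro powr_mono2) auto
    moreover have "0 \<le> s powr (1 + \<alpha>)" by simp
    ultimately have "0 \<le> s powr (1 + \<alpha>) + t powr (1 + \<alpha>) - (t - s) powr (1 + \<alpha>)" by linarith
    then show ?thesis using \<alpha> by simp
  qed
  have "(\<integral>\<^sup>+z. ennreal (?f z) \<partial>(lborel \<Otimes>\<^sub>M lborel)) = (\<integral>\<^sup>+u. \<integral>\<^sup>+v. ennreal (?f (u, v)) \<partial>lborel \<partial>lborel)"
    by (subst lborel.nn_integral_fst[symmetric]) auto
  also have "\<dots> = (\<integral>\<^sup>+u. ennreal ((u powr \<alpha> + (t - u) powr \<alpha>) / \<alpha>) * indicator {0<..s} u \<partial>lborel)"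
  proof (intro nn_integral_cong)
    fix u
    show "(\<integral>\<^sup>+v. ennreal (?f (u, v)) \<partial>lborel) = ennreal ((u powr \<alpha> + (t - u) powr \<alpha>) / \<alpha>) * indicator {0<..s} u"
    proof (cases "u \<in> {0<..s}")
      case True
      have "(\<integral>\<^sup>+v. ennreal (?f (u, v)) \<partial>lborel) = (\<integral>\<^sup>+v. ennreal (\<bar>u - v\<bar> powr (\<alpha> - 1)) * indicator {0<..t} v \<partial>lborel)"
        using True by (intro nn_integral_cong) (auto split: split_indicator)
      then show ?thesis using True nn_riesz_inner[of u t] assms by simp
    qed simp
  qed
  also have "\<dots> = (\<integral>\<^sup>+u. ennreal (1 / \<alpha>) * (ennreal (u powr \<alpha>) * indicator {0<..s} u + ennreal ((t - u) powr \<alpha>) * indicator {0<..s} u) \<partial>lborel)"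
    using \<alpha> by (intro nn_integral_cong) (auto simp: ennreal_plus[symmetric] ennreal_mult[symmetric] simp del: ennreal_plus split: split_indicator)
  also have "\<dots> = ennreal (1 / \<alpha>) * ((\<integral>\<^sup>+u. ennreal (u powr \<alpha>) * indicator {0<..s} u \<partial>lborel) + (\<integral>\<^sup>+u. ennreal ((t - u) powr \<alpha>) * indicator {0<..s} u \<partial>lborel))"
    by (subst nn_integral_cmult, simp, subst nn_integral_add) auto
  also have "(\<integral>\<^sup>+u. ennreal (u powr \<alpha>) * indicator {0<..s} u \<partial>lborel) = (\<integral>\<^sup>+u. ennreal (u powr \<alpha>) * indicator {0..s} u \<partial>lborel)"
    using AE_lborel_singleton[of "0::real"]
    by (intro nn_integral_cong_AE) (auto elim!: eventually_mono split: split_indicator)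
  also have "\<dots> = ennreal (s powr (\<alpha> + 1) / (\<alpha> + 1))"
    using nn_integral_powr_Icc[of \<alpha> s] \<alpha> assms by simp
  also have "ennreal (1 / \<alpha>) * (ennreal (s powr (\<alpha> + 1) / (\<alpha> + 1)) + (\<integral>\<^sup>+u. ennreal ((t - u) powr \<alpha>) * indicator {0<..s} u \<partial>lborel)) = ennreal ?r"
  proof -
    have "(t - s) powr (1 + \<alpha>) \<le> t powr (1 + \<alpha>)" using assms \<alpha> by (intro powr_mono2) auto
    then have nn: "0 \<le> (t powr (\<alpha> + 1) - (t - s) powr (\<alpha> + 1)) / (\<alpha> + 1)"
      using \<alpha> by (simp add: add.commute)
    have "1 / \<alpha> * (X / (\<alpha> + 1) + Y / (\<alpha> + 1)) = (X + Y) / (\<alpha> * (\<alpha> + 1))" for X Y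
      by (simp add: add_divide_distrib distrib_left)
    from this[of "s powr (\<alpha> + 1)" "t powr (\<alpha> + 1) - (t - s) powr (\<alpha> + 1)"]
    have "1 / \<alpha> * (s powr (\<alpha> + 1) / (\<alpha> + 1) + (t powr (\<alpha> + 1) - (t - s) powr (\<alpha> + 1)) / (\<alpha> + 1)) = ?r"
      by (simp add: add.commute[of \<alpha> 1] add_diff_eq)
    then show ?thesis
      unfolding nn_powr_shift[OF assms]
      using \<alpha> nn by (subst ennreal_plus[symmetric], simp, simp, subst ennreal_mult[symmetric]) auto
  qed
  finally show ?thesis
    unfolding riesz_def using r0
    by (subst integral_eq_nn_integral) auto
qed

text \<open>The second mixed derivative of the covariance of fractional Brownian motion is a multiple of \<open>\<bar>s - t\<bar>\<^sup>\<alpha>\<^sup>-\<^sup>1\<close>; integrating it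
back over a rectangle at the origin recovers the covariance.\<close>

lemma riesz_indicator:
  assumes "0 \<le> s" "0 \<le> t"
  shows "riesz \<alpha> (indicator {0<..s}) (indicator {0<..t}) = (s powr (1 + \<alpha>) + t powr (1 + \<alpha>) - \<bar>s - t\<bar> powr (1 + \<alpha>)) / (\<alpha> * (\<alpha> + 1))"
proof (cases "s \<le> t")
  case True
  then show ?thesis using riesz_indicator_le[of s t] assms by (simp add: abs_if)
next
  case False
  then show ?thesis using riesz_indicator_le[of t s] assms
    by (subst riesz_commute) (auto simp: abs_if add.commute)
qed

end

section \<open>Gaussian tails and centred Gaussian variables\<close>

abbreviation stdn :: "real measure" where "stdn \<equiv> density lborel std_normal_density"

lemma prob_stdn: "prob_space stdn" by (rule prob_space_normal_density) simp

lemma sets_stdn [simp, measurable_cong]: "sets stdn = sets borel" by simp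

lemma space_stdn [simp]: "space stdn = UNIV" by simp

text \<open>The upper tail of the standard normal law.\<close>

definition gtail :: "real \<Rightarrow> real" where "gtail x = measure stdn {x<..}"

lemma emeasure_stdn: "A \<in> sets borel \<Longrightarrow> emeasure stdn A = (\<integral>\<^sup>+z. ennreal (std_normal_density z) * indicator A z \<partial>lborel)"
  by (simp add: emeasure_density)

lemma stdn_reflect:
  assumes [measurable]: "A \<in> sets borel" shows "measure stdn (uminus -` A) = measure stdn A"
proof -
  have "emeasure stdn (uminus -` A) = (\<integral>\<^sup>+z. ennreal (std_normal_density z) * indicator A (- z) \<partial>lborel)"
    using measurable_sets[OF borel_measurable_uminus[of id borel] assms] by (subst emeasure_stdn) (auto simp: indicator_def)
  also have "\<dots> = (\<integral>\<^sup>+z. ennreal (std_normal_density (- z)) * indicator A z \<partial>lborel)"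
    by (subst nn_integral_real_affine[where c="-1" and t=0]) auto
  also have "\<dots> = emeasure stdn A" by (subst emeasure_stdn) (auto simp: std_normal_density_def)
  finally show ?thesis by (simp add: measure_def)
qed

lemma gtail_mono: "x \<le> y \<Longrightarrow> gtail y \<le> gtail x"
proof -
  interpret prob_space stdn by (rule prob_stdn)
  show "x \<le> y \<Longrightarrow> gtail y \<le> gtail x" unfolding gtail_def by (intro finite_measure_mono) auto
qed

lemma gtail_nonneg [simp]: "0 \<le> gtail x" by (simp add: gtail_def)

lemma gtail_le_1 [simp]: "gtail x \<le> 1"
proof -
  interpret prob_space stdn by (rule prob_stdn)
  show ?thesis unfolding gtail_def by simp
qed

lemma stdn_singleton: "measure stdn {x} = 0"
proof -
  have "emeasure stdn {x} = 0"
    using AE_lborel_singleton[of x]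
    by (subst emeasure_stdn, simp, subst nn_integral_0_iff_AE) (auto elim!: eventually_mono)
  then show ?thesis by (simp add: measure_def)
qed

lemma gtail_minus: "gtail (- x) = 1 - gtail x"
proof -
  interpret prob_space stdn by (rule prob_stdn)
  have "gtail x = measure stdn (uminus -` {x<..})" unfolding gtail_def by (rule stdn_reflect[symmetric]) simp
  also have "uminus -` {x<..} = {..< -x}" by auto
  finally have 1: "gtail x = measure stdn {..< -x}" .
  have "1 = measure stdn UNIV" using prob_space by simp
  also have "UNIV = {..< -x} \<union> ({-x} \<union> {-x<..})" by auto
  also have "measure stdn \<dots> = measure stdn {..< -x} + (measure stdn {-x} + measure stdn {-x<..})"
    by (subst finite_measure_Union; (subst finite_measure_Union)?) auto
  finally show ?thesis unfolding 1 gtail_def[of "-x"] stdn_singleton by simp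
qed

lemma gtail_0: "gtail 0 = 1/2" using gtail_minus[of 0] by simp

lemma gtail_half_le: "x \<le> 0 \<Longrightarrow> 1/2 \<le> gtail x" using gtail_mono[of x 0] gtail_0 by simp

lemma measure_stdn_abs:
  assumes "0 \<le> x" shows "measure stdn {z. \<bar>z\<bar> > x} = 2 * gtail x"
proof -
  interpret prob_space stdn by (rule prob_stdn)
  have "gtail x = measure stdn (uminus -` {x<..})" unfolding gtail_def by (rule stdn_reflect[symmetric]) simp
  also have "uminus -` {x<..} = {..< -x}" by auto
  finally have 1: "gtail x = measure stdn {..< -x}" .
  have "{z. \<bar>z\<bar> > x} = {..< -x} \<union> {x<..}" by auto
  then show ?thesis using assms 1 by (subst (asm) 1, simp, subst finite_measure_Union) (auto simp: gtail_def)
qed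

text \<open>Mills' ratio: both bounds come from differentiating the density divided by its argument.\<close>

lemma mills:
  assumes x: "x > 0"
  shows "gtail x \<le> std_normal_density x / x" "std_normal_density x / x \<le> (1 + 1 / x\<^sup>2) * gtail x"
proof -
  interpret prob_space stdn by (rule prob_stdn)
  let ?\<phi> = std_normal_density
  let ?I = "\<integral>\<^sup>+z. ennreal (?\<phi> z * (1 + 1 / z\<^sup>2)) * indicator {x..} z \<partial>lborel"
  have e: "?I = ennreal (0 - (- (?\<phi> x / x)))"
  proof (rule nn_integral_FTC_atLeast)
    show "((\<lambda>z. - (?\<phi> z / z)) has_real_derivative ?\<phi> z * (1 + 1 / z\<^sup>2)) (at z)" if "x \<le> z" for z
    proof -
      have z: "z > 0" using that x by simp
      have D: "(?\<phi> has_real_derivative (- z * ?\<phi> z)) (at z)"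
      proof -
        define c where "c = 1 / sqrt (2 * pi)"
        have "((\<lambda>z. c * exp (- z\<^sup>2 / 2)) has_real_derivative - z * (c * exp (- z\<^sup>2 / 2))) (at z)"
          by (auto intro!: derivative_eq_intros)
        moreover have "?\<phi> = (\<lambda>z. c * exp (- z\<^sup>2 / 2))"
          by (auto simp: fun_eq_iff std_normal_density_def c_def)
        ultimately show ?thesis by (simp only:)
      qed
      show ?thesis using z
        by (auto intro!: derivative_eq_intros D) (simp add: power2_eq_square field_simps)
    qed
    show "((\<lambda>z. - (?\<phi> z / z)) \<longlongrightarrow> 0) at_top"
      unfolding std_normal_density_def by real_asymp
  qed (auto simp: std_normal_density_def)
  have t: "ennreal (gtail x) = (\<integral>\<^sup>+z. ennreal (?\<phi> z) * indicator {x..} z \<partial>lborel)"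
  proof -
    have "ennreal (gtail x) = (\<integral>\<^sup>+z. ennreal (?\<phi> z) * indicator {x<..} z \<partial>lborel)"
      unfolding gtail_def by (subst emeasure_eq_measure[symmetric], subst emeasure_stdn) auto
    also have "\<dots> = (\<integral>\<^sup>+z. ennreal (?\<phi> z) * indicator {x..} z \<partial>lborel)"
      using AE_lborel_singleton[of x]
      by (intro nn_integral_cong_AE) (auto elim!: eventually_mono split: split_indicator)
    finally show ?thesis .
  qed
  have p0: "0 \<le> ?\<phi> x / x" using x by (intro divide_nonneg_pos normal_density_nonneg)
  have "?\<phi> z \<le> ?\<phi> z * (1 + 1 / z\<^sup>2)" for z
    using mult_left_mono[of 1 "1 + 1 / z\<^sup>2" "?\<phi> z"] by simp
  then have "ennreal (gtail x) \<le> ?I"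
    unfolding t by (intro nn_integral_mono mult_right_mono ennreal_leI) auto
  then show "gtail x \<le> ?\<phi> x / x" using e p0 by simp
  have "?I \<le> (\<integral>\<^sup>+z. ennreal (1 + 1 / x\<^sup>2) * (ennreal (?\<phi> z) * indicator {x..} z) \<partial>lborel)"
  proof (intro nn_integral_mono)
    fix z
    have "ennreal (?\<phi> z * (1 + 1 / z\<^sup>2)) \<le> ennreal (1 + 1 / x\<^sup>2) * ennreal (?\<phi> z)" if "x \<le> z"
    proof -
      have "1 / z\<^sup>2 \<le> 1 / x\<^sup>2" using that x by (intro divide_left_mono power_mono) auto
      then have "?\<phi> z * (1 + 1 / z\<^sup>2) \<le> (1 + 1 / x\<^sup>2) * ?\<phi> z" by (simp add: mult_left_mono mult.commute)
      then show ?thesis by (simp add: ennreal_mult[symmetric] ennreal_leI del: ennreal_plus)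
    qed
    then show "ennreal (?\<phi> z * (1 + 1 / z\<^sup>2)) * indicator {x..} z \<le> ennreal (1 + 1 / x\<^sup>2) * (ennreal (?\<phi> z) * indicator {x..} z)"
      by (auto split: split_indicator)
  qed
  also have "\<dots> = ennreal (1 + 1 / x\<^sup>2) * ennreal (gtail x)"
    unfolding t by (rule nn_integral_cmult) auto
  also have "\<dots> = ennreal ((1 + 1 / x\<^sup>2) * gtail x)" by (simp add: ennreal_mult[symmetric] del: ennreal_plus)
  finally have "ennreal (?\<phi> x / x) \<le> ennreal ((1 + 1 / x\<^sup>2) * gtail x)" using e by simp
  then show "?\<phi> x / x \<le> (1 + 1 / x\<^sup>2) * gtail x"
    by (subst (asm) ennreal_le_iff) (auto intro!: mult_nonneg_nonneg)
qed

text \<open>Comparison of two tails, exact up to the constant from Mills' ratio. It is what allows the sums over chaining levels to be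
measured in units of the single tail \<open>gtail x\<close> of the final bound.\<close>

lemma gtail_scale:
  assumes "x > 0" "\<tau> > 0"
  shows "gtail (\<tau> * x) \<le> (1 + 1 / x\<^sup>2) / \<tau> * exp ((1 - \<tau>\<^sup>2) * x\<^sup>2 / 2) * gtail x"
proof -
  have "gtail (\<tau> * x) \<le> std_normal_density (\<tau> * x) / (\<tau> * x)" using assms by (intro mills) auto
  also have "\<dots> = exp ((1 - \<tau>\<^sup>2) * x\<^sup>2 / 2) / \<tau> * (std_normal_density x / x)"
  proof -
    have "exp (- (\<tau> * x)\<^sup>2 / 2) = exp ((1 - \<tau>\<^sup>2) * x\<^sup>2 / 2) * exp (- x\<^sup>2 / 2)"
      by (subst exp_add[symmetric], intro arg_cong[where f=exp]) (simp add: field_simps power_mult_distrib)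
    then show ?thesis by (simp add: std_normal_density_def mult_ac)
  qed
  also have "\<dots> \<le> exp ((1 - \<tau>\<^sup>2) * x\<^sup>2 / 2) / \<tau> * ((1 + 1 / x\<^sup>2) * gtail x)"
    using assms mills by (intro mult_left_mono) auto
  finally show ?thesis by (simp add: mult_ac)
qed

text \<open>Polynomial decay of every order: for small powers \<open>\<delta>\<close> of the mesh in the variance of an increment, a high order is
needed to beat the number of increments.\<close>

lemma gtail_poly:
  assumes y: "y > 0"
  shows "gtail y \<le> fact j * 2 ^ j / y ^ (2 * j)"
proof (cases "y \<ge> 1")
  case True
  have "gtail y \<le> std_normal_density y / y" by (rule mills[OF y])
  also have "\<dots> \<le> std_normal_density y"
  proof -
    have "std_normal_density y / y \<le> std_normal_density y / 1" using True by (intro divide_left_mono) auto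
    then show ?thesis by simp
  qed
  also have "\<dots> \<le> exp (- (y\<^sup>2 / 2))"
  proof -
    have c: "1 / sqrt (2 * pi) \<le> 1" using pi_gt3 by simp
    have "std_normal_density y = 1 / sqrt (2 * pi) * exp (- (y\<^sup>2 / 2))" by (subst std_normal_density_def) simp
    also have "\<dots> \<le> 1 * exp (- (y\<^sup>2 / 2))" by (intro mult_right_mono c) simp
    finally show ?thesis by simp
  qed
  also have "\<dots> = 1 / exp (y\<^sup>2 / 2)" by (simp add: exp_minus inverse_eq_divide)
  also have "\<dots> \<le> 1 / ((y\<^sup>2 / 2) ^ j / fact j)"
  proof (intro divide_left_mono)
    have "(\<Sum>n\<in>{j}. inverse (fact n) * (y\<^sup>2 / 2) ^ n) \<le> (\<Sum>n. inverse (fact n) * (y\<^sup>2 / 2) ^ n)"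
      by (rule sum_le_suminf[OF summable_exp]) auto
    also have "\<dots> = exp (y\<^sup>2 / 2)" unfolding exp_def by simp
    finally have "inverse (fact j) * (y\<^sup>2 / 2) ^ j \<le> exp (y\<^sup>2 / 2)" by simp
    then show "(y\<^sup>2 / 2) ^ j / fact j \<le> exp (y\<^sup>2 / 2)"
      by (simp only: divide_inverse mult.commute)
  qed (use y in auto)
  also have "\<dots> = fact j * 2 ^ j / y ^ (2 * j)" by (simp add: power_divide power_mult)
  finally show ?thesis .
next
  case False
  then have "y ^ (2 * j) \<le> 1" using y by (intro power_le_one) auto
  moreover have "1 \<le> (fact j * 2 ^ j :: real)"
    using mult_mono[OF fact_ge_1[of j] one_le_power[of "2::real" j]] by simp
  ultimately have "1 \<le> fact j * 2 ^ j / y ^ (2 * j)" using y by (simp add: le_divide_eq)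
  then show ?thesis using gtail_le_1[of y] by linarith
qed

lemma LBINT_gauss: "(LBINT x = ereal a .. \<infinity>. c * exp (- x\<^sup>2 / 2)) = c * sqrt (2 * pi) * gtail a"
proof -
  have "(LBINT x = ereal a .. \<infinity>. c * exp (- x\<^sup>2 / 2)) = (\<integral>x. (c * sqrt (2 * pi)) * (std_normal_density x * indicator {a<..} x) \<partial>lborel)"
    proof -
    have "(LBINT x = ereal a .. \<infinity>. c * exp (- x\<^sup>2 / 2)) = (\<integral>x. indicator (einterval (ereal a) \<infinity>) x *\<^sub>R (c * exp (- x\<^sup>2 / 2)) \<partial>lborel)"
      by (simp only: interval_lebesgue_integral_def set_lebesgue_integral_def ereal_less_eq if_True)
    also have "\<dots> = (\<integral>x. (c * sqrt (2 * pi)) * (std_normal_density x * indicator {a<..} x) \<partial>lborel)"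
      by (intro Bochner_Integration.integral_cong) (auto simp: std_normal_density_def einterval_def split: split_indicator)
    finally show ?thesis .
  qed
  also have "\<dots> = c * sqrt (2 * pi) * (\<integral>x. std_normal_density x * indicator {a<..} x \<partial>lborel)"
    by (rule integral_mult_right_zero)
  also have "(\<integral>x. std_normal_density x * indicator {a<..} x \<partial>lborel) = gtail a"
    unfolding gtail_def measure_def
    by (subst emeasure_stdn, simp, subst integral_eq_nn_integral) (auto simp: ennreal_mult ennreal_indicator)
  finally show ?thesis .
qed

lemma LBINT_gauss_MInf: "(LBINT x = - \<infinity> .. \<infinity>. c * exp (- x\<^sup>2 / 2)) = c * sqrt (2 * pi)"
proof -
  interpret prob_space stdn by (rule prob_stdn)
  have "(LBINT x = - \<infinity> .. \<infinity>. c * exp (- x\<^sup>2 / 2)) = (\<integral>x. (c * sqrt (2 * pi)) * std_normal_density x \<partial>lborel)"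
    unfolding interval_lebesgue_integral_def set_lebesgue_integral_def
    by (auto simp: std_normal_density_def intro!: Bochner_Integration.integral_cong split: split_indicator)
  also have "\<dots> = c * sqrt (2 * pi) * (\<integral>x. std_normal_density x \<partial>lborel)"
    by (rule integral_mult_right_zero)
  finally show ?thesis using integral_normal_density[of 1 0] by simp
qed

lemma gtail_tendsto_left: assumes x: "x > 0"
  shows "((\<lambda>\<eta>. gtail (x - \<eta>)) \<longlongrightarrow> gtail x) (at_right 0)"
proof -
  interpret prob_space stdn by (rule prob_stdn)
  have le: "gtail y \<le> gtail x + (x - y)" if "y \<le> x" for y
  proof -
    have "emeasure stdn {y<..x} = (\<integral>\<^sup>+z. ennreal (std_normal_density z) * indicator {y<..x} z \<partial>lborel)"
      by (rule emeasure_stdn) auto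
    also have "\<dots> \<le> (\<integral>\<^sup>+z. indicator {y<..x} z \<partial>lborel)"
    proof (intro nn_integral_mono)
      fix z :: real
      have "1 \<le> sqrt (2 * pi)" using pi_gt3 by simp
      then have "1 / sqrt (2 * pi) * exp (- z\<^sup>2 / 2) \<le> 1 * 1" by (intro mult_mono) auto
      then show "ennreal (std_normal_density z) * indicator {y<..x} z \<le> indicator {y<..x} z"
        by (auto simp: std_normal_density_def split: split_indicator)
    qed
    also have "\<dots> = ennreal (x - y)" using that by simp
    finally have *: "measure stdn {y<..x} \<le> x - y" using that
      by (subst (asm) emeasure_eq_measure) simp
    have "gtail y = measure stdn ({y<..x} \<union> {x<..})"
      unfolding gtail_def using that by (intro arg_cong[where f="measure stdn"]) auto
    also have "\<dots> = measure stdn {y<..x} + gtail x" unfolding gtail_def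
      by (rule finite_measure_Union) auto
    finally show ?thesis using * by linarith
  qed
  show ?thesis
  proof (rule real_tendsto_sandwich)
    show "\<forall>\<^sub>F \<eta> in at_right 0. gtail x \<le> gtail (x - \<eta>)"
      by (intro eventually_at_rightI[of 0 1] gtail_mono) auto
    show "\<forall>\<^sub>F \<eta> in at_right 0. gtail (x - \<eta>) \<le> gtail x + \<eta>"
    proof (rule eventually_at_rightI[of 0 1])
      fix \<eta> :: real assume "\<eta> \<in> {0<..<1}"
      then show "gtail (x - \<eta>) \<le> gtail x + \<eta>" using le[of "x - \<eta>"] by simp
    qed simp
    have "((\<lambda>\<eta>. gtail x + \<eta>) \<longlongrightarrow> gtail x + 0) (at_right 0)" by (intro tendsto_intros)
    then show "((\<lambda>\<eta>. gtail x + \<eta>) \<longlongrightarrow> gtail x) (at_right 0)" by simp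
  qed auto
qed

text \<open>Centred normal with variance \<open>v\<close>, stated through the characteristic function: this covers point masses and passes to limits
without a case distinction.\<close>

definition cgauss :: "'a measure \<Rightarrow> ('a \<Rightarrow> real) \<Rightarrow> real \<Rightarrow> bool" where
  "cgauss M X v \<longleftrightarrow> X \<in> borel_measurable M \<and> 0 \<le> v \<and>
     (\<forall>\<theta>. char (distr M borel X) \<theta> = complex_of_real (exp (- (v * \<theta>\<^sup>2) / 2)))"

lemma char_scale:
  assumes [measurable]: "X \<in> borel_measurable M"
  shows "char (distr M borel (\<lambda>\<omega>. c * X \<omega>)) \<theta> = char (distr M borel X) (c * \<theta>)"
  unfolding char_def by (simp add: integral_distr mult_ac)

lemma char_stdn_scale: "char (distr stdn borel (\<lambda>z. c * z)) \<theta> = complex_of_real (exp (- (c\<^sup>2 * \<theta>\<^sup>2) / 2))"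
proof -
  have "distr stdn borel (\<lambda>z. z) = stdn" by (subst distr_id2) auto
  then show ?thesis using char_scale[of "\<lambda>z. z" stdn c \<theta>] by (simp add: char_std_normal_distribution power_mult_distrib)
qed

context prob_space
begin

lemma cgauss_law:
  assumes "cgauss M X v" shows "distr M borel X = distr stdn borel (\<lambda>z. sqrt v * z)"
proof (rule Levy_uniqueness)
  have [measurable]: "X \<in> borel_measurable M" using assms by (simp add: cgauss_def)
  show "real_distribution (distr M borel X)" by (rule real_distribution_distr) simp
  interpret N: prob_space stdn by (rule prob_stdn)
  show "real_distribution (distr stdn borel (\<lambda>z. sqrt v * z))"
    by (rule N.real_distribution_distr) simp
  show "char (distr M borel X) = char (distr stdn borel (\<lambda>z. sqrt v * z))"
    using assms by (auto simp: cgauss_def char_stdn_scale)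
qed

lemma cgauss_prob:
  assumes "cgauss M X v" and [measurable]: "A \<in> sets borel"
  shows "\<P>(\<omega> in M. X \<omega> \<in> A) = measure stdn {z. sqrt v * z \<in> A}"
proof -
  have [measurable]: "X \<in> borel_measurable M" using assms by (simp add: cgauss_def)
  have "measure (distr M borel X) A = measure (distr stdn borel (\<lambda>z. sqrt v * z)) A"
    by (simp add: cgauss_law[OF assms(1)])
  then show ?thesis
    by (simp add: measure_distr vimage_def Int_def conj_commute)
qed

lemma cgauss_zero_AE:
  assumes "cgauss M X 0" shows "AE \<omega> in M. X \<omega> = 0"
proof -
  have [measurable]: "X \<in> borel_measurable M" using assms by (simp add: cgauss_def)
  interpret N: prob_space stdn by (rule prob_stdn)
  have "\<P>(\<omega> in M. X \<omega> \<in> {0}) = measure stdn {z. sqrt 0 * z \<in> {0}}"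
    by (rule cgauss_prob[OF assms]) simp
  also have "\<dots> = 1" using N.prob_space by simp
  finally show ?thesis by (subst prob_Collect_eq_1[symmetric]) auto
qed

lemma cgauss_gt:
  assumes "cgauss M X v" "v > 0"
  shows "\<P>(\<omega> in M. X \<omega> > a) = gtail (a / sqrt v)"
proof -
  have "\<P>(\<omega> in M. X \<omega> \<in> {a<..}) = measure stdn {z. sqrt v * z \<in> {a<..}}"
    by (rule cgauss_prob[OF assms(1)]) simp
  also have "{z. sqrt v * z \<in> {a<..}} = {a / sqrt v <..}" using assms(2) by (auto simp: field_simps)
  finally show ?thesis by (simp add: gtail_def)
qed

lemma cgauss_abs_gt:
  assumes X: "cgauss M X v" and s: "v \<le> s\<^sup>2" "0 \<le> s" and a: "0 \<le> a"
  shows "\<P>(\<omega> in M. \<bar>X \<omega>\<bar> > a * s) \<le> 2 * gtail a"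
proof -
  interpret N: prob_space stdn by (rule prob_stdn)
  have v: "0 \<le> v" using X by (simp add: cgauss_def)
  have "\<P>(\<omega> in M. X \<omega> \<in> {x. \<bar>x\<bar> > a * s}) = measure stdn {z. sqrt v * z \<in> {x. \<bar>x\<bar> > a * s}}"
    by (rule cgauss_prob[OF X]) simp
  also have "\<dots> \<le> measure stdn {z. \<bar>z\<bar> > a}"
  proof (intro N.finite_measure_mono, safe)
    fix z assume "a * s < \<bar>sqrt v * z\<bar>"
    also have "\<bar>sqrt v * z\<bar> = sqrt v * \<bar>z\<bar>" using v by (simp add: abs_mult)
    also have "\<dots> \<le> s * \<bar>z\<bar>" using s by (intro mult_right_mono real_le_lsqrt) auto
    finally have "s * a < s * \<bar>z\<bar>" by (simp add: mult.commute)
    then show "a < \<bar>z\<bar>" using s mult_left_mono[of "\<bar>z\<bar>" a s] by (meson not_le)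
  qed auto
  also have "\<dots> = 2 * gtail a" by (rule measure_stdn_abs[OF a])
  finally show ?thesis by simp
qed

lemma cgauss_second_moment:
  assumes "cgauss M X v"
  shows "integrable M (\<lambda>\<omega>. (X \<omega>)\<^sup>2)" "(\<integral>\<omega>. (X \<omega>)\<^sup>2 \<partial>M) = v"
proof -
  have [measurable]: "X \<in> borel_measurable M" and v: "0 \<le> v" using assms by (auto simp: cgauss_def)
  have i: "integrable stdn (\<lambda>z. z\<^sup>2)" and m: "(\<integral>z. z\<^sup>2 \<partial>stdn) = 1"
    using std_normal_distribution_even_moments[of 1] by (auto simp: numeral_2_eq_2)
  have "integrable (distr M borel X) (\<lambda>x. x\<^sup>2)"
    unfolding cgauss_law[OF assms] using i by (subst integrable_distr_eq) (auto simp: power_mult_distrib)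
  then show "integrable M (\<lambda>\<omega>. (X \<omega>)\<^sup>2)" by (subst (asm) integrable_distr_eq) auto
  have "(\<integral>\<omega>. (X \<omega>)\<^sup>2 \<partial>M) = (\<integral>x. x\<^sup>2 \<partial>distr M borel X)" by (simp add: integral_distr)
  also have "\<dots> = (\<integral>z. v * z\<^sup>2 \<partial>stdn)"
    unfolding cgauss_law[OF assms] using v by (subst integral_distr) (auto simp: power_mult_distrib)
  also have "\<dots> = v" using m by simp
  finally show "(\<integral>\<omega>. (X \<omega>)\<^sup>2 \<partial>M) = v" .
qed

lemma cgauss_of_gaussian_rv:
  assumes X: "gaussian_rv M X" and E: "expectation X = 0"
  shows "cgauss M X (expectation (\<lambda>\<omega>. (X \<omega>)\<^sup>2))" "integrable M (\<lambda>\<omega>. (X \<omega>)\<^sup>2)"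
proof -
  have [measurable]: "X \<in> borel_measurable M" using X by (simp add: gaussian_rv_def)
  consider (normal) \<mu> \<sigma> where "0 < \<sigma>" "distributed M lborel X (normal_density \<mu> \<sigma>)"
    | (const) \<mu> where "AE \<omega> in M. X \<omega> = \<mu>" using X by (auto simp: gaussian_rv_def)
  then have "\<exists>v. cgauss M X v"
  proof cases
    case normal
    have "\<mu> = 0" using normal_distributed_expectation[OF normal(1,2)] E by simp
    then have "distributed M lborel (\<lambda>x. X x / \<sigma>) std_normal_density"
      using normal normal_standard_normal_convert[of \<sigma> X \<mu>] by simp
    from distributed_distr_eq_density[OF this]
    have d: "distr M borel (\<lambda>x. X x / \<sigma>) = stdn" by (subst distr_cong[OF refl sets_lborel[symmetric] refl]) simp
    have "char (distr M borel X) \<theta> = complex_of_real (exp (- (\<sigma>\<^sup>2 * \<theta>\<^sup>2) / 2))" for \<theta>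
    proof -
      have "char (distr M borel X) \<theta> = char (distr M borel (\<lambda>x. \<sigma> * (X x / \<sigma>))) \<theta>" using normal(1) by simp
      also have "\<dots> = char stdn (\<sigma> * \<theta>)" unfolding d[symmetric] by (rule char_scale) simp
      finally show ?thesis by (simp add: char_std_normal_distribution power_mult_distrib)
    qed
    then show ?thesis by (intro exI[of _ "\<sigma>\<^sup>2"]) (auto simp: cgauss_def)
  next
    case const
    have "expectation X = expectation (\<lambda>_. \<mu>)" using const by (intro integral_cong_AE) auto
    then have mu: "\<mu> = 0" using E by (simp add: prob_space)
    have "char (distr M borel X) \<theta> = 1" for \<theta>
    proof -
      have "char (distr M borel X) \<theta> = (CLINT x|M. iexp (\<theta> * X x))" by (simp add: char_def integral_distr)
      also have "\<dots> = (CLINT x|M. 1)" using const mu by (intro integral_cong_AE) (auto elim!: eventually_mono)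
      finally show ?thesis by (simp add: prob_space)
    qed
    then show ?thesis by (intro exI[of _ 0]) (auto simp: cgauss_def)
  qed
  then obtain v where v: "cgauss M X v" by blast
  then show "cgauss M X (expectation (\<lambda>\<omega>. (X \<omega>)\<^sup>2))" using cgauss_second_moment(2)[OF v] by simp
  show "integrable M (\<lambda>\<omega>. (X \<omega>)\<^sup>2)" by (rule cgauss_second_moment(1)[OF v])
qed

text \<open>\<open>\<bar>exp (i\<theta>x) - exp (i\<theta>y)\<bar> \<le> \<bar>\<theta>\<bar> \<bar>x - y\<bar>\<close>, and \<open>\<bar>x - y\<bar> \<le> e + (x - y)\<^sup>2/e\<close> reduces the first moment to the second.\<close>

lemma char_diff_le:
  assumes [measurable]: "X \<in> borel_measurable M" "Y \<in> borel_measurable M"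
    and e: "e > 0" and d: "(\<integral>\<^sup>+\<omega>. ennreal ((X \<omega> - Y \<omega>)\<^sup>2) \<partial>M) \<le> ennreal (e\<^sup>2)"
  shows "cmod (char (distr M borel X) \<theta> - char (distr M borel Y) \<theta>) \<le> \<bar>\<theta>\<bar> * (2 * e)"
proof -
  have ie: "integrable M (\<lambda>\<omega>. iexp (\<theta> * X \<omega>))" "integrable M (\<lambda>\<omega>. iexp (\<theta> * Y \<omega>))"
    by (auto intro!: integrable_iexp)
  have "char (distr M borel X) \<theta> - char (distr M borel Y) \<theta> = (CLINT \<omega>|M. iexp (\<theta> * X \<omega>) - iexp (\<theta> * Y \<omega>))"
    by (subst Bochner_Integration.integral_diff[OF ie]) (simp add: char_def integral_distr)
  then have "ennreal (cmod (char (distr M borel X) \<theta> - char (distr M borel Y) \<theta>)) \<le> (\<integral>\<^sup>+\<omega>. cmod (iexp (\<theta> * X \<omega>) - iexp (\<theta> * Y \<omega>)) \<partial>M)"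
    using integral_norm_bound_ennreal[OF Bochner_Integration.integrable_diff[OF ie]] by simp
  also have "\<dots> \<le> (\<integral>\<^sup>+\<omega>. ennreal \<bar>\<theta>\<bar> * (ennreal e + ennreal (1 / e) * ennreal ((X \<omega> - Y \<omega>)\<^sup>2)) \<partial>M)"
  proof (intro nn_integral_mono)
    fix \<omega>
    define D where "D = \<bar>X \<omega> - Y \<omega>\<bar>"
    have "cmod (iexp (\<theta> * X \<omega>) - iexp (\<theta> * Y \<omega>)) = cmod (iexp (\<theta> * Y \<omega>) * (iexp (\<theta> * (X \<omega> - Y \<omega>)) - 1))"
      by (simp add: exp_add[symmetric] algebra_simps)
    also have "\<dots> = cmod (iexp (\<theta> * (X \<omega> - Y \<omega>)) - 1)" by (simp add: norm_mult)
    also have "\<dots> \<le> \<bar>\<theta> * (X \<omega> - Y \<omega>)\<bar>" using iexp_approx1[of "\<theta> * (X \<omega> - Y \<omega>)" 0] by simp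
    also have "\<dots> = \<bar>\<theta>\<bar> * D" by (simp add: abs_mult D_def)
    also have "D \<le> e + 1 / e * D\<^sup>2"
    proof (cases "D \<le> e")
      case True then show ?thesis using e by (simp add: add_increasing2)
    next
      case False
      then have "e * D \<le> D * D" using e by (intro mult_right_mono) auto
      then have "D \<le> 1 / e * D\<^sup>2" using e by (simp add: power2_eq_square field_simps)
      then show ?thesis using e by simp
    qed
    then have "\<bar>\<theta>\<bar> * D \<le> \<bar>\<theta>\<bar> * (e + 1 / e * (X \<omega> - Y \<omega>)\<^sup>2)" by (intro mult_left_mono) (auto simp: D_def)
    finally have "ennreal (cmod (iexp (\<theta> * X \<omega>) - iexp (\<theta> * Y \<omega>))) \<le> ennreal (\<bar>\<theta>\<bar> * (e + 1 / e * (X \<omega> - Y \<omega>)\<^sup>2))"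
      by (rule ennreal_leI)
    also have "\<dots> = ennreal \<bar>\<theta>\<bar> * (ennreal e + ennreal (1 / e) * ennreal ((X \<omega> - Y \<omega>)\<^sup>2))"
      using e by (simp add: ennreal_mult[symmetric] ennreal_plus[symmetric] del: ennreal_plus)
    finally show "ennreal (cmod (iexp (\<theta> * X \<omega>) - iexp (\<theta> * Y \<omega>))) \<le> \<dots>" .
  qed
  also have "\<dots> = ennreal \<bar>\<theta>\<bar> * (ennreal e + ennreal (1 / e) * (\<integral>\<^sup>+\<omega>. ennreal ((X \<omega> - Y \<omega>)\<^sup>2) \<partial>M))"
    by (subst nn_integral_cmult, simp, subst nn_integral_add, simp, simp, subst nn_integral_cmult) (auto simp: emeasure_space_1)
  also have "\<dots> \<le> ennreal \<bar>\<theta>\<bar> * (ennreal e + ennreal (1 / e) * ennreal (e\<^sup>2))"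
    using d by (intro mult_left_mono add_left_mono) auto
  also have "\<dots> = ennreal (\<bar>\<theta>\<bar> * (2 * e))"
    using e by (simp add: ennreal_mult[symmetric] ennreal_plus[symmetric] power2_eq_square del: ennreal_plus)
  finally show ?thesis using e by (subst (asm) ennreal_le_iff) auto
qed

text \<open>Characteristic functions converge under convergence in \<open>L\<^sup>2\<close>.\<close>

lemma cgauss_limit:
  assumes X: "\<And>k. cgauss M (X k) (v k)" and Y [measurable]: "Y \<in> borel_measurable M"
    and lim: "(\<lambda>k. \<integral>\<^sup>+\<omega>. ennreal ((X k \<omega> - Y \<omega>)\<^sup>2) \<partial>M) \<longlonglongrightarrow> 0" and v: "v \<longlonglongrightarrow> w"
  shows "cgauss M Y w"
proof -
  have [measurable]: "X k \<in> borel_measurable M" for k using X by (simp add: cgauss_def)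
  have "0 \<le> w" using v X by (intro LIMSEQ_le_const[OF v]) (auto simp: cgauss_def)
  moreover have "char (distr M borel Y) \<theta> = complex_of_real (exp (- (w * \<theta>\<^sup>2) / 2))" for \<theta>
  proof (rule LIMSEQ_unique)
    show "(\<lambda>k. char (distr M borel (X k)) \<theta>) \<longlonglongrightarrow> complex_of_real (exp (- (w * \<theta>\<^sup>2) / 2))"
      using X unfolding cgauss_def by (auto intro!: tendsto_intros v)
    show "(\<lambda>k. char (distr M borel (X k)) \<theta>) \<longlonglongrightarrow> char (distr M borel Y) \<theta>"
    proof (rule LIMSEQ_I)
      fix r :: real assume r: "r > 0"
      define a where "a = \<bar>\<theta>\<bar> + 1"
      have a: "a > 0" by (simp add: a_def)
      define e where "e = r / (4 * a)"
      have e: "e > 0" using r a by (simp add: e_def)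
      have "eventually (\<lambda>k. (\<integral>\<^sup>+\<omega>. ennreal ((X k \<omega> - Y \<omega>)\<^sup>2) \<partial>M) < ennreal (e\<^sup>2)) sequentially"
        using e by (intro order_tendstoD(2)[OF lim]) auto
      then obtain k0 where k0: "\<And>k. k \<ge> k0 \<Longrightarrow> (\<integral>\<^sup>+\<omega>. ennreal ((X k \<omega> - Y \<omega>)\<^sup>2) \<partial>M) \<le> ennreal (e\<^sup>2)"
        unfolding eventually_sequentially by (meson less_imp_le)
      have "norm (char (distr M borel (X k)) \<theta> - char (distr M borel Y) \<theta>) < r" if "k \<ge> k0" for k
      proof -
        have "norm (char (distr M borel (X k)) \<theta> - char (distr M borel Y) \<theta>) \<le> \<bar>\<theta>\<bar> * (2 * e)"
          by (intro char_diff_le k0 that e) auto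
        also have "\<dots> \<le> a * (2 * e)" using e by (intro mult_right_mono) (auto simp: a_def)
        also have "\<dots> = r / 2" using a by (simp add: e_def)
        also have "\<dots> < r" using r by simp
        finally show ?thesis .
      qed
      then show "\<exists>no. \<forall>k\<ge>no. norm (char (distr M borel (X k)) \<theta> - char (distr M borel Y) \<theta>) < r" by blast
    qed
  qed
  ultimately show ?thesis by (simp add: cgauss_def)
qed

end

section \<open>Gaussianity of integrals against fractional Brownian motion\<close>

locale fbm = prob_space M + riesz_exp \<alpha> p for M :: "'a measure" and \<alpha> p :: real +
  fixes \<xi> :: "real \<Rightarrow> 'a \<Rightarrow> real"
  assumes fbm: "fractional_brownian_motion M \<alpha> \<xi>"
begin

definition \<kappa> :: real where "\<kappa> = fbm_const \<alpha> * \<alpha> * (\<alpha> + 1)"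

text \<open>Finite linear combinations of values of \<open>\<xi>\<close>, paired with the step function whose integral they are.\<close>

definition gform :: "('a \<Rightarrow> real) \<Rightarrow> (real \<Rightarrow> real) \<Rightarrow> bool" where
  "gform X \<phi> \<longleftrightarrow> (\<exists>F a. finite F \<and> F \<subseteq> {0..} \<and> X = (\<lambda>\<omega>. \<Sum>t\<in>F. a t * \<xi> t \<omega>) \<and>
     \<phi> = (\<lambda>u. \<Sum>t\<in>F. a t * indicator {0<..t} u))"

lemma gform_single: "0 \<le> t \<Longrightarrow> gform (\<xi> t) (indicator {0<..t})"
  unfolding gform_def by (intro exI[of _ "{t}"] exI[of _ "\<lambda>_. 1"]) auto

lemma gform_zero: "gform (\<lambda>_. 0) (\<lambda>_. 0)"
  unfolding gform_def by (intro exI[of _ "{}"] exI[of _ "\<lambda>_. 1"]) auto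

lemma gform_cmult: "gform X \<phi> \<Longrightarrow> gform (\<lambda>\<omega>. c * X \<omega>) (\<lambda>u. c * \<phi> u)"
proof -
  assume "gform X \<phi>"
  then obtain F a where F: "finite F" "F \<subseteq> {0..}" "X = (\<lambda>\<omega>. \<Sum>t\<in>F. a t * \<xi> t \<omega>)" "\<phi> = (\<lambda>u. \<Sum>t\<in>F. a t * indicator {0<..t} u)"
    by (auto simp: gform_def)
  show ?thesis
    unfolding gform_def
    by (intro exI[of _ F] exI[of _ "\<lambda>t. c * a t"] conjI F(1,2)) (simp_all only: F(3,4) sum_distrib_left mult.assoc)
qed

lemma gform_add:
  assumes "gform X \<phi>" "gform Y \<psi>" shows "gform (\<lambda>\<omega>. X \<omega> + Y \<omega>) (\<lambda>u. \<phi> u + \<psi> u)"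
proof -
  obtain F a where F: "finite F" "F \<subseteq> {0..}" "X = (\<lambda>\<omega>. \<Sum>t\<in>F. a t * \<xi> t \<omega>)" "\<phi> = (\<lambda>u. \<Sum>t\<in>F. a t * indicator {0<..t} u)"
    using assms(1) by (auto simp: gform_def)
  obtain G b where G: "finite G" "G \<subseteq> {0..}" "Y = (\<lambda>\<omega>. \<Sum>t\<in>G. b t * \<xi> t \<omega>)" "\<psi> = (\<lambda>u. \<Sum>t\<in>G. b t * indicator {0<..t} u)"
    using assms(2) by (auto simp: gform_def)
  define c where "c = (\<lambda>t. (if t \<in> F then a t else 0) + (if t \<in> G then b t else 0))"
  have "(\<Sum>t\<in>F \<union> G. c t * z t) = (\<Sum>t\<in>F. a t * z t) + (\<Sum>t\<in>G. b t * z t)" for z :: "real \<Rightarrow> real"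
  proof -
    have "(\<Sum>t\<in>F \<union> G. c t * z t) = (\<Sum>t\<in>F \<union> G. (if t \<in> F then a t * z t else 0)) + (\<Sum>t\<in>F \<union> G. (if t \<in> G then b t * z t else 0))"
      by (subst sum.distrib[symmetric], intro sum.cong) (auto simp: c_def distrib_right)
    also have "(\<Sum>t\<in>F \<union> G. (if t \<in> F then a t * z t else 0)) = (\<Sum>t\<in>F. a t * z t)"
      using F G by (intro sum.mono_neutral_cong_right) auto
    also have "(\<Sum>t\<in>F \<union> G. (if t \<in> G then b t * z t else 0)) = (\<Sum>t\<in>G. b t * z t)"
      using F G by (intro sum.mono_neutral_cong_right) auto
    finally show ?thesis .
  qed
  then show ?thesis
    unfolding gform_def using F G by (intro exI[of _ "F \<union> G"] exI[of _ c]) auto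
qed

lemma gform_diff: "gform X \<phi> \<Longrightarrow> gform Y \<psi> \<Longrightarrow> gform (\<lambda>\<omega>. X \<omega> - Y \<omega>) (\<lambda>u. \<phi> u - \<psi> u)"
  using gform_add[of X \<phi> "\<lambda>\<omega>. -1 * Y \<omega>" "\<lambda>u. -1 * \<psi> u"] gform_cmult[of Y \<psi> "-1"] by simp

lemma gform_sum:
  "finite I \<Longrightarrow> (\<And>i. i \<in> I \<Longrightarrow> gform (X i) (\<phi> i)) \<Longrightarrow> gform (\<lambda>\<omega>. \<Sum>i\<in>I. X i \<omega>) (\<lambda>u. \<Sum>i\<in>I. \<phi> i u)"
  by (induction I rule: finite_induct) (auto intro!: gform_add gform_zero)

lemma gform_Lp_fun: "gform X \<phi> \<Longrightarrow> \<phi> \<in> Lp_fun p"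
  unfolding gform_def using p_gt_1 by (auto intro!: Lp_fun_sum Lp_fun_cmult)

lemma xi_gauss: "0 \<le> t \<Longrightarrow> gaussian_rv M (\<xi> t)"
proof -
  assume t: "0 \<le> t"
  have "gaussian_process M {0..} \<xi>" using fbm by (simp add: fractional_brownian_motion_def)
  then have "gaussian_rv M (\<lambda>\<omega>. \<Sum>s\<in>{t}. 1 * \<xi> s \<omega>)"
    unfolding gaussian_process_def using t by (elim allE[of _ "{t}"] allE[of _ "\<lambda>_. 1"]) auto
  then show ?thesis by simp
qed

lemma xi_mean: "0 \<le> t \<Longrightarrow> expectation (\<xi> t) = 0"
  using fbm by (simp add: fractional_brownian_motion_def)

lemma xi_meas: "0 \<le> t \<Longrightarrow> \<xi> t \<in> borel_measurable M"
  using xi_gauss by (simp add: gaussian_rv_def)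

lemma xi_sq: "0 \<le> t \<Longrightarrow> integrable M (\<lambda>\<omega>. (\<xi> t \<omega>)\<^sup>2)"
  using cgauss_of_gaussian_rv xi_gauss xi_mean by blast

lemma xi_prod:
  assumes "0 \<le> s" "0 \<le> t" shows "integrable M (\<lambda>\<omega>. \<xi> s \<omega> * \<xi> t \<omega>)"
proof (rule Bochner_Integration.integrable_bound)
  show "integrable M (\<lambda>\<omega>. (\<xi> s \<omega>)\<^sup>2 + (\<xi> t \<omega>)\<^sup>2)" using assms xi_sq by auto
  show "(\<lambda>\<omega>. \<xi> s \<omega> * \<xi> t \<omega>) \<in> borel_measurable M" using xi_meas assms by auto
  have "\<bar>x * y\<bar> \<le> x\<^sup>2 + y\<^sup>2" for x y :: real
  proof -
    have "2 * \<bar>x * y\<bar> \<le> x\<^sup>2 + y\<^sup>2"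
      using sum_squares_bound[of "\<bar>x\<bar>" "\<bar>y\<bar>"] by (simp add: abs_mult mult.assoc)
    then show ?thesis using abs_ge_zero[of "x * y"] by linarith
  qed
  then show "AE \<omega> in M. norm (\<xi> s \<omega> * \<xi> t \<omega>) \<le> norm ((\<xi> s \<omega>)\<^sup>2 + (\<xi> t \<omega>)\<^sup>2)" by auto
qed

lemma xi_integrable: assumes "0 \<le> t" shows "integrable M (\<xi> t)"
proof (rule Bochner_Integration.integrable_bound)
  show "integrable M (\<lambda>\<omega>. 1 + (\<xi> t \<omega>)\<^sup>2)" using assms xi_sq by auto
  show "\<xi> t \<in> borel_measurable M" using xi_meas assms by auto
  have "\<bar>x\<bar> \<le> 1 + x\<^sup>2" for x :: real
    using sum_squares_bound[of "\<bar>x\<bar>" 1] abs_ge_zero[of x] by (simp add: power2_eq_square)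
  then show "AE \<omega> in M. norm (\<xi> t \<omega>) \<le> norm (1 + (\<xi> t \<omega>)\<^sup>2)" by auto
qed

lemma xi_cov: "0 \<le> s \<Longrightarrow> 0 \<le> t \<Longrightarrow> expectation (\<lambda>\<omega>. \<xi> s \<omega> * \<xi> t \<omega>) = \<kappa> * riesz \<alpha> (indicator {0<..s}) (indicator {0<..t})"
  using fbm \<alpha> by (simp add: fractional_brownian_motion_def riesz_indicator \<kappa>_def)

text \<open>The quadratic form in the covariances of \<open>\<xi>\<close> is the Riesz form of the step function, by \<open>riesz_indicator\<close> and bilinearity.\<close>

lemma gform_cgauss:
  assumes "gform X \<phi>" shows "cgauss M X (\<kappa> * riesz \<alpha> \<phi> \<phi>)"
proof -
  obtain F a where F: "finite F" "F \<subseteq> {0..}" and X: "X = (\<lambda>\<omega>. \<Sum>t\<in>F. a t * \<xi> t \<omega>)" and \<phi>: "\<phi> = (\<lambda>u. \<Sum>t\<in>F. a t * indicator {0<..t} u)"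
    using assms(1) by (auto simp: gform_def)
  have t0: "0 \<le> t" if "t \<in> F" for t using F that by auto
  have g: "gaussian_rv M X" using fbm F unfolding X fractional_brownian_motion_def gaussian_process_def by auto
  have "expectation X = (\<Sum>t\<in>F. a t * expectation (\<xi> t))"
    unfolding X using xi_integrable t0 by (subst Bochner_Integration.integral_sum) auto
  also have "\<dots> = 0" using xi_mean t0 by (intro sum.neutral) auto
  finally have m: "expectation X = 0" .
  have "expectation (\<lambda>\<omega>. (X \<omega>)\<^sup>2) = expectation (\<lambda>\<omega>. \<Sum>s\<in>F. \<Sum>t\<in>F. a s * a t * (\<xi> s \<omega> * \<xi> t \<omega>))"
    unfolding X power2_eq_square by (simp add: sum_product mult_ac)
  also have "\<dots> = (\<Sum>s\<in>F. \<Sum>t\<in>F. a s * a t * expectation (\<lambda>\<omega>. \<xi> s \<omega> * \<xi> t \<omega>))"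
    using xi_prod t0 by (subst Bochner_Integration.integral_sum, simp, intro sum.cong refl, subst Bochner_Integration.integral_sum) auto
  also have "\<dots> = (\<Sum>s\<in>F. \<Sum>t\<in>F. a s * a t * (\<kappa> * riesz \<alpha> (indicator {0<..s}) (indicator {0<..t})))"
    using xi_cov t0 by (intro sum.cong refl) auto
  also have "\<dots> = \<kappa> * (\<Sum>s\<in>F. \<Sum>t\<in>F. a s * a t * riesz \<alpha> (indicator {0<..s}) (indicator {0<..t}))"
    by (simp add: sum_distrib_left mult_ac)
  also have "\<dots> = \<kappa> * riesz \<alpha> \<phi> \<phi>"
    unfolding \<phi> using F by (subst riesz_sum_sum) auto
  finally show ?thesis using cgauss_of_gaussian_rv(1)[OF g m] by simp
qed

text \<open>The sign is read off from the variance of \<open>\<xi>\<close> at time \<open>1\<close> rather than from the Gamma and cosine factors.\<close>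

lemma \<kappa>_nonneg: "0 \<le> \<kappa>"
proof -
  have "cgauss M (\<xi> 1) (\<kappa> * riesz \<alpha> (indicator {0<..1}) (indicator {0<..1}))" by (intro gform_cgauss gform_single) simp
  then have "0 \<le> \<kappa> * riesz \<alpha> (indicator {0<..1}) (indicator {0<..1})" by (simp add: cgauss_def)
  moreover have "0 < riesz \<alpha> (indicator {0<..1}) (indicator {0<..1})" using \<alpha> by (simp add: riesz_indicator)
  ultimately show ?thesis by (simp add: zero_le_mult_iff)
qed

lemma gform_L2_le:
  assumes "gform X \<phi>" "e > 0" "Lpn p \<phi> \<le> ennreal (e powr p)"
  shows "(\<integral>\<^sup>+\<omega>. ennreal ((X \<omega>)\<^sup>2) \<partial>M) \<le> ennreal (\<kappa> * hlsK \<alpha> * e\<^sup>2)"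
proof -
  have "\<bar>riesz \<alpha> \<phi> \<phi>\<bar> \<le> hlsK \<alpha> * e * e"
    using gform_Lp_fun[OF assms(1)] assms(2,3) by (intro riesz_bound) (auto simp: Lp_fun_def)
  then have "\<kappa> * riesz \<alpha> \<phi> \<phi> \<le> \<kappa> * (hlsK \<alpha> * e * e)" using \<kappa>_nonneg by (intro mult_left_mono) auto
  then show ?thesis
    using cgauss_second_moment[OF gform_cgauss[OF assms(1)]]
    by (subst nn_integral_eq_integral) (auto intro!: ennreal_leI simp: power2_eq_square mult_ac)
qed

text \<open>The step function with the coefficients of \<open>dyadic_step\<close> on half-open intervals. Written as a combination of the indicators
of \<open>{0<..t}\<close>, it is the counterpart of \<open>dyadic_integral\<close> in the sense of \<open>gform\<close>.\<close>

definition hstep :: "real \<Rightarrow> nat \<Rightarrow> (nat \<Rightarrow> real) \<Rightarrow> real \<Rightarrow> real" where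
  "hstep t n a x = (\<Sum>i<2 ^ n. a i * (indicator {0<..real (Suc i) / 2 ^ n * t} x - indicator {0<..real i / 2 ^ n * t} x))"

lemma hstep_gform: "0 \<le> t \<Longrightarrow> gform (dyadic_integral \<xi> t n a) (hstep t n a)"
  unfolding dyadic_integral_def[abs_def] hstep_def[abs_def]
  by (intro gform_sum gform_cmult gform_diff gform_single) auto

lemma hstep_meas [measurable]: "hstep t n a \<in> borel_measurable borel"
  unfolding hstep_def[abs_def] by measurable

lemma hstep_AE:
  assumes "0 \<le> t" shows "AE x in lborel. dyadic_step t n a x = hstep t n a x"
proof -
  have "AE x in lborel. \<forall>i\<in>{..<2^n}. x \<noteq> real i / 2 ^ n * t"
    by (intro AE_finite_allI AE_lborel_singleton) auto
  then show ?thesis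
  proof (rule AE_mp, intro AE_I2 impI)
    fix x assume x: "\<forall>i\<in>{..<2^n}. x \<noteq> real i / 2 ^ n * t"
    show "dyadic_step t n a x = hstep t n a x"
      unfolding dyadic_step_def hstep_def
    proof (intro sum.cong refl arg_cong2[where f="(*)"])
      fix i assume i: "i \<in> {..<2^n::nat}"
      have "0 \<le> real i / 2 ^ n * t" "real i / 2 ^ n * t \<le> real (Suc i) / 2 ^ n * t"
        using assms by (auto intro!: mult_right_mono divide_right_mono)
      moreover have "x \<noteq> real i / 2 ^ n * t" using x i by auto
      ultimately show "indicator {real i / 2 ^ n * t..real (Suc i) / 2 ^ n * t} x =
         (indicator {0<..real (Suc i) / 2 ^ n * t} x - indicator {0<..real i / 2 ^ n * t} x :: real)"
        by (auto split: split_indicator)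
    qed
  qed
qed

lemma hstep_outside: "0 \<le> t \<Longrightarrow> x \<notin> {0<..t} \<Longrightarrow> hstep t n a x = 0"
proof -
  assume t: "0 \<le> t" and x: "x \<notin> {0<..t}"
  have "real (Suc i) / 2 ^ n * t \<le> t" if "i < 2 ^ n" for i
  proof -
    have "real (Suc i) \<le> real (2 ^ n)" using that by (subst of_nat_le_iff) auto
    then have "real (Suc i) / 2 ^ n \<le> 1" by simp
    then show ?thesis using t by (intro mult_left_le_one_le) auto
  qed
  moreover have "real i / 2 ^ n * t \<le> t" if "i < 2 ^ n" for i
  proof -
    have "real i \<le> real (2 ^ n)" using that by (subst of_nat_le_iff) auto
    then have "real i / 2 ^ n \<le> 1" by simp
    then show ?thesis using t by (intro mult_left_le_one_le) auto
  qed
  ultimately show ?thesis using x unfolding hstep_def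
    by (intro sum.neutral) (fastforce split: split_indicator)
qed

lemma hstep_value:
  assumes t: "0 < t" and x: "x \<in> {0<..t}"
  shows "\<exists>i<2^n. real i / 2 ^ n * t < x \<and> x \<le> real (Suc i) / 2 ^ n * t \<and> hstep t n a x = a i"
proof -
  define N :: nat where "N = 2 ^ n"
  have N: "N > 0" "real N = 2 ^ n" by (auto simp: N_def)
  define y where "y = x * real N / t"
  have y: "0 < y" "y \<le> real N" using x t N by (auto simp: y_def field_simps)
  define i where "i = nat (\<lceil>y\<rceil> - 1)"
  have c: "\<lceil>y\<rceil> \<ge> 1" using y by linarith
  then have ri: "real i = of_int \<lceil>y\<rceil> - 1" by (simp add: i_def)
  have i1: "real i < y" "y \<le> real i + 1" unfolding ri using ceiling_correct[of y] by linarith+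
  have iN: "i < N" using i1 y by linarith
  have lt: "real i / N * t < x" using i1(1) t N by (auto simp: y_def field_simps)
  have le: "x \<le> real (Suc i) / N * t" using i1(2) t N by (auto simp: y_def field_simps)
  have "hstep t n a x = (\<Sum>j<N. if j = i then a i else 0)"
    unfolding hstep_def N_def[symmetric]
  proof (intro sum.cong refl)
    fix j assume j: "j \<in> {..<N}"
    have m: "real k / N * t \<le> real l / N * t" if "k \<le> l" for k l
      using that t by (intro mult_right_mono divide_right_mono) auto
    show "a j * (indicator {0<..real (Suc j) / 2 ^ n * t} x - indicator {0<..real j / 2 ^ n * t} x) = (if j = i then a i else 0)"
    proof (cases j i rule: linorder_cases)
      case less
      then have "real (Suc j) / N * t \<le> real i / N * t" "real j / N * t \<le> real i / N * t" by (intro m; simp)+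
      then show ?thesis using less lt by (auto simp: N split: split_indicator)
    next
      case equal
      then show ?thesis using lt le x by (auto simp: N split: split_indicator)
    next
      case greater
      then have "real (Suc i) / N * t \<le> real j / N * t" "real (Suc i) / N * t \<le> real (Suc j) / N * t" by (intro m; simp)+
      then show ?thesis using greater le x by (auto simp: N split: split_indicator)
    qed
  qed
  also have "\<dots> = a i" using iN by simp
  finally show ?thesis using iN lt le by (intro exI[of _ i]) (auto simp: N N_def)
qed

text \<open>A Borel representative of \<open>f\<close> cut off to \<open>[0,t]\<close>.\<close>

definition supp_version :: "(real \<Rightarrow> real) \<Rightarrow> real \<Rightarrow> (real \<Rightarrow> real) \<Rightarrow> bool" where
  "supp_version f t G \<longleftrightarrow> G \<in> Lp_fun p \<and> (AE x in lborel. G x = f x * indicator {0..t} x)"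

lemma step_approx_iff:
  assumes t: "0 \<le> t" and G: "supp_version f t G"
  shows "step_approx p t f N a \<longleftrightarrow> (\<lambda>k. Lpn p (\<lambda>x. hstep t (N k) (a k) x - G x)) \<longlonglongrightarrow> 0"
proof -
  have "(\<integral>\<^sup>+x\<in>{0..t}. ennreal (\<bar>dyadic_step t n b x - f x\<bar> powr p) \<partial>lebesgue) = Lpn p (\<lambda>x. hstep t n b x - G x)" for n b
    unfolding Lpn_def nn_integral_completion
  proof (rule nn_integral_cong_AE)
    have "AE x in lborel. G x = f x * indicator {0..t} x" using G by (simp add: supp_version_def)
    with hstep_AE[OF t, of n b] AE_lborel_singleton[of 0]
    show "AE x in lborel. ennreal (\<bar>dyadic_step t n b x - f x\<bar> powr p) * indicator {0..t} x = ennreal (\<bar>hstep t n b x - G x\<bar> powr p)"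
    proof eventually_elim
      case (elim x)
      then show ?case using hstep_outside[OF t, of x n b] p_gt_1 by (cases "x \<in> {0..t}") auto
    qed
  qed
  then show ?thesis by (simp add: step_approx_def)
qed

lemma Lpn_sum_tendsto:
  assumes "finite I" "\<And>i k. i \<in> I \<Longrightarrow> H i k \<in> borel_measurable borel" "\<And>i. i \<in> I \<Longrightarrow> (\<lambda>k. Lpn p (H i k)) \<longlonglongrightarrow> 0"
  shows "(\<lambda>k::nat. Lpn p (\<lambda>x. \<Sum>i\<in>I. b i * H i k x)) \<longlonglongrightarrow> 0"
  using assms
proof (induction I rule: finite_induct)
  case empty then show ?case by (simp add: Lpn_def)
next
  case (insert j I)
  have [measurable]: "H j k \<in> borel_measurable borel" for k using insert by auto
  have [measurable]: "(\<lambda>x. \<Sum>i\<in>I. b i * H i k x) \<in> borel_measurable borel" for k using insert by (intro borel_measurable_sum borel_measurable_times) auto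
  have "(\<lambda>k. ennreal (2 powr p) * (ennreal (\<bar>b j\<bar> powr p) * Lpn p (H j k) + Lpn p (\<lambda>x. \<Sum>i\<in>I. b i * H i k x))) \<longlonglongrightarrow> ennreal (2 powr p) * (ennreal (\<bar>b j\<bar> powr p) * 0 + 0)"
    using insert by (intro tendsto_intros ennreal_tendsto_cmult) auto
  then have lim: "(\<lambda>k. ennreal (2 powr p) * (ennreal (\<bar>b j\<bar> powr p) * Lpn p (H j k) + Lpn p (\<lambda>x. \<Sum>i\<in>I. b i * H i k x))) \<longlonglongrightarrow> 0" by simp
  show ?case
  proof (rule tendsto_sandwich[OF _ _ tendsto_const lim])
    show "\<forall>\<^sub>F k in sequentially. Lpn p (\<lambda>x. \<Sum>i\<in>insert j I. b i * H i k x) \<le> ennreal (2 powr p) * (ennreal (\<bar>b j\<bar> powr p) * Lpn p (H j k) + Lpn p (\<lambda>x. \<Sum>i\<in>I. b i * H i k x))"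
      using insert p_gt_1 Lpn_add_le[of "\<lambda>x. b j * H j _ x" "\<lambda>x. \<Sum>i\<in>I. b i * H i _ x" p]
      by (intro always_eventually allI) (auto simp: Lpn_cmult)
  qed auto
qed

lemma L2_sum_tendsto:
  assumes "finite I" "\<And>i k. i \<in> I \<Longrightarrow> D i k \<in> borel_measurable M" "\<And>i. i \<in> I \<Longrightarrow> (\<lambda>k. \<integral>\<^sup>+\<omega>. ennreal ((D i k \<omega>)\<^sup>2) \<partial>M) \<longlonglongrightarrow> 0"
  shows "(\<lambda>k::nat. \<integral>\<^sup>+\<omega>. ennreal ((\<Sum>i\<in>I. b i * D i k \<omega>)\<^sup>2) \<partial>M) \<longlonglongrightarrow> 0"
proof -
  have "(\<lambda>k. of_nat (card I) * (\<Sum>i\<in>I. ennreal ((b i)\<^sup>2) * (\<integral>\<^sup>+\<omega>. ennreal ((D i k \<omega>)\<^sup>2) \<partial>M))) \<longlonglongrightarrow> of_nat (card I) * (\<Sum>i\<in>I. ennreal ((b i)\<^sup>2) * 0)"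
    using assms(3) by (intro ennreal_tendsto_cmult tendsto_sum) (auto simp: of_nat_less_top)
  then have lim: "(\<lambda>k. of_nat (card I) * (\<Sum>i\<in>I. ennreal ((b i)\<^sup>2) * (\<integral>\<^sup>+\<omega>. ennreal ((D i k \<omega>)\<^sup>2) \<partial>M))) \<longlonglongrightarrow> 0" by simp
  show ?thesis
  proof (rule tendsto_sandwich[OF _ _ tendsto_const lim])
    show "\<forall>\<^sub>F k in sequentially. (\<integral>\<^sup>+\<omega>. ennreal ((\<Sum>i\<in>I. b i * D i k \<omega>)\<^sup>2) \<partial>M) \<le> of_nat (card I) * (\<Sum>i\<in>I. ennreal ((b i)\<^sup>2) * (\<integral>\<^sup>+\<omega>. ennreal ((D i k \<omega>)\<^sup>2) \<partial>M))"
    proof (intro always_eventually allI)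
      fix k
      have "(\<integral>\<^sup>+\<omega>. ennreal ((\<Sum>i\<in>I. b i * D i k \<omega>)\<^sup>2) \<partial>M) \<le> (\<integral>\<^sup>+\<omega>. of_nat (card I) * (\<Sum>i\<in>I. ennreal ((b i)\<^sup>2) * ennreal ((D i k \<omega>)\<^sup>2)) \<partial>M)"
      proof (intro nn_integral_mono)
        fix \<omega>
        have "(\<Sum>i\<in>I. b i * D i k \<omega>)\<^sup>2 \<le> real (card I) * (\<Sum>i\<in>I. (b i * D i k \<omega>)\<^sup>2)"
          using sum_squared_le_sum_of_squares[of "\<lambda>i. b i * D i k \<omega>" I] assms(1) by (simp add: mult.commute)
        then have "ennreal ((\<Sum>i\<in>I. b i * D i k \<omega>)\<^sup>2) \<le> ennreal (real (card I) * (\<Sum>i\<in>I. (b i * D i k \<omega>)\<^sup>2))" by (rule ennreal_leI)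
        also have "\<dots> = of_nat (card I) * (\<Sum>i\<in>I. ennreal ((b i)\<^sup>2) * ennreal ((D i k \<omega>)\<^sup>2))"
          by (subst ennreal_mult) (auto simp: sum_nonneg ennreal_mult[symmetric] power_mult_distrib ennreal_of_nat_eq_real_of_nat)
        finally show "ennreal ((\<Sum>i\<in>I. b i * D i k \<omega>)\<^sup>2) \<le> \<dots>" .
      qed
      also have "\<dots> = of_nat (card I) * (\<Sum>i\<in>I. ennreal ((b i)\<^sup>2) * (\<integral>\<^sup>+\<omega>. ennreal ((D i k \<omega>)\<^sup>2) \<partial>M))"
        using assms(2) by (subst nn_integral_cmult, simp, subst nn_integral_sum) (auto simp: nn_integral_cmult)
      finally show "(\<integral>\<^sup>+\<omega>. ennreal ((\<Sum>i\<in>I. b i * D i k \<omega>)\<^sup>2) \<partial>M) \<le> \<dots>" .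
    qed
  qed auto
qed

text \<open>Approximate all integrals of the family by step functions at once. The combination of the step integrals is a \<open>gform\<close> with
variance given by the Riesz form; its \<open>L\<^sup>2(\<Omega>)\<close> limit is Gaussian with the limiting variance by \<open>riesz_tendsto\<close>.\<close>

lemma integral_family_gauss:
  assumes I: "finite I" and t: "\<And>i. i \<in> I \<Longrightarrow> 0 \<le> t i"
    and G: "\<And>i. i \<in> I \<Longrightarrow> supp_version (f i) (t i) (G i)"
    and X: "\<And>i. i \<in> I \<Longrightarrow> has_fbm_integral M \<xi> \<alpha> (f i) (t i) (X i)"
  shows "cgauss M (\<lambda>\<omega>. \<Sum>i\<in>I. b i * X i \<omega>) (\<kappa> * riesz \<alpha> (\<lambda>u. \<Sum>i\<in>I. b i * G i u) (\<lambda>u. \<Sum>i\<in>I. b i * G i u))"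
proof -
  have "\<forall>i\<in>I. \<exists>N a. step_approx p (t i) (f i) N a"
    using X by (auto simp: has_fbm_integral_def p)
  then obtain N a where Na: "\<And>i. i \<in> I \<Longrightarrow> step_approx p (t i) (f i) (N i) (a i)" by metis
  have Xm [measurable]: "X i \<in> borel_measurable M" if "i \<in> I" for i using X that by (auto simp: has_fbm_integral_def)
  have L: "(\<lambda>k. \<integral>\<^sup>+\<omega>. ennreal ((dyadic_integral \<xi> (t i) (N i k) (a i k) \<omega> - X i \<omega>)\<^sup>2) \<partial>M) \<longlonglongrightarrow> 0" if "i \<in> I" for i
    using X[OF that] Na[OF that] unfolding has_fbm_integral_def p by blast
  have S: "(\<lambda>k. Lpn p (\<lambda>x. hstep (t i) (N i k) (a i k) x - G i x)) \<longlonglongrightarrow> 0" if "i \<in> I" for i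
    using Na[OF that] step_approx_iff[OF t[OF that] G[OF that]] by simp
  have Gl: "G i \<in> Lp_fun p" if "i \<in> I" for i using G[OF that] by (simp add: supp_version_def)
  have gf: "gform (\<lambda>\<omega>. \<Sum>i\<in>I. b i * dyadic_integral \<xi> (t i) (N i k) (a i k) \<omega>) (\<lambda>u. \<Sum>i\<in>I. b i * hstep (t i) (N i k) (a i k) u)" for k
    using I t by (intro gform_sum gform_cmult hstep_gform) auto
  show ?thesis
  proof (rule cgauss_limit[OF gform_cgauss[OF gf]])
    show "(\<lambda>\<omega>. \<Sum>i\<in>I. b i * X i \<omega>) \<in> borel_measurable M" by (intro borel_measurable_sum borel_measurable_times) auto
    have dm: "dyadic_integral \<xi> (t i) n c \<in> borel_measurable M" if "i \<in> I" for i n c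
      using gform_cgauss[OF hstep_gform[OF t[OF that]]] by (simp add: cgauss_def)
    have "(\<lambda>k. \<integral>\<^sup>+\<omega>. ennreal ((\<Sum>i\<in>I. b i * (dyadic_integral \<xi> (t i) (N i k) (a i k) \<omega> - X i \<omega>))\<^sup>2) \<partial>M) \<longlonglongrightarrow> 0"
      using L dm by (intro L2_sum_tendsto I) auto
    then show "(\<lambda>k. \<integral>\<^sup>+\<omega>. ennreal (((\<Sum>i\<in>I. b i * dyadic_integral \<xi> (t i) (N i k) (a i k) \<omega>) - (\<Sum>i\<in>I. b i * X i \<omega>))\<^sup>2) \<partial>M) \<longlonglongrightarrow> 0"
      by (simp add: right_diff_distrib sum_subtractf)
    have "(\<lambda>k. Lpn p (\<lambda>x. \<Sum>i\<in>I. b i * (hstep (t i) (N i k) (a i k) x - G i x))) \<longlonglongrightarrow> 0"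
      using S Gl by (intro Lpn_sum_tendsto I) (auto simp: Lp_fun_def intro!: borel_measurable_diff hstep_meas)
    then have "(\<lambda>k. Lpn p (\<lambda>x. (\<Sum>i\<in>I. b i * hstep (t i) (N i k) (a i k) x) - (\<Sum>i\<in>I. b i * G i x))) \<longlonglongrightarrow> 0"
      by (simp add: right_diff_distrib sum_subtractf)
    then have "(\<lambda>k. riesz \<alpha> (\<lambda>x. \<Sum>i\<in>I. b i * hstep (t i) (N i k) (a i k) x) (\<lambda>x. \<Sum>i\<in>I. b i * hstep (t i) (N i k) (a i k) x))
       \<longlonglongrightarrow> riesz \<alpha> (\<lambda>x. \<Sum>i\<in>I. b i * G i x) (\<lambda>x. \<Sum>i\<in>I. b i * G i x)"
      using I Gl p_gt_1 by (intro riesz_tendsto Lp_fun_sum Lp_fun_cmult) auto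
    then show "(\<lambda>k. \<kappa> * riesz \<alpha> (\<lambda>x. \<Sum>i\<in>I. b i * hstep (t i) (N i k) (a i k) x) (\<lambda>x. \<Sum>i\<in>I. b i * hstep (t i) (N i k) (a i k) x))
       \<longlonglongrightarrow> \<kappa> * riesz \<alpha> (\<lambda>x. \<Sum>i\<in>I. b i * G i x) (\<lambda>x. \<Sum>i\<in>I. b i * G i x)"
      by (intro tendsto_intros)
  qed
qed

end

section \<open>Existence of the integral\<close>

lemma Lpn_tendsto_dominated:
  assumes [measurable]: "\<And>k. G k \<in> borel_measurable borel" "W \<in> borel_measurable borel"
    and W: "Lpn p W < \<infinity>" and p: "0 < p"
    and bd: "\<And>k. AE x in lborel. \<bar>G k x\<bar> \<le> \<bar>W x\<bar>"
    and lim: "AE x in lborel. (\<lambda>k. G k x) \<longlonglongrightarrow> 0"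
  shows "(\<lambda>k::nat. Lpn p (G k)) \<longlonglongrightarrow> 0"
proof -
  have "(\<lambda>k. \<integral>\<^sup>+x. ennreal (\<bar>G k x\<bar> powr p) \<partial>lborel) \<longlonglongrightarrow> (\<integral>\<^sup>+x. 0 \<partial>(lborel::real measure))"
  proof (rule nn_integral_dominated_convergence[where w="\<lambda>x. ennreal (\<bar>W x\<bar> powr p)" and u'="\<lambda>x. 0"])
    show "AE x in lborel. ennreal (\<bar>G k x\<bar> powr p) \<le> ennreal (\<bar>W x\<bar> powr p)" for k
      using bd[of k] p by (auto elim!: eventually_mono intro!: ennreal_leI powr_mono2)
    show "AE x in lborel. (\<lambda>k. ennreal (\<bar>G k x\<bar> powr p)) \<longlonglongrightarrow> 0"
      using lim
    proof eventually_elim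
      case (elim x)
      have "(\<lambda>k. \<bar>G k x\<bar> powr p) \<longlonglongrightarrow> 0"
        using p tendsto_rabs_zero[OF elim] by (intro tendsto_zero_powrI[where b=p] tendsto_const) auto
      then show ?case using tendsto_ennrealI by fastforce
    qed
  qed (use W in \<open>auto simp: Lpn_def\<close>)
  then show ?thesis by (simp add: Lpn_def)
qed

context fbm
begin

text \<open>A bounded measurable function is an almost everywhere limit of continuous functions, which after truncation are bounded by
the same constant; each of them is sampled on a dyadic partition fine enough for its modulus of continuity.\<close>

lemma step_approx_bounded:
  assumes t: "0 < t" and [measurable]: "G \<in> borel_measurable borel" and m: "\<And>x. \<bar>G x\<bar> \<le> m * indicator {0..t} x"
  shows "\<exists>N a. (\<lambda>k. Lpn p (\<lambda>x. hstep t (N k) (a k) x - G x)) \<longlonglongrightarrow> 0"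
proof -
  have m0: "m \<ge> 0" using m[of 0] t by simp
  have "G measurable_on UNIV"
    by (rule lebesgue_measurable_imp_measurable_on) (auto intro: measurable_completion)
  then obtain S g where S: "negligible S" and g: "\<And>n. continuous_on UNIV (g n)"
    and gl: "\<And>x. x \<notin> S \<Longrightarrow> (\<lambda>n. g n x) \<longlonglongrightarrow> G x"
    by (auto simp: measurable_on_def)
  define c where "c = (\<lambda>n x. max (- m) (min m (g n x)))"
  have cc: "continuous_on UNIV (c n)" for n unfolding c_def using g by (intro continuous_intros)
  have cb: "\<bar>c n x\<bar> \<le> m" for n x using m0 by (auto simp: c_def)
  have Gb: "\<bar>G x\<bar> \<le> m" for x using m[of x] m0 by (cases "x \<in> {0..t}") auto
  have cl: "(\<lambda>n. c n x) \<longlonglongrightarrow> G x" if "x \<notin> S" for x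
  proof -
    have "(\<lambda>n. max (- m) (min m (g n x))) \<longlonglongrightarrow> max (- m) (min m (G x))" by (intro tendsto_intros gl that)
    moreover have "max (- m) (min m (G x)) = G x" using Gb[of x] by auto
    ultimately show ?thesis by (simp add: c_def)
  qed
  have "\<exists>n. \<forall>x\<in>{0..t}. \<forall>y\<in>{0..t}. \<bar>x - y\<bar> \<le> t / 2 ^ n \<longrightarrow> \<bar>c k x - c k y\<bar> \<le> 1 / (real k + 1)" for k
  proof -
    have "uniformly_continuous_on {0..t} (c k)"
      by (rule compact_uniformly_continuous[OF continuous_on_subset[OF cc]]) auto
    then obtain d where d: "d > 0" "\<And>x y. x \<in> {0..t} \<Longrightarrow> y \<in> {0..t} \<Longrightarrow> dist y x < d \<Longrightarrow> dist (c k y) (c k x) < 1 / (real k + 1)"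
      unfolding uniformly_continuous_on_def by (metis add_pos_nonneg divide_pos_pos of_nat_0_le_iff zero_less_one add.commute)
    obtain n where n: "t / d < 2 ^ n" using real_arch_pow[of 2 "t / d"] by auto
    then have "t / 2 ^ n < d" using d t by (simp add: field_simps)
    then show ?thesis using d(2) by (intro exI[of _ n]) (auto simp: dist_real_def intro!: less_imp_le)
  qed
  then obtain N where N: "\<And>k x y. x \<in> {0..t} \<Longrightarrow> y \<in> {0..t} \<Longrightarrow> \<bar>x - y\<bar> \<le> t / 2 ^ (N k) \<Longrightarrow> \<bar>c k x - c k y\<bar> \<le> 1 / (real k + 1)"
    by metis
  define a where "a = (\<lambda>k i. c k (real i / 2 ^ (N k) * t))"
  have near: "\<bar>hstep t (N k) (a k) x - c k x\<bar> \<le> 1 / (real k + 1) \<and> \<bar>hstep t (N k) (a k) x\<bar> \<le> m" if x: "x \<in> {0<..t}" for k x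
  proof -
    obtain i where i: "i < 2 ^ N k" "real i / 2 ^ N k * t < x" "x \<le> real (Suc i) / 2 ^ N k * t" "hstep t (N k) (a k) x = a k i"
      using hstep_value[OF t x, of "N k" "a k"] by auto
    have "real (Suc i) / 2 ^ N k * t = real i / 2 ^ N k * t + t / 2 ^ N k" by (simp add: add_divide_distrib distrib_right)
    then have "\<bar>real i / 2 ^ N k * t - x\<bar> \<le> t / 2 ^ N k" using i by linarith
    moreover have "real i / 2 ^ N k * t \<in> {0..t}" using i(2) x t by auto
    ultimately have "\<bar>c k (real i / 2 ^ N k * t) - c k x\<bar> \<le> 1 / (real k + 1)" using x by (intro N) auto
    then show ?thesis using i(4) cb by (simp add: a_def)
  qed
  have "(\<lambda>k. Lpn p (\<lambda>x. hstep t (N k) (a k) x - G x)) \<longlonglongrightarrow> 0"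
  proof (rule Lpn_tendsto_dominated[where W="\<lambda>x. 2 * m * indicator {0..t} x"])
    show "Lpn p (\<lambda>x. 2 * m * indicator {0..t} x) < \<infinity>"
      using Lp_fun_bounded[of "\<lambda>x. 2 * m * indicator {0..t} x" "2 * m" 0 t p] m0 p_gt_1 by (auto simp: Lp_fun_def split: split_indicator)
    show "AE x in lborel. \<bar>hstep t (N k) (a k) x - G x\<bar> \<le> \<bar>2 * m * indicator {0..t} x\<bar>" for k
    proof (rule AE_mp[OF AE_lborel_singleton[of 0]], intro AE_I2 impI)
      fix x :: real assume x0: "x \<noteq> 0"
      show "\<bar>hstep t (N k) (a k) x - G x\<bar> \<le> \<bar>2 * m * indicator {0..t} x\<bar>"
      proof (cases "x \<in> {0<..t}")
        case True
        then have "\<bar>hstep t (N k) (a k) x\<bar> \<le> m" "\<bar>G x\<bar> \<le> m" using near Gb by auto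
        then show ?thesis using True by auto
      next
        case False
        then have "hstep t (N k) (a k) x = 0" using hstep_outside t by simp
        moreover have "G x = 0" using False x0 m[of x] by auto
        ultimately show ?thesis by simp
      qed
    qed
    have "AE x in lebesgue. x \<notin> S" using S by (simp add: negligible_iff_null_sets AE_not_in)
    then have "AE x in lborel. x \<notin> S" by (simp add: AE_completion_iff)
    then show "AE x in lborel. (\<lambda>k. hstep t (N k) (a k) x - G x) \<longlonglongrightarrow> 0"
      using AE_lborel_singleton[of 0]
    proof eventually_elim
      case (elim x)
      show ?case
      proof (cases "x \<in> {0<..t}")
        case True
        have "(\<lambda>k. hstep t (N k) (a k) x - c k x) \<longlonglongrightarrow> 0"
        proof (rule Lim_null_comparison)
          show "\<forall>\<^sub>F k in sequentially. norm (hstep t (N k) (a k) x - c k x) \<le> 1 / (real k + 1)"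
            using near[OF True] by auto
          show "(\<lambda>k. 1 / (real k + 1)) \<longlonglongrightarrow> 0" by real_asymp
        qed
        moreover have "(\<lambda>k. c k x - G x) \<longlonglongrightarrow> 0" using elim by (intro LIM_zero cl) auto
        ultimately have "(\<lambda>k. (hstep t (N k) (a k) x - c k x) + (c k x - G x)) \<longlonglongrightarrow> 0 + 0" by (rule tendsto_add)
        then show ?thesis by simp
      next
        case False
        then have "hstep t (N k) (a k) x = 0" for k using hstep_outside t by simp
        moreover have "G x = 0" using False elim m[of x] by auto
        ultimately show ?thesis by simp
      qed
    qed
  qed (use p_gt_1 in auto)
  then show ?thesis by blast
qed

text \<open>Truncate to reduce to bounded functions, then choose a diagonal sequence.\<close>

lemma step_approx_ex:
  assumes t: "0 \<le> t" and G: "supp_version f t G"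
  shows "\<exists>N a. step_approx p t f N a"
proof (cases "t = 0")
  case True
  have "AE x in lborel. G x = 0"
    using G AE_lborel_singleton[of 0] True by (auto simp: supp_version_def elim!: eventually_elim2)
  then have "Lpn p (\<lambda>x. hstep t 0 (\<lambda>_. 0) x - G x) = (\<integral>\<^sup>+x. 0 \<partial>(lborel::real measure))"
    unfolding Lpn_def by (intro nn_integral_cong_AE) (auto simp: hstep_def elim!: eventually_mono)
  then have "(\<lambda>k::nat. Lpn p (\<lambda>x. hstep t 0 (\<lambda>_. 0) x - G x)) \<longlonglongrightarrow> 0" by simp
  then show ?thesis
    using step_approx_iff[OF t G, of "\<lambda>_. 0" "\<lambda>_ _. 0"] by blast
next
  case False
  then have t0: "0 < t" using t by simp
  have [measurable]: "G \<in> borel_measurable borel" and GL: "Lpn p G < \<infinity>" and GA: "AE x in lborel. G x = f x * indicator {0..t} x"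
    using G by (auto simp: supp_version_def Lp_fun_def)
  define H where "H = (\<lambda>m x. max (- real m) (min (real m) (G x)) * indicator {0..t} x)"
  have [measurable]: "H m \<in> borel_measurable borel" for m unfolding H_def by measurable
  have HG: "(\<lambda>m. Lpn p (\<lambda>x. H m x - G x)) \<longlonglongrightarrow> 0"
  proof (rule Lpn_tendsto_dominated[where W=G])
    show "AE x in lborel. \<bar>H k x - G x\<bar> \<le> \<bar>G x\<bar>" for k
      using GA by (auto simp: H_def elim!: eventually_mono split: split_indicator)
    show "AE x in lborel. (\<lambda>k. H k x - G x) \<longlonglongrightarrow> 0"
      using GA
    proof eventually_elim
      case (elim x)
      obtain k0 where k0: "\<bar>G x\<bar> \<le> real k0" using real_arch_simple by blast
      have "H k x - G x = 0" if "k \<ge> k0" for k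
      proof -
        have "\<bar>G x\<bar> \<le> real k" using k0 that by (meson of_nat_le_iff order_trans)
        then show ?thesis using elim by (auto simp: H_def split: split_indicator)
      qed
      then have "eventually (\<lambda>k. H k x - G x = 0) sequentially" by (auto simp: eventually_sequentially)
      then show ?case by (rule tendsto_eventually)
    qed
  qed (use GL p_gt_1 in auto)
  have e: "\<exists>n b. Lpn p (\<lambda>x. hstep t n b x - G x) < ennreal e" if e: "e > 0" for e
  proof -
    define d where "d = e / (2 powr p * 2)"
    have d: "d > 0" using e by (simp add: d_def)
    obtain m where m: "Lpn p (\<lambda>x. H m x - G x) < ennreal d"
      using order_tendstoD(2)[OF HG, of "ennreal d"] d by (auto simp: eventually_sequentially)
    have "\<bar>H m x\<bar> \<le> real m * indicator {0..t} x" for x by (auto simp: H_def split: split_indicator)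
    from step_approx_bounded[OF t0 _ this] obtain N a where "(\<lambda>k. Lpn p (\<lambda>x. hstep t (N k) (a k) x - H m x)) \<longlonglongrightarrow> 0" by auto
    then obtain k where k: "Lpn p (\<lambda>x. hstep t (N k) (a k) x - H m x) < ennreal d"
      using order_tendstoD(2)[of _ 0 sequentially "ennreal d"] d by (auto simp: eventually_sequentially)
    have "Lpn p (\<lambda>x. hstep t (N k) (a k) x - G x) = Lpn p (\<lambda>x. (hstep t (N k) (a k) x - H m x) + (H m x - G x))" by simp
    also have "\<dots> \<le> ennreal (2 powr p) * (Lpn p (\<lambda>x. hstep t (N k) (a k) x - H m x) + Lpn p (\<lambda>x. H m x - G x))"
      using p_gt_1 by (intro Lpn_add_le) auto
    also have "\<dots> < ennreal (2 powr p) * (ennreal d + ennreal d)"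
      using add_strict_mono[OF k m] by (intro ennreal_mult_strict_left_mono) auto
    also have "\<dots> = ennreal e"
      using d by (simp add: ennreal_plus[symmetric] ennreal_mult[symmetric] d_def del: ennreal_plus)
    finally show ?thesis by blast
  qed
  have "\<forall>k. \<exists>n b. Lpn p (\<lambda>x. hstep t n b x - G x) < ennreal (1 / (real k + 1))" using e by simp
  then obtain N a where Na: "\<And>k. Lpn p (\<lambda>x. hstep t (N k) (a k) x - G x) < ennreal (1 / (real k + 1))" by metis
  have "(\<lambda>k. Lpn p (\<lambda>x. hstep t (N k) (a k) x - G x)) \<longlonglongrightarrow> 0"
  proof (rule tendsto_sandwich[OF _ _ tendsto_const])
    have "(\<lambda>k. 1 / (real k + 1)) \<longlonglongrightarrow> 0" by real_asymp
    from tendsto_ennrealI[OF this] show "(\<lambda>k. ennreal (1 / (real k + 1))) \<longlonglongrightarrow> 0" by simp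
    show "\<forall>\<^sub>F k in sequentially. Lpn p (\<lambda>x. hstep t (N k) (a k) x - G x) \<le> ennreal (1 / (real k + 1))"
      by (intro always_eventually allI less_imp_le Na)
  qed auto
  then show ?thesis using step_approx_iff[OF t G] by blast
qed

lemma gform_diff_L2:
  assumes X: "gform X \<phi>" and Y: "gform Y \<psi>" and [measurable]: "G \<in> borel_measurable borel" and e: "e > 0"
    and "Lpn p (\<lambda>x. \<phi> x - G x) \<le> ennreal (e powr p)" "Lpn p (\<lambda>x. \<psi> x - G x) \<le> ennreal (e powr p)"
  shows "(\<integral>\<^sup>+\<omega>. ennreal ((X \<omega> - Y \<omega>)\<^sup>2) \<partial>M) \<le> ennreal (\<kappa> * hlsK \<alpha> * (4 * e)\<^sup>2)"
proof (rule gform_L2_le[OF gform_diff[OF X Y]])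
  have [measurable]: "\<phi> \<in> borel_measurable borel" "\<psi> \<in> borel_measurable borel"
    using gform_Lp_fun[OF X] gform_Lp_fun[OF Y] by (auto simp: Lp_fun_def)
  have "Lpn p (\<lambda>x. \<phi> x - \<psi> x) = Lpn p (\<lambda>x. (\<phi> x - G x) + (-1) * (\<psi> x - G x))" by simp
  also have "\<dots> \<le> ennreal (2 powr p) * (Lpn p (\<lambda>x. \<phi> x - G x) + Lpn p (\<lambda>x. (-1) * (\<psi> x - G x)))"
    using p_gt_1 by (intro Lpn_add_le) auto
  also have "Lpn p (\<lambda>x. (-1) * (\<psi> x - G x)) = Lpn p (\<lambda>x. \<psi> x - G x)" by (subst Lpn_cmult) auto
  also have "ennreal (2 powr p) * (Lpn p (\<lambda>x. \<phi> x - G x) + Lpn p (\<lambda>x. \<psi> x - G x)) \<le> ennreal (2 powr p) * (ennreal (e powr p) + ennreal (e powr p))"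
    using assms by (intro mult_left_mono add_mono) auto
  also have "\<dots> = ennreal ((2 * e) powr p * 2)"
    using e by (simp add: ennreal_plus[symmetric] ennreal_mult[symmetric] powr_mult del: ennreal_plus)
  also have "\<dots> \<le> ennreal ((2 * e) powr p * 2 powr p)"
    using p_gt_1 powr_mono[of 1 p "2::real"] by (intro ennreal_leI mult_left_mono) auto
  also have "(2 * e) powr p * 2 powr p = (4 * e) powr p"
    using e by (subst powr_mult[symmetric]) (auto simp: mult_ac)
  finally show "Lpn p (\<lambda>x. \<phi> x - \<psi> x) \<le> ennreal ((4 * e) powr p)" .
qed (use e in auto)

text \<open>By \<open>gform_L2_le\<close> step integrals of functions that are close in \<open>L\<^sup>p\<close> are close in \<open>L\<^sup>2(\<Omega>)\<close>. This gives a Cauchy sequence;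
an almost surely convergent subsequence provides the limit, and Fatou's lemma the convergence in \<open>L\<^sup>2\<close> along every
approximating sequence.\<close>

lemma fbm_integral_ex:
  assumes t: "0 \<le> t" and G: "supp_version f t G"
  shows "\<exists>X. has_fbm_integral M \<xi> \<alpha> f t X"
proof -
  obtain N a where Na: "step_approx p t f N a" using step_approx_ex[OF t G] by blast
  have [measurable]: "G \<in> borel_measurable borel" using G by (auto simp: supp_version_def Lp_fun_def)
  define I where "I = (\<lambda>n b. dyadic_integral \<xi> t n b)"
  have gf: "gform (I n b) (hstep t n b)" for n b unfolding I_def by (rule hstep_gform[OF t])
  have Im [measurable]: "I n b \<in> borel_measurable M" for n b using gform_cgauss[OF gf] by (simp add: cgauss_def)
  define K where "K = \<kappa> * hlsK \<alpha> * 16"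
  have K: "K \<ge> 0" using \<kappa>_nonneg hlsK_pos by (simp add: K_def)
  have close: "\<exists>k0. \<forall>k\<ge>k0. Lpn p (\<lambda>x. hstep t (N' k) (a' k) x - G x) \<le> ennreal (e powr p)"
    if "e > 0" "step_approx p t f N' a'" for e N' a'
    using order_tendstoD(2)[OF that(2)[unfolded step_approx_iff[OF t G]], of "ennreal (e powr p)"] that(1)
    unfolding eventually_sequentially by (auto intro: less_imp_le)
  have diff: "(\<integral>\<^sup>+\<omega>. ennreal ((I n b \<omega> - I n' b' \<omega>)\<^sup>2) \<partial>M) \<le> ennreal (K * e\<^sup>2)"
    if "e > 0" "Lpn p (\<lambda>x. hstep t n b x - G x) \<le> ennreal (e powr p)" "Lpn p (\<lambda>x. hstep t n' b' x - G x) \<le> ennreal (e powr p)" for e n b n' b'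
    using gform_diff_L2[OF gf gf _ that] by (simp add: K_def power_mult_distrib mult_ac)
  define J where "J = (\<lambda>k. I (N k) (a k))"
  have Jm [measurable]: "J k \<in> borel_measurable M" for k unfolding J_def by measurable
  have Jsq: "integrable M (\<lambda>\<omega>. (J k \<omega>)\<^sup>2)" for k
    unfolding J_def by (rule cgauss_second_moment(1)[OF gform_cgauss[OF gf]])
  have abs_sq: "\<bar>x\<bar> \<le> d + x\<^sup>2 / d" if "d > 0" for x d :: real
  proof (cases "\<bar>x\<bar> \<le> d")
    case True then show ?thesis using that by (simp add: add_increasing2)
  next
    case False
    then have "d * \<bar>x\<bar> \<le> \<bar>x\<bar> * \<bar>x\<bar>" using that by (intro mult_right_mono) auto
    then have "\<bar>x\<bar> \<le> x\<^sup>2 / d" using that by (simp add: power2_eq_square field_simps)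
    then show ?thesis using that by simp
  qed
  have Jint: "integrable M (J k)" for k
  proof (rule Bochner_Integration.integrable_bound)
    show "integrable M (\<lambda>\<omega>. 1 + (J k \<omega>)\<^sup>2)" using Jsq by auto
    show "AE \<omega> in M. norm (J k \<omega>) \<le> norm (1 + (J k \<omega>)\<^sup>2)" using abs_sq[of 1] by auto
  qed auto
  obtain r where r: "strict_mono r" "AE \<omega> in M. Cauchy (\<lambda>i. J (r i) \<omega>)"
  proof (rule cauchy_L1_AE_cauchy_subseq[of M J, OF Jint])
    fix e :: real assume e: "e > 0"
    define d where "d = e / (2 + 2 * K)"
    have d: "d > 0" using e K by (simp add: d_def add_pos_nonneg)
    obtain k0 where k0: "\<And>k. k \<ge> k0 \<Longrightarrow> Lpn p (\<lambda>x. hstep t (N k) (a k) x - G x) \<le> ennreal (d powr p)"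
      using close[OF d Na] by blast
    have "LINT \<omega>|M. norm (J i \<omega> - J j \<omega>) < e" if ij: "i \<ge> k0" "j \<ge> k0" for i j
    proof -
      have isq: "integrable M (\<lambda>\<omega>. (J i \<omega> - J j \<omega>)\<^sup>2)"
        using cgauss_second_moment(1)[OF gform_cgauss[OF gform_diff[OF gf gf]]] by (simp add: J_def)
      have "ennreal (LINT \<omega>|M. (J i \<omega> - J j \<omega>)\<^sup>2) \<le> ennreal (K * d\<^sup>2)"
        using diff[OF d k0[OF ij(1)] k0[OF ij(2)]] isq by (subst nn_integral_eq_integral[symmetric]) (auto simp: J_def)
      then have sq: "(LINT \<omega>|M. (J i \<omega> - J j \<omega>)\<^sup>2) \<le> K * d\<^sup>2" using K by simp
      have "LINT \<omega>|M. norm (J i \<omega> - J j \<omega>) \<le> (LINT \<omega>|M. d + (J i \<omega> - J j \<omega>)\<^sup>2 / d)"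
        using Jint isq abs_sq[OF d] by (intro integral_mono) auto
      also have "\<dots> = d + (LINT \<omega>|M. (J i \<omega> - J j \<omega>)\<^sup>2) / d"
        using isq by (subst Bochner_Integration.integral_add) (auto simp: prob_space)
      also have "\<dots> \<le> d + K * d\<^sup>2 / d" using sq d by (intro add_left_mono divide_right_mono) auto
      also have "\<dots> = d * (1 + K)" using d by (simp add: power2_eq_square algebra_simps)
      also have "\<dots> < d * (2 + 2 * K)" using d K by (intro mult_strict_left_mono) auto
      also have "\<dots> = e" using K by (simp add: d_def add_pos_nonneg)
      finally show ?thesis .
    qed
    then show "\<exists>N. \<forall>i\<ge>N. \<forall>j\<ge>N. LINT \<omega>|M. norm (J i \<omega> - J j \<omega>) < e" by blast
  qed blast
  define X where "X = (\<lambda>\<omega>. lim (\<lambda>i. J (r i) \<omega>))"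
  have Xm [measurable]: "X \<in> borel_measurable M" unfolding X_def by measurable
  have Xl: "AE \<omega> in M. (\<lambda>i. J (r i) \<omega>) \<longlonglongrightarrow> X \<omega>"
    using r(2) by eventually_elim (auto simp: X_def Cauchy_convergent_iff convergent_LIMSEQ_iff)
  have JX: "(\<integral>\<^sup>+\<omega>. ennreal ((I n b \<omega> - X \<omega>)\<^sup>2) \<partial>M) \<le> ennreal (K * e\<^sup>2)"
    if e: "e > 0" and b: "Lpn p (\<lambda>x. hstep t n b x - G x) \<le> ennreal (e powr p)" for e n b
  proof -
    obtain k0 where k0: "\<And>k. k \<ge> k0 \<Longrightarrow> Lpn p (\<lambda>x. hstep t (N k) (a k) x - G x) \<le> ennreal (e powr p)"
      using close[OF e Na] by blast
    have "(\<integral>\<^sup>+\<omega>. ennreal ((I n b \<omega> - X \<omega>)\<^sup>2) \<partial>M) = (\<integral>\<^sup>+\<omega>. liminf (\<lambda>i. ennreal ((I n b \<omega> - J (r i) \<omega>)\<^sup>2)) \<partial>M)"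
    proof (intro nn_integral_cong_AE)
      show "AE \<omega> in M. ennreal ((I n b \<omega> - X \<omega>)\<^sup>2) = liminf (\<lambda>i. ennreal ((I n b \<omega> - J (r i) \<omega>)\<^sup>2))"
        using Xl
      proof eventually_elim
        case (elim \<omega>)
        then have "(\<lambda>i. ennreal ((I n b \<omega> - J (r i) \<omega>)\<^sup>2)) \<longlonglongrightarrow> ennreal ((I n b \<omega> - X \<omega>)\<^sup>2)"
          by (intro tendsto_ennrealI tendsto_intros)
        then show ?case using lim_imp_Liminf[OF sequentially_bot] by metis
      qed
    qed
    also have "\<dots> \<le> liminf (\<lambda>i. \<integral>\<^sup>+\<omega>. ennreal ((I n b \<omega> - J (r i) \<omega>)\<^sup>2) \<partial>M)"
      by (intro nn_integral_liminf) auto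
    also have "\<dots> \<le> liminf (\<lambda>i::nat. ennreal (K * e\<^sup>2))"
    proof (intro Liminf_mono)
      have "(\<integral>\<^sup>+\<omega>. ennreal ((I n b \<omega> - J (r i) \<omega>)\<^sup>2) \<partial>M) \<le> ennreal (K * e\<^sup>2)" if "i \<ge> k0" for i
        unfolding J_def using that seq_suble[OF r(1), of i] by (intro diff e b k0) auto
      then show "\<forall>\<^sub>F i in sequentially. (\<integral>\<^sup>+\<omega>. ennreal ((I n b \<omega> - J (r i) \<omega>)\<^sup>2) \<partial>M) \<le> ennreal (K * e\<^sup>2)"
        by (auto simp: eventually_sequentially)
    qed
    also have "\<dots> = ennreal (K * e\<^sup>2)" by (simp add: Liminf_const)
    finally show ?thesis .
  qed
  have "(\<lambda>k. \<integral>\<^sup>+\<omega>. ennreal ((dyadic_integral \<xi> t (N' k) (a' k) \<omega> - X \<omega>)\<^sup>2) \<partial>M) \<longlonglongrightarrow> 0"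
    if A: "step_approx p t f N' a'" for N' a'
  proof (rule order_tendstoI)
    fix y :: ennreal assume y: "0 < y"
    obtain z where z: "0 < z" "ennreal z < y"
    proof -
      obtain w where w: "0 < w" "w < y" using dense[OF y] by auto
      then have "w < \<top>" using less_top_ennreal by (metis top_greatest order_less_le_trans)
      then show ?thesis using w that[of "enn2real w"] by (auto simp: enn2real_positive_iff)
    qed
    define e where "e = sqrt (z / (K + 1))"
    have e: "e > 0" using z K by (simp add: e_def add_nonneg_pos)
    have "K * e\<^sup>2 = z * (K / (K + 1))" using z K by (simp add: e_def)
    also have "\<dots> \<le> z * 1" using z K by (intro mult_left_mono) (auto simp: divide_le_eq)
    finally have Ke: "K * e\<^sup>2 \<le> z" by simp
    obtain k0 where k0: "\<And>k. k \<ge> k0 \<Longrightarrow> Lpn p (\<lambda>x. hstep t (N' k) (a' k) x - G x) \<le> ennreal (e powr p)"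
      using close[OF e A] by blast
    have "(\<integral>\<^sup>+\<omega>. ennreal ((dyadic_integral \<xi> t (N' k) (a' k) \<omega> - X \<omega>)\<^sup>2) \<partial>M) < y" if "k \<ge> k0" for k
      using JX[OF e k0[OF that]] Ke z(2) unfolding I_def by (meson ennreal_leI order_le_less_trans order_trans)
    then show "\<forall>\<^sub>F k in sequentially. (\<integral>\<^sup>+\<omega>. ennreal ((dyadic_integral \<xi> t (N' k) (a' k) \<omega> - X \<omega>)\<^sup>2) \<partial>M) < y"
      by (auto simp: eventually_sequentially)
  qed simp
  then have "has_fbm_integral M \<xi> \<alpha> f t X"
    unfolding has_fbm_integral_def p[symmetric] using Na Xm by blast
  then show ?thesis by blast
qed

end

section \<open>Variances of increments and the continuous version\<close>

lemma lebesgue_measurable_AE_eq: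
  fixes f g :: "real \<Rightarrow> real"
  assumes g: "g \<in> borel_measurable borel" and ae: "AE x in lborel. f x = g x"
  shows "f \<in> borel_measurable lebesgue"
proof (rule measurableI)
  fix A :: "real set" assume A: "A \<in> sets borel"
  have gl: "g \<in> borel_measurable lebesgue" using g by (intro measurable_completion) simp
  show "f -` A \<inter> space lebesgue \<in> sets lebesgue"
  proof (rule completion.in_sets_AE)
    show "g -` A \<inter> space lebesgue \<in> sets lebesgue" by (rule measurable_sets[OF gl A])
    show "AE x in lebesgue. (x \<in> g -` A \<inter> space lebesgue) = (x \<in> f -` A \<inter> space lebesgue)"
      unfolding AE_completion_iff using ae by (auto elim!: eventually_mono)
  qed auto
qed auto

text \<open>Rounding \<open>t\<close> down to the dyadic grids moves by at most one step from one level to the next, so the values along the grids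
converge geometrically; two points at distance below \<open>2\<^sup>-\<^sup>n\<close> are rounded to equal or neighbouring points of level \<open>n\<close>, which
makes the limit continuous.\<close>

lemma dyadic_chain_limit:
  fixes y :: "real \<Rightarrow> real" and r t :: real
  assumes r: "0 < r" "r < 1"
    and inc: "\<And>n i. n \<ge> n0 \<Longrightarrow> i < 2 ^ n \<Longrightarrow> \<bar>y (real (Suc i) / 2 ^ n) - y (real i / 2 ^ n)\<bar> \<le> r ^ n"
  shows "t \<in> {0..1} \<Longrightarrow> (\<lambda>n. y (of_int \<lfloor>2 ^ n * t\<rfloor> / 2 ^ n)) \<longlonglongrightarrow> lim (\<lambda>n. y (of_int \<lfloor>2 ^ n * t\<rfloor> / 2 ^ n))"
    and "continuous_on {0..1} (\<lambda>t::real. lim (\<lambda>n. y (of_int \<lfloor>2 ^ n * t\<rfloor> / 2 ^ n)))"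
proof -
  define c where "c = (\<lambda>n (t::real). y (of_int \<lfloor>2 ^ n * t\<rfloor> / 2 ^ n))"
  have idx: "0 \<le> \<lfloor>2 ^ n * t\<rfloor>" "\<lfloor>2 ^ n * t\<rfloor> \<le> 2 ^ n" if "t \<in> {0..1}" for n and t :: real
  proof -
    have "2 ^ n * t \<le> 2 ^ n" using that by simp
    then have "\<lfloor>2 ^ n * t\<rfloor> \<le> \<lfloor>2 ^ n :: real\<rfloor>" by (rule floor_mono)
    also have "\<lfloor>2 ^ n :: real\<rfloor> = 2 ^ n" by (metis floor_of_int of_int_numeral of_int_power)
    finally show "\<lfloor>2 ^ n * t\<rfloor> \<le> 2 ^ n" .
  qed (use that in auto)
  have step: "\<bar>c (Suc n) t - c n t\<bar> \<le> r ^ n" if n: "n \<ge> n0" and t: "t \<in> {0..1}" for n t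
  proof -
    define i where "i = \<lfloor>2 ^ n * t\<rfloor>"
    define k where "k = \<lfloor>2 ^ Suc n * t\<rfloor>"
    have i: "of_int i \<le> 2 ^ n * t" "2 ^ n * t < of_int i + 1" "0 \<le> i"
      using idx[OF t, of n] unfolding i_def by linarith+
    have k: "of_int k \<le> 2 * (2 ^ n * t)" "2 * (2 ^ n * t) < of_int k + 1" "k \<le> 2 ^ Suc n"
      using idx[OF t, of "Suc n"] unfolding k_def by (auto, linarith+)
    have "of_int (2 * i) < (of_int (k + 1) :: real)" "of_int k < (of_int (2 * i + 2) :: real)" using i k by simp_all
    then have "2 * i < k + 1" "k < 2 * i + 2" unfolding of_int_less_iff by auto
    then have kk: "k = 2 * i \<or> k = 2 * i + 1" by linarith
    have ck: "c (Suc n) t = y (of_int k / 2 ^ Suc n)" by (simp only: c_def k_def)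
    have ci: "c n t = y (of_int i / 2 ^ n)" by (simp only: c_def i_def)
    from kk consider "k = 2 * i" | "k = 2 * i + 1" by blast
    then show ?thesis
    proof cases
      case 1
      then have "c (Suc n) t = c n t" unfolding ck ci by simp
      then show ?thesis using r by simp
    next
      case 2
      define j where "j = nat (2 * i)"
      have j: "int j = 2 * i" using i by (simp add: j_def)
      have "int j < 2 ^ Suc n" using 2 k j by linarith
      then have j2: "j < 2 ^ Suc n" by (metis of_nat_less_iff of_nat_numeral of_nat_power)
      have "real j = of_int (int j)" by (simp only: of_int_of_nat_eq)
      then have rj: "real j = 2 * of_int i" by (simp add: j)
      then have "real (Suc j) = of_int k" using 2 by simp
      note this rj
      then have "c (Suc n) t = y (real (Suc j) / 2 ^ Suc n)" "c n t = y (real j / 2 ^ Suc n)"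
        unfolding ck ci by simp_all
      then have "\<bar>c (Suc n) t - c n t\<bar> \<le> r ^ Suc n" using inc[of "Suc n" j] n j2 by simp
      also have "\<dots> \<le> r ^ n" using r by (intro power_decreasing) auto
      finally show ?thesis .
    qed
  qed
  have far: "\<bar>c (n + d) t - c n t\<bar> \<le> r ^ n / (1 - r)" if n: "n \<ge> n0" and t: "t \<in> {0..1}" for n d t
  proof -
    have "\<bar>c (n + d) t - c n t\<bar> \<le> r ^ n * (1 - r ^ d) / (1 - r)"
    proof (induction d)
      case (Suc d)
      have "\<bar>c (n + Suc d) t - c n t\<bar> \<le> \<bar>c (Suc (n + d)) t - c (n + d) t\<bar> + \<bar>c (n + d) t - c n t\<bar>" by simp
      also have "\<dots> \<le> r ^ (n + d) + r ^ n * (1 - r ^ d) / (1 - r)" using step[of "n + d" t] n t Suc by simp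
      also have "\<dots> = r ^ n * (1 - r ^ Suc d) / (1 - r)" using r by (simp add: field_simps power_add)
      finally show ?case .
    qed simp
    also have "\<dots> \<le> r ^ n * 1 / (1 - r)" using r by (intro divide_right_mono mult_left_mono) auto
    finally show ?thesis by simp
  qed
  have small: "\<exists>n\<ge>n0. C * r ^ n < e" if "e > 0" for C e :: real
  proof -
    have "(\<lambda>n. C * r ^ n) \<longlonglongrightarrow> C * 0" using r by (intro tendsto_intros LIMSEQ_realpow_zero) auto
    then have "\<forall>\<^sub>F n in sequentially. C * r ^ n < e" using that by (intro order_tendstoD(2)[where y="C * 0"]) auto
    then obtain n1 where "\<And>n. n \<ge> n1 \<Longrightarrow> C * r ^ n < e" by (auto simp: eventually_sequentially)
    then show ?thesis by (intro exI[of _ "max n0 n1"]) auto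
  qed
  have conv: "(\<lambda>n. c n t) \<longlonglongrightarrow> lim (\<lambda>n. c n t)" if t: "t \<in> {0..1}" for t :: real
  proof -
    have "Cauchy (\<lambda>n. c n t)"
    proof (rule metric_CauchyI)
      fix e :: real assume "e > 0"
      then obtain n where n: "n \<ge> n0" "(2 / (1 - r)) * r ^ n < e" using small by blast
      have "dist (c m t) (c k t) < e" if "m \<ge> n" "k \<ge> n" for m k
      proof -
        have "\<bar>c m t - c n t\<bar> \<le> r ^ n / (1 - r)" "\<bar>c k t - c n t\<bar> \<le> r ^ n / (1 - r)"
          using far[OF n(1) t, of "m - n"] far[OF n(1) t, of "k - n"] that by auto
        then have "\<bar>c m t - c k t\<bar> \<le> 2 * (r ^ n / (1 - r))" by linarith
        also have "\<dots> < e" using n(2) by simp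
        finally show ?thesis by (simp add: dist_real_def)
      qed
      then show "\<exists>M. \<forall>m\<ge>M. \<forall>k\<ge>M. dist (c m t) (c k t) < e" by blast
    qed
    then show ?thesis by (simp add: Cauchy_convergent_iff convergent_LIMSEQ_iff)
  qed
  then show "t \<in> {0..1} \<Longrightarrow> (\<lambda>n. y (of_int \<lfloor>2 ^ n * t\<rfloor> / 2 ^ n)) \<longlonglongrightarrow> lim (\<lambda>n. y (of_int \<lfloor>2 ^ n * t\<rfloor> / 2 ^ n))"
    by (simp add: c_def)
  have close: "\<bar>lim (\<lambda>n. c n t) - c n t\<bar> \<le> r ^ n / (1 - r)" if n: "n \<ge> n0" and t: "t \<in> {0..1}" for n t
  proof (rule LIMSEQ_le_const2)
    show "(\<lambda>d. \<bar>c (n + d) t - c n t\<bar>) \<longlonglongrightarrow> \<bar>lim (\<lambda>n. c n t) - c n t\<bar>"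
      using LIMSEQ_ignore_initial_segment[OF conv[OF t], of n] by (intro tendsto_intros) (simp add: add.commute)
  qed (use far[OF n t] in auto)
  have osc: "\<bar>c n s - c n t\<bar> \<le> r ^ n" if n: "n \<ge> n0" and s: "s \<in> {0..1}" and t: "t \<in> {0..1}" and st: "s \<le> t" "t - s < 1 / 2 ^ n" for n s t
  proof -
    define i where "i = \<lfloor>2 ^ n * s\<rfloor>"
    define k where "k = \<lfloor>2 ^ n * t\<rfloor>"
    have "2 ^ n * s \<le> 2 ^ n * t" using st by simp
    then have ik: "i \<le> k" unfolding i_def k_def by (rule floor_mono)
    have "2 ^ n * t - 2 ^ n * s < 1" using st(2) by (simp add: field_simps)
    moreover have "of_int k \<le> 2 ^ n * t" "2 ^ n * s < of_int i + 1" unfolding i_def k_def by linarith+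
    ultimately have "of_int k < (of_int (i + 2) :: real)" by simp
    then have "k < i + 2" unfolding of_int_less_iff .
    with ik consider "k = i" | "k = i + 1" by linarith
    then show ?thesis
    proof cases
      case 1
      then have "c n s = c n t" by (simp add: c_def i_def[symmetric] k_def[symmetric])
      then show ?thesis using r by simp
    next
      case 2
      define j where "j = nat i"
      have j: "int j = i" using idx[OF s, of n] by (simp add: j_def i_def)
      have "k \<le> 2 ^ n" unfolding k_def by (rule idx[OF t])
      then have "int j < 2 ^ n" using 2 j by linarith
      then have j2: "j < 2 ^ n" by (metis of_nat_less_iff of_nat_numeral of_nat_power)
      have "real j = of_int (int j)" by (simp only: of_int_of_nat_eq)
      then have rj: "real j = of_int i" by (simp add: j)
      then have "real (Suc j) = of_int k" using 2 by simp
      note this rj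
      then have "c n t = y (real (Suc j) / 2 ^ n)" "c n s = y (real j / 2 ^ n)"
        by (simp_all add: c_def i_def[symmetric] k_def[symmetric])
      then show ?thesis using inc[of n j] n j2 by (simp add: abs_minus_commute)
    qed
  qed
  have "continuous_on {0..1} (\<lambda>t. lim (\<lambda>n. c n t))"
    unfolding continuous_on_iff
  proof (intro ballI allI impI)
    fix t e :: real assume t: "t \<in> {0..1}" and e: "e > 0"
    obtain n where n: "n \<ge> n0" "(1 + 2 / (1 - r)) * r ^ n < e" using small[OF e] by blast
    have "dist (lim (\<lambda>n. c n s)) (lim (\<lambda>n. c n t)) < e" if s: "s \<in> {0..1}" and st: "dist s t < 1 / 2 ^ n" for s
    proof -
      have "\<bar>c n s - c n t\<bar> \<le> r ^ n"
      proof (cases "s \<le> t")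
        case True then show ?thesis using osc[OF n(1) s t] st by (simp add: dist_real_def)
      next
        case False then show ?thesis using osc[OF n(1) t s] st by (simp add: dist_real_def abs_minus_commute)
      qed
      then have "\<bar>lim (\<lambda>n. c n s) - lim (\<lambda>n. c n t)\<bar> \<le> r ^ n + 2 * (r ^ n / (1 - r))"
        using close[OF n(1) s] close[OF n(1) t] by linarith
      also have "\<dots> = (1 + 2 / (1 - r)) * r ^ n" by (simp add: distrib_right)
      also have "\<dots> < e" by (rule n)
      finally show ?thesis by (simp add: dist_real_def)
    qed
    then show "\<exists>d>0. \<forall>s\<in>{0..1}. dist s t < d \<longrightarrow> dist (lim (\<lambda>n. c n s)) (lim (\<lambda>n. c n t)) < e"
      by (intro exI[of _ "1 / 2 ^ n"]) auto
  qed
  then show "continuous_on {0..1} (\<lambda>t::real. lim (\<lambda>n. y (of_int \<lfloor>2 ^ n * t\<rfloor> / 2 ^ n)))" by (simp add: c_def)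
qed

lemma fbm_q_sym: "fbm_q \<alpha> h s t = fbm_q \<alpha> h t s"
  unfolding fbm_q_def interval_lebesgue_integral_def set_lebesgue_integral_def
  by (cases s t rule: linorder_cases) simp_all

context fbm
begin

text \<open>A Borel representative of \<open>f\<close> on the half-line, extended by \<open>0\<close>.\<close>

definition borel_version :: "(real \<Rightarrow> real) \<Rightarrow> (real \<Rightarrow> real) \<Rightarrow> bool" where
  "borel_version f g \<longleftrightarrow> g \<in> Lp_fun p \<and> (AE x in lborel. g x = f x * indicator {0..} x)"

lemma borel_version_ex: assumes "in_Lp p {0..} f" shows "\<exists>g. borel_version f g"
proof -
  have m: "(\<lambda>x. indicator {0..} x * f x) \<in> borel_measurable lebesgue"
    using assms by (simp add: in_Lp_def set_borel_measurable_def)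
  then obtain g where g [measurable]: "g \<in> borel_measurable borel" and ae: "AE x in lborel. indicator {0..} x * f x = g x"
    using completion_ex_borel_measurable_real[of "\<lambda>x. indicator {0..} x * f x" lborel] by auto
  have i: "integrable lebesgue (\<lambda>x. indicator {0..} x * (\<bar>f x\<bar> powr p))"
    using assms by (simp add: in_Lp_def set_integrable_def)
  have "Lpn p g = (\<integral>\<^sup>+x. ennreal (norm (indicator {0..} x * (\<bar>f x\<bar> powr p))) \<partial>lborel)"
    unfolding Lpn_def using ae p_gt_1
    by (intro nn_integral_cong_AE) (auto elim!: eventually_mono split: split_indicator)
  also have "\<dots> < \<infinity>" using i by (simp add: integrable_iff_bounded nn_integral_completion)
  finally show ?thesis using ae by (intro exI[of _ g]) (auto simp: borel_version_def Lp_fun_def mult.commute elim!: eventually_mono)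
qed

lemma Lp_fun_restrict: "g \<in> Lp_fun p \<Longrightarrow> A \<in> sets borel \<Longrightarrow> (\<lambda>x. g x * indicator A x) \<in> Lp_fun p"
proof -
  assume g: "g \<in> Lp_fun p" and [measurable]: "A \<in> sets borel"
  have [measurable]: "g \<in> borel_measurable borel" using g by (simp add: Lp_fun_def)
  have "Lpn p (\<lambda>x. g x * indicator A x) \<le> Lpn p g" using p_gt_1 by (intro Lpn_mono) (auto split: split_indicator)
  then show ?thesis using g by (auto simp: Lp_fun_def)
qed

lemma borel_version_supp: "borel_version f g \<Longrightarrow> supp_version f t (\<lambda>x. g x * indicator {0..t} x)"
  unfolding borel_version_def supp_version_def
  by (auto intro!: Lp_fun_restrict elim!: eventually_mono split: split_indicator)

text \<open>The iterated integral over the Lebesgue measure and the double integral over the product Borel measure agree by Fubini's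
theorem, once \<open>f\<close> is replaced by its Borel representative.\<close>

lemma fbm_q_riesz:
  assumes g: "borel_version f g" and st: "0 \<le> s" "s \<le> t"
  shows "fbm_q \<alpha> f s t = \<kappa> * riesz \<alpha> (\<lambda>x. g x * indicator {s..t} x) (\<lambda>x. g x * indicator {s..t} x)"
proof -
  define h where "h = (\<lambda>x. g x * indicator {s<..<t} x)"
  have gL: "g \<in> Lp_fun p" and ga: "AE x in lborel. g x = f x * indicator {0..} x" using g by (auto simp: borel_version_def)
  have hL: "h \<in> Lp_fun p" unfolding h_def by (rule Lp_fun_restrict[OF gL]) simp
  have [measurable]: "g \<in> borel_measurable borel" "h \<in> borel_measurable borel" using gL hL by (auto simp: Lp_fun_def)
  have hf: "AE x in lborel. indicator {s<..<t} x * f x = h x"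
    using ga st by (auto simp: h_def elim!: eventually_mono split: split_indicator)
  have ei: "einterval (ereal s) (ereal t) = {s<..<t}" by (auto simp: einterval_def)
  have kk: "\<bar>u - v\<bar> powr (\<alpha> - 1) = 1 / \<bar>u - v\<bar> powr (1 - \<alpha>)" for u v :: real
    using powr_minus_divide[of "\<bar>u - v\<bar>" "1 - \<alpha>"] by simp
  have inner: "(LINT u=ereal s..ereal t|lebesgue. (f u * f v / \<bar>u - v\<bar> powr (1 - \<alpha>))) = f v * (\<integral>u. h u * \<bar>u - v\<bar> powr (\<alpha> - 1) \<partial>lborel)" for v
  proof -
    have "(LINT u=ereal s..ereal t|lebesgue. (f u * f v / \<bar>u - v\<bar> powr (1 - \<alpha>))) = (\<integral>u. f v * (indicator {s<..<t} u * f u * \<bar>u - v\<bar> powr (\<alpha> - 1)) \<partial>lebesgue)"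
      using st by (simp add: interval_lebesgue_integral_def set_lebesgue_integral_def ei kk mult_ac)
    also have "\<dots> = f v * (\<integral>u. indicator {s<..<t} u * f u * \<bar>u - v\<bar> powr (\<alpha> - 1) \<partial>lebesgue)" by (rule integral_mult_right_zero)
    also have "(\<integral>u. indicator {s<..<t} u * f u * \<bar>u - v\<bar> powr (\<alpha> - 1) \<partial>lebesgue) = (\<integral>u. h u * \<bar>u - v\<bar> powr (\<alpha> - 1) \<partial>lebesgue)"
    proof (rule integral_cong_AE)
      show ae: "AE u in lebesgue. indicator {s<..<t} u * f u * \<bar>u - v\<bar> powr (\<alpha> - 1) = h u * \<bar>u - v\<bar> powr (\<alpha> - 1)"
        unfolding AE_completion_iff using hf by (auto elim!: eventually_mono)
      show m: "(\<lambda>u. h u * \<bar>u - v\<bar> powr (\<alpha> - 1)) \<in> borel_measurable lebesgue"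
        by (intro measurable_completion) measurable
      show "(\<lambda>u. indicator {s<..<t} u * f u * \<bar>u - v\<bar> powr (\<alpha> - 1)) \<in> borel_measurable lebesgue"
        by (rule lebesgue_measurable_AE_eq[OF _ ae[unfolded AE_completion_iff]]) measurable
    qed
    also have "\<dots> = (\<integral>u. h u * \<bar>u - v\<bar> powr (\<alpha> - 1) \<partial>lborel)" by (rule integral_completion) measurable
    finally show ?thesis .
  qed
  have "(LINT v=ereal s..ereal t|lebesgue. (LINT u=ereal s..ereal t|lebesgue. (f u * f v / \<bar>u - v\<bar> powr (1 - \<alpha>))))
    = (\<integral>v. (indicator {s<..<t} v * f v) * (\<integral>u. h u * \<bar>u - v\<bar> powr (\<alpha> - 1) \<partial>lborel) \<partial>lebesgue)"
    unfolding inner using st by (simp add: interval_lebesgue_integral_def set_lebesgue_integral_def ei mult_ac)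
  also have "\<dots> = (\<integral>v. h v * (\<integral>u. h u * \<bar>u - v\<bar> powr (\<alpha> - 1) \<partial>lborel) \<partial>lebesgue)"
  proof (rule integral_cong_AE)
    show ae: "AE v in lebesgue. indicator {s<..<t} v * f v * (\<integral>u. h u * \<bar>u - v\<bar> powr (\<alpha> - 1) \<partial>lborel) = h v * (\<integral>u. h u * \<bar>u - v\<bar> powr (\<alpha> - 1) \<partial>lborel)"
      unfolding AE_completion_iff using hf by (auto elim!: eventually_mono)
    show m: "(\<lambda>v. h v * (\<integral>u. h u * \<bar>u - v\<bar> powr (\<alpha> - 1) \<partial>lborel)) \<in> borel_measurable lebesgue"
      by (intro measurable_completion) measurable
    show "(\<lambda>v. indicator {s<..<t} v * f v * (\<integral>u. h u * \<bar>u - v\<bar> powr (\<alpha> - 1) \<partial>lborel)) \<in> borel_measurable lebesgue"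
      by (rule lebesgue_measurable_AE_eq[OF _ ae[unfolded AE_completion_iff]]) measurable
  qed
  also have "\<dots> = (\<integral>v. h v * (\<integral>u. h u * \<bar>u - v\<bar> powr (\<alpha> - 1) \<partial>lborel) \<partial>lborel)" by (rule integral_completion) measurable
  also have "\<dots> = (\<integral>v. (\<integral>u. h u * h v * \<bar>u - v\<bar> powr (\<alpha> - 1) \<partial>lborel) \<partial>lborel)"
    by (subst integral_mult_right_zero[symmetric]) (simp add: mult_ac)
  also have "\<dots> = riesz \<alpha> h h"
    unfolding riesz_def using lborel_pair.integral_snd[of "\<lambda>u v. h u * h v * \<bar>u - v\<bar> powr (\<alpha> - 1)"] riesz_integrable[OF hL hL]
    by (simp add: case_prod_beta')
  also have "\<dots> = riesz \<alpha> (\<lambda>x. g x * indicator {s..t} x) (\<lambda>x. g x * indicator {s..t} x)"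
  proof (rule riesz_eq_diag[OF Lp_fun_restrict[OF gL]])
    show "AE x in lborel. h x = g x * indicator {s..t} x"
      using AE_lborel_singleton[of s] AE_lborel_singleton[of t]
      by eventually_elim (auto simp: h_def split: split_indicator)
  qed auto
  finally show ?thesis by (simp add: fbm_q_def \<kappa>_def)
qed

lemma incr_gauss_le:
  assumes g: "borel_version f g" and st: "0 \<le> s" "s \<le> t"
    and X: "has_fbm_integral M \<xi> \<alpha> f s X" "has_fbm_integral M \<xi> \<alpha> f t Y"
  shows "cgauss M (\<lambda>\<omega>. Y \<omega> - X \<omega>) (fbm_q \<alpha> f s t)"
proof -
  let ?G = "\<lambda>i x. g x * indicator {0..(if i then t else s)} x"
  let ?b = "\<lambda>i. if i then 1 else - 1 :: real"
  let ?S = "\<lambda>x. \<Sum>i\<in>UNIV. ?b i * ?G i x"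
  have gL: "g \<in> Lp_fun p" using g by (simp add: borel_version_def)
  have [measurable]: "g \<in> borel_measurable borel" using gL by (auto simp: Lp_fun_def)
  have "cgauss M (\<lambda>\<omega>. \<Sum>i\<in>UNIV. ?b i * (if i then Y else X) \<omega>) (\<kappa> * riesz \<alpha> ?S ?S)"
    using g st X by (intro integral_family_gauss[where t="\<lambda>i. if i then t else s" and f="\<lambda>_. f"] borel_version_supp) auto
  also have "riesz \<alpha> ?S ?S = riesz \<alpha> (\<lambda>x. g x * indicator {s..t} x) (\<lambda>x. g x * indicator {s..t} x)"
  proof (rule riesz_eq_diag[OF Lp_fun_restrict[OF gL]])
    show "AE x in lborel. ?S x = g x * indicator {s..t} x"
      using AE_lborel_singleton[of s] st
      by (auto simp: UNIV_bool elim!: eventually_mono split: split_indicator)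
  qed auto
  finally show ?thesis using fbm_q_riesz[OF g st] by (simp add: UNIV_bool)
qed

lemma cgauss_uminus: "cgauss M X v \<Longrightarrow> cgauss M (\<lambda>\<omega>. - X \<omega>) v"
  using char_scale[of X M "-1"] by (auto simp: cgauss_def)

lemma incr_gauss:
  assumes g: "borel_version f g" and st: "0 \<le> s" "0 \<le> t"
    and X: "has_fbm_integral M \<xi> \<alpha> f s X" "has_fbm_integral M \<xi> \<alpha> f t Y"
  shows "cgauss M (\<lambda>\<omega>. Y \<omega> - X \<omega>) (fbm_q \<alpha> f s t)"
proof (cases "s \<le> t")
  case True then show ?thesis using incr_gauss_le assms by blast
next
  case False
  then have "cgauss M (\<lambda>\<omega>. X \<omega> - Y \<omega>) (fbm_q \<alpha> f t s)" using assms by (intro incr_gauss_le) auto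
  from cgauss_uminus[OF this] show ?thesis by (simp add: fbm_q_sym)
qed

lemma point_gauss:
  assumes g: "borel_version f g" and t: "0 \<le> t" and Y: "has_fbm_integral M \<xi> \<alpha> f t Y"
  shows "cgauss M Y (fbm_q \<alpha> f 0 t)"
proof -
  let ?S = "\<lambda>x. \<Sum>i\<in>{()}. 1 * (g x * indicator {0..t} x)"
  have "cgauss M (\<lambda>\<omega>. \<Sum>i\<in>{()}. 1 * Y \<omega>) (\<kappa> * riesz \<alpha> ?S ?S)"
    using g t Y by (intro integral_family_gauss[where t="\<lambda>_. t" and f="\<lambda>_. f"] borel_version_supp) auto
  then show ?thesis using fbm_q_riesz[OF g _ t] by simp
qed

text \<open>On \<open>[s,t]\<close> the kernel with exponent \<open>\<alpha> - 1\<close> is at most \<open>\<bar>s - t\<bar>\<^sup>\<alpha>\<^sup>-\<^sup>\<beta>\<close> times the kernel with exponent \<open>\<beta> - 1\<close>, whose Riesz form is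
bounded because \<open>f\<close> lies in the \<open>L\<^sup>p\<close> space of \<open>\<beta>\<close>.\<close>

lemma fbm_q_modulus:
  assumes g: "borel_version f g" and \<beta>: "0 < \<beta>" "\<beta> < \<alpha>" and f: "in_Lp (2 / (1 + \<beta>)) {0..1} f"
  shows "\<exists>C>0. \<forall>s\<in>{0..1}. \<forall>t\<in>{0..1}. fbm_q \<alpha> f s t \<le> C * \<bar>s - t\<bar> powr (\<alpha> - \<beta>)"
proof -
  interpret B: riesz_exp \<beta> "2 / (1 + \<beta>)" using \<alpha> \<beta> by unfold_locales auto
  have gL: "g \<in> Lp_fun p" and ga: "AE x in lborel. g x = f x * indicator {0..} x" using g by (auto simp: borel_version_def)
  have [measurable]: "g \<in> borel_measurable borel" using gL by (auto simp: Lp_fun_def)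
  define h where "h = (\<lambda>x. g x * indicator {0..1} x)"
  have [measurable]: "h \<in> borel_measurable borel" unfolding h_def by measurable
  have i: "integrable lebesgue (\<lambda>x. indicator {0..1} x * (\<bar>f x\<bar> powr (2 / (1 + \<beta>))))"
    using f by (simp add: in_Lp_def set_integrable_def)
  have "Lpn (2 / (1 + \<beta>)) h = (\<integral>\<^sup>+x. ennreal (norm (indicator {0..1} x * (\<bar>f x\<bar> powr (2 / (1 + \<beta>))))) \<partial>lborel)"
    unfolding Lpn_def h_def using ga B.p_gt_1
    by (intro nn_integral_cong_AE) (auto elim!: eventually_mono split: split_indicator)
  also have "\<dots> < \<infinity>" using i by (simp add: integrable_iff_bounded nn_integral_completion)
  finally obtain b where b: "b > 0" "Lpn (2 / (1 + \<beta>)) h \<le> ennreal (b powr (2 / (1 + \<beta>)))"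
    using Lpn_le_powr_ex B.p_gt_1 by blast
  define C where "C = \<kappa> * (hlsK \<beta> * b * b)"
  have le: "fbm_q \<alpha> f s t \<le> C * \<bar>s - t\<bar> powr (\<alpha> - \<beta>)" if st: "0 \<le> s" "s \<le> t" "t \<le> 1" for s t
  proof -
    define w where "w = (\<lambda>x. g x * indicator {s..t} x)"
    have wL: "w \<in> Lp_fun p" unfolding w_def by (rule Lp_fun_restrict[OF gL]) simp
    have [measurable]: "w \<in> borel_measurable borel" using wL by (auto simp: Lp_fun_def)
    have wh: "\<bar>w x\<bar> \<le> \<bar>h x\<bar>" for x using st by (auto simp: w_def h_def split: split_indicator)
    have wb: "Lpn (2 / (1 + \<beta>)) w \<le> ennreal (b powr (2 / (1 + \<beta>)))"
      using Lpn_mono[of w h, OF wh B.p_gt_1(3)] b(2) by (rule order_trans)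
    have "ennreal \<bar>riesz \<alpha> w w\<bar> \<le> (\<integral>\<^sup>+z. norm (w (fst z) * w (snd z) * \<bar>fst z - snd z\<bar> powr (\<alpha> - 1)) \<partial>(lborel \<Otimes>\<^sub>M lborel))"
      using integral_norm_bound_ennreal[OF riesz_integrable[OF wL wL]] by (simp add: riesz_def)
    also have "\<dots> \<le> (\<integral>\<^sup>+z. ennreal (\<bar>s - t\<bar> powr (\<alpha> - \<beta>)) * norm (w (fst z) * w (snd z) * \<bar>fst z - snd z\<bar> powr (\<beta> - 1)) \<partial>(lborel \<Otimes>\<^sub>M lborel))"
    proof (intro nn_integral_mono)
      fix z :: "real \<times> real"
      show "ennreal (norm (w (fst z) * w (snd z) * \<bar>fst z - snd z\<bar> powr (\<alpha> - 1))) \<le>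
         ennreal (\<bar>s - t\<bar> powr (\<alpha> - \<beta>)) * norm (w (fst z) * w (snd z) * \<bar>fst z - snd z\<bar> powr (\<beta> - 1))"
      proof (cases "fst z \<in> {s..t} \<and> snd z \<in> {s..t}")
        case True
        have "\<bar>fst z - snd z\<bar> powr (\<alpha> - 1) = \<bar>fst z - snd z\<bar> powr (\<alpha> - \<beta>) * \<bar>fst z - snd z\<bar> powr (\<beta> - 1)"
          by (subst powr_add[symmetric]) simp
        also have "\<dots> \<le> \<bar>s - t\<bar> powr (\<alpha> - \<beta>) * \<bar>fst z - snd z\<bar> powr (\<beta> - 1)"
          using True \<beta> by (intro mult_right_mono powr_mono2) auto
        finally have "\<bar>w (fst z)\<bar> * \<bar>w (snd z)\<bar> * \<bar>fst z - snd z\<bar> powr (\<alpha> - 1) \<le> \<bar>w (fst z)\<bar> * \<bar>w (snd z)\<bar> * (\<bar>s - t\<bar> powr (\<alpha> - \<beta>) * \<bar>fst z - snd z\<bar> powr (\<beta> - 1))"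
          by (intro mult_left_mono) auto
        then show ?thesis
          by (subst ennreal_mult[symmetric]) (auto simp: abs_mult mult_ac intro!: ennreal_leI)
      next
        case False
        then have "w (fst z) = 0 \<or> w (snd z) = 0" by (auto simp: w_def)
        then show ?thesis by auto
      qed
    qed
    also have "\<dots> = ennreal (\<bar>s - t\<bar> powr (\<alpha> - \<beta>)) * (\<integral>\<^sup>+z. norm (w (fst z) * w (snd z) * \<bar>fst z - snd z\<bar> powr (\<beta> - 1)) \<partial>(lborel \<Otimes>\<^sub>M lborel))"
      by (intro nn_integral_cmult) auto
    also have "\<dots> \<le> ennreal (\<bar>s - t\<bar> powr (\<alpha> - \<beta>)) * ennreal (hlsK \<beta> * b * b)"
      using b wb by (intro mult_left_mono B.riesz_nn_le) auto
    also have "\<dots> = ennreal (\<bar>s - t\<bar> powr (\<alpha> - \<beta>) * (hlsK \<beta> * b * b))"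
      using B.hlsK_pos b by (simp add: ennreal_mult[symmetric])
    finally have "\<bar>riesz \<alpha> w w\<bar> \<le> \<bar>s - t\<bar> powr (\<alpha> - \<beta>) * (hlsK \<beta> * b * b)"
      using B.hlsK_pos b by (subst (asm) ennreal_le_iff) auto
    then have "\<kappa> * riesz \<alpha> w w \<le> \<kappa> * (\<bar>s - t\<bar> powr (\<alpha> - \<beta>) * (hlsK \<beta> * b * b))"
      using \<kappa>_nonneg by (intro mult_left_mono) auto
    then show ?thesis using fbm_q_riesz[OF g st(1,2)] by (simp add: w_def C_def mult_ac)
  qed
  have C0: "C \<ge> 0" using \<kappa>_nonneg B.hlsK_pos b by (simp add: C_def)
  have "fbm_q \<alpha> f s t \<le> (C + 1) * \<bar>s - t\<bar> powr (\<alpha> - \<beta>)" if "s \<in> {0..1}" "t \<in> {0..1}" for s t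
  proof -
    have "fbm_q \<alpha> f s t \<le> C * \<bar>s - t\<bar> powr (\<alpha> - \<beta>)"
    proof (cases "s \<le> t")
      case True then show ?thesis using le that by auto
    next
      case False then show ?thesis using le[of t s] that fbm_q_sym[of \<alpha> f s t] by (auto simp: abs_minus_commute)
    qed
    also have "\<dots> \<le> (C + 1) * \<bar>s - t\<bar> powr (\<alpha> - \<beta>)" by (intro mult_right_mono) auto
    finally show ?thesis .
  qed
  then show ?thesis using C0 by (intro exI[of _ "C + 1"]) auto
qed

lemma has_fbm_integral_AE:
  assumes X: "has_fbm_integral M \<xi> \<alpha> f t X" and [measurable]: "Y \<in> borel_measurable M" and ae: "AE \<omega> in M. X \<omega> = Y \<omega>"
  shows "has_fbm_integral M \<xi> \<alpha> f t Y"
proof -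
  have "(\<integral>\<^sup>+\<omega>. ennreal ((D \<omega> - Y \<omega>)\<^sup>2) \<partial>M) = (\<integral>\<^sup>+\<omega>. ennreal ((D \<omega> - X \<omega>)\<^sup>2) \<partial>M)" for D
    using ae by (intro nn_integral_cong_AE) (auto elim!: eventually_mono)
  then show ?thesis using X by (auto simp: has_fbm_integral_def)
qed

text \<open>Kolmogorov's argument. The tail bound of order \<open>2j\<close>, with \<open>j\<close> large compared with \<open>1/(\<alpha> - \<beta>)\<close>, beats the \<open>2\<^sup>n\<close> increments of
level \<open>n\<close>, so by Borel and Cantelli these are eventually below \<open>r\<^sup>n\<close> and \<open>dyadic_chain_limit\<close> applies. The limit has the
right value at each \<open>t\<close> because the increment from \<open>t\<close> to its dyadic approximation tends to \<open>0\<close> in \<open>L\<^sup>2\<close>.\<close>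

lemma continuous_version_ex:
  assumes g: "borel_version f g" and \<beta>: "0 < \<beta>" "\<beta> < \<alpha>" and f: "in_Lp (2 / (1 + \<beta>)) {0..1} f"
  shows "\<exists>Y. continuous_version M \<xi> \<alpha> f Y"
proof -
  obtain C where C: "C > 0" "\<And>s t. s \<in> {0..1} \<Longrightarrow> t \<in> {0..1} \<Longrightarrow> fbm_q \<alpha> f s t \<le> C * \<bar>s - t\<bar> powr (\<alpha> - \<beta>)"
    using fbm_q_modulus[OF assms] by blast
  define \<delta> where "\<delta> = \<alpha> - \<beta>"
  have \<delta>: "\<delta> > 0" using \<beta> by (simp add: \<delta>_def)
  have "\<forall>t. \<exists>X. 0 \<le> t \<longrightarrow> has_fbm_integral M \<xi> \<alpha> f t X" using fbm_integral_ex borel_version_supp[OF g] by blast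
  then obtain Y where Y: "\<And>t. 0 \<le> t \<Longrightarrow> has_fbm_integral M \<xi> \<alpha> f t (Y t)" by metis
  have Ym: "Y t \<in> borel_measurable M" if "0 \<le> t" for t using Y[OF that] by (simp add: has_fbm_integral_def)
  define r where "r = 2 powr (- (\<delta> / 4))"
  have r: "0 < r" "r < 1" using \<delta> powr_less_mono[of "- (\<delta> / 4)" 0 "2::real"] by (auto simp: r_def)
  obtain j :: nat where j: "4 / \<delta> \<le> real j" using real_arch_simple by blast
  define E where "E = (\<lambda>n i. {\<omega> \<in> space M. \<bar>Y (real (Suc i) / 2 ^ n) \<omega> - Y (real i / 2 ^ n) \<omega>\<bar> > r ^ n})"
  define A where "A = (\<lambda>n. \<Union>i\<in>{..<2 ^ n::nat}. E n i)"
  have Yd [measurable]: "Y (real i / 2 ^ n) \<in> borel_measurable M" for n i by (intro Ym) simp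
  have Em [measurable]: "E n i \<in> sets M" for n i unfolding E_def by measurable
  define K where "K = 2 * (fact j * 2 ^ j * C ^ j)"
  have Eb: "prob (E n i) \<le> K * (1 / 4) ^ n" if i: "i < 2 ^ n" for n i
  proof -
    have iu: "real i / 2 ^ n \<in> {0..1}" "real (Suc i) / 2 ^ n \<in> {0..1}"
    proof -
      have "real (Suc i) \<le> real (2 ^ n)" using i by (subst of_nat_le_iff) auto
      then show "real (Suc i) / 2 ^ n \<in> {0..1}" by auto
      have "real i \<le> real (2 ^ n)" using i by (subst of_nat_le_iff) auto
      then show "real i / 2 ^ n \<in> {0..1}" by auto
    qed
    define s where "s = sqrt (C * (1 / 2 ^ n) powr \<delta>)"
    have s: "s > 0" using C by (simp add: s_def)
    have "real i / 2 ^ n - real (Suc i) / 2 ^ n = - (1 / 2 ^ n)" by (simp add: diff_divide_distrib[symmetric])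
    then have q: "fbm_q \<alpha> f (real i / 2 ^ n) (real (Suc i) / 2 ^ n) \<le> s\<^sup>2"
      using C(2)[OF iu] C(1) by (simp add: s_def \<delta>_def)
    have "prob (E n i) = \<P>(\<omega> in M. \<bar>Y (real (Suc i) / 2 ^ n) \<omega> - Y (real i / 2 ^ n) \<omega>\<bar> > (r ^ n / s) * s)"
      using s by (simp add: E_def)
    also have "\<dots> \<le> 2 * gtail (r ^ n / s)"
      using iu s r by (intro cgauss_abs_gt[OF incr_gauss[OF g] q] Y) auto
    also have "\<dots> \<le> 2 * (fact j * 2 ^ j / (r ^ n / s) ^ (2 * j))"
      using gtail_poly[of "r ^ n / s" j] r s by auto
    also have "\<dots> = 2 * (fact j * 2 ^ j * ((s\<^sup>2) ^ j / ((r ^ n)\<^sup>2) ^ j))"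
      by (simp add: power_divide power_mult)
    finally have le: "prob (E n i) \<le> 2 * (fact j * 2 ^ j * ((s\<^sup>2) ^ j / ((r ^ n)\<^sup>2) ^ j))" .
    have "(s\<^sup>2) ^ j / ((r ^ n)\<^sup>2) ^ j = (s\<^sup>2 / (r ^ n)\<^sup>2) ^ j" by (simp add: power_divide)
    also have "s\<^sup>2 / (r ^ n)\<^sup>2 = C * 2 powr (- (real n * \<delta> / 2))"
    proof -
      have "s\<^sup>2 = C * 2 powr (- (real n * \<delta>))"
      proof -
        have "(1 / 2 ^ n :: real) = 2 powr (- real n)" by (simp add: powr_minus_divide powr_realpow)
        then have "(1 / 2 ^ n :: real) powr \<delta> = 2 powr (- (real n * \<delta>))" by (simp only: powr_powr mult_minus_left)
        then show ?thesis using C(1) by (simp add: s_def)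
      qed
      moreover have "(r ^ n)\<^sup>2 = 2 powr (- (real n * \<delta> / 2))"
      proof -
        have "r ^ n = r powr real n" using r by (simp add: powr_realpow)
        also have "\<dots> = 2 powr (- (\<delta> / 4) * real n)" by (simp only: r_def powr_powr)
        finally have "(r ^ n)\<^sup>2 = 2 powr (- (\<delta> / 4) * real n + - (\<delta> / 4) * real n)"
          by (simp only: power2_eq_square powr_add)
        also have "- (\<delta> / 4) * real n + - (\<delta> / 4) * real n = - (real n * \<delta> / 2)" by simp
        finally show ?thesis .
      qed
      ultimately have "s\<^sup>2 / (r ^ n)\<^sup>2 = C * (2 powr (- (real n * \<delta>)) / 2 powr (- (real n * \<delta> / 2)))" by simp
      also have "2 powr (- (real n * \<delta>)) / 2 powr (- (real n * \<delta> / 2)) = 2 powr (- (real n * \<delta> / 2))"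
        by (subst powr_diff[symmetric], intro arg_cong[where f="\<lambda>x. 2 powr x"]) simp
      finally show ?thesis .
    qed
    also have "(C * 2 powr (- (real n * \<delta> / 2))) ^ j = C ^ j * 2 powr (- (real n * (\<delta> * real j / 2)))"
    proof -
      have "(2 powr (- (real n * \<delta> / 2))) ^ j = (2 powr (- (real n * \<delta> / 2))) powr real j" by (simp add: powr_realpow)
      also have "\<dots> = 2 powr (- (real n * \<delta> / 2) * real j)" by (simp only: powr_powr)
      also have "- (real n * \<delta> / 2) * real j = - (real n * (\<delta> * real j / 2))" by simp
      finally show ?thesis by (simp only: power_mult_distrib)
    qed
    finally have X: "(s\<^sup>2) ^ j / ((r ^ n)\<^sup>2) ^ j = C ^ j * 2 powr (- (real n * (\<delta> * real j / 2)))" .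
    have "2 powr (- (real n * (\<delta> * real j / 2))) \<le> 2 powr (- (real n * 2))"
    proof -
      have "2 \<le> \<delta> * real j / 2" using j \<delta> by (simp add: field_simps)
      then have "real n * 2 \<le> real n * (\<delta> * real j / 2)" by (intro mult_left_mono) auto
      then show ?thesis by (intro powr_mono) auto
    qed
    also have "2 powr (- (real n * 2)) = (1/4::real) ^ n"
    proof -
      have "2 powr (- (real n * 2)) = (2 powr (-2)) powr real n" by (simp add: powr_powr mult.commute)
      also have "2 powr (-2) = (1/4::real)" by (simp add: powr_minus_divide)
      finally show ?thesis by (simp add: powr_realpow)
    qed
    finally have "2 powr (- (real n * (\<delta> * real j / 2))) \<le> (1 / 4 :: real) ^ n" .
    then have "C ^ j * 2 powr (- (real n * (\<delta> * real j / 2))) \<le> C ^ j * (1 / 4) ^ n"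
      by (rule mult_left_mono) (use C(1) in simp)
    then have "(2 * (fact j * 2 ^ j)) * ((s\<^sup>2) ^ j / ((r ^ n)\<^sup>2) ^ j) \<le> (2 * (fact j * 2 ^ j)) * (C ^ j * (1 / 4) ^ n)"
      unfolding X by (rule mult_left_mono) simp
    with le show ?thesis unfolding K_def by (simp only: mult.assoc)
  qed
  have Am [measurable]: "A n \<in> sets M" for n unfolding A_def by measurable
  have "prob (A n) \<le> K * (1 / 2) ^ n" for n
  proof -
    have "prob (A n) \<le> (\<Sum>i<2 ^ n. prob (E n i))" unfolding A_def by (intro finite_measure_subadditive_finite) auto
    also have "\<dots> \<le> (\<Sum>i<2 ^ n::nat. K * (1 / 4) ^ n)" using Eb by (intro sum_mono) auto
    also have "\<dots> = real (2 ^ n) * (K * (1 / 4) ^ n)" by (simp only: sum_constant card_lessThan)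
    also have "\<dots> = K * (2 ^ n * (1 / 4) ^ n)" by (simp only: of_nat_power of_nat_numeral mult.left_commute)
    also have "2 ^ n * (1 / 4) ^ n = (1 / 2 :: real) ^ n" by (subst power_mult_distrib[symmetric]) simp
    finally show ?thesis .
  qed
  then have An: "norm (prob (A n)) \<le> K * (1 / 2) ^ n" for n by simp
  have "summable (\<lambda>n. K * (1 / 2) ^ n)" by (intro summable_mult summable_geometric) simp
  then have sA: "summable (\<lambda>n. prob (A n))"
    using An by (rule summable_comparison_test'[where N=0])
  have "AE \<omega> in M. eventually (\<lambda>n. \<omega> \<in> space M - A n) sequentially"
  proof (rule borel_cantelli_AE1[OF Am _ sA])
    show "emeasure M (A n) < \<infinity>" for n by (simp add: emeasure_eq_measure)
  qed
  then have good: "AE \<omega> in M. \<exists>n0. \<forall>n\<ge>n0. \<forall>i<2^n. \<bar>Y (real (Suc i) / 2 ^ n) \<omega> - Y (real i / 2 ^ n) \<omega>\<bar> \<le> r ^ n"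
  proof eventually_elim
    case (elim \<omega>)
    then obtain n0 where n0: "\<And>n. n \<ge> n0 \<Longrightarrow> \<omega> \<in> space M - A n" unfolding eventually_sequentially by blast
    show ?case
    proof (intro exI[of _ n0] allI impI)
      fix n i :: nat assume "n \<ge> n0" "i < 2 ^ n"
      with n0[of n] have "\<omega> \<in> space M" "\<omega> \<notin> E n i" by (auto simp: A_def)
      then show "\<bar>Y (real (Suc i) / 2 ^ n) \<omega> - Y (real i / 2 ^ n) \<omega>\<bar> \<le> r ^ n"
        unfolding E_def by (simp add: not_less)
    qed
  qed
  define D where "D = (\<lambda>n (t::real). of_int \<lfloor>2 ^ n * t\<rfloor> / 2 ^ n :: real)"
  define Z where "Z = (\<lambda>t \<omega>. lim (\<lambda>n. Y (D n t) \<omega>))"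
  have Du: "D n t \<in> {0..1}" "\<bar>D n t - t\<bar> \<le> 1 / 2 ^ n" if "t \<in> {0..1}" for n t
  proof -
    have "of_int \<lfloor>2 ^ n * t\<rfloor> \<le> 2 ^ n * t" "2 ^ n * t < of_int \<lfloor>2 ^ n * t\<rfloor> + 1" by linarith+
    then have 1: "D n t \<le> t" "t < D n t + 1 / 2 ^ n" by (auto simp: D_def field_simps)
    moreover have "0 \<le> D n t" using that by (auto simp: D_def)
    ultimately show "D n t \<in> {0..1}" using that by auto
    show "\<bar>D n t - t\<bar> \<le> 1 / 2 ^ n" using 1 by linarith
  qed
  have Zc: "AE \<omega> in M. (\<forall>t\<in>{0..1}. (\<lambda>n. Y (D n t) \<omega>) \<longlonglongrightarrow> Z t \<omega>) \<and> continuous_on {0..1} (\<lambda>t. Z t \<omega>)"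
    using good
  proof eventually_elim
    case (elim \<omega>)
    then obtain n0 where n0: "\<And>n i. n \<ge> n0 \<Longrightarrow> i < 2 ^ n \<Longrightarrow> \<bar>Y (real (Suc i) / 2 ^ n) \<omega> - Y (real i / 2 ^ n) \<omega>\<bar> \<le> r ^ n" by blast
    note dc = dyadic_chain_limit[OF r, where y="\<lambda>t. Y t \<omega>" and ?n0.0=n0]
    show ?case
    proof (intro conjI ballI)
      fix t :: real assume "t \<in> {0..1}"
      show "(\<lambda>n. Y (D n t) \<omega>) \<longlonglongrightarrow> Z t \<omega>"
        unfolding Z_def D_def by (rule dc(1)) (fact n0, fact)
    next
      show "continuous_on {0..1} (\<lambda>t. Z t \<omega>)"
        unfolding Z_def D_def by (rule dc(2)) (fact n0)
    qed
  qed
  have "has_fbm_integral M \<xi> \<alpha> f t (Z t)" if t: "t \<in> {0..1}" for t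
  proof (rule has_fbm_integral_AE[OF Y])
    have [measurable]: "Y (D n t) \<in> borel_measurable M" for n using Du[OF t] by (intro Ym) auto
    have Yt [measurable]: "Y t \<in> borel_measurable M" using t by (intro Ym) auto
    show [measurable]: "Z t \<in> borel_measurable M" unfolding Z_def by measurable
    have L2: "(\<integral>\<^sup>+\<omega>. ennreal ((Y (D n t) \<omega> - Y t \<omega>)\<^sup>2) \<partial>M) \<le> ennreal (C * (1 / 2 ^ n) powr \<delta>)" for n
    proof -
      have cg: "cgauss M (\<lambda>\<omega>. Y (D n t) \<omega> - Y t \<omega>) (fbm_q \<alpha> f t (D n t))"
        using t Du(1)[OF t, of n] by (intro incr_gauss[OF g] Y) auto
      have "(\<integral>\<^sup>+\<omega>. ennreal ((Y (D n t) \<omega> - Y t \<omega>)\<^sup>2) \<partial>M) = ennreal (fbm_q \<alpha> f t (D n t))"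
        using cgauss_second_moment[OF cg] by (subst nn_integral_eq_integral) auto
      also have "\<dots> \<le> ennreal (C * \<bar>t - D n t\<bar> powr \<delta>)"
        unfolding \<delta>_def by (intro ennreal_leI C(2) t Du)
      also have "\<dots> \<le> ennreal (C * (1 / 2 ^ n) powr \<delta>)"
        using Du(2)[OF t, of n] C(1) \<delta> by (intro ennreal_leI mult_left_mono powr_mono2) (auto simp: abs_minus_commute)
      finally show ?thesis .
    qed
    have lim0: "(\<lambda>n. ennreal (C * (1 / 2 ^ n) powr \<delta>)) \<longlonglongrightarrow> ennreal 0"
    proof (rule tendsto_ennrealI)
      have "(\<lambda>n. (1 / 2) ^ n :: real) \<longlonglongrightarrow> 0" by (intro LIMSEQ_realpow_zero) auto
      then have "(\<lambda>n. 1 / 2 ^ n :: real) \<longlonglongrightarrow> 0" by (simp add: power_one_over)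
      then have "(\<lambda>n. (1 / 2 ^ n :: real) powr \<delta>) \<longlonglongrightarrow> 0"
        using \<delta> by (intro tendsto_zero_powrI[where b=\<delta>] tendsto_const) auto
      from tendsto_mult[OF tendsto_const[of C] this] show "(\<lambda>n. C * (1 / 2 ^ n) powr \<delta>) \<longlonglongrightarrow> 0" by simp
    qed
    have "(\<integral>\<^sup>+\<omega>. ennreal ((Z t \<omega> - Y t \<omega>)\<^sup>2) \<partial>M) = (\<integral>\<^sup>+\<omega>. liminf (\<lambda>n. ennreal ((Y (D n t) \<omega> - Y t \<omega>)\<^sup>2)) \<partial>M)"
    proof (intro nn_integral_cong_AE)
      show "AE \<omega> in M. ennreal ((Z t \<omega> - Y t \<omega>)\<^sup>2) = liminf (\<lambda>n. ennreal ((Y (D n t) \<omega> - Y t \<omega>)\<^sup>2))"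
        using Zc
      proof eventually_elim
        case (elim \<omega>)
        then have l: "(\<lambda>n. Y (D n t) \<omega>) \<longlonglongrightarrow> Z t \<omega>" using t by blast
        have "(\<lambda>n. ennreal ((Y (D n t) \<omega> - Y t \<omega>)\<^sup>2)) \<longlonglongrightarrow> ennreal ((Z t \<omega> - Y t \<omega>)\<^sup>2)"
          by (intro tendsto_ennrealI tendsto_power tendsto_diff l tendsto_const)
        then show ?case by (rule lim_imp_Liminf[OF sequentially_bot, symmetric])
      qed
    qed
    also have "\<dots> \<le> liminf (\<lambda>n. \<integral>\<^sup>+\<omega>. ennreal ((Y (D n t) \<omega> - Y t \<omega>)\<^sup>2) \<partial>M)"
      by (intro nn_integral_liminf) auto
    also have "\<dots> \<le> liminf (\<lambda>n. ennreal (C * (1 / 2 ^ n) powr \<delta>))"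
      by (intro Liminf_mono always_eventually allI L2)
    also have "liminf (\<lambda>n. ennreal (C * (1 / 2 ^ n) powr \<delta>)) = 0"
      using lim_imp_Liminf[OF sequentially_bot lim0] by simp
    finally have z: "(\<integral>\<^sup>+\<omega>. ennreal ((Z t \<omega> - Y t \<omega>)\<^sup>2) \<partial>M) = 0" by simp
    have Zm [measurable]: "Z t \<in> borel_measurable M" unfolding Z_def by measurable
    have zm: "(\<lambda>\<omega>. ennreal ((Z t \<omega> - Y t \<omega>)\<^sup>2)) \<in> borel_measurable M" by measurable
    have "AE \<omega> in M. ennreal ((Z t \<omega> - Y t \<omega>)\<^sup>2) = 0" using z unfolding nn_integral_0_iff_AE[OF zm] .
    then show "AE \<omega> in M. Y t \<omega> = Z t \<omega>" by eventually_elim simp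
  qed (use t in auto)
  moreover have "AE \<omega> in M. continuous_on {0..1} (\<lambda>t. Z t \<omega>)" using Zc by eventually_elim blast
  ultimately show ?thesis unfolding continuous_version_def by blast
qed
end

section \<open>Chaining over grids\<close>

text \<open>Midpoints of \<open>N\<close> equal intervals: the mesh is half as large as for the end points, which the numerical estimates rely on.\<close>

definition mgrid :: "nat \<Rightarrow> real set" where
  "mgrid N = (\<lambda>i. (2 * real i + 1) / (2 * real N)) ` {..<N}"

lemma mgrid: "finite (mgrid N)" "card (mgrid N) \<le> N" "mgrid N \<subseteq> {0..1}"
proof -
  show "finite (mgrid N)" by (simp add: mgrid_def)
  show "card (mgrid N) \<le> N" unfolding mgrid_def using card_image_le[of "{..<N}"] by fastforce
  show "mgrid N \<subseteq> {0..1}"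
  proof
    fix t assume "t \<in> mgrid N"
    then obtain i where i: "i < N" "t = (2 * real i + 1) / (2 * real N)" by (auto simp: mgrid_def)
    then have "2 * real i + 1 \<le> 2 * real N" by linarith
    then show "t \<in> {0..1}" using i by (simp add: divide_le_eq)
  qed
qed

lemma mgrid_near:
  assumes N: "N \<ge> 1" and t: "t \<in> {0..1}"
  shows "\<exists>s\<in>mgrid N. \<bar>t - s\<bar> \<le> 1 / (2 * real N)"
proof -
  define i where "i = min (nat \<lfloor>real N * t\<rfloor>) (N - 1)"
  have i: "i < N" using N by (auto simp: i_def)
  have Nt: "0 \<le> real N * t" "real N * t \<le> real N" using t by (auto simp: mult_left_le)
  have 1: "real i \<le> real N * t"
  proof -
    have "real i \<le> real (nat \<lfloor>real N * t\<rfloor>)" by (simp add: i_def)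
    also have "\<dots> \<le> real N * t" using Nt by linarith
    finally show ?thesis .
  qed
  have 2: "real N * t \<le> real i + 1"
  proof (cases "nat \<lfloor>real N * t\<rfloor> \<le> N - 1")
    case True
    then have "real i = real (nat \<lfloor>real N * t\<rfloor>)" by (simp add: i_def)
    then show ?thesis using Nt by linarith
  next
    case False
    then have "i = N - 1" by (simp add: i_def)
    then show ?thesis using Nt N by simp
  qed
  have "t - (2 * real i + 1) / (2 * real N) = (real N * t - (real i + 1 / 2)) / real N"
    using N by (simp add: field_simps)
  then have "\<bar>t - (2 * real i + 1) / (2 * real N)\<bar> = \<bar>real N * t - (real i + 1 / 2)\<bar> / real N"
    by (simp only: abs_divide abs_of_nat)
  also have "\<bar>real N * t - (real i + 1 / 2)\<bar> \<le> 1 / 2" using 1 2 by linarith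
  then have "\<bar>real N * t - (real i + 1 / 2)\<bar> / real N \<le> (1 / 2) / real N" by (rule divide_right_mono) simp
  finally show ?thesis using i by (auto simp: mgrid_def)
qed

context prob_space
begin

lemma prob_le_AE:
  assumes L: "L \<in> sets M" and ae: "AE \<omega> in M. E \<omega> \<longleftrightarrow> \<omega> \<in> L" and b: "prob L \<le> b"
  shows "prob_le M E b"
proof -
  let ?S = "{\<omega> \<in> space M. E \<omega>}"
  have LS: "L \<in> sets (completion M)" using L by (simp add: sets_completionI_sets)
  have ae': "AE \<omega> in completion M. (\<omega> \<in> L) = (\<omega> \<in> ?S)"
    unfolding AE_completion_iff using ae AE_space by eventually_elim auto
  have S: "?S \<in> sets (completion M)"
    by (rule completion.in_sets_AE[OF ae' LS]) auto
  have "emeasure (completion M) ?S = emeasure (completion M) L"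
    using ae' by (intro emeasure_eq_AE S LS) (auto elim!: eventually_mono)
  also have "\<dots> = emeasure M L" using L by simp
  finally have "measure (completion M) ?S = prob L" by (simp add: measure_def)
  then show ?thesis using S b by (simp add: prob_le_def)
qed

text \<open>For a continuous path the supremum exceeds \<open>l\<close> if and only if all sufficiently fine grids contain a point with value above
\<open>l\<close>. So the event is, up to a null set, the lower limit of the grid events, which is measurable and inherits their bound.\<close>

lemma sup_event:
  fixes Z :: "real \<Rightarrow> 'a \<Rightarrow> real"
  assumes Zm: "\<And>t. t \<in> {0..1} \<Longrightarrow> Z t \<in> borel_measurable M"
    and cont: "AE \<omega> in M. continuous_on {0..1} (\<lambda>t. Z t \<omega>)"
    and G: "\<And>k. finite (G k)" "\<And>k. G k \<subseteq> {0..1}"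
    and near: "\<And>k t. t \<in> {0..1} \<Longrightarrow> \<exists>s\<in>G k. \<bar>t - s\<bar> \<le> e k" and e: "e \<longlonglongrightarrow> 0"
    and b: "\<And>k. \<P>(\<omega> in M. \<exists>s\<in>G k. Z s \<omega> > l) \<le> b"
  shows "prob_le M (\<lambda>\<omega>. (SUP t\<in>{0..1}. Z t \<omega>) > l) b"
proof -
  define E where "E = (\<lambda>k. {\<omega> \<in> space M. \<exists>s\<in>G k. Z s \<omega> > l})"
  have Em [measurable]: "E k \<in> sets M" for k
  proof -
    have "E k = (\<Union>s\<in>G k. {\<omega> \<in> space M. Z s \<omega> > l})" by (auto simp: E_def)
    moreover have "{\<omega> \<in> space M. Z s \<omega> > l} \<in> sets M" if "s \<in> G k" for s
    proof -
      have [measurable]: "Z s \<in> borel_measurable M" using that G(2)[of k] by (intro Zm) auto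
      show ?thesis by measurable
    qed
    ultimately show ?thesis using G(1)[of k] by auto
  qed
  define I where "I = (\<lambda>K. \<Inter>k\<in>{K..}. E k)"
  have Im: "I K \<in> sets M" for K unfolding I_def by measurable
  have "incseq I" unfolding I_def by (intro incseq_SucI INT_anti_mono) auto
  then have "(\<lambda>K. prob (I K)) \<longlonglongrightarrow> prob (\<Union>K. I K)"
    using Im by (intro finite_Lim_measure_incseq) auto
  note lim = this
  have "prob (I K) \<le> b" for K
  proof -
    have "I K \<subseteq> E K" by (auto simp: I_def)
    then have "prob (I K) \<le> prob (E K)" by (rule finite_measure_mono) (rule Em)
    then show ?thesis using b[of K] by (simp add: E_def)
  qed
  then have pL: "prob (\<Union>K. I K) \<le> b" using LIMSEQ_le_const2[OF lim] by blast
  show ?thesis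
  proof (rule prob_le_AE[OF _ _ pL])
    show "(\<Union>K. I K) \<in> sets M" using Im by auto
    show "AE \<omega> in M. (SUP t\<in>{0..1}. Z t \<omega>) > l \<longleftrightarrow> \<omega> \<in> (\<Union>K. I K)"
      using cont AE_space
    proof eventually_elim
      case (elim \<omega>)
      have "compact ((\<lambda>t. Z t \<omega>) ` {0..1})" by (intro compact_continuous_image elim) auto
      then have bdd: "bdd_above ((\<lambda>t. Z t \<omega>) ` {0..1})" by (intro bounded_imp_bdd_above compact_imp_bounded)
      have iff: "(SUP t\<in>{0..1}. Z t \<omega>) > l \<longleftrightarrow> (\<exists>t\<in>{0..1}. Z t \<omega> > l)"
        using bdd by (intro less_cSUP_iff) auto
      show ?case unfolding iff
      proof
        assume "\<exists>t\<in>{0..1}. Z t \<omega> > l"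
        then obtain t where t: "t \<in> {0..1}" "Z t \<omega> > l" by blast
        obtain d where d: "d > 0" "\<And>s. s \<in> {0..1} \<Longrightarrow> dist s t < d \<Longrightarrow> dist (Z s \<omega>) (Z t \<omega>) < Z t \<omega> - l"
          using elim(1) t unfolding continuous_on_iff by (metis diff_gt_0_iff_gt)
        have "eventually (\<lambda>k. e k < d) sequentially" using d(1) by (intro order_tendstoD(2)[OF e])
        then obtain K where K: "\<And>k. k \<ge> K \<Longrightarrow> e k < d" unfolding eventually_sequentially by blast
        have "\<omega> \<in> E k" if k: "k \<ge> K" for k
        proof -
          obtain s where s: "s \<in> G k" "\<bar>t - s\<bar> \<le> e k" using near[OF t(1)] by blast
          then have "dist s t < d" using K[OF k] by (simp add: dist_real_def abs_minus_commute)
          moreover have "s \<in> {0..1}" using s G(2) by blast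
          ultimately have "dist (Z s \<omega>) (Z t \<omega>) < Z t \<omega> - l" using d(2) by blast
          then have "Z s \<omega> > l" by (simp add: dist_real_def)
          then show ?thesis using s elim(2) by (auto simp: E_def)
        qed
        then show "\<omega> \<in> (\<Union>K. I K)" by (auto simp: I_def)
      next
        assume "\<omega> \<in> (\<Union>K. I K)"
        then obtain K where "\<omega> \<in> E K" by (auto simp: I_def)
        then show "\<exists>t\<in>{0..1}. Z t \<omega> > l" using G(2)[of K] by (auto simp: E_def)
      qed
    qed
  qed
qed

text \<open>Induction on the level: if a value on the new grid is large, then either its neighbour on the old grid is, or the link between
them is longer than \<open>\<tau>\<^sub>n\<^sub>+\<^sub>1 d\<^sub>n x\<close>.\<close>

lemma chain_bound:
  fixes Y :: "real \<Rightarrow> 'a \<Rightarrow> real" and N :: "nat \<Rightarrow> nat"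
  assumes inc: "\<And>s t. s \<in> {0..1} \<Longrightarrow> t \<in> {0..1} \<Longrightarrow> cgauss M (\<lambda>\<omega>. Y t \<omega> - Y s \<omega>) (q s t)"
    and pt: "\<And>t. t \<in> {0..1} \<Longrightarrow> cgauss M (Y t) (q 0 t)"
    and N: "\<And>k. N k \<ge> 1" and \<tau>: "\<And>k. \<tau> k \<ge> 0" and x: "x \<ge> 0"
    and \<sigma>: "\<sigma> \<ge> 0" "\<And>t. t \<in> {0..1} \<Longrightarrow> q 0 t \<le> \<sigma>\<^sup>2"
    and d: "\<And>k. d k \<ge> 0" "\<And>k s t. s \<in> {0..1} \<Longrightarrow> t \<in> {0..1} \<Longrightarrow> \<bar>s - t\<bar> \<le> 1 / (2 * real (N k)) \<Longrightarrow> q s t \<le> (d k)\<^sup>2"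
  shows "\<P>(\<omega> in M. \<exists>t\<in>mgrid (N n). \<bar>Y t \<omega>\<bar> > x * (\<tau> 0 * \<sigma> + (\<Sum>k<n. \<tau> (Suc k) * d k)))
     \<le> (\<Sum>k\<le>n. 2 * real (N k) * gtail (\<tau> k * x))"
proof (induction n)
  have Ym: "Y t \<in> borel_measurable M" if "t \<in> {0..1}" for t using pt[OF that] by (simp add: cgauss_def)
  have union: "\<P>(\<omega> in M. \<exists>t\<in>mgrid n. X t \<omega>) \<le> real n * b"
    if "\<And>t. t \<in> {0..1} \<Longrightarrow> {\<omega> \<in> space M. X t \<omega>} \<in> sets M" "\<And>t. t \<in> {0..1} \<Longrightarrow> \<P>(\<omega> in M. X t \<omega>) \<le> b" "0 \<le> b" for X n b
  proof -
    have g: "t \<in> {0..1}" if "t \<in> mgrid n" for t using that mgrid(3) by blast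
    have "\<P>(\<omega> in M. \<exists>t\<in>mgrid n. X t \<omega>) = prob (\<Union>t\<in>mgrid n. {\<omega> \<in> space M. X t \<omega>})"
      by (intro arg_cong[where f=prob]) auto
    also have "\<dots> \<le> (\<Sum>t\<in>mgrid n. \<P>(\<omega> in M. X t \<omega>))"
      using that g by (intro finite_measure_subadditive_finite mgrid) auto
    also have "\<dots> \<le> (\<Sum>t\<in>mgrid n. b)" using that g by (intro sum_mono) auto
    also have "\<dots> = real (card (mgrid n)) * b" by simp
    also have "\<dots> \<le> real n * b" using mgrid(2)[of n] that by (intro mult_right_mono) auto
    finally show ?thesis .
  qed
  {
    case 0
    have "\<P>(\<omega> in M. \<exists>t\<in>mgrid (N 0). \<bar>Y t \<omega>\<bar> > (\<tau> 0 * x) * \<sigma>) \<le> real (N 0) * (2 * gtail (\<tau> 0 * x))"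
    proof (rule union)
      fix t :: real assume t: "t \<in> {0..1}"
      have [measurable]: "Y t \<in> borel_measurable M" by (rule Ym[OF t])
      show "{\<omega> \<in> space M. \<bar>Y t \<omega>\<bar> > (\<tau> 0 * x) * \<sigma>} \<in> sets M" by measurable
      show "\<P>(\<omega> in M. \<bar>Y t \<omega>\<bar> > (\<tau> 0 * x) * \<sigma>) \<le> 2 * gtail (\<tau> 0 * x)"
        using \<sigma> \<tau> x t by (intro cgauss_abs_gt[OF pt]) auto
    qed simp
    then show ?case by (simp add: mult_ac)
  next
    case (Suc n)
    let ?c = "\<lambda>n. x * (\<tau> 0 * \<sigma> + (\<Sum>k<n. \<tau> (Suc k) * d k))"
    have "\<forall>t. \<exists>s. t \<in> {0..1} \<longrightarrow> s \<in> mgrid (N n) \<and> \<bar>t - s\<bar> \<le> 1 / (2 * real (N n))" using mgrid_near[OF N] by blast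
    then obtain \<pi> where \<pi>: "\<And>t. t \<in> {0..1} \<Longrightarrow> \<pi> t \<in> mgrid (N n)" "\<And>t. t \<in> {0..1} \<Longrightarrow> \<bar>t - \<pi> t\<bar> \<le> 1 / (2 * real (N n))" by metis
    have \<pi>1: "\<pi> t \<in> {0..1}" if "t \<in> {0..1}" for t using \<pi>(1)[OF that] mgrid(3) by blast
    let ?A = "{\<omega> \<in> space M. \<exists>t\<in>mgrid (N n). \<bar>Y t \<omega>\<bar> > ?c n}"
    let ?B = "{\<omega> \<in> space M. \<exists>t\<in>mgrid (N (Suc n)). \<bar>Y t \<omega> - Y (\<pi> t) \<omega>\<bar> > (\<tau> (Suc n) * x) * d n}"
    have setm: "{\<omega> \<in> space M. \<exists>t\<in>mgrid k. X t \<omega>} \<in> sets M"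
      if "\<And>t. t \<in> {0..1} \<Longrightarrow> {\<omega> \<in> space M. X t \<omega>} \<in> sets M" for X k
    proof -
      have "{\<omega> \<in> space M. \<exists>t\<in>mgrid k. X t \<omega>} = (\<Union>t\<in>mgrid k. {\<omega> \<in> space M. X t \<omega>})" by auto
      moreover have "{\<omega> \<in> space M. X t \<omega>} \<in> sets M" if "t \<in> mgrid k" for t
        using that mgrid(3)[of k] by (intro \<open>\<And>t. t \<in> {0..1} \<Longrightarrow> {\<omega> \<in> space M. X t \<omega>} \<in> sets M\<close>) blast
      ultimately show ?thesis using mgrid(1) by (simp only: sets.finite_UN)
    qed
    have Am: "?A \<in> sets M"
    proof (rule setm)
      fix t :: real assume "t \<in> {0..1}"
      then have [measurable]: "Y t \<in> borel_measurable M" by (rule Ym)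
      show "{\<omega> \<in> space M. \<bar>Y t \<omega>\<bar> > ?c n} \<in> sets M" by measurable
    qed
    have Bm1: "{\<omega> \<in> space M. \<bar>Y t \<omega> - Y (\<pi> t) \<omega>\<bar> > (\<tau> (Suc n) * x) * d n} \<in> sets M" if "t \<in> {0..1}" for t
    proof -
      have [measurable]: "Y t \<in> borel_measurable M" "Y (\<pi> t) \<in> borel_measurable M" by (fact Ym[OF that], fact Ym[OF \<pi>1[OF that]])
      show ?thesis by measurable
    qed
    have Bm: "?B \<in> sets M" by (rule setm[OF Bm1])
    have "{\<omega> \<in> space M. \<exists>t\<in>mgrid (N (Suc n)). \<bar>Y t \<omega>\<bar> > ?c (Suc n)} \<subseteq> ?A \<union> ?B"
    proof safe
      fix \<omega> t assume w: "\<omega> \<in> space M" and t: "t \<in> mgrid (N (Suc n))" and gt: "\<bar>Y t \<omega>\<bar> > ?c (Suc n)"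
        and nB: "\<not> (\<exists>t\<in>mgrid (N (Suc n)). \<bar>Y t \<omega> - Y (\<pi> t) \<omega>\<bar> > (\<tau> (Suc n) * x) * d n)"
      have t01: "t \<in> {0..1}" using t mgrid(3) by blast
      have "\<bar>Y t \<omega> - Y (\<pi> t) \<omega>\<bar> \<le> (\<tau> (Suc n) * x) * d n" using nB t by force
      moreover have "?c (Suc n) = ?c n + (\<tau> (Suc n) * x) * d n" by (simp add: algebra_simps)
      ultimately have "\<bar>Y (\<pi> t) \<omega>\<bar> > ?c n" using gt by linarith
      then show "\<exists>t\<in>mgrid (N n). \<bar>Y t \<omega>\<bar> > ?c n" using \<pi>(1)[OF t01] by blast
    qed
    then have "\<P>(\<omega> in M. \<exists>t\<in>mgrid (N (Suc n)). \<bar>Y t \<omega>\<bar> > ?c (Suc n)) \<le> prob (?A \<union> ?B)"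
      using Am Bm by (intro finite_measure_mono) auto
    also have "\<dots> \<le> prob ?A + prob ?B" by (rule measure_Un_le[OF Am Bm])
    finally have AB: "\<P>(\<omega> in M. \<exists>t\<in>mgrid (N (Suc n)). \<bar>Y t \<omega>\<bar> > ?c (Suc n)) \<le> prob ?A + prob ?B" .
    have PB: "prob ?B \<le> real (N (Suc n)) * (2 * gtail (\<tau> (Suc n) * x))"
    proof (rule union[OF Bm1])
      fix t :: real assume t: "t \<in> {0..1}"
      have "q (\<pi> t) t \<le> (d n)\<^sup>2" using \<pi>(2)[OF t] by (intro d \<pi>1 t) (simp add: abs_minus_commute)
      then show "\<P>(\<omega> in M. \<bar>Y t \<omega> - Y (\<pi> t) \<omega>\<bar> > (\<tau> (Suc n) * x) * d n) \<le> 2 * gtail (\<tau> (Suc n) * x)"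
        using d(1)[of n] \<tau>[of "Suc n"] x by (intro cgauss_abs_gt[OF inc[OF \<pi>1[OF t] t]]) auto
    qed auto
    have "prob ?A + prob ?B \<le> (\<Sum>k\<le>Suc n. 2 * real (N k) * gtail (\<tau> k * x))"
      using add_mono[OF Suc.IH PB] by (simp only: sum.atMost_Suc mult.assoc mult.left_commute)
    with AB show ?case by (rule order_trans)
  }
qed

end

section \<open>Numerical estimates for the two choices of grids\<close>

lemma geom_sum_le:
  fixes a :: "nat \<Rightarrow> real"
  assumes "\<And>k. a k \<le> c * r ^ k" "0 \<le> r" "r < 1" "0 \<le> c"
  shows "(\<Sum>k<n. a k) \<le> c / (1 - r)"
proof -
  have "(\<Sum>k<n. a k) \<le> (\<Sum>k<n. c * r ^ k)" by (intro sum_mono assms(1))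
  also have "\<dots> = c * (\<Sum>k<n. r ^ k)" by (simp only: sum_distrib_left)
  also have "\<dots> \<le> c * (1 / (1 - r))"
  proof (rule mult_left_mono)
    have "(\<Sum>k<n. r ^ k) = (1 - r ^ n) / (1 - r)" using assms(3) by (simp add: sum_gp_strict)
    also have "\<dots> \<le> 1 / (1 - r)" using assms(2,3) by (intro divide_right_mono) auto
    finally show "(\<Sum>k<n. r ^ k) \<le> 1 / (1 - r)" .
  qed (rule assms(4))
  finally show ?thesis by simp
qed

lemma exp_quad_lower: "0 \<le> z \<Longrightarrow> 1 + z + z\<^sup>2 / 2 \<le> exp (z::real)"
  by (rule exp_lower_Taylor_quadratic)

lemma sqrt_2pi_ge: "5 / 2 \<le> sqrt (2 * pi)"
  using pi_approx by (intro real_le_rsqrt) (simp add: power2_eq_square)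

lemma mills_exp:
  assumes "x > 0" shows "exp (- x\<^sup>2 / 2) * (x / (1 + x\<^sup>2)) \<le> sqrt (2 * pi) * gtail x"
proof -
  have "std_normal_density x / x \<le> (1 + 1 / x\<^sup>2) * gtail x" by (rule mills[OF assms])
  then have "sqrt (2 * pi) * (std_normal_density x / x) \<le> sqrt (2 * pi) * ((1 + 1 / x\<^sup>2) * gtail x)"
    by (rule mult_left_mono) simp
  moreover have "sqrt (2 * pi) * (std_normal_density x / x) = exp (- x\<^sup>2 / 2) / x"
    by (simp add: std_normal_density_def)
  ultimately have "exp (- x\<^sup>2 / 2) / x \<le> (1 + 1 / x\<^sup>2) * (sqrt (2 * pi) * gtail x)" by (simp only: mult.left_commute)
  then have "(x\<^sup>2 / (1 + x\<^sup>2)) * (exp (- x\<^sup>2 / 2) / x) \<le> (x\<^sup>2 / (1 + x\<^sup>2)) * ((1 + 1 / x\<^sup>2) * (sqrt (2 * pi) * gtail x))"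
    by (rule mult_left_mono) simp
  moreover have "(x\<^sup>2 / (1 + x\<^sup>2)) * (exp (- x\<^sup>2 / 2) / x) = exp (- x\<^sup>2 / 2) * (x / (1 + x\<^sup>2))"
    using assms by (simp add: power2_eq_square)
  moreover have "(x\<^sup>2 / (1 + x\<^sup>2)) * (1 + 1 / x\<^sup>2) = 1"
  proof -
    have "1 + 1 / x\<^sup>2 = (1 + x\<^sup>2) / x\<^sup>2" using assms by (simp add: add_divide_distrib add.commute)
    moreover have "1 + x\<^sup>2 \<noteq> 0" by (smt (verit) zero_le_power2)
    ultimately show ?thesis using assms by simp
  qed
  ultimately show ?thesis by (simp only: mult.assoc[symmetric] mult_1_left)
qed

text \<open>The second assumption on \<open>x\<close> says that the bound to be proved is not trivial; it forces \<open>x\<close> to be fairly large. \<open>V j\<close> below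
is the square of \<open>(6/5)\<^sup>j\<^sup>+\<^sup>1\<close>, the grid of level \<open>j\<close> has \<open>gsize j\<close>, about half of \<open>m\<close> to the power \<open>V j\<close>, points, and the
thresholds \<open>thr\<close> are three quarters of the square root of \<open>V\<close>.\<close>

locale chain_numerics =
  fixes m :: nat and x L :: real
  assumes m: "m \<ge> 2" and L: "L = ln (real m)" and x: "x > 0"
    and b: "5 / 2 * (real m)\<^sup>2 * (sqrt (2 * pi) * gtail x) < 1"
begin

lemma L_ge: "2 / 3 \<le> L" "0 \<le> L"
proof -
  have "ln 2 \<le> ln (real m)" using m by (subst ln_le_cancel_iff) auto
  then show "2 / 3 \<le> L" using ln2_ge_two_thirds unfolding L by linarith
  then show "0 \<le> L" by simp
qed

lemma exp_L: "exp L = real m" using m by (simp add: L)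

lemma exp_2L: "exp (2 * L) = (real m)\<^sup>2"
  by (simp add: exp_double exp_L)

lemma x_ge: "165 / 100 \<le> x"
proof (rule ccontr)
  assume "\<not> 165 / 100 \<le> x"
  then have "gtail (165/100) \<le> gtail x" by (intro gtail_mono) auto
  then have "sqrt (2 * pi) * gtail (165/100) \<le> sqrt (2 * pi) * gtail x" by (rule mult_left_mono) simp
  note g = this
  have "exp (- (165/100)\<^sup>2 / 2) * (165/100 / (1 + (165/100)\<^sup>2)) \<le> sqrt (2 * pi) * gtail (165/100)"
    by (rule mills_exp) simp
  from this g have 1: "exp (- (165/100)\<^sup>2 / 2) * (165/100 / (1 + (165/100)\<^sup>2)) \<le> sqrt (2 * pi) * gtail x"
    by (rule order_trans)
  have e1: "exp (1::real) \<le> 272 / 100" using e_less_272 by simp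
  have "exp (36125/100000 :: real) \<le> 1 + 36125/100000 + (36125/100000)\<^sup>2" by (rule exp_bound) auto
  also have "\<dots> \<le> 150 / 100" by (simp add: power2_eq_square)
  finally have e2: "exp (36125/100000 :: real) \<le> 150 / 100" .
  have "exp ((165/100)\<^sup>2 / 2 :: real) = exp (1 + 36125/100000)" by (simp add: power2_eq_square)
  also have "\<dots> = exp 1 * exp (36125/100000)" by (rule exp_add)
  also have "\<dots> \<le> 272 / 100 * (150 / 100)" using e1 e2 by (intro mult_mono) auto
  finally have "1 / (408/100) \<le> 1 / exp ((165/100)\<^sup>2 / 2 :: real)" by (intro divide_left_mono) auto
  then have 2: "100/408 \<le> exp (- (165/100)\<^sup>2 / 2 :: real)" by (simp add: exp_minus inverse_eq_divide)
  have "100/408 * (165/100 / (1 + (165/100)\<^sup>2)) \<le> exp (- (165/100)\<^sup>2 / 2) * (165/100 / (1 + (165/100)\<^sup>2) :: real)"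
    using 2 by (rule mult_right_mono) simp
  with 1 have "100/408 * (165/100 / (1 + (165/100)\<^sup>2)) \<le> sqrt (2 * pi) * gtail x" by linarith
  then have 3: "1/10 \<le> sqrt (2 * pi) * gtail x" by (simp add: power2_eq_square)
  have "2 * 2 \<le> real m * real m" using m by (intro mult_mono) auto
  then have "5/2 * 4 * (1/10) \<le> 5 / 2 * (real m)\<^sup>2 * (sqrt (2 * pi) * gtail x)"
    using 3 by (intro mult_mono) (auto simp: power2_eq_square)
  then show False using b by simp
qed

lemma x_sq: "27225 / 10000 \<le> x\<^sup>2" "1 + 1 / x\<^sup>2 \<le> 13674 / 10000"
proof -
  have "(165/100)\<^sup>2 \<le> x\<^sup>2" using x_ge by (intro power_mono) auto
  then show 1: "27225 / 10000 \<le> x\<^sup>2" by (simp add: power2_eq_square)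
  then have "1 / x\<^sup>2 \<le> 1 / (27225 / 10000)" using x by (intro divide_left_mono) auto
  then show "1 + 1 / x\<^sup>2 \<le> 13674 / 10000" by simp
qed

text \<open>A nontrivial bound means that \<open>m\<^sup>2 exp (- x\<^sup>2/2)\<close> is, by Mills' ratio, at most about \<open>2/5 (x + 1/x)\<close>. As \<open>x\<^sup>2 \<le> 1 + 4L\<close>, the
right-hand side grows only like \<open>\<surd>L\<close>, which is dominated by \<open>exp (L/6)\<close>.\<close>

lemma x_sq_ge_log:
  assumes up: "x\<^sup>2 \<le> 1 + 4 * L" shows "11 / 3 * L \<le> x\<^sup>2"
proof -
  define y where "y = exp (2 * L) * exp (- x\<^sup>2 / 2)"
  have y0: "y > 0" by (simp add: y_def)
  have "5 / 2 * (real m)\<^sup>2 * (exp (- x\<^sup>2 / 2) * (x / (1 + x\<^sup>2))) \<le> 5 / 2 * (real m)\<^sup>2 * (sqrt (2 * pi) * gtail x)"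
    using mills_exp[OF x] by (intro mult_left_mono) auto
  moreover have "5 / 2 * (real m)\<^sup>2 * (exp (- x\<^sup>2 / 2) * (x / (1 + x\<^sup>2))) = y * (5 / 2 * (x / (1 + x\<^sup>2)))"
    unfolding y_def exp_2L by (simp only: mult_ac)
  ultimately have "y * (5 / 2 * (x / (1 + x\<^sup>2))) < 1" using b by linarith
  moreover have pos: "0 < 5 / 2 * (x / (1 + x\<^sup>2))" using x by (simp add: add_pos_nonneg)
  ultimately have "y < 1 / (5 / 2 * (x / (1 + x\<^sup>2)))" by (simp only: pos_less_divide_eq)
  also have "\<dots> = 2 / 5 * (x + 1 / x)" using x by (simp add: power2_eq_square add_divide_distrib)
  finally have "y\<^sup>2 \<le> (2 / 5 * (x + 1 / x))\<^sup>2" using y0 by (intro power_mono) auto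
  also have "\<dots> = 4 / 25 * (x\<^sup>2 + 2 + 1 / x\<^sup>2)"
    using x by (simp add: power2_eq_square algebra_simps)
  also have "\<dots> \<le> 4 / 25 * (1 + 4 * L + 2 + 3674/10000)" using up x_sq(2) by simp
  also have "\<dots> \<le> 1 + L / 3 + (L / 3)\<^sup>2 / 2"
  proof -
    have "0 \<le> (L - 276/100)\<^sup>2" by simp
    then show ?thesis by (simp add: power2_eq_square algebra_simps)
  qed
  also have "\<dots> \<le> exp (L / 3)" using L_ge by (intro exp_quad_lower) auto
  also have "y\<^sup>2 = exp (4 * L - x\<^sup>2)"
    by (simp add: y_def power_mult_distrib exp_double[symmetric] exp_add[symmetric])
  finally have "4 * L - x\<^sup>2 \<le> L / 3" by simp
  then show ?thesis by simp
qed

definition V :: "nat \<Rightarrow> real" where "V j = (36/25) ^ (j + 1)"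
definition gsize :: "nat \<Rightarrow> nat" where "gsize j = nat \<lceil>exp (V j * L) / 2\<rceil>"
definition thr :: "nat \<Rightarrow> real" where "thr j = 3 / 4 * (6 / 5) ^ (j + 1)"

lemma thr_sq: "(thr j)\<^sup>2 = 9 / 16 * V j"
proof -
  have "((6 / 5 :: real) ^ (j + 1))\<^sup>2 = ((6 / 5)\<^sup>2) ^ (j + 1)" by (simp only: power_mult[symmetric] mult.commute)
  also have "(6 / 5 :: real)\<^sup>2 = 36 / 25" by (simp add: power2_eq_square)
  finally show ?thesis by (simp only: thr_def V_def power_mult_distrib) (simp add: power2_eq_square)
qed

lemma thr_pos: "0 < thr j" by (simp add: thr_def)

lemma V_pos: "0 < V j" by (simp add: V_def)

lemma V_mono: "i \<le> j \<Longrightarrow> V i \<le> V j" unfolding V_def by (intro power_increasing) auto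

lemma gsize: "exp (V j * L) / 2 \<le> real (gsize j)" "real (gsize j) \<le> exp (V j * L) / 2 + 1" "1 \<le> gsize j"
proof -
  have p: "0 < exp (V j * L) / 2" by simp
  then have c: "0 < \<lceil>exp (V j * L) / 2\<rceil>" by (simp only: zero_less_ceiling)
  then have r: "real (gsize j) = of_int \<lceil>exp (V j * L) / 2\<rceil>" by (simp add: gsize_def)
  show "exp (V j * L) / 2 \<le> real (gsize j)" unfolding r by (rule le_of_int_ceiling)
  show "real (gsize j) \<le> exp (V j * L) / 2 + 1" unfolding r by linarith
  have "0 < real (gsize j)" unfolding r using c by (simp only: of_int_0_less_iff)
  then show "1 \<le> gsize j" by simp
qed

lemma exp_neg_le: "0 \<le> z \<Longrightarrow> exp (- z) \<le> 1 / (1 + z :: real)"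
proof -
  assume z: "0 \<le> z"
  have "exp (- z) = 1 / exp z" by (simp add: exp_minus inverse_eq_divide)
  also have "\<dots> \<le> 1 / (1 + z)" using z by (intro divide_left_mono) auto
  finally show ?thesis .
qed

text \<open>After scaling the tail to \<open>gtail x\<close>, the exponent left over is \<open>(V - (thr\<^sup>2 - 1) 11/6) L\<close>, in which the lower bound \<open>11/3 L\<close> for
\<open>x\<^sup>2\<close> has been used; with \<open>thr\<^sup>2 = 9/16 V\<close> it equals \<open>2L - (1/6 + V/32) L\<close>.\<close>

lemma term_bound:
  assumes up: "x\<^sup>2 \<le> 1 + 4 * L" and j: "j \<ge> 1"
    and e1: "exp (- (V j * L)) \<le> a1" and e2: "exp (- ((1 / 6 + V j / 32) * L)) \<le> a2"
  shows "real (gsize j) * gtail (thr j * x) \<le> ((1 / 2 + a1) * a2 * (13674 / 10000)) / thr j * ((real m)\<^sup>2 * gtail x)"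
proof -
  let ?t = "thr j"
  have V1: "16 / 9 \<le> V j" using V_mono[OF j] by (simp add: V_def power2_eq_square)
  then have t1: "1 \<le> ?t\<^sup>2" unfolding thr_sq by simp
  have a: "0 \<le> a1" "0 \<le> a2" using e1 e2 exp_ge_zero order_trans by blast+
  have "(1 - ?t\<^sup>2) * x\<^sup>2 / 2 \<le> (1 - ?t\<^sup>2) * (11 / 3 * L) / 2"
    using x_sq_ge_log[OF up] t1 by (intro divide_right_mono mult_left_mono_neg) auto
  then have E: "exp ((1 - ?t\<^sup>2) * x\<^sup>2 / 2) \<le> exp ((1 - ?t\<^sup>2) * (11 / 3 * L) / 2)" by simp
  have "gtail (?t * x) \<le> (1 + 1 / x\<^sup>2) / ?t * exp ((1 - ?t\<^sup>2) * x\<^sup>2 / 2) * gtail x"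
    by (rule gtail_scale[OF x thr_pos])
  also have "\<dots> \<le> (13674 / 10000) / ?t * exp ((1 - ?t\<^sup>2) * (11 / 3 * L) / 2) * gtail x"
    using x_sq(2) E thr_pos[of j] by (intro mult_right_mono mult_mono divide_right_mono) auto
  finally have g: "gtail (?t * x) \<le> (13674 / 10000) / ?t * exp ((1 - ?t\<^sup>2) * (11 / 3 * L) / 2) * gtail x" .
  have "real (gsize j) \<le> exp (V j * L) * (1 / 2 + exp (- (V j * L)))"
    using gsize(2)[of j] by (simp add: distrib_left exp_add[symmetric])
  also have "\<dots> \<le> exp (V j * L) * (1 / 2 + a1)" using e1 by (intro mult_left_mono) auto
  finally have n: "real (gsize j) \<le> exp (V j * L) * (1 / 2 + a1)" .
  have "real (gsize j) * gtail (?t * x) \<le> (exp (V j * L) * (1 / 2 + a1)) * ((13674 / 10000) / ?t * exp ((1 - ?t\<^sup>2) * (11 / 3 * L) / 2) * gtail x)"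
    using n g a by (intro mult_mono) auto
  also have "\<dots> = (1 / 2 + a1) * (exp (V j * L) * exp ((1 - ?t\<^sup>2) * (11 / 3 * L) / 2)) * (13674 / 10000) / ?t * gtail x"
    by simp
  also have "exp (V j * L) * exp ((1 - ?t\<^sup>2) * (11 / 3 * L) / 2) = exp (- ((1 / 6 + V j / 32) * L)) * exp (2 * L)"
    unfolding thr_sq by (simp only: exp_add[symmetric]) (simp add: field_simps)
  also have "(1 / 2 + a1) * (exp (- ((1 / 6 + V j / 32) * L)) * exp (2 * L)) * (13674 / 10000) / ?t * gtail x
     \<le> (1 / 2 + a1) * (a2 * exp (2 * L)) * (13674 / 10000) / ?t * gtail x"
    using e2 a thr_pos[of j] by (intro mult_right_mono divide_right_mono mult_left_mono) auto
  finally show ?thesis unfolding exp_2L by (simp add: mult_ac)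
qed

text \<open>At level \<open>0\<close> the threshold is below \<open>1\<close>, so here the upper bound for \<open>x\<^sup>2\<close> enters. Rounding the number of points up to
an integer weighs most for \<open>m = 2\<close>, which is therefore computed separately.\<close>

lemma first_term:
  assumes up: "x\<^sup>2 \<le> 1 + 4 * L"
  shows "real (gsize 0) * gtail (thr 0 * x) \<le> 1142 / 1000 * ((real m)\<^sup>2 * gtail x)"
proof -
  have V0: "V 0 = 36 / 25" and t0: "thr 0 = 9 / 10" by (simp_all add: V_def thr_def)
  have n: "real (gsize 0) * exp (- (162 / 100 * L)) \<le> 68 / 100"
  proof (cases "m = 2")
    case True
    have "exp (V 0 * L) / 2 \<le> 2"
    proof -
      have "exp (V 0 * L) \<le> exp (2 * L)" unfolding V0 using L_ge by simp
      also have "\<dots> = 4" unfolding exp_2L True by simp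
      finally show ?thesis by simp
    qed
    then have "\<lceil>exp (V 0 * L) / 2\<rceil> \<le> 2" by (simp add: ceiling_le_iff)
    then have "gsize 0 \<le> 2" by (simp add: gsize_def)
    then have "real (gsize 0) * exp (- (162 / 100 * L)) \<le> 2 * exp (- (162 / 100 * L))" by (intro mult_right_mono) auto
    also have "2 * exp (- (162 / 100 * L)) = exp (- (62 / 100 * L))"
    proof -
      have "2 = exp L" using exp_L True by simp
      then have "2 * exp (- (162 / 100 * L)) = exp L * exp (- (162 / 100 * L))" by simp
      also have "\<dots> = exp (- (62 / 100 * L))" by (simp add: exp_add[symmetric])
      finally show ?thesis .
    qed
    also have "\<dots> \<le> exp (- (124 / 300))" using L_ge by simp
    also have "\<dots> = 1 / exp (124 / 300)" by (simp add: exp_minus inverse_eq_divide)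
    also have "\<dots> \<le> 1 / (1 + 124 / 300 + (124 / 300)\<^sup>2 / 2)"
      using exp_quad_lower[of "124/300"] by (intro divide_left_mono) (auto intro!: mult_pos_pos add_pos_nonneg)
    also have "\<dots> \<le> 68 / 100" by (simp add: power2_eq_square)
    finally show ?thesis .
  next
    case False
    then have m3: "real m \<ge> 3" using m by simp
    have "1 \<le> ln (3::real)" using exp_le by (subst ln_ge_iff) auto
    also have "ln 3 \<le> L" unfolding L using m3 by (subst ln_le_cancel_iff) auto
    finally have L1: "1 \<le> L" .
    have "real (gsize 0) * exp (- (162 / 100 * L)) \<le> (exp (V 0 * L) / 2 + 1) * exp (- (162 / 100 * L))"
      using gsize(2) by (intro mult_right_mono) auto
    also have "\<dots> = exp (- (18 / 100 * L)) / 2 + exp (- (162 / 100 * L))"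
    proof -
      have "exp (V 0 * L) * exp (- (162 / 100 * L)) = exp (- (18 / 100 * L))"
        unfolding V0 by (simp add: exp_add[symmetric])
      then show ?thesis by (simp add: distrib_right)
    qed
    also have "\<dots> \<le> (1 / (1 + 18 / 100)) / 2 + 1 / (1 + 162 / 100 + (162 / 100)\<^sup>2 / 2)"
    proof (intro add_mono divide_right_mono)
      have "exp (- (18 / 100 * L)) \<le> exp (- (18 / 100))" using L1 by simp
      also have "\<dots> \<le> 1 / (1 + 18 / 100)" by (rule exp_neg_le) simp
      finally show "exp (- (18 / 100 * L)) \<le> 1 / (1 + 18 / 100)" .
      have "exp (- (162 / 100 * L)) \<le> exp (- (162 / 100))" using L1 by simp
      also have "\<dots> = 1 / exp (162 / 100)" by (simp add: exp_minus inverse_eq_divide)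
      also have "\<dots> \<le> 1 / (1 + 162 / 100 + (162 / 100)\<^sup>2 / 2)"
        using exp_quad_lower[of "162/100"] by (intro divide_left_mono) (auto intro!: mult_pos_pos add_pos_nonneg)
      finally show "exp (- (162 / 100 * L)) \<le> 1 / (1 + 162 / 100 + (162 / 100)\<^sup>2 / 2)" .
    qed simp
    also have "\<dots> \<le> 68 / 100" by (simp add: power2_eq_square)
    finally show ?thesis .
  qed
  have e: "exp (95 / 1000 :: real) \<le> 1105 / 1000"
  proof -
    have "exp (95 / 1000 :: real) \<le> 1 + 95 / 1000 + (95 / 1000)\<^sup>2" by (rule exp_bound) auto
    also have "\<dots> \<le> 1105 / 1000" by (simp add: power2_eq_square)
    finally show ?thesis .
  qed
  have "(1 - (thr 0)\<^sup>2) * x\<^sup>2 / 2 \<le> 95 / 1000 + 38 / 100 * L"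
    unfolding t0 using up by (simp add: power2_eq_square)
  then have E: "exp ((1 - (thr 0)\<^sup>2) * x\<^sup>2 / 2) \<le> exp (95 / 1000) * exp (38 / 100 * L)"
    by (simp only: exp_add[symmetric] exp_le_cancel_iff)
  also have "\<dots> \<le> 1105 / 1000 * exp (38 / 100 * L)" using e by (intro mult_right_mono) auto
  finally have E: "exp ((1 - (thr 0)\<^sup>2) * x\<^sup>2 / 2) \<le> 1105 / 1000 * exp (38 / 100 * L)" .
  have "gtail (thr 0 * x) \<le> (1 + 1 / x\<^sup>2) / thr 0 * exp ((1 - (thr 0)\<^sup>2) * x\<^sup>2 / 2) * gtail x"
    by (rule gtail_scale[OF x thr_pos])
  also have "\<dots> \<le> (13674 / 10000) / (9 / 10) * (1105 / 1000 * exp (38 / 100 * L)) * gtail x"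
    using x_sq(2) E unfolding t0 by (intro mult_right_mono mult_mono divide_right_mono) auto
  finally have "real (gsize 0) * gtail (thr 0 * x) \<le> real (gsize 0) * ((13674 / 10000) / (9 / 10) * (1105 / 1000 * exp (38 / 100 * L)) * gtail x)"
    by (rule mult_left_mono) simp
  also have "exp (38 / 100 * L) = exp (- (162 / 100 * L)) * exp (2 * L)" by (simp add: exp_add[symmetric])
  also have "real (gsize 0) * ((13674 / 10000) / (9 / 10) * (1105 / 1000 * (exp (- (162 / 100 * L)) * exp (2 * L))) * gtail x)
     = (real (gsize 0) * exp (- (162 / 100 * L))) * ((13674 / 10000) / (9 / 10) * (1105 / 1000) * (exp (2 * L) * gtail x))"
    by simp
  also have "\<dots> \<le> 68 / 100 * ((13674 / 10000) / (9 / 10) * (1105 / 1000) * (exp (2 * L) * gtail x))"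
    using n by (intro mult_right_mono) auto
  also have "\<dots> \<le> 1142 / 1000 * (exp (2 * L) * gtail x)"
    by (simp add: mult_right_mono)
  finally show ?thesis unfolding exp_2L by simp
qed

lemma even_chain_sum:
  assumes up: "x\<^sup>2 \<le> 1 + 4 * L"
  shows "(\<Sum>k<n. real (gsize (2 * k)) * gtail (thr (2 * k) * x)) \<le> 3 * ((real m)\<^sup>2 * gtail x)"
proof -
  let ?g = "(real m)\<^sup>2 * gtail x"
  have g0: "0 \<le> ?g" by simp
  have V2: "298 / 100 \<le> V j" if "j \<ge> 2" for j
    using V_mono[OF that] by (simp add: V_def eval_nat_numeral)
  have t: "real (gsize (2 * Suc k)) * gtail (thr (2 * Suc k) * x) \<le> (5668 / 10000 * ?g) * (25 / 36) ^ k" for k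
  proof -
    have V: "298 / 100 \<le> V (2 * Suc k)" by (rule V2) simp
    have ln2: "ln 2 \<le> (1::real)" using ln2_le_25_over_36 by simp
    have "298 / 100 * ln 2 \<le> V (2 * Suc k) * L"
      unfolding L using V m by (intro mult_mono ln_mono) auto
    then have "exp (- (V (2 * Suc k) * L)) \<le> exp (- (298 / 100 * ln 2))" by simp
    also have "\<dots> = exp (- (3 * ln 2)) * exp (2 / 100 * ln 2)" by (simp add: exp_add[symmetric])
    also have "exp (- (3 * ln 2)) = (1 / 8 :: real)"
    proof -
      have "exp (3 * ln 2) = (2::real) ^ 3" using exp_of_nat_mult[of 3 "ln (2::real)"] by simp
      then show ?thesis by (simp add: exp_minus)
    qed
    also have "exp (2 / 100 * ln 2) \<le> (1 + 2 / 100 + (2 / 100)\<^sup>2 :: real)"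
    proof -
      have "exp (2 / 100 * ln 2) \<le> exp (2 / 100 :: real)" using ln2 by simp
      also have "\<dots> \<le> 1 + 2 / 100 + (2 / 100)\<^sup>2" by (rule exp_bound) auto
      finally show ?thesis .
    qed
    finally have e1: "exp (- (V (2 * Suc k) * L)) \<le> 13 / 100" by (simp add: power2_eq_square)
    have "17319 / 100000 \<le> (1 / 6 + V (2 * Suc k) / 32) * L"
    proof -
      have "(1 / 6 + 298 / 100 / 32) * (2 / 3) \<le> (1 / 6 + V (2 * Suc k) / 32) * L"
        using V L_ge by (intro mult_mono) auto
      then show ?thesis by simp
    qed
    then have "exp (- ((1 / 6 + V (2 * Suc k) / 32) * L)) \<le> exp (- (17319 / 100000))" by simp
    also have "\<dots> \<le> 1 / (1 + 17319 / 100000)" by (rule exp_neg_le) simp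
    also have "\<dots> \<le> 8524 / 10000" by simp
    finally have e2: "exp (- ((1 / 6 + V (2 * Suc k) / 32) * L)) \<le> 8524 / 10000" .
    have tt: "thr (2 * Suc k) = 1296 / 1000 * (36 / 25) ^ k"
    proof -
      have "thr (2 * Suc k) = 3 / 4 * ((6 / 5) ^ 3 * (6 / 5) ^ (2 * k))" by (simp add: thr_def eval_nat_numeral)
      also have "(6 / 5 :: real) ^ (2 * k) = (36 / 25) ^ k" by (simp add: power_mult power2_eq_square)
      finally show ?thesis by (simp add: eval_nat_numeral)
    qed
    have "real (gsize (2 * Suc k)) * gtail (thr (2 * Suc k) * x)
      \<le> ((1 / 2 + 13 / 100) * (8524 / 10000) * (13674 / 10000)) / thr (2 * Suc k) * ?g"
      by (rule term_bound[OF up _ e1 e2]) simp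
    also have "\<dots> = (((1 / 2 + 13 / 100) * (8524 / 10000) * (13674 / 10000)) / (1296 / 1000)) * ((25 / 36) ^ k * ?g)"
      unfolding tt by (simp add: power_divide)
    also have "\<dots> \<le> 5668 / 10000 * ((25 / 36) ^ k * ?g)" using g0 by (intro mult_right_mono) auto
    finally show ?thesis by (simp add: mult_ac)
  qed
  have S: "(\<Sum>k<n. real (gsize (2 * Suc k)) * gtail (thr (2 * Suc k) * x)) \<le> (5668 / 10000 * ?g) / (1 - 25 / 36)" for n
    using g0 by (intro geom_sum_le t) auto
  show ?thesis
  proof (cases n)
    case 0 then show ?thesis by simp
  next
    case (Suc n')
    have "(\<Sum>k<n. real (gsize (2 * k)) * gtail (thr (2 * k) * x)) = real (gsize 0) * gtail (thr 0 * x) + (\<Sum>k<n'. real (gsize (2 * Suc k)) * gtail (thr (2 * Suc k) * x))"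
      unfolding Suc by (subst sum.lessThan_Suc_shift) simp
    also have "\<dots> \<le> 1142 / 1000 * ?g + (5668 / 10000 * ?g) / (1 - 25 / 36)"
      by (intro add_mono first_term[OF up] S)
    also have "\<dots> \<le> 3 * ?g" using g0 by simp
    finally show ?thesis .
  qed
qed

lemma odd_chain_sum:
  assumes up: "x\<^sup>2 \<le> 1 + 4 * L"
  shows "(\<Sum>k<n. real (gsize (2 * k + 1)) * gtail (thr (2 * k + 1) * x)) \<le> 3 * ((real m)\<^sup>2 * gtail x)"
proof -
  let ?g = "(real m)\<^sup>2 * gtail x"
  have g0: "0 \<le> ?g" by simp
  have t: "real (gsize (2 * k + 1)) * gtail (thr (2 * k + 1) * x) \<le> (855 / 1000 * ?g) * (25 / 36) ^ k" for k
  proof -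
    have "V 1 \<le> V (2 * k + 1)" by (rule V_mono) simp
    moreover have "2 \<le> V 1" by (simp add: V_def power2_eq_square)
    ultimately have V: "2 \<le> V (2 * k + 1)" by (rule order_trans[rotated])
    have "exp (- (V (2 * k + 1) * L)) \<le> exp (- (2 * L))" using V L_ge by (simp add: mult_right_mono)
    also have "\<dots> = 1 / (real m)\<^sup>2" by (simp add: exp_minus exp_2L inverse_eq_divide)
    also have "\<dots> \<le> 1 / 2\<^sup>2" using m by (intro divide_left_mono power_mono) auto
    finally have e1: "exp (- (V (2 * k + 1) * L)) \<le> 1 / 4" by simp
    have "1 / 9 \<le> (1 / 6 + V (2 * k + 1) / 32) * L"
    proof -
      have "(1 / 6) * (2 / 3) \<le> (1 / 6 + V (2 * k + 1) / 32) * L"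
        using V L_ge by (intro mult_mono) auto
      then show ?thesis by simp
    qed
    then have "exp (- ((1 / 6 + V (2 * k + 1) / 32) * L)) \<le> exp (- (1 / 9))" by simp
    also have "\<dots> \<le> 1 / (1 + 1 / 9)" by (rule exp_neg_le) simp
    finally have e2: "exp (- ((1 / 6 + V (2 * k + 1) / 32) * L)) \<le> 9 / 10" by simp
    have tt: "thr (2 * k + 1) = 108 / 100 * (36 / 25) ^ k"
    proof -
      have "thr (2 * k + 1) = 3 / 4 * ((6 / 5) ^ 2 * (6 / 5) ^ (2 * k))" by (simp add: thr_def eval_nat_numeral)
      also have "(6 / 5 :: real) ^ (2 * k) = (36 / 25) ^ k" by (simp add: power_mult power2_eq_square)
      finally show ?thesis by (simp add: eval_nat_numeral)
    qed
    have "real (gsize (2 * k + 1)) * gtail (thr (2 * k + 1) * x)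
      \<le> ((1 / 2 + 1 / 4) * (9 / 10) * (13674 / 10000)) / thr (2 * k + 1) * ?g"
      by (rule term_bound[OF up _ e1 e2]) simp
    also have "\<dots> = (((1 / 2 + 1 / 4) * (9 / 10) * (13674 / 10000)) / (108 / 100)) * ((25 / 36) ^ k * ?g)"
      unfolding tt by (simp add: power_divide)
    also have "\<dots> \<le> 855 / 1000 * ((25 / 36) ^ k * ?g)" using g0 by (intro mult_right_mono) auto
    finally show ?thesis by (simp add: mult_ac)
  qed
  have "(\<Sum>k<n. real (gsize (2 * k + 1)) * gtail (thr (2 * k + 1) * x)) \<le> (855 / 1000 * ?g) / (1 - 25 / 36)"
    using g0 by (intro geom_sum_le t) auto
  also have "\<dots> \<le> 3 * ?g" using g0 by simp
  finally show ?thesis .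
qed

text \<open>Since \<open>x\<^sup>2 \<ge> 1 + 4L\<close>, the growth \<open>exp (2\<^sup>k\<^sup>+\<^sup>1 L)\<close> of the grids is compensated by the decay of the tails, and the factor \<open>1/\<surd>2\<close>
per level from the Mills ratio makes the sum geometric.\<close>

lemma dyadic_chain_sum:
  assumes lo: "1 + 4 * L \<le> x\<^sup>2"
  shows "(\<Sum>k<n. real (m ^ (2 ^ (k + 1))) * gtail (sqrt 2 ^ k * x)) \<le> 3 * ((real m)\<^sup>2 * gtail x)"
proof -
  let ?g = "(real m)\<^sup>2 * gtail x"
  have g0: "0 \<le> ?g" by simp
  define r where "r = 1 / sqrt 2"
  have "sqrt 2 \<ge> 14142 / 10000" by (rule real_le_rsqrt) (simp add: power2_eq_square)
  then have "1 / sqrt 2 \<le> 1 / (14142 / 10000)" by (intro divide_left_mono) auto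
  then have r: "0 \<le> r" "r \<le> 70712 / 100000" by (auto simp: r_def)
  have xx: "366 / 100 \<le> x\<^sup>2" using lo L_ge by simp
  then have "1 / x\<^sup>2 \<le> 1 / (366 / 100)" using x by (intro divide_left_mono) auto
  then have x1: "1 + 1 / x\<^sup>2 \<le> 12733 / 10000" by simp
  have t: "real (m ^ (2 ^ (Suc k + 1))) * gtail (sqrt 2 ^ Suc k * x) \<le> (7836 / 10000 * r * ?g) * r ^ k" for k
  proof -
    let ?k = "Suc k"
    have "(sqrt 2 ^ ?k)\<^sup>2 = ((sqrt 2)\<^sup>2) ^ ?k" by (simp only: power_mult[symmetric] mult.commute)
    then have sq: "(sqrt 2 ^ ?k)\<^sup>2 = 2 ^ ?k" by simp
    have two: "2 \<le> (2::real) ^ ?k" by simp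
    then have neg: "1 - (2::real) ^ ?k \<le> 0" by linarith
    have "(1 - 2 ^ ?k) * x\<^sup>2 / 2 \<le> (1 - 2 ^ ?k) * (1 + 4 * L) / 2"
      by (intro divide_right_mono mult_left_mono_neg lo neg) simp
    also have "\<dots> = (1 - 2 ^ ?k) * (1 / 2) + 2 * L - 2 ^ ?k * (2 * L)" by (simp add: field_simps)
    also have "\<dots> \<le> - (1 / 2) + 2 * L - 2 ^ ?k * (2 * L)" using two by simp
    finally have E: "exp ((1 - 2 ^ ?k) * x\<^sup>2 / 2) \<le> exp (- (1 / 2) + 2 * L - 2 ^ ?k * (2 * L))" by simp
    have mm: "real (m ^ (2 ^ (?k + 1))) = exp (2 ^ ?k * (2 * L))"
    proof -
      have "exp (2 ^ ?k * (2 * L)) = exp (real (2 ^ (?k + 1)) * L)" by (simp add: mult_ac)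
      also have "\<dots> = exp L ^ (2 ^ (?k + 1))" by (rule exp_of_nat_mult)
      finally show ?thesis by (simp add: exp_L)
    qed
    have "gtail (sqrt 2 ^ ?k * x) \<le> (1 + 1 / x\<^sup>2) / sqrt 2 ^ ?k * exp ((1 - (sqrt 2 ^ ?k)\<^sup>2) * x\<^sup>2 / 2) * gtail x"
      by (rule gtail_scale[OF x]) simp
    also have "\<dots> \<le> (12733 / 10000) / sqrt 2 ^ ?k * exp (- (1 / 2) + 2 * L - 2 ^ ?k * (2 * L)) * gtail x"
      unfolding sq using x1 E by (intro mult_right_mono mult_mono divide_right_mono) auto
    finally have "real (m ^ (2 ^ (?k + 1))) * gtail (sqrt 2 ^ ?k * x) \<le> exp (2 ^ ?k * (2 * L)) * ((12733 / 10000) / sqrt 2 ^ ?k * exp (- (1 / 2) + 2 * L - 2 ^ ?k * (2 * L)) * gtail x)"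
      unfolding mm by (rule mult_left_mono) simp
    also have "\<dots> = (12733 / 10000) * (1 / sqrt 2 ^ ?k) * (exp (2 ^ ?k * (2 * L)) * exp (- (1 / 2) + 2 * L - 2 ^ ?k * (2 * L))) * gtail x"
      by simp
    also have "exp (2 ^ ?k * (2 * L)) * exp (- (1 / 2) + 2 * L - 2 ^ ?k * (2 * L)) = exp (- (1 / 2)) * exp (2 * L)"
      by (simp only: exp_add[symmetric]) simp
    also have "1 / sqrt 2 ^ ?k = r * r ^ k" by (simp add: r_def power_one_over)
    also have "(12733 / 10000) * (r * r ^ k) * (exp (- (1 / 2)) * exp (2 * L)) * gtail x
       = ((12733 / 10000) * exp (- (1 / 2))) * (r * ?g * r ^ k)" unfolding exp_2L by simp
    also have "\<dots> \<le> 7836 / 10000 * (r * ?g * r ^ k)"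
    proof (rule mult_right_mono)
      have "exp (- (1 / 2) :: real) = 1 / exp (1 / 2)" by (simp add: exp_minus inverse_eq_divide)
      also have "\<dots> \<le> 1 / (1 + 1 / 2 + (1 / 2)\<^sup>2 / 2)"
        using exp_quad_lower[of "1/2"] by (intro divide_left_mono) (auto intro!: mult_pos_pos add_pos_nonneg)
      also have "\<dots> = 8 / 13" by (simp add: power2_eq_square)
      finally show "(12733 / 10000) * exp (- (1 / 2)) \<le> (7836 / 10000 :: real)" by simp
    qed (use r g0 in auto)
    finally show ?thesis by (simp only: mult_ac)
  qed
  have S: "(\<Sum>k<n. real (m ^ (2 ^ (Suc k + 1))) * gtail (sqrt 2 ^ Suc k * x)) \<le> 2 * ?g" for n
  proof -
    have "(\<Sum>k<n. real (m ^ (2 ^ (Suc k + 1))) * gtail (sqrt 2 ^ Suc k * x)) \<le> (7836 / 10000 * r * ?g) / (1 - r)"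
      using g0 r by (intro geom_sum_le t) auto
    also have "\<dots> \<le> (7836 / 10000 * (70712 / 100000) * ?g) / (1 - 70712 / 100000)"
      using r g0 by (intro frac_le mult_right_mono mult_left_mono mult_nonneg_nonneg) auto
    also have "\<dots> \<le> 2 * ?g" using g0 by simp
    finally show ?thesis .
  qed
  show ?thesis
  proof (cases n)
    case 0 then show ?thesis by simp
  next
    case (Suc n')
    have "(\<Sum>k<n. real (m ^ (2 ^ (k + 1))) * gtail (sqrt 2 ^ k * x)) = ?g + (\<Sum>k<n'. real (m ^ (2 ^ (Suc k + 1))) * gtail (sqrt 2 ^ Suc k * x))"
      unfolding Suc by (subst sum.lessThan_Suc_shift) (simp del: power_Suc)
    also have "\<dots> \<le> ?g + 2 * ?g" by (intro add_left_mono S)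
    also have "?g + 2 * ?g = 3 * ?g" by simp
    finally show ?thesis .
  qed
qed

end

section \<open>Tail bound for the supremum of the absolute value\<close>

definition osc :: "(real \<Rightarrow> real \<Rightarrow> real) \<Rightarrow> real \<Rightarrow> ennreal" where
  "osc q h = (SUP (s, t)\<in>{(s, t). s \<in> {0..1} \<and> t \<in> {0..1} \<and> \<bar>s - t\<bar> \<le> h}. ennreal (sqrt (q s t)))"

definition chain_const :: "(real \<Rightarrow> real \<Rightarrow> real) \<Rightarrow> nat \<Rightarrow> ennreal" where
  "chain_const q m =
     (SUP (s, t)\<in>{0..1} \<times> {0..1}. ennreal (sqrt (q s t))) +
     ennreal (2 + sqrt 2) *
       (\<integral>\<^sup>+x\<in>{1..}.
          (SUP (s, t)\<in>{(s, t). s \<in> {0..1} \<and> t \<in> {0..1} \<and> \<bar>s - t\<bar> < real m powr (- (x\<^sup>2))}.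
             ennreal (sqrt (q s t))) \<partial>lborel)"

text \<open>A lower Riemann sum: on \<open>[v\<^sub>k, v\<^sub>k\<^sub>+\<^sub>1)\<close> the integrand is at least the oscillation at the scale \<open>h\<^sub>k\<close>.\<close>

lemma osc_sum_le:
  fixes v h :: "nat \<Rightarrow> real"
  assumes m: "m \<ge> 2" and v0: "v 0 = 1" and v: "\<And>k. v k \<le> v (Suc k)"
    and h: "\<And>k. h k \<le> real m powr (- ((v (Suc k))\<^sup>2))"
  shows "(\<Sum>k<n. ennreal (v (Suc k) - v k) * osc q (h k)) \<le> (\<integral>\<^sup>+x\<in>{1..}.
          (SUP (s, t)\<in>{(s, t). s \<in> {0..1} \<and> t \<in> {0..1} \<and> \<bar>s - t\<bar> < real m powr (- (x\<^sup>2))}.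
             ennreal (sqrt (q s t))) \<partial>lborel)"
proof -
  have mono: "v i \<le> v j" if "i \<le> j" for i j using lift_Suc_mono_le[of v] v that by blast
  have v1: "1 \<le> v k" for k using mono[of 0 k] v0 by simp
  have "(\<Sum>k<n. ennreal (v (Suc k) - v k) * osc q (h k)) = (\<Sum>k<n. osc q (h k) * emeasure lborel {v k..<v (Suc k)})"
    using v by (intro sum.cong) (simp_all add: mult.commute)
  also have "\<dots> = (\<Sum>k<n. \<integral>\<^sup>+u. osc q (h k) * indicator {v k..<v (Suc k)} u \<partial>lborel)"
    by (intro sum.cong refl nn_integral_cmult_indicator[symmetric]) simp
  also have "\<dots> = (\<integral>\<^sup>+u. (\<Sum>k<n. osc q (h k) * indicator {v k..<v (Suc k)} u) \<partial>lborel)"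
    by (intro nn_integral_sum[symmetric]) simp
  also have "\<dots> \<le> (\<integral>\<^sup>+x\<in>{1..}.
          (SUP (s, t)\<in>{(s, t). s \<in> {0..1} \<and> t \<in> {0..1} \<and> \<bar>s - t\<bar> < real m powr (- (x\<^sup>2))}.
             ennreal (sqrt (q s t))) \<partial>lborel)"
  proof (rule nn_integral_mono)
    fix u :: real
    let ?D = "(SUP (s, t)\<in>{(s, t). s \<in> {0..1} \<and> t \<in> {0..1} \<and> \<bar>s - t\<bar> < real m powr (- (u\<^sup>2))}. ennreal (sqrt (q s t)))"
    show "(\<Sum>k<n. osc q (h k) * indicator {v k..<v (Suc k)} u) \<le> ?D * indicator {1..} u"
    proof (cases "\<exists>k<n. u \<in> {v k..<v (Suc k)}")
      case False
      then have "(\<Sum>k<n. osc q (h k) * indicator {v k..<v (Suc k)} u) = 0" by (intro sum.neutral) auto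
      then show ?thesis by simp
    next
      case True
      then obtain k0 where k0: "k0 < n" "u \<in> {v k0..<v (Suc k0)}" by blast
      have "u \<notin> {v k..<v (Suc k)}" if "k \<noteq> k0" for k
      proof (cases "k < k0")
        case True
        then have "v (Suc k) \<le> v k0" by (intro mono) simp
        then show ?thesis using k0 by auto
      next
        case False
        then have "v (Suc k0) \<le> v k" using that by (intro mono) simp
        then show ?thesis using k0 by auto
      qed
      then have "(\<Sum>k<n. osc q (h k) * indicator {v k..<v (Suc k)} u) = (\<Sum>k<n. if k = k0 then osc q (h k0) else 0)"
        using k0(2) by (intro sum.cong) auto
      also have "\<dots> = osc q (h k0)" using k0(1) by simp
      also have "\<dots> \<le> ?D"
        unfolding osc_def
      proof (rule SUP_subset_mono)
        have "u\<^sup>2 < (v (Suc k0))\<^sup>2" using k0(2) v1[of k0] by (intro power_strict_mono) auto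
        then have "real m powr (- ((v (Suc k0))\<^sup>2)) < real m powr (- (u\<^sup>2))" using m by (intro powr_less_mono) auto
        then have "h k0 < real m powr (- (u\<^sup>2))" using h[of k0] by linarith
        then show "{(s, t). s \<in> {0..1} \<and> t \<in> {0..1} \<and> \<bar>s - t\<bar> \<le> h k0} \<subseteq> {(s, t). s \<in> {0..1} \<and> t \<in> {0..1} \<and> \<bar>s - t\<bar> < real m powr (- (u\<^sup>2))}"
          by auto
      qed simp
      finally show ?thesis using k0(2) v1[of k0] by simp
    qed
  qed
  finally show ?thesis .
qed

locale gauss_chain = prob_space M for M :: "'a measure" +
  fixes Y :: "real \<Rightarrow> 'a \<Rightarrow> real" and q :: "real \<Rightarrow> real \<Rightarrow> real" and m :: nat
  assumes inc: "\<And>s t. s \<in> {0..1} \<Longrightarrow> t \<in> {0..1} \<Longrightarrow> cgauss M (\<lambda>\<omega>. Y t \<omega> - Y s \<omega>) (q s t)"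
    and pt: "\<And>t. t \<in> {0..1} \<Longrightarrow> cgauss M (Y t) (q 0 t)"
    and m: "m \<ge> 2" and fin: "chain_const q m < \<infinity>"
begin

definition c :: real where "c = enn2real (chain_const q m)"
definition \<sigma> :: real where "\<sigma> = enn2real (SUP (s, t)\<in>{0..1} \<times> {0..1}. ennreal (sqrt (q s t)))"
definition d :: "real \<Rightarrow> real" where "d h = enn2real (osc q h)"

lemma sup_fin: "(SUP (s, t)\<in>{0..1} \<times> {0..1}. ennreal (sqrt (q s t))) < \<infinity>"
  using fin by (simp add: chain_const_def less_top[symmetric])

lemma osc_fin: "osc q h < \<infinity>"
proof -
  have "osc q h \<le> (SUP (s, t)\<in>{0..1} \<times> {0..1}. ennreal (sqrt (q s t)))"
    unfolding osc_def by (rule SUP_subset_mono) auto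
  then show ?thesis using sup_fin by (rule le_less_trans)
qed

lemma c_nonneg: "0 \<le> c" and \<sigma>_nonneg: "0 \<le> \<sigma>" and d_nonneg: "0 \<le> d h"
  by (simp_all add: c_def \<sigma>_def d_def)

lemma q_le_\<sigma>: assumes "s \<in> {0..1}" "t \<in> {0..1}" shows "q s t \<le> \<sigma>\<^sup>2"
proof (rule sqrt_le_D)
  have "ennreal (sqrt (q s t)) \<le> (SUP (s, t)\<in>{0..1} \<times> {0..1}. ennreal (sqrt (q s t)))"
    using assms by (intro SUP_upper2[of "(s, t)"]) auto
  also have "\<dots> = ennreal \<sigma>" unfolding \<sigma>_def using sup_fin by simp
  finally show "sqrt (q s t) \<le> \<sigma>" using \<sigma>_nonneg by simp
qed

lemma q_le_d: assumes "s \<in> {0..1}" "t \<in> {0..1}" "\<bar>s - t\<bar> \<le> h" shows "q s t \<le> (d h)\<^sup>2"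
proof (rule sqrt_le_D)
  have "ennreal (sqrt (q s t)) \<le> osc q h"
    unfolding osc_def using assms by (intro SUP_upper2[of "(s, t)"]) auto
  also have "\<dots> = ennreal (d h)" unfolding d_def using osc_fin[of h] by simp
  finally show "sqrt (q s t) \<le> d h" using d_nonneg[of h] by simp
qed

lemma sum_d_le_c:
  fixes v h :: "nat \<Rightarrow> real"
  assumes v0: "v 0 = 1" and v: "\<And>k. v k \<le> v (Suc k)"
    and h: "\<And>k. h k \<le> real m powr (- ((v (Suc k))\<^sup>2))"
  shows "\<sigma> + (2 + sqrt 2) * (\<Sum>k<n. (v (Suc k) - v k) * d (h k)) \<le> c"
proof -
  have "ennreal (\<Sum>k<n. (v (Suc k) - v k) * d (h k)) = (\<Sum>k<n. ennreal ((v (Suc k) - v k) * d (h k)))"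
    using v d_nonneg by (intro sum_ennreal[symmetric]) auto
  also have "\<dots> = (\<Sum>k<n. ennreal (v (Suc k) - v k) * osc q (h k))"
    using v osc_fin by (intro sum.cong refl) (simp add: ennreal_mult d_def)
  also note osc_sum_le[OF m v0 v h]
  finally have J: "ennreal (\<Sum>k<n. (v (Suc k) - v k) * d (h k)) \<le> (\<integral>\<^sup>+x\<in>{1..}.
          (SUP (s, t)\<in>{(s, t). s \<in> {0..1} \<and> t \<in> {0..1} \<and> \<bar>s - t\<bar> < real m powr (- (x\<^sup>2))}.
             ennreal (sqrt (q s t))) \<partial>lborel)" .
  have S0: "0 \<le> (\<Sum>k<n. (v (Suc k) - v k) * d (h k))" using v d_nonneg by (intro sum_nonneg) auto
  have "ennreal (\<sigma> + (2 + sqrt 2) * (\<Sum>k<n. (v (Suc k) - v k) * d (h k)))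
     = ennreal \<sigma> + ennreal (2 + sqrt 2) * ennreal (\<Sum>k<n. (v (Suc k) - v k) * d (h k))"
    using S0 \<sigma>_nonneg by (simp add: ennreal_mult ennreal_plus)
  also have "ennreal \<sigma> = (SUP (s, t)\<in>{0..1} \<times> {0..1}. ennreal (sqrt (q s t)))" unfolding \<sigma>_def using sup_fin by simp
  also have "(SUP (s, t)\<in>{0..1} \<times> {0..1}. ennreal (sqrt (q s t))) + ennreal (2 + sqrt 2) * ennreal (\<Sum>k<n. (v (Suc k) - v k) * d (h k)) \<le> chain_const q m"
    unfolding chain_const_def by (intro add_left_mono mult_left_mono J) simp
  also have "chain_const q m = ennreal c" unfolding c_def using fin by simp
  finally show ?thesis using c_nonneg by simp
qed

text \<open>Both signs together double the sum of the tails, and \<open>2 * 3 \<le> 5/2 \<surd>(2\<pi>)\<close>: this is where the constant \<open>5/2\<close> is spent.\<close>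

lemma chain_prob:
  fixes N :: "nat \<Rightarrow> nat" and \<tau> :: "nat \<Rightarrow> real"
  assumes N: "\<And>k. N k \<ge> 1" and \<tau>: "\<And>k. \<tau> k \<ge> 0" and x: "x > 0"
    and th: "\<And>n. \<tau> 0 * \<sigma> + (\<Sum>k<n. \<tau> (Suc k) * d (1 / (2 * real (N k)))) \<le> c"
    and sum: "\<And>n. (\<Sum>k<n. real (N k) * gtail (\<tau> k * x)) \<le> 3 * ((real m)\<^sup>2 * gtail x)"
  shows "\<P>(\<omega> in M. \<exists>t\<in>mgrid (N n). \<bar>Y t \<omega>\<bar> > x * c) \<le> 5 / 2 * (real m)\<^sup>2 * (sqrt (2 * pi) * gtail x)"
proof -
  let ?T = "x * (\<tau> 0 * \<sigma> + (\<Sum>k<n. \<tau> (Suc k) * d (1 / (2 * real (N k)))))"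
  have Ym: "Y t \<in> borel_measurable M" if "t \<in> {0..1}" for t using pt[OF that] by (simp add: cgauss_def)
  have T: "?T \<le> x * c" using th x by (intro mult_left_mono) auto
  have "\<P>(\<omega> in M. \<exists>t\<in>mgrid (N n). \<bar>Y t \<omega>\<bar> > x * c) \<le> \<P>(\<omega> in M. \<exists>t\<in>mgrid (N n). \<bar>Y t \<omega>\<bar> > ?T)"
  proof (rule finite_measure_mono)
    show "{\<omega> \<in> space M. \<exists>t\<in>mgrid (N n). \<bar>Y t \<omega>\<bar> > x * c} \<subseteq> {\<omega> \<in> space M. \<exists>t\<in>mgrid (N n). \<bar>Y t \<omega>\<bar> > ?T}"
      using T by force
    have "{\<omega> \<in> space M. \<exists>t\<in>mgrid (N n). \<bar>Y t \<omega>\<bar> > ?T} = (\<Union>t\<in>mgrid (N n). {\<omega> \<in> space M. \<bar>Y t \<omega>\<bar> > ?T})" by auto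
    also have "\<dots> \<in> sets M"
    proof (rule sets.finite_UN[OF mgrid(1)])
      fix t assume "t \<in> mgrid (N n)"
      then have [measurable]: "Y t \<in> borel_measurable M" using mgrid(3) by (intro Ym) blast
      show "{\<omega> \<in> space M. \<bar>Y t \<omega>\<bar> > ?T} \<in> sets M" by measurable
    qed
    finally show "{\<omega> \<in> space M. \<exists>t\<in>mgrid (N n). \<bar>Y t \<omega>\<bar> > ?T} \<in> sets M" .
  qed
  also have "\<dots> \<le> (\<Sum>k\<le>n. 2 * real (N k) * gtail (\<tau> k * x))"
    using \<sigma>_nonneg d_nonneg x by (intro chain_bound[where q=q] inc pt N \<tau> q_le_\<sigma> q_le_d) auto
  also have "\<dots> = 2 * (\<Sum>k<Suc n. real (N k) * gtail (\<tau> k * x))"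
    by (simp only: sum_distrib_left lessThan_Suc_atMost mult.assoc)
  also have "\<dots> \<le> 2 * (3 * ((real m)\<^sup>2 * gtail x))" by (intro mult_left_mono sum) simp
  also have "\<dots> \<le> 5 / 2 * (real m)\<^sup>2 * (sqrt (2 * pi) * gtail x)"
  proof -
    have "2 * (3 * ((real m)\<^sup>2 * gtail x)) = 6 * ((real m)\<^sup>2 * gtail x)" by simp
    also have "\<dots> \<le> (5 / 2 * sqrt (2 * pi)) * ((real m)\<^sup>2 * gtail x)"
      using sqrt_2pi_ge by (intro mult_right_mono) auto
    also have "\<dots> = 5 / 2 * (real m)\<^sup>2 * (sqrt (2 * pi) * gtail x)" by (simp only: mult_ac)
    finally show ?thesis .
  qed
  finally show ?thesis .
qed

lemma sup_chain_prob:
  fixes N :: "nat \<Rightarrow> nat" and \<tau> :: "nat \<Rightarrow> real"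
  assumes cont: "AE \<omega> in M. continuous_on {0..1} (\<lambda>t. Y t \<omega>)"
    and N: "\<And>k. N k \<ge> 1" "(\<lambda>k. 1 / (2 * real (N k))) \<longlonglongrightarrow> 0"
    and b: "\<And>n. \<P>(\<omega> in M. \<exists>t\<in>mgrid (N n). \<bar>Y t \<omega>\<bar> > l) \<le> b"
  shows "prob_le M (\<lambda>\<omega>. (SUP t\<in>{0..1}. \<bar>Y t \<omega>\<bar>) > l) b"
proof (rule sup_event[OF _ _ mgrid(1) mgrid(3) mgrid_near N(2)])
  show "(\<lambda>\<omega>. \<bar>Y t \<omega>\<bar>) \<in> borel_measurable M" if "t \<in> {0..1}" for t
    using pt[OF that] by (auto simp add: cgauss_def)
  show "AE \<omega> in M. continuous_on {0..1} (\<lambda>t. \<bar>Y t \<omega>\<bar>)"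
    using cont by eventually_elim (intro continuous_intros)
qed (use N b in auto)

text \<open>The weights \<open>(2 + \<surd>2) (v\<^sub>k\<^sub>+\<^sub>1 - v\<^sub>k)\<close> equal the thresholds when \<open>v\<^sub>k = 2\<^sup>k\<^sup>/\<^sup>2\<close>. When \<open>v\<^sub>k = (6/5)\<^sup>k\<close>, twice these weights dominate
\<open>thr (k + 2)\<close>; the levels of equal parity then form a chain each, and the two chains share the budget \<open>2c\<close>.\<close>

lemma chaining_sup_bound:
  assumes cont: "AE \<omega> in M. continuous_on {0..1} (\<lambda>t. Y t \<omega>)" and x: "x > 0"
  shows "prob_le M (\<lambda>\<omega>. (SUP t\<in>{0..1}. \<bar>Y t \<omega>\<bar>) > x * c) (5 / 2 * (real m)\<^sup>2 * (sqrt (2 * pi) * gtail x))"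
proof (cases "5 / 2 * (real m)\<^sup>2 * (sqrt (2 * pi) * gtail x) < 1")
  case False
  show ?thesis
  proof (rule sup_chain_prob[OF cont, where N=Suc])
    show "(\<lambda>k. 1 / (2 * real (Suc k))) \<longlonglongrightarrow> 0" by real_asymp
    show "\<P>(\<omega> in M. \<exists>t\<in>mgrid (Suc n). \<bar>Y t \<omega>\<bar> > x * c) \<le> 5 / 2 * (real m)\<^sup>2 * (sqrt (2 * pi) * gtail x)" for n
      using False prob_le_1[of "{\<omega> \<in> space M. \<exists>t\<in>mgrid (Suc n). \<bar>Y t \<omega>\<bar> > x * c}"] by linarith
  qed simp
next
  case True
  define L where "L = ln (real m)"
  interpret num: chain_numerics m x L
    using m x True by unfold_locales (simp_all add: L_def)
  have mpow: "exp (- (y * L)) = real m powr (- y)" for y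
    using m by (simp add: powr_def L_def)
  show ?thesis
  proof (cases "1 + 4 * L \<le> x\<^sup>2")
    case True
    let ?N = "\<lambda>k. m ^ (2 ^ (k + 1))"
    let ?v = "\<lambda>k. sqrt 2 ^ k"
    have N1: "1 \<le> ?N k" for k using m by simp
    have s1: "1 \<le> sqrt (2::real)" by simp
    have vm: "?v k \<le> ?v (Suc k)" for k using s1 by (simp add: mult_left_mono)
    have h: "1 / (2 * real (?N k)) \<le> real m powr (- ((?v (Suc k))\<^sup>2))" for k
    proof -
      have "(?v (Suc k))\<^sup>2 = ((sqrt 2)\<^sup>2) ^ (Suc k)" by (simp only: power_mult[symmetric] mult.commute)
      also have "\<dots> = real (2 ^ (k + 1))" by simp
      finally have "real m powr (- ((?v (Suc k))\<^sup>2)) = 1 / (real m powr (real (2 ^ (k + 1))))" by (simp only: powr_minus_divide)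
      also have "real m powr (real (2 ^ (k + 1))) = real (?N k)" using m by (subst powr_realpow) auto
      finally have "real m powr (- ((?v (Suc k))\<^sup>2)) = 1 / real (?N k)" .
      moreover have "1 / (2 * real (?N k)) \<le> 1 / real (?N k)" using N1[of k] by (intro divide_left_mono) (use m in auto)
      ultimately show ?thesis by simp
    qed
    show ?thesis
    proof (rule sup_chain_prob[OF cont, where N="?N"])
      show "(\<lambda>k. 1 / (2 * real (?N k))) \<longlonglongrightarrow> 0"
      proof (rule tendsto_sandwich[OF _ _ tendsto_const])
        have "real (Suc k) \<le> real (?N k)" for k
        proof -
          have "k < 2 ^ k" by (rule less_exp)
          also have "(2::nat) ^ k \<le> 2 ^ (k + 1)" by simp
          also have "(2::nat) ^ (k + 1) < 2 ^ (2 ^ (k + 1))" by (rule less_exp)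
          also have "(2::nat) ^ (2 ^ (k + 1)) \<le> ?N k" using m by (intro power_mono) auto
          finally show ?thesis by (simp only: of_nat_le_iff Suc_le_eq)
        qed
        then show "\<forall>\<^sub>F k in sequentially. 1 / (2 * real (?N k)) \<le> 1 / (2 * real (Suc k))"
          using m by (intro always_eventually allI divide_left_mono mult_left_mono) auto
        show "(\<lambda>k. 1 / (2 * real (Suc k))) \<longlonglongrightarrow> 0" by real_asymp
      qed auto
      show "\<P>(\<omega> in M. \<exists>t\<in>mgrid (?N n). \<bar>Y t \<omega>\<bar> > x * c) \<le> 5 / 2 * (real m)\<^sup>2 * (sqrt (2 * pi) * gtail x)" for n
      proof (rule chain_prob[OF N1, where \<tau>="?v"])
        show "(\<Sum>k<n. real (?N k) * gtail (?v k * x)) \<le> 3 * ((real m)\<^sup>2 * gtail x)" for n by (rule num.dyadic_chain_sum[OF True])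
        fix n
        have "(2 + sqrt 2) * (?v (Suc k) - ?v k) = ?v (Suc k)" for k
        proof -
          have "sqrt 2 * sqrt 2 = (2::real)" by simp
          then show ?thesis by (simp add: algebra_simps)
        qed
        then have "?v 0 * \<sigma> + (\<Sum>k<n. ?v (Suc k) * d (1 / (2 * real (?N k)))) = \<sigma> + (2 + sqrt 2) * (\<Sum>k<n. (?v (Suc k) - ?v k) * d (1 / (2 * real (?N k))))"
          by (simp only: sum_distrib_left mult.assoc[symmetric] power_0 mult_1_left)
        also have "\<dots> \<le> c" by (rule sum_d_le_c[where v="?v" and h="\<lambda>k. 1 / (2 * real (?N k))", OF _ vm h]) simp
        finally show "?v 0 * \<sigma> + (\<Sum>k<n. ?v (Suc k) * d (1 / (2 * real (?N k)))) \<le> c" .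
      qed (use x in auto)
    qed (rule N1)
  next
    case False
    then have up: "x\<^sup>2 \<le> 1 + 4 * L" by simp
    let ?v = "\<lambda>k. (6 / 5 :: real) ^ k"
    let ?h = "\<lambda>j. 1 / (2 * real (num.gsize j))"
    have Vv: "(?v (Suc j))\<^sup>2 = num.V j" for j
    proof -
      have "(?v (Suc j))\<^sup>2 = ((6 / 5)\<^sup>2) ^ (Suc j)" by (simp only: power_mult[symmetric] mult.commute)
      also have "(6 / 5 :: real)\<^sup>2 = 36 / 25" by (simp add: power2_eq_square)
      finally show ?thesis by (simp add: num.V_def)
    qed
    have h: "?h j \<le> real m powr (- ((?v (Suc j))\<^sup>2))" for j
    proof -
      have "?h j \<le> 1 / exp (num.V j * L)" using num.gsize(1)[of j] num.gsize(3)[of j] by (intro divide_left_mono) auto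
      also have "\<dots> = exp (- (num.V j * L))" by (simp add: exp_minus inverse_eq_divide)
      finally show ?thesis unfolding Vv mpow .
    qed
    have h0: "?h j \<le> 3 / 2 * (25 / 36) ^ j" for j
    proof -
      have "?h j \<le> exp (- (num.V j * L))" using h[of j] unfolding Vv mpow .
      also have "\<dots> \<le> exp (- (num.V j * (2 / 3)))" using num.L_ge num.V_pos[of j] by simp
      also have "\<dots> \<le> 1 / (1 + num.V j * (2 / 3))" using num.V_pos[of j] by (intro num.exp_neg_le) simp
      also have "\<dots> \<le> 1 / ((36 / 25) ^ j * (2 / 3))"
      proof (intro divide_left_mono)
        have "0 \<le> (36 / 25 :: real) ^ j" "num.V j = 36 / 25 * (36 / 25) ^ j" by (simp_all add: num.V_def)
        then show "(36 / 25) ^ j * (2 / 3) \<le> 1 + num.V j * (2 / 3)" by linarith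
        show "0 < (1 + num.V j * (2 / 3)) * ((36 / 25) ^ j * (2 / 3))"
          using num.V_pos[of j] by (intro mult_pos_pos add_pos_pos) auto
      qed simp
      also have "\<dots> = 3 / 2 * (25 / 36) ^ j" by (simp add: power_divide)
      finally show ?thesis .
    qed
    define A where "A = (\<lambda>n. num.thr 0 * \<sigma> + (\<Sum>k<n. num.thr (2 * Suc k) * d (?h (2 * k))))"
    define B where "B = (\<lambda>n. num.thr 1 * \<sigma> + (\<Sum>k<n. num.thr (2 * Suc k + 1) * d (?h (2 * k + 1))))"
    have mA: "mono A" and mB: "mono B"
      using num.thr_pos d_nonneg by (auto intro!: incseq_SucI mult_nonneg_nonneg simp: A_def B_def less_imp_le)
    have AB: "A n + B n \<le> 2 * c" for n
    proof -
      have e: "A n + B n = (num.thr 0 + num.thr 1) * \<sigma> + (\<Sum>j<2 * n. num.thr (j + 2) * d (?h j))"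
        by (induction n) (simp_all add: A_def B_def algebra_simps)
      have s2: "14 / 10 \<le> sqrt (2::real)" by (rule real_le_rsqrt) (simp add: power2_eq_square)
      have "(\<Sum>j<2 * n. num.thr (j + 2) * d (?h j)) \<le> (\<Sum>j<2 * n. 2 * (2 + sqrt 2) * ((?v (Suc j) - ?v j) * d (?h j)))"
      proof (rule sum_mono)
        fix j
        have "num.thr (j + 2) = 1296 / 1000 * ?v j" by (simp add: num.thr_def eval_nat_numeral)
        also have "\<dots> \<le> (2 * (2 + sqrt 2) / 5) * ?v j" using s2 by (intro mult_right_mono) auto
        also have "\<dots> = 2 * (2 + sqrt 2) * (?v (Suc j) - ?v j)" by (simp add: field_simps)
        finally have "num.thr (j + 2) * d (?h j) \<le> 2 * (2 + sqrt 2) * (?v (Suc j) - ?v j) * d (?h j)"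
          by (rule mult_right_mono) (rule d_nonneg)
        then show "num.thr (j + 2) * d (?h j) \<le> 2 * (2 + sqrt 2) * ((?v (Suc j) - ?v j) * d (?h j))" by (simp only: mult.assoc)
      qed
      also have "\<dots> = 2 * ((2 + sqrt 2) * (\<Sum>j<2 * n. (?v (Suc j) - ?v j) * d (?h j)))"
        by (simp only: sum_distrib_left mult.assoc)
      finally have s: "(\<Sum>j<2 * n. num.thr (j + 2) * d (?h j)) \<le> 2 * ((2 + sqrt 2) * (\<Sum>j<2 * n. (?v (Suc j) - ?v j) * d (?h j)))" .
      have "(num.thr 0 + num.thr 1) * \<sigma> \<le> 2 * \<sigma>"
        using \<sigma>_nonneg by (intro mult_right_mono) (simp_all add: num.thr_def power2_eq_square)
      moreover have "\<sigma> + (2 + sqrt 2) * (\<Sum>j<2 * n. (?v (Suc j) - ?v j) * d (?h j)) \<le> c"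
        by (rule sum_d_le_c[where v="?v" and h="?h", OF _ _ h]) simp_all
      ultimately show ?thesis using e s by linarith
    qed
    have "(\<forall>n. A n \<le> c) \<or> (\<forall>n. B n \<le> c)"
    proof (rule ccontr)
      assume "\<not> ((\<forall>n. A n \<le> c) \<or> (\<forall>n. B n \<le> c))"
      then obtain n n' where "c < A n" "c < B n'" by (auto simp: not_le)
      moreover have "A n \<le> A (max n n')" "B n' \<le> B (max n n')" using mA mB by (auto simp: mono_def)
      ultimately show False using AB[of "max n n'"] by linarith
    qed
    then show ?thesis
    proof
      assume A: "\<forall>n. A n \<le> c"
      show ?thesis
      proof (rule sup_chain_prob[OF cont, where N="\<lambda>k. num.gsize (2 * k)"])
        show "(\<lambda>k. ?h (2 * k)) \<longlonglongrightarrow> 0"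
        proof (rule tendsto_sandwich[OF _ _ tendsto_const])
          show "\<forall>\<^sub>F k in sequentially. ?h (2 * k) \<le> 3 / 2 * (25 / 36) ^ (2 * k)" using h0 by (intro always_eventually) blast
          show "(\<lambda>k. 3 / 2 * (25 / 36 :: real) ^ (2 * k)) \<longlonglongrightarrow> 0" by real_asymp
        qed auto
        show "\<P>(\<omega> in M. \<exists>t\<in>mgrid (num.gsize (2 * n)). \<bar>Y t \<omega>\<bar> > x * c) \<le> 5 / 2 * (real m)\<^sup>2 * (sqrt (2 * pi) * gtail x)" for n
        proof (rule chain_prob[where \<tau>="\<lambda>k. num.thr (2 * k)" and N="\<lambda>k. num.gsize (2 * k)"])
          show "num.thr (2 * 0) * \<sigma> + (\<Sum>k<n. num.thr (2 * Suc k) * d (?h (2 * k))) \<le> c" for n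
            using A unfolding A_def by simp
        qed (use x num.gsize(3) num.thr_pos num.even_chain_sum[OF up] in \<open>auto intro: less_imp_le\<close>)
      qed (rule num.gsize(3))
    next
      assume B: "\<forall>n. B n \<le> c"
      show ?thesis
      proof (rule sup_chain_prob[OF cont, where N="\<lambda>k. num.gsize (2 * k + 1)"])
        show "(\<lambda>k. ?h (2 * k + 1)) \<longlonglongrightarrow> 0"
        proof (rule tendsto_sandwich[OF _ _ tendsto_const])
          show "\<forall>\<^sub>F k in sequentially. ?h (2 * k + 1) \<le> 3 / 2 * (25 / 36) ^ (2 * k + 1)" using h0 by (intro always_eventually) blast
          show "(\<lambda>k. 3 / 2 * (25 / 36 :: real) ^ (2 * k + 1)) \<longlonglongrightarrow> 0" by real_asymp
        qed auto
        show "\<P>(\<omega> in M. \<exists>t\<in>mgrid (num.gsize (2 * n + 1)). \<bar>Y t \<omega>\<bar> > x * c) \<le> 5 / 2 * (real m)\<^sup>2 * (sqrt (2 * pi) * gtail x)" for n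
        proof (rule chain_prob[where \<tau>="\<lambda>k. num.thr (2 * k + 1)" and N="\<lambda>k. num.gsize (2 * k + 1)"])
          show "num.thr (2 * 0 + 1) * \<sigma> + (\<Sum>k<n. num.thr (2 * Suc k + 1) * d (?h (2 * k + 1))) \<le> c" for n
            using B unfolding B_def by simp
          show "(\<Sum>k<n. real (num.gsize (2 * k + 1)) * gtail (num.thr (2 * k + 1) * x)) \<le> 3 * ((real m)\<^sup>2 * gtail x)" for n
            by (rule num.odd_chain_sum[OF up])
        qed (use x num.gsize(3) num.thr_pos in \<open>auto intro: less_imp_le\<close>)
      qed (rule num.gsize(3))
    qed
  qed
qed

lemma abs_sup_tail:
  assumes cont: "AE \<omega> in M. continuous_on {0..1} (\<lambda>t. Y t \<omega>)" and lam: "lam > 0"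
  shows "prob_le M (\<lambda>\<omega>. (SUP t\<in>{0..1}. \<bar>Y t \<omega>\<bar>) > lam)
     (LBINT x = ereal lam / enn2ereal (chain_const q m) .. \<infinity>. 5 / 2 * (real m)\<^sup>2 * exp (- x\<^sup>2 / 2))"
proof -
  have "chain_const q m = ennreal c" unfolding c_def using fin by simp
  then have ce: "enn2ereal (chain_const q m) = ereal c" using c_nonneg by (simp add: enn2ereal_ennreal)
  show ?thesis
  proof (cases "c = 0")
    case False
    then have c: "c > 0" using c_nonneg by simp
    have e: "ereal lam / enn2ereal (chain_const q m) = ereal (lam / c)" using c by (simp add: ce)
    show ?thesis using chaining_sup_bound[OF cont, of "lam / c"] c lam
      unfolding e LBINT_gauss by (simp add: mult.assoc)
  next
    case True
    have inf: "ereal lam / enn2ereal (chain_const q m) = \<infinity>" unfolding ce True using lam ereal_divide_zero[of lam] by simp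
    have "\<sigma> \<le> c" using sum_d_le_c[of "\<lambda>_. 1" "\<lambda>_. 0" 0] by simp
    then have s0: "\<sigma> = 0" using \<sigma>_nonneg True by simp
    have Y0: "AE \<omega> in M. Y t \<omega> = 0" if t: "t \<in> {0..1}" for t
    proof -
      have "q 0 t \<le> 0" using q_le_\<sigma>[of 0 t] t s0 by simp
      moreover have "0 \<le> q 0 t" using pt[OF t] by (simp add: cgauss_def)
      ultimately have "q 0 t = 0" by simp
      then show ?thesis using cgauss_zero_AE pt[OF t] by simp
    qed
    have "prob_le M (\<lambda>\<omega>. (SUP t\<in>{0..1}. \<bar>Y t \<omega>\<bar>) > lam) 0"
    proof (rule sup_chain_prob[OF cont, where N=Suc])
      show "(\<lambda>k. 1 / (2 * real (Suc k))) \<longlonglongrightarrow> 0" by real_asymp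
      fix n
      have "AE \<omega> in M. \<forall>t\<in>mgrid (Suc n). Y t \<omega> = 0"
        using Y0 mgrid(3) by (intro AE_finite_allI mgrid) blast
      then have "AE \<omega> in M. \<not> (\<exists>t\<in>mgrid (Suc n). \<bar>Y t \<omega>\<bar> > lam)"
        by eventually_elim (use lam in auto)
      then have "\<P>(\<omega> in M. \<exists>t\<in>mgrid (Suc n). \<bar>Y t \<omega>\<bar> > lam) = 0"
        by (intro prob_eq_0_AE)
      then show "\<P>(\<omega> in M. \<exists>t\<in>mgrid (Suc n). \<bar>Y t \<omega>\<bar> > lam) \<le> 0" by simp
    qed simp
    then show ?thesis unfolding inf by simp
  qed
qed

end

section \<open>Gaussian vectors and their laws\<close>

text \<open>Levy uniqueness for finite measures, here the laws of \<open>X\<close> and \<open>Y\<close> weighted with the densities \<open>G\<close> and \<open>H\<close>.\<close>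

lemma weighted_char_unique:
  fixes M :: "'a measure" and N :: "'b measure"
  assumes "prob_space M" "prob_space N"
    and G [measurable]: "G \<in> borel_measurable M" "X \<in> borel_measurable M"
    and H [measurable]: "H \<in> borel_measurable N" "Y \<in> borel_measurable N"
    and Gb: "\<And>\<omega>. 0 \<le> G \<omega>" "\<And>\<omega>. G \<omega> \<le> 2" and Hb: "\<And>\<omega>. 0 \<le> H \<omega>" "\<And>\<omega>. H \<omega> \<le> 2"
    and eq: "\<And>t. (CLINT \<omega>|M. complex_of_real (G \<omega>) * iexp (t * X \<omega>)) = (CLINT \<omega>|N. complex_of_real (H \<omega>) * iexp (t * Y \<omega>))"
    and A [measurable]: "A \<in> sets borel"
  shows "(\<integral>\<omega>. G \<omega> * indicator A (X \<omega>) \<partial>M) = (\<integral>\<omega>. H \<omega> * indicator A (Y \<omega>) \<partial>N)"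
proof -
  interpret M: prob_space M by fact
  interpret N: prob_space N by fact
  have iG: "integrable M G" by (rule M.integrable_const_bound[where B=2]) (use Gb in auto)
  have iH: "integrable N H" by (rule N.integrable_const_bound[where B=2]) (use Hb in auto)
  define c where "c = (\<integral>\<omega>. G \<omega> \<partial>M)"
  have cH: "c = (\<integral>\<omega>. H \<omega> \<partial>N)" using eq[of 0] by (simp add: c_def)
  have c0: "0 \<le> c" unfolding c_def using Gb by simp
  show ?thesis
  proof (cases "c = 0")
    case True
    have "AE \<omega> in M. G \<omega> = 0" using integral_nonneg_eq_0_iff_AE[OF iG] Gb True by (simp add: c_def)
    then have "(\<integral>\<omega>. G \<omega> * indicator A (X \<omega>) \<partial>M) = (\<integral>\<omega>. 0 \<partial>M)" by (intro integral_cong_AE) auto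
    moreover have "AE \<omega> in N. H \<omega> = 0" using integral_nonneg_eq_0_iff_AE[OF iH] Hb True by (simp add: cH)
    then have "(\<integral>\<omega>. H \<omega> * indicator A (Y \<omega>) \<partial>N) = (\<integral>\<omega>. 0 \<partial>N)" by (intro integral_cong_AE) auto
    ultimately show ?thesis by simp
  next
    case False
    then have c: "c > 0" using c0 by simp
    have law: "real_distribution (distr (density K (\<lambda>\<omega>. ennreal (F \<omega> / c))) borel Z)
       \<and> (\<forall>t. char (distr (density K (\<lambda>\<omega>. ennreal (F \<omega> / c))) borel Z) t = (CLINT \<omega>|K. complex_of_real (F \<omega>) * iexp (t * Z \<omega>)) / complex_of_real c)
       \<and> measure (distr (density K (\<lambda>\<omega>. ennreal (F \<omega> / c))) borel Z) A = (\<integral>\<omega>. F \<omega> * indicator A (Z \<omega>) \<partial>K) / c"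
      if K: "prob_space K" and [measurable]: "F \<in> borel_measurable K" "Z \<in> borel_measurable K" and F: "\<And>\<omega>. 0 \<le> F \<omega>" "integrable K F" "c = (\<integral>\<omega>. F \<omega> \<partial>K)"
      for K :: "'c measure" and F Z
    proof -
      let ?D = "density K (\<lambda>\<omega>. ennreal (F \<omega> / c))"
      have Fc: "0 \<le> F \<omega> / c" for \<omega> using F(1) c by simp
      have "emeasure ?D (space ?D) = (\<integral>\<^sup>+\<omega>. ennreal (F \<omega> / c) \<partial>K)"
        by (simp add: emeasure_density cong: nn_integral_cong)
      also have "\<dots> = ennreal (\<integral>\<omega>. F \<omega> / c \<partial>K)" using F Fc by (intro nn_integral_eq_integral) auto
      also have "(\<integral>\<omega>. F \<omega> / c \<partial>K) = 1" using F(3) c by simp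
      finally have D: "prob_space ?D" by (intro prob_spaceI) simp
      interpret D: prob_space ?D by (rule D)
      have "char (distr ?D borel Z) t = (CLINT \<omega>|K. complex_of_real (F \<omega>) * iexp (t * Z \<omega>)) / complex_of_real c" for t
      proof -
        have "char (distr ?D borel Z) t = (CLINT \<omega>|?D. iexp (t * Z \<omega>))" unfolding char_def by (rule integral_distr) simp_all
        also have "\<dots> = (CLINT \<omega>|K. (F \<omega> / c) *\<^sub>R iexp (t * Z \<omega>))" by (rule integral_density) (use Fc in auto)
        also have "\<dots> = (CLINT \<omega>|K. complex_of_real (F \<omega>) * iexp (t * Z \<omega>) / complex_of_real c)"
          by (intro Bochner_Integration.integral_cong) (simp_all add: scaleR_conv_of_real)
        finally show ?thesis by simp
      qed
      moreover have "measure (distr ?D borel Z) A = (\<integral>\<omega>. F \<omega> * indicator A (Z \<omega>) \<partial>K) / c"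
      proof -
        have "measure (distr ?D borel Z) A = (\<integral>x. indicator A x \<partial>(distr ?D borel Z))" by simp
        also have "\<dots> = (\<integral>\<omega>. indicator A (Z \<omega>) \<partial>?D)" by (rule integral_distr) simp_all
        also have "\<dots> = (\<integral>\<omega>. (F \<omega> / c) *\<^sub>R indicator A (Z \<omega>) \<partial>K)" by (rule integral_density) (use Fc in auto)
        also have "\<dots> = (\<integral>\<omega>. F \<omega> * indicator A (Z \<omega>) / c \<partial>K)" by simp
        finally show ?thesis by simp
      qed
      moreover have "real_distribution (distr ?D borel Z)" by (rule D.real_distribution_distr) simp
      ultimately show ?thesis by blast
    qed
    note lM = law[OF assms(1) G(1,2) Gb(1) iG c_def] and lN = law[OF assms(2) H(1,2) Hb(1) iH cH]
    have "distr (density M (\<lambda>\<omega>. ennreal (G \<omega> / c))) borel X = distr (density N (\<lambda>\<omega>. ennreal (H \<omega> / c))) borel Y"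
    proof (rule Levy_uniqueness)
      show "char (distr (density M (\<lambda>\<omega>. ennreal (G \<omega> / c))) borel X) = char (distr (density N (\<lambda>\<omega>. ennreal (H \<omega> / c))) borel Y)"
      proof (rule ext)
        fix t show "char (distr (density M (\<lambda>\<omega>. ennreal (G \<omega> / c))) borel X) t = char (distr (density N (\<lambda>\<omega>. ennreal (H \<omega> / c))) borel Y) t"
          using lM lN by (simp only: eq)
      qed
    qed (use lM lN in blast)+
    then show ?thesis using lM lN c by simp
  qed
qed

text \<open>Uniqueness for random vectors by induction over the coordinates that have been passed from exponentials to indicators. For
the coordinate in turn, \<open>weighted_char_unique\<close> is applied with nonnegative weights: \<open>P\<close>, \<open>P (1 + cos U)\<close> and \<open>P (1 + sin U)\<close>, where
\<open>P\<close> collects the indicators already treated and \<open>U\<close> the linear form in the coordinates still to come.\<close>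

lemma joint_char_unique:
  fixes M :: "'a measure" and N :: "'b measure" and X :: "'i \<Rightarrow> 'a \<Rightarrow> real" and Y :: "'i \<Rightarrow> 'b \<Rightarrow> real"
  assumes M: "prob_space M" and N: "prob_space N" and I: "finite I"
    and X [measurable]: "\<And>i. i \<in> I \<Longrightarrow> X i \<in> borel_measurable M" and Y [measurable]: "\<And>i. i \<in> I \<Longrightarrow> Y i \<in> borel_measurable N"
    and eq: "\<And>b. (CLINT \<omega>|M. iexp (\<Sum>i\<in>I. b i * X i \<omega>)) = (CLINT \<omega>|N. iexp (\<Sum>i\<in>I. b i * Y i \<omega>))"
    and A [measurable]: "\<And>i. A i \<in> sets borel"
  shows "\<P>(\<omega> in M. \<forall>i\<in>I. X i \<omega> \<in> A i) = \<P>(\<omega> in N. \<forall>i\<in>I. Y i \<omega> \<in> A i)"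
proof -
  interpret M: prob_space M by fact
  interpret N: prob_space N by fact
  define P where "P = (\<lambda>J \<omega>. \<Prod>i\<in>J. indicator (A i) (X i \<omega>) :: real)"
  define Q where "Q = (\<lambda>J \<omega>. \<Prod>i\<in>J. indicator (A i) (Y i \<omega>) :: real)"
  have Pb: "0 \<le> P J \<omega>" "P J \<omega> \<le> 1" for J \<omega> unfolding P_def by (auto intro!: prod_nonneg prod_le_1)
  have Qb: "0 \<le> Q J \<omega>" "Q J \<omega> \<le> 1" for J \<omega> unfolding Q_def by (auto intro!: prod_nonneg prod_le_1)
  have Pm [measurable]: "P J \<in> borel_measurable M" if "J \<subseteq> I" for J
    unfolding P_def using that by (intro borel_measurable_prod) (auto intro!: borel_measurable_indicator' simp: measurable_sets)
  have Qm [measurable]: "Q J \<in> borel_measurable N" if "J \<subseteq> I" for J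
    unfolding Q_def using that by (intro borel_measurable_prod) (auto intro!: borel_measurable_indicator' simp: measurable_sets)
  have key: "(CLINT \<omega>|M. complex_of_real (P J \<omega>) * iexp (\<Sum>i\<in>I - J. b i * X i \<omega>)) = (CLINT \<omega>|N. complex_of_real (Q J \<omega>) * iexp (\<Sum>i\<in>I - J. b i * Y i \<omega>))"
    if "J \<subseteq> I" for J b
    using finite_subset[OF that I] that
  proof (induction J arbitrary: b rule: finite_induct)
    case empty then show ?case using eq by (simp add: P_def Q_def)
  next
    case (insert j J)
    define R where "R = I - insert j J"
    have jI: "j \<in> I" and JI: "J \<subseteq> I" and RI: "R \<subseteq> I" using insert.prems by (auto simp: R_def)
    have fR: "finite R" using I RI finite_subset by blast
    have IJ: "I - J = insert j R" "j \<notin> R" using insert by (auto simp: R_def)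
    define U where "U = (\<lambda>\<omega>. \<Sum>i\<in>R. b i * X i \<omega>)"
    define V where "V = (\<lambda>\<omega>. \<Sum>i\<in>R. b i * Y i \<omega>)"
    have [measurable]: "X j \<in> borel_measurable M" "Y j \<in> borel_measurable N" using X Y jI by auto
    have [measurable]: "P J \<in> borel_measurable M" "Q J \<in> borel_measurable N" using Pm[OF JI] Qm[OF JI] .
    have [measurable]: "U \<in> borel_measurable M" "V \<in> borel_measurable N" unfolding U_def V_def using RI by (auto intro!: borel_measurable_sum borel_measurable_times)
    have bnd: "integrable M (\<lambda>\<omega>. complex_of_real (P J \<omega>) * iexp (h \<omega>))" if [measurable]: "h \<in> borel_measurable M" for h
      by (rule M.integrable_const_bound[where B=1]) (use Pb in \<open>auto simp: norm_mult\<close>)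
    have bndN: "integrable N (\<lambda>\<omega>. complex_of_real (Q J \<omega>) * iexp (h \<omega>))" if [measurable]: "h \<in> borel_measurable N" for h
      by (rule N.integrable_const_bound[where B=1]) (use Qb in \<open>auto simp: norm_mult\<close>)
    have E: "(CLINT \<omega>|M. complex_of_real (P J \<omega>) * iexp (s * U \<omega> + t * X j \<omega>)) = (CLINT \<omega>|N. complex_of_real (Q J \<omega>) * iexp (s * V \<omega> + t * Y j \<omega>))" for s t
    proof -
      have "(\<Sum>i\<in>I - J. (if i = j then t else s * b i) * Z i) = s * (\<Sum>i\<in>R. b i * Z i) + t * Z j" for Z :: "'i \<Rightarrow> real"
      proof -
        have "(\<Sum>i\<in>R. (if i = j then t else s * b i) * Z i) = s * (\<Sum>i\<in>R. b i * Z i)"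
          unfolding sum_distrib_left using IJ(2) by (intro sum.cong) auto
        then show ?thesis unfolding IJ(1) using fR IJ(2) by simp
      qed
      then show ?thesis using insert.IH[OF JI, of "\<lambda>i. if i = j then t else s * b i"] unfolding U_def V_def by simp
    qed
    have cosE: "(CLINT \<omega>|M. complex_of_real (P J \<omega> * cos (U \<omega>)) * iexp (t * X j \<omega>)) = (CLINT \<omega>|N. complex_of_real (Q J \<omega> * cos (V \<omega>)) * iexp (t * Y j \<omega>))" for t
    proof -
      have id: "complex_of_real (p * cos u) * iexp x = (complex_of_real p * iexp (1 * u + x) + complex_of_real p * iexp (- 1 * u + x)) / 2" for p u x :: real
        by (simp add: complex_eq_iff Re_exp Im_exp cos_add sin_add cos_diff sin_diff algebra_simps)
      show ?thesis unfolding id using E[of 1 t] E[of "- 1" t] bnd[of "\<lambda>\<omega>. 1 * U \<omega> + t * X j \<omega>"] bnd[of "\<lambda>\<omega>. - 1 * U \<omega> + t * X j \<omega>"]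
        bndN[of "\<lambda>\<omega>. 1 * V \<omega> + t * Y j \<omega>"] bndN[of "\<lambda>\<omega>. - 1 * V \<omega> + t * Y j \<omega>"] by simp
    qed
    have sinE: "(CLINT \<omega>|M. complex_of_real (P J \<omega> * sin (U \<omega>)) * iexp (t * X j \<omega>)) = (CLINT \<omega>|N. complex_of_real (Q J \<omega> * sin (V \<omega>)) * iexp (t * Y j \<omega>))" for t
    proof -
      have id: "complex_of_real (p * sin u) * iexp x = (- \<i>) * (complex_of_real p * iexp (1 * u + x) - complex_of_real p * iexp (- 1 * u + x)) / 2" for p u x :: real
        by (simp add: complex_eq_iff Re_exp Im_exp cos_add sin_add cos_diff sin_diff algebra_simps)
      show ?thesis unfolding id using E[of 1 t] E[of "- 1" t] bnd[of "\<lambda>\<omega>. 1 * U \<omega> + t * X j \<omega>"] bnd[of "\<lambda>\<omega>. - 1 * U \<omega> + t * X j \<omega>"]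
        bndN[of "\<lambda>\<omega>. 1 * V \<omega> + t * Y j \<omega>"] bndN[of "\<lambda>\<omega>. - 1 * V \<omega> + t * Y j \<omega>"] by simp
    qed
    have PE: "(CLINT \<omega>|M. complex_of_real (P J \<omega>) * iexp (t * X j \<omega>)) = (CLINT \<omega>|N. complex_of_real (Q J \<omega>) * iexp (t * Y j \<omega>))" for t
      using E[of 0 t] by simp
    have iX: "integrable M (\<lambda>\<omega>. P J \<omega> * g (U \<omega>) * indicator (A j) (X j \<omega>))" if [measurable]: "g \<in> borel_measurable borel" and "\<And>x. \<bar>g x\<bar> \<le> 1" for g :: "real \<Rightarrow> real"
      by (rule M.integrable_const_bound[where B=1]) (use Pb that(2) in \<open>auto simp: abs_mult intro!: mult_le_one split: split_indicator\<close>)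
    have iY: "integrable N (\<lambda>\<omega>. Q J \<omega> * g (V \<omega>) * indicator (A j) (Y j \<omega>))" if [measurable]: "g \<in> borel_measurable borel" and "\<And>x. \<bar>g x\<bar> \<le> 1" for g :: "real \<Rightarrow> real"
      by (rule N.integrable_const_bound[where B=1]) (use Qb that(2) in \<open>auto simp: abs_mult intro!: mult_le_one split: split_indicator\<close>)
    have one: "(\<integral>\<omega>. P J \<omega> * indicator (A j) (X j \<omega>) \<partial>M) = (\<integral>\<omega>. Q J \<omega> * indicator (A j) (Y j \<omega>) \<partial>N)"
    proof (rule weighted_char_unique[OF M N])
      show "P J \<omega> \<le> 2" "Q J \<omega>' \<le> 2" for \<omega> \<omega>' using Pb[of J \<omega>] Qb[of J \<omega>'] by auto
    qed (use Pb Qb PE in auto)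
    have trig: "(\<integral>\<omega>. P J \<omega> * g (U \<omega>) * indicator (A j) (X j \<omega>) \<partial>M) = (\<integral>\<omega>. Q J \<omega> * g (V \<omega>) * indicator (A j) (Y j \<omega>) \<partial>N)"
      if g [measurable]: "g \<in> borel_measurable borel" and gb: "\<And>x. \<bar>g x\<bar> \<le> 1"
        and ge: "\<And>t. (CLINT \<omega>|M. complex_of_real (P J \<omega> * g (U \<omega>)) * iexp (t * X j \<omega>)) = (CLINT \<omega>|N. complex_of_real (Q J \<omega> * g (V \<omega>)) * iexp (t * Y j \<omega>))" for g :: "real \<Rightarrow> real"
    proof -
      have gb': "- 1 \<le> g x" "g x \<le> 1" for x using gb[of x] by auto
      have w: "0 \<le> p * (1 + g x)" "p * (1 + g x) \<le> 2" if "0 \<le> p" "p \<le> 1" for p x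
      proof -
        show "0 \<le> p * (1 + g x)" using gb'[of x] that by (intro mult_nonneg_nonneg) auto
        have "p * (1 + g x) \<le> 1 * 2" using gb'[of x] that by (intro mult_mono) auto
        then show "p * (1 + g x) \<le> 2" by simp
      qed
      have 1: "(\<integral>\<omega>. P J \<omega> * (1 + g (U \<omega>)) * indicator (A j) (X j \<omega>) \<partial>M) = (\<integral>\<omega>. Q J \<omega> * (1 + g (V \<omega>)) * indicator (A j) (Y j \<omega>) \<partial>N)"
      proof (rule weighted_char_unique[OF M N])
        fix t
        have i1: "integrable M (\<lambda>\<omega>. complex_of_real (P J \<omega> * g (U \<omega>)) * iexp (t * X j \<omega>))"
          by (rule M.integrable_const_bound[where B=1]) (use Pb gb in \<open>auto simp: norm_mult abs_mult intro!: mult_le_one\<close>)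
        have i2: "integrable N (\<lambda>\<omega>. complex_of_real (Q J \<omega> * g (V \<omega>)) * iexp (t * Y j \<omega>))"
          by (rule N.integrable_const_bound[where B=1]) (use Qb gb in \<open>auto simp: norm_mult abs_mult intro!: mult_le_one\<close>)
        have id: "complex_of_real (p * (1 + u)) * z = complex_of_real p * z + complex_of_real (p * u) * z" for p u z by (simp add: algebra_simps)
        show "(CLINT \<omega>|M. complex_of_real (P J \<omega> * (1 + g (U \<omega>))) * iexp (t * X j \<omega>)) = (CLINT \<omega>|N. complex_of_real (Q J \<omega> * (1 + g (V \<omega>))) * iexp (t * Y j \<omega>))"
          unfolding id using i1 i2 bnd[of "\<lambda>\<omega>. t * X j \<omega>"] bndN[of "\<lambda>\<omega>. t * Y j \<omega>"] ge[of t] PE[of t]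
          by (subst (1 2) Bochner_Integration.integral_add) auto
      qed (use w Pb Qb in auto)
      have id: "p * (1 + u) * z = p * 1 * z + p * u * z" for p u z :: real by (simp add: algebra_simps)
      show ?thesis
        using 1 one iX[of "\<lambda>_. 1"] iY[of "\<lambda>_. 1"] iX[OF g gb] iY[OF g gb] unfolding id
        by (subst (asm) (1 2) Bochner_Integration.integral_add) auto
    qed
    have ix: "complex_of_real p * iexp u = complex_of_real (q * cos u * r) + \<i> * complex_of_real (q * sin u * r)" if "p = r * q" for p q r u :: real
      by (simp add: complex_eq_iff Re_exp Im_exp that algebra_simps)
    have Pi: "P (insert j J) \<omega> = indicator (A j) (X j \<omega>) * P J \<omega>" for \<omega> unfolding P_def using insert.hyps by simp
    have Qi: "Q (insert j J) \<omega> = indicator (A j) (Y j \<omega>) * Q J \<omega>" for \<omega> unfolding Q_def using insert.hyps by simp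
    have "(CLINT \<omega>|M. complex_of_real (P (insert j J) \<omega>) * iexp (U \<omega>)) = complex_of_real (\<integral>\<omega>. P J \<omega> * cos (U \<omega>) * indicator (A j) (X j \<omega>) \<partial>M) + \<i> * complex_of_real (\<integral>\<omega>. P J \<omega> * sin (U \<omega>) * indicator (A j) (X j \<omega>) \<partial>M)"
      unfolding ix[OF Pi] using iX[of cos] iX[of sin] by (subst Bochner_Integration.integral_add) (auto simp: integral_complex_of_real simp del: of_real_mult)
    also have "\<dots> = complex_of_real (\<integral>\<omega>. Q J \<omega> * cos (V \<omega>) * indicator (A j) (Y j \<omega>) \<partial>N) + \<i> * complex_of_real (\<integral>\<omega>. Q J \<omega> * sin (V \<omega>) * indicator (A j) (Y j \<omega>) \<partial>N)"
      using trig[of cos, OF _ _ cosE] trig[of sin, OF _ _ sinE] by simp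
    also have "\<dots> = (CLINT \<omega>|N. complex_of_real (Q (insert j J) \<omega>) * iexp (V \<omega>))"
      unfolding ix[OF Qi] using iY[of cos] iY[of sin] by (subst Bochner_Integration.integral_add) (auto simp: integral_complex_of_real simp del: of_real_mult)
    finally show ?case unfolding U_def V_def R_def .
  qed
  have ind: "(\<Prod>i\<in>I. indicator (A i) (Z i) :: real) = of_bool (\<forall>i\<in>I. Z i \<in> A i)" for Z :: "'i \<Rightarrow> real"
    using I by (induction I rule: finite_induct) (auto simp: indicator_def)
  have S: "{\<omega> \<in> space K. \<phi> \<omega>} \<inter> space K = {\<omega> \<in> space K. \<phi> \<omega>}" for K :: "'c measure" and \<phi> by auto
  have "\<P>(\<omega> in M. \<forall>i\<in>I. X i \<omega> \<in> A i) = (\<integral>\<omega>. indicator {\<omega> \<in> space M. \<forall>i\<in>I. X i \<omega> \<in> A i} \<omega> \<partial>M)"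
    by (simp add: S)
  also have "\<dots> = (\<integral>\<omega>. P I \<omega> \<partial>M)"
    unfolding P_def ind by (intro Bochner_Integration.integral_cong) (auto simp: indicator_def)
  also have "\<dots> = (\<integral>\<omega>. Q I \<omega> \<partial>N)"
    using key[of I "\<lambda>_. 0"] by simp
  also have "\<dots> = (\<integral>\<omega>. indicator {\<omega> \<in> space N. \<forall>i\<in>I. Y i \<omega> \<in> A i} \<omega> \<partial>N)"
    unfolding Q_def ind by (intro Bochner_Integration.integral_cong) (auto simp: indicator_def)
  also have "\<dots> = \<P>(\<omega> in N. \<forall>i\<in>I. Y i \<omega> \<in> A i)" by (simp add: S)
  finally show ?thesis .
qed

text \<open>A centred Gaussian vector with covariance matrix \<open>C\<close>.\<close>

definition gvec :: "'a measure \<Rightarrow> 'i set \<Rightarrow> ('i \<Rightarrow> 'a \<Rightarrow> real) \<Rightarrow> ('i \<Rightarrow> 'i \<Rightarrow> real) \<Rightarrow> bool" where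
  "gvec M I X C \<longleftrightarrow> (\<forall>b. cgauss M (\<lambda>\<omega>. \<Sum>i\<in>I. b i * X i \<omega>) (\<Sum>i\<in>I. \<Sum>j\<in>I. b i * b j * C i j))"

lemma gvec_cong:
  assumes "gvec M I X C" "\<And>i j. i \<in> I \<Longrightarrow> j \<in> I \<Longrightarrow> C i j = D i j" shows "gvec M I X D"
proof -
  have "(\<Sum>i\<in>I. \<Sum>j\<in>I. b i * b j * C i j) = (\<Sum>i\<in>I. \<Sum>j\<in>I. b i * b j * D i j)" for b
    using assms(2) by (intro sum.cong) auto
  then show ?thesis using assms(1) by (simp add: gvec_def)
qed

lemma gvec_coord:
  assumes "gvec M I X C" "finite I" "i \<in> I" shows "cgauss M (X i) (C i i)"
proof -
  have "cgauss M (\<lambda>\<omega>. \<Sum>k\<in>I. (if k = i then 1 else 0) * X k \<omega>) (\<Sum>k\<in>I. \<Sum>l\<in>I. (if k = i then 1 else 0) * (if l = i then 1 else 0) * C k l)"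
    using assms(1) unfolding gvec_def by (rule spec)
  moreover have "(\<Sum>k\<in>I. (if k = i then 1 else 0) * X k \<omega>) = X i \<omega>" for \<omega>
    using assms(2,3) by (simp add: if_distrib if_distribR cong: if_cong)
  moreover have "(\<Sum>k\<in>I. \<Sum>l\<in>I. (if k = i then 1 else 0) * (if l = i then 1 else 0) * C k l) = C i i"
  proof -
    have "(\<Sum>k\<in>I. \<Sum>l\<in>I. (if k = i then 1 else 0) * (if l = i then 1 else 0) * C k l) = (\<Sum>k\<in>I. if k = i then (\<Sum>l\<in>I. if l = i then C i i else 0) else 0)"
      by (intro sum.cong refl) (auto intro!: sum.cong)
    then show ?thesis using assms(2,3) by simp
  qed
  ultimately show ?thesis by simp
qed

lemma gvec_measurable: "gvec M I X C \<Longrightarrow> finite I \<Longrightarrow> i \<in> I \<Longrightarrow> X i \<in> borel_measurable M"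
  using gvec_coord[of M I X C i] by (simp add: cgauss_def)

lemma gvec_event:
  assumes M: "prob_space M" and N: "prob_space N" and I: "finite I" and X: "gvec M I X C" and Y: "gvec N I Y C"
    and A: "\<And>i. A i \<in> sets borel"
  shows "\<P>(\<omega> in M. \<forall>i\<in>I. X i \<omega> \<in> A i) = \<P>(\<omega> in N. \<forall>i\<in>I. Y i \<omega> \<in> A i)"
proof (rule joint_char_unique[OF M N I])
  fix b
  have c: "(CLINT \<omega>|K. iexp (\<Sum>i\<in>I. b i * Z i \<omega>)) = complex_of_real (exp (- (\<Sum>i\<in>I. \<Sum>j\<in>I. b i * b j * C i j) / 2))"
    if "gvec K I Z C" for K :: "'z measure" and Z
  proof -
    have g: "cgauss K (\<lambda>\<omega>. \<Sum>i\<in>I. b i * Z i \<omega>) (\<Sum>i\<in>I. \<Sum>j\<in>I. b i * b j * C i j)" using that unfolding gvec_def by blast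
    have [measurable]: "(\<lambda>\<omega>. \<Sum>i\<in>I. b i * Z i \<omega>) \<in> borel_measurable K" using g by (simp add: cgauss_def)
    have "char (distr K borel (\<lambda>\<omega>. \<Sum>i\<in>I. b i * Z i \<omega>)) 1 = (CLINT \<omega>|K. iexp (1 * (\<Sum>i\<in>I. b i * Z i \<omega>)))"
      unfolding char_def by (rule integral_distr) simp_all
    then show ?thesis using g by (simp add: cgauss_def)
  qed
  show "(CLINT \<omega>|M. iexp (\<Sum>i\<in>I. b i * X i \<omega>)) = (CLINT \<omega>|N. iexp (\<Sum>i\<in>I. b i * Y i \<omega>))"
    unfolding c[OF X] c[OF Y] ..
qed (use gvec_measurable[OF X I] gvec_measurable[OF Y I] A in auto)

text \<open>The law of a Gaussian vector, and hence the probability that some coordinate exceeds \<open>l\<close>, depends on the covariance matrix only.\<close>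

lemma gvec_exceed:
  assumes M: "prob_space M" and N: "prob_space N" and I: "finite I" and X: "gvec M I X C" and Y: "gvec N I Y C"
  shows "\<P>(\<omega> in M. \<exists>i\<in>I. X i \<omega> > l) = \<P>(\<omega> in N. \<exists>i\<in>I. Y i \<omega> > l)"
proof -
  have c: "\<P>(\<omega> in K. \<exists>i\<in>I. Z i \<omega> > l) = 1 - \<P>(\<omega> in K. \<forall>i\<in>I. Z i \<omega> \<in> {..l})"
    if K: "prob_space K" and Z: "gvec K I Z C" for K :: "'z measure" and Z
  proof -
    interpret K: prob_space K by fact
    have [measurable]: "i \<in> I \<Longrightarrow> Z i \<in> borel_measurable K" for i by (rule gvec_measurable[OF Z I])
    have "{\<omega> \<in> space K. \<forall>i\<in>I. Z i \<omega> \<in> {..l}} \<in> K.events" using I by (intro sets.sets_Collect_finite_All) auto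
    then have "K.prob (space K - {\<omega> \<in> space K. \<forall>i\<in>I. Z i \<omega> \<in> {..l}}) = 1 - \<P>(\<omega> in K. \<forall>i\<in>I. Z i \<omega> \<in> {..l})"
      by (rule K.prob_compl)
    also have "space K - {\<omega> \<in> space K. \<forall>i\<in>I. Z i \<omega> \<in> {..l}} = {\<omega> \<in> space K. \<exists>i\<in>I. Z i \<omega> > l}" by (auto simp: not_le)
    finally show ?thesis .
  qed
  show ?thesis unfolding c[OF M X] c[OF N Y]
    using gvec_event[OF M N I X Y, of "\<lambda>_. {..l}"] by simp
qed

lemma gvec_linear:
  assumes X: "gvec M I X C"
  shows "gvec M J (\<lambda>i \<omega>. \<Sum>k\<in>I. T i k * X k \<omega>) (\<lambda>i j. \<Sum>k\<in>I. \<Sum>l\<in>I. T i k * T j l * C k l)"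
  unfolding gvec_def
proof
  fix b
  define a where "a = (\<lambda>k. \<Sum>i\<in>J. b i * T i k)"
  have "(\<Sum>i\<in>J. b i * (\<Sum>k\<in>I. T i k * X k \<omega>)) = (\<Sum>k\<in>I. a k * X k \<omega>)" for \<omega>
  proof -
    have "(\<Sum>i\<in>J. b i * (\<Sum>k\<in>I. T i k * X k \<omega>)) = (\<Sum>i\<in>J. \<Sum>k\<in>I. b i * T i k * X k \<omega>)" by (simp only: sum_distrib_left mult.assoc)
    also have "\<dots> = (\<Sum>k\<in>I. \<Sum>i\<in>J. b i * T i k * X k \<omega>)" by (rule sum.swap)
    finally show ?thesis unfolding a_def by (simp only: sum_distrib_right)
  qed
  moreover have "(\<Sum>i\<in>J. \<Sum>j\<in>J. b i * b j * (\<Sum>k\<in>I. \<Sum>l\<in>I. T i k * T j l * C k l)) = (\<Sum>k\<in>I. \<Sum>l\<in>I. a k * a l * C k l)"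
  proof -
    have "(\<Sum>i\<in>J. \<Sum>j\<in>J. b i * b j * (\<Sum>k\<in>I. \<Sum>l\<in>I. T i k * T j l * C k l)) = (\<Sum>i\<in>J. \<Sum>j\<in>J. \<Sum>k\<in>I. \<Sum>l\<in>I. (b i * T i k) * (b j * T j l) * C k l)"
      by (simp only: sum_distrib_left mult_ac)
    also have "\<dots> = (\<Sum>i\<in>J. \<Sum>k\<in>I. \<Sum>j\<in>J. \<Sum>l\<in>I. (b i * T i k) * (b j * T j l) * C k l)"
      by (rule sum.cong[OF refl], rule sum.swap)
    also have "\<dots> = (\<Sum>k\<in>I. \<Sum>i\<in>J. \<Sum>j\<in>J. \<Sum>l\<in>I. (b i * T i k) * (b j * T j l) * C k l)"
      by (rule sum.swap)
    also have "\<dots> = (\<Sum>k\<in>I. \<Sum>i\<in>J. \<Sum>l\<in>I. \<Sum>j\<in>J. (b i * T i k) * (b j * T j l) * C k l)"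
      by (rule sum.cong[OF refl], rule sum.cong[OF refl], rule sum.swap)
    also have "\<dots> = (\<Sum>k\<in>I. \<Sum>l\<in>I. \<Sum>i\<in>J. \<Sum>j\<in>J. (b i * T i k) * (b j * T j l) * C k l)"
      by (rule sum.cong[OF refl], rule sum.swap)
    also have "\<dots> = (\<Sum>k\<in>I. \<Sum>l\<in>I. a k * a l * C k l)"
      unfolding a_def by (rule sum.cong[OF refl], rule sum.cong[OF refl], subst sum_product, simp only: sum_distrib_right)
    finally show ?thesis .
  qed
  ultimately show "cgauss M (\<lambda>\<omega>. \<Sum>i\<in>J. b i * (\<Sum>k\<in>I. T i k * X k \<omega>)) (\<Sum>i\<in>J. \<Sum>j\<in>J. b i * b j * (\<Sum>k\<in>I. \<Sum>l\<in>I. T i k * T j l * C k l))"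
    using X unfolding gvec_def by simp
qed

lemma gvec_scale:
  assumes X: "gvec M I X C" shows "gvec M I (\<lambda>i \<omega>. s * X i \<omega>) (\<lambda>i j. s\<^sup>2 * C i j)"
  unfolding gvec_def
proof
  fix b
  have "cgauss M (\<lambda>\<omega>. \<Sum>i\<in>I. (b i * s) * X i \<omega>) (\<Sum>i\<in>I. \<Sum>j\<in>I. (b i * s) * (b j * s) * C i j)"
    using X[unfolded gvec_def, THEN spec, of "\<lambda>i. b i * s"] .
  moreover have "(\<Sum>i\<in>I. \<Sum>j\<in>I. (b i * s) * (b j * s) * C i j) = (\<Sum>i\<in>I. \<Sum>j\<in>I. b i * b j * (s\<^sup>2 * C i j))"
    by (intro sum.cong refl) (simp add: power2_eq_square)
  ultimately show "cgauss M (\<lambda>\<omega>. \<Sum>i\<in>I. b i * (s * X i \<omega>)) (\<Sum>i\<in>I. \<Sum>j\<in>I. b i * b j * (s\<^sup>2 * C i j))"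
    by (simp only: mult.assoc)
qed

lemma cgauss_pair_add:
  assumes M: "prob_space M" and N: "prob_space N" and X: "cgauss M X v" and Y: "cgauss N Y w"
  shows "cgauss (M \<Otimes>\<^sub>M N) (\<lambda>z. X (fst z) + Y (snd z)) (v + w)"
proof -
  interpret M: prob_space M by fact
  interpret N: prob_space N by fact
  interpret P: pair_prob_space M N ..
  have [measurable]: "X \<in> borel_measurable M" "Y \<in> borel_measurable N" using X Y by (auto simp: cgauss_def)
  have "char (distr (M \<Otimes>\<^sub>M N) borel (\<lambda>z. X (fst z) + Y (snd z))) \<theta> = complex_of_real (exp (- ((v + w) * \<theta>\<^sup>2) / 2))" for \<theta>
  proof -
    have "char (distr (M \<Otimes>\<^sub>M N) borel (\<lambda>z. X (fst z) + Y (snd z))) \<theta> = (CLINT z|M \<Otimes>\<^sub>M N. iexp (\<theta> * (X (fst z) + Y (snd z))))"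
      unfolding char_def by (rule integral_distr) simp_all
    also have "\<dots> = (CLINT x|M. CLINT y|N. iexp (\<theta> * (X (fst (x, y)) + Y (snd (x, y)))))"
      by (rule P.integral_fst'[symmetric], rule P.integrable_const_bound[where B=1]) auto
    also have "\<dots> = (CLINT x|M. CLINT y|N. iexp (\<theta> * X x) * iexp (\<theta> * Y y))"
      by (simp add: distrib_left exp_add)
    also have "\<dots> = (CLINT x|M. iexp (\<theta> * X x)) * (CLINT y|N. iexp (\<theta> * Y y))" by simp
    also have "(CLINT x|M. iexp (\<theta> * X x)) = char (distr M borel X) \<theta>" unfolding char_def by (rule integral_distr[symmetric]) simp_all
    also have "(CLINT x|N. iexp (\<theta> * Y x)) = char (distr N borel Y) \<theta>" unfolding char_def by (rule integral_distr[symmetric]) simp_all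
    also have "char (distr M borel X) \<theta> * char (distr N borel Y) \<theta> = complex_of_real (exp (- (v * \<theta>\<^sup>2) / 2) * exp (- (w * \<theta>\<^sup>2) / 2))"
      using X Y unfolding cgauss_def by (simp only: of_real_mult)
    also have "exp (- (v * \<theta>\<^sup>2) / 2) * exp (- (w * \<theta>\<^sup>2) / 2) = exp (- ((v + w) * \<theta>\<^sup>2) / 2)"
      by (simp only: exp_add[symmetric]) (simp add: field_simps)
    finally show ?thesis .
  qed
  then show ?thesis using X Y by (simp add: cgauss_def)
qed

lemma gvec_pair_add:
  assumes M: "prob_space M" and N: "prob_space N" and X: "gvec M I X C" and Y: "gvec N I Y D"
  shows "gvec (M \<Otimes>\<^sub>M N) I (\<lambda>i z. X i (fst z) + Y i (snd z)) (\<lambda>i j. C i j + D i j)"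
  unfolding gvec_def
proof
  fix b
  have "cgauss (M \<Otimes>\<^sub>M N) (\<lambda>z. (\<Sum>i\<in>I. b i * X i (fst z)) + (\<Sum>i\<in>I. b i * Y i (snd z))) ((\<Sum>i\<in>I. \<Sum>j\<in>I. b i * b j * C i j) + (\<Sum>i\<in>I. \<Sum>j\<in>I. b i * b j * D i j))"
    using X Y unfolding gvec_def by (intro cgauss_pair_add[OF M N]) auto
  then show "cgauss (M \<Otimes>\<^sub>M N) (\<lambda>z. \<Sum>i\<in>I. b i * (X i (fst z) + Y i (snd z))) (\<Sum>i\<in>I. \<Sum>j\<in>I. b i * b j * (C i j + D i j))"
    by (simp only: distrib_left sum.distrib)
qed

lemma gvec_column: "gvec stdn I (\<lambda>i z. u i * z) (\<lambda>i j. u i * u j)"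
  unfolding gvec_def cgauss_def
proof (intro allI conjI)
  fix b \<theta>
  have f: "(\<lambda>z. \<Sum>i\<in>I. b i * (u i * z)) = (\<lambda>z. (\<Sum>i\<in>I. b i * u i) * z)" by (simp add: sum_distrib_right mult.assoc)
  have v: "(\<Sum>i\<in>I. \<Sum>j\<in>I. b i * b j * (u i * u j)) = (\<Sum>i\<in>I. b i * u i)\<^sup>2" by (simp add: power2_eq_square sum_product mult_ac)
  show "(\<lambda>z. \<Sum>i\<in>I. b i * (u i * z)) \<in> borel_measurable stdn" by simp
  show "0 \<le> (\<Sum>i\<in>I. \<Sum>j\<in>I. b i * b j * (u i * u j))" unfolding v by simp
  show "char (distr stdn borel (\<lambda>z. \<Sum>i\<in>I. b i * (u i * z))) \<theta> = complex_of_real (exp (- ((\<Sum>i\<in>I. \<Sum>j\<in>I. b i * b j * (u i * u j)) * \<theta>\<^sup>2) / 2))"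
    unfolding f v by (rule char_stdn_scale)
qed

text \<open>An inexhaustible supply of independent standard normal variables.\<close>

definition iidn :: "(nat \<Rightarrow> real) measure" where "iidn = PiM UNIV (\<lambda>_. stdn)"

lemma prob_iidn: "prob_space iidn" unfolding iidn_def by (intro prob_space_PiM prob_stdn)

lemma gvec_iid: assumes K: "finite K" shows "gvec iidn K (\<lambda>k w. w k) (\<lambda>k l. of_bool (k = l))"
  unfolding gvec_def
proof
  fix b :: "nat \<Rightarrow> real"
  interpret N: prob_space stdn by (rule prob_stdn)
  interpret W: prob_space iidn by (rule prob_iidn)
  interpret PP: product_prob_space "\<lambda>_::nat. stdn" UNIV by unfold_locales
  have coord [measurable]: "(\<lambda>w. w k) \<in> borel_measurable iidn" for k
  proof -
    have "(\<lambda>w. w k) \<in> measurable iidn stdn" unfolding iidn_def by (rule measurable_component_singleton) simp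
    then show ?thesis by (simp add: measurable_def)
  qed
  have law: "distr iidn borel (\<lambda>w. w k) = distr stdn borel (\<lambda>z. z)" for k
  proof -
    have "distr iidn stdn (\<lambda>w. w k) = stdn" unfolding iidn_def by (rule PP.PiM_component) simp
    then have "distr (distr iidn stdn (\<lambda>w. w k)) borel (\<lambda>z. z) = distr stdn borel (\<lambda>z. z)" by simp
    moreover have "distr (distr iidn stdn (\<lambda>w. w k)) borel (\<lambda>z. z) = distr iidn borel (\<lambda>w. w k)"
      by (subst distr_distr) (auto simp: comp_def)
    ultimately show ?thesis by simp
  qed
  have "W.indep_vars (\<lambda>_. borel) (\<lambda>k w. b k * w k) K"
  proof (cases "K = {}")
    case False
    have "distr iidn (PiM K (\<lambda>_. stdn)) (\<lambda>w. \<lambda>k\<in>K. w k) = PiM K (\<lambda>_. stdn)"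
      using PP.distr_PiM_restrict_finite[OF K] by (simp add: iidn_def restrict_def)
    also have "PiM K (\<lambda>_. stdn) = PiM K (\<lambda>k. distr iidn stdn (\<lambda>w. w k))"
      by (intro PiM_cong) (simp_all add: iidn_def PP.PiM_component)
    finally have "W.indep_vars (\<lambda>_. stdn) (\<lambda>k w. w k) K"
      using coord by (subst W.indep_vars_iff_distr_eq_PiM'[OF False]) (auto simp: measurable_def)
    then show ?thesis by (rule W.indep_vars_compose2) simp
  qed (simp add: W.indep_vars_def W.indep_sets_def)
  then have "char (distr iidn borel (\<lambda>w. \<Sum>k\<in>K. b k * w k)) \<theta> = (\<Prod>k\<in>K. char (distr iidn borel (\<lambda>w. b k * w k)) \<theta>)" for \<theta>
    by (rule W.char_distr_sum)
  also have "(\<Prod>k\<in>K. char (distr iidn borel (\<lambda>w. b k * w k)) \<theta>) = (\<Prod>k\<in>K. complex_of_real (exp (- ((b k)\<^sup>2 * \<theta>\<^sup>2) / 2)))" for \<theta>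
  proof (intro prod.cong refl)
    fix k
    have "char (distr iidn borel (\<lambda>w. b k * w k)) \<theta> = char (distr iidn borel (\<lambda>w. w k)) (b k * \<theta>)" by (rule char_scale) simp
    also have "\<dots> = char (distr stdn borel (\<lambda>z. b k * z)) \<theta>" unfolding law by (rule char_scale[symmetric]) simp
    also have "\<dots> = complex_of_real (exp (- ((b k)\<^sup>2 * \<theta>\<^sup>2) / 2))" by (rule char_stdn_scale)
    finally show "char (distr iidn borel (\<lambda>w. b k * w k)) \<theta> = complex_of_real (exp (- ((b k)\<^sup>2 * \<theta>\<^sup>2) / 2))" .
  qed
  also have "(\<Prod>k\<in>K. complex_of_real (exp (- ((b k)\<^sup>2 * \<theta>\<^sup>2) / 2))) = complex_of_real (exp (- ((\<Sum>k\<in>K. (b k)\<^sup>2) * \<theta>\<^sup>2) / 2))" for \<theta>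
  proof -
    have "(\<Prod>k\<in>K. exp (- ((b k)\<^sup>2 * \<theta>\<^sup>2) / 2)) = exp (\<Sum>k\<in>K. - ((b k)\<^sup>2 * \<theta>\<^sup>2) / 2)" using K by (rule exp_sum[symmetric])
    also have "(\<Sum>k\<in>K. - ((b k)\<^sup>2 * \<theta>\<^sup>2) / 2) = - ((\<Sum>k\<in>K. (b k)\<^sup>2) * \<theta>\<^sup>2) / 2"
      by (simp only: sum_distrib_right sum_negf[symmetric] sum_divide_distrib)
    finally show ?thesis by (simp only: of_real_prod[symmetric])
  qed
  finally have ch: "char (distr iidn borel (\<lambda>w. \<Sum>k\<in>K. b k * w k)) \<theta> = complex_of_real (exp (- ((\<Sum>k\<in>K. (b k)\<^sup>2) * \<theta>\<^sup>2) / 2))" for \<theta> .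
  have "(\<Sum>k\<in>K. \<Sum>l\<in>K. b k * b l * of_bool (k = l)) = (\<Sum>k\<in>K. (b k)\<^sup>2)"
    using K by (intro sum.cong refl) (simp add: of_bool_def if_distrib power2_eq_square cong: if_cong)
  then show "cgauss iidn (\<lambda>w. \<Sum>k\<in>K. b k * w k) (\<Sum>k\<in>K. \<Sum>l\<in>K. b k * b l * of_bool (k = l))"
    unfolding cgauss_def by (auto simp: ch intro!: sum_nonneg)
qed

lemma gvec_columns:
  assumes K: "finite K"
  shows "gvec iidn I (\<lambda>i w. \<Sum>k\<in>K. y k i * w k) (\<lambda>i j. \<Sum>k\<in>K. y k i * y k j)"
proof -
  have "(\<Sum>k\<in>K. \<Sum>l\<in>K. y k i * y l j * of_bool (k = l)) = (\<Sum>k\<in>K. y k i * y k j)" for i j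
    using K by (intro sum.cong refl) (simp add: of_bool_def if_distrib cong: if_cong)
  then show ?thesis using gvec_linear[OF gvec_iid[OF K], of I "\<lambda>i k. y k i"] by simp
qed

text \<open>Levy's inequality for independent increments, expressed by the covariance \<open>v (min i j)\<close>. Reflecting the path after its first
passage at time \<open>k\<close>, that is replacing \<open>V\<^sub>n\<close> by \<open>2V\<^sub>k - V\<^sub>n\<close>, preserves the covariances; and on the first passage event a path
that ends below \<open>l\<close> is reflected to one that ends above \<open>l\<close>.\<close>

lemma gvec_levy:
  fixes n :: nat
  assumes M: "prob_space M" and V: "gvec M {..n} V C" and C: "\<And>i j. i \<le> n \<Longrightarrow> j \<le> n \<Longrightarrow> C i j = v (min i j)"
  shows "\<P>(\<omega> in M. \<exists>i\<in>{..n}. V i \<omega> > l) \<le> 2 * \<P>(\<omega> in M. V n \<omega> > l)"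
proof -
  interpret prob_space M by fact
  have Vm: "V i \<in> borel_measurable M" if "i \<le> n" for i using gvec_measurable[OF V, of i] that by simp
  have Vs: "{\<omega> \<in> space M. V i \<omega> > l} \<in> events" "{\<omega> \<in> space M. V i \<omega> \<le> l} \<in> events" if "i \<le> n" for i
  proof -
    have [measurable]: "V i \<in> borel_measurable M" by (rule Vm[OF that])
    show "{\<omega> \<in> space M. V i \<omega> > l} \<in> events" "{\<omega> \<in> space M. V i \<omega> \<le> l} \<in> events" by measurable
  qed
  define A where "A = (\<lambda>k. {\<omega> \<in> space M. (\<forall>i\<in>{..<k}. V i \<omega> \<le> l) \<and> V k \<omega> > l})"
  have Am: "A k \<in> events" if "k \<le> n" for k
  proof -
    have "{\<omega> \<in> space M. \<forall>i\<in>{..<k}. V i \<omega> \<le> l} \<in> events"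
      using that by (intro sets.sets_Collect_finite_All Vs) auto
    moreover have "{\<omega> \<in> space M. V k \<omega> > l} \<in> events" using that by (rule Vs)
    ultimately have "{\<omega> \<in> space M. \<forall>i\<in>{..<k}. V i \<omega> \<le> l} \<inter> {\<omega> \<in> space M. V k \<omega> > l} \<in> events" by (rule sets.Int)
    also have "{\<omega> \<in> space M. \<forall>i\<in>{..<k}. V i \<omega> \<le> l} \<inter> {\<omega> \<in> space M. V k \<omega> > l} = A k" by (auto simp: A_def)
    finally show ?thesis .
  qed
  have Bm: "{\<omega> \<in> space M. V n \<omega> > l} \<in> events" by (rule Vs) simp
  have disj: "disjoint_family_on A {..n}"
    unfolding disjoint_family_on_def
  proof (intro ballI impI)
    fix j k :: nat assume "j \<noteq> k"
    then consider "j < k" | "k < j" by linarith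
    then show "A j \<inter> A k = {}" by cases (force simp: A_def)+
  qed
  have half: "prob (A k) \<le> 2 * prob (A k \<inter> {\<omega> \<in> space M. V n \<omega> > l})" if k: "k \<le> n" for k
  proof (cases "k = n")
    case True
    then have "A k \<inter> {\<omega> \<in> space M. V n \<omega> > l} = A k" by (auto simp: A_def)
    then show ?thesis by simp
  next
    case False
    then have kn: "k < n" using k by simp
    define J where "J = {..Suc k}"
    define T1 where "T1 = (\<lambda>i j. if i \<le> k then of_bool (j = i) else of_bool (j = n) :: real)"
    \<comment> \<open>\<open>T1\<close> selects \<open>V\<^sub>0, ..., V\<^sub>k, V\<^sub>n\<close>, and \<open>T2\<close> the same vector with \<open>V\<^sub>n\<close> reflected at \<open>V\<^sub>k\<close>\<close>
    define T2 where "T2 = (\<lambda>i j. if i \<le> k then of_bool (j = i) else 2 * of_bool (j = k) - of_bool (j = n) :: real)"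
    have fin: "finite {..n}" by simp
    have s1: "(\<Sum>j\<in>{..n}. of_bool (j = i) * f j) = f i" if "i \<le> n" for i and f :: "nat \<Rightarrow> real"
    proof -
      have "(\<Sum>j\<in>{..n}. of_bool (j = i) * f j) = (\<Sum>j\<in>{..n}. if j = i then f j else 0)" by (intro sum.cong) auto
      then show ?thesis using that by simp
    qed
    have e1: "(\<Sum>j\<in>{..n}. T1 i j * f j) = (if i \<le> k then f i else f n)" for i and f :: "nat \<Rightarrow> real"
      using kn by (simp add: T1_def s1)
    have e2: "(\<Sum>j\<in>{..n}. T2 i j * f j) = (if i \<le> k then f i else 2 * f k - f n)" for i and f :: "nat \<Rightarrow> real"
      using kn by (simp add: T2_def s1 left_diff_distrib sum_subtractf mult.assoc sum_distrib_left[symmetric])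
    have dbl: "(\<Sum>a\<in>{..n}. \<Sum>c\<in>{..n}. T i a * T j c * C a c) = (\<Sum>a\<in>{..n}. T i a * (\<Sum>c\<in>{..n}. T j c * C a c))" for T :: "nat \<Rightarrow> nat \<Rightarrow> real" and i j
      by (simp only: sum_distrib_left mult.assoc)
    have G1: "gvec M J (\<lambda>i \<omega>. if i \<le> k then V i \<omega> else V n \<omega>) (\<lambda>i j. \<Sum>a\<in>{..n}. \<Sum>c\<in>{..n}. T1 i a * T1 j c * C a c)"
      using gvec_linear[OF V, of J T1] by (simp only: e1)
    have G2: "gvec M J (\<lambda>i \<omega>. if i \<le> k then V i \<omega> else 2 * V k \<omega> - V n \<omega>) (\<lambda>i j. \<Sum>a\<in>{..n}. \<Sum>c\<in>{..n}. T2 i a * T2 j c * C a c)"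
      using gvec_linear[OF V, of J T2] by (simp only: e2)
    have "gvec M J (\<lambda>i \<omega>. if i \<le> k then V i \<omega> else 2 * V k \<omega> - V n \<omega>) (\<lambda>i j. \<Sum>a\<in>{..n}. \<Sum>c\<in>{..n}. T1 i a * T1 j c * C a c)"
    proof (rule gvec_cong[OF G2])
      fix i j assume "i \<in> J" "j \<in> J"
      then show "(\<Sum>a\<in>{..n}. \<Sum>c\<in>{..n}. T2 i a * T2 j c * C a c) = (\<Sum>a\<in>{..n}. \<Sum>c\<in>{..n}. T1 i a * T1 j c * C a c)"
        unfolding dbl e1 e2 using kn by (auto simp: C J_def min_def)
    qed
    note G2 = this
    define B where "B = (\<lambda>i. if i < k then {..l} else if i = k then {l<..} else {..l})"
    have eqp: "\<P>(\<omega> in M. \<forall>i\<in>J. (if i \<le> k then V i \<omega> else V n \<omega>) \<in> B i) = \<P>(\<omega> in M. \<forall>i\<in>J. (if i \<le> k then V i \<omega> else 2 * V k \<omega> - V n \<omega>) \<in> B i)"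
      by (rule gvec_event[OF M M _ G1 G2]) (auto simp: J_def B_def)
    have J: "(\<forall>i\<in>J. (if i \<le> k then V i \<omega> else z) \<in> B i) \<longleftrightarrow> (\<forall>i\<in>{..<k}. V i \<omega> \<le> l) \<and> V k \<omega> > l \<and> z \<le> l" for \<omega> z
    proof -
      have "J = insert (Suc k) (insert k {..<k})" unfolding J_def by auto
      then show ?thesis by (auto simp: B_def)
    qed
    have "prob (A k - {\<omega> \<in> space M. V n \<omega> > l}) = \<P>(\<omega> in M. (\<forall>i\<in>{..<k}. V i \<omega> \<le> l) \<and> V k \<omega> > l \<and> V n \<omega> \<le> l)"
      by (intro arg_cong[where f=prob]) (auto simp: A_def)
    also have "\<dots> = \<P>(\<omega> in M. (\<forall>i\<in>{..<k}. V i \<omega> \<le> l) \<and> V k \<omega> > l \<and> 2 * V k \<omega> - V n \<omega> \<le> l)"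
      using eqp unfolding J .
    also have "\<dots> \<le> prob (A k \<inter> {\<omega> \<in> space M. V n \<omega> > l})"
      using Am[OF k] Bm by (intro finite_measure_mono) (auto simp: A_def)
    finally have "prob (A k - {\<omega> \<in> space M. V n \<omega> > l}) \<le> prob (A k \<inter> {\<omega> \<in> space M. V n \<omega> > l})" .
    moreover have "prob (A k) = prob (A k \<inter> {\<omega> \<in> space M. V n \<omega> > l}) + prob (A k - {\<omega> \<in> space M. V n \<omega> > l})"
      using Am[OF k] Bm by (subst finite_measure_Union[symmetric]) (auto simp: Int_Diff_Un)
    ultimately show ?thesis by simp
  qed
  have "{\<omega> \<in> space M. \<exists>i\<in>{..n}. V i \<omega> > l} = (\<Union>k\<le>n. A k)"
  proof (intro set_eqI iffI)
    fix \<omega> assume w: "\<omega> \<in> {\<omega> \<in> space M. \<exists>i\<in>{..n}. V i \<omega> > l}"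
    define k where "k = (LEAST i. V i \<omega> > l)"
    obtain i where i: "i \<le> n" "V i \<omega> > l" using w by auto
    have "V k \<omega> > l" unfolding k_def by (rule LeastI[of _ i]) (rule i(2))
    moreover have "k \<le> i" unfolding k_def by (rule Least_le) (rule i(2))
    moreover have "V j \<omega> \<le> l" if "j < k" for j using not_less_Least[of j "\<lambda>i. V i \<omega> > l"] that unfolding k_def by (simp add: not_less)
    ultimately have "k \<le> n" "\<omega> \<in> A k" using w i by (auto simp: A_def)
    then show "\<omega> \<in> (\<Union>k\<le>n. A k)" by blast
  qed (auto simp: A_def)
  then have "\<P>(\<omega> in M. \<exists>i\<in>{..n}. V i \<omega> > l) = (\<Sum>k\<le>n. prob (A k))"
    using Am disj finite_measure_finite_Union[of "{..n}" A] by (simp add: image_subset_iff)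
  also have "\<dots> \<le> (\<Sum>k\<le>n. 2 * prob (A k \<inter> {\<omega> \<in> space M. V n \<omega> > l}))" by (intro sum_mono half) simp
  also have "\<dots> = 2 * prob (\<Union>k\<le>n. A k \<inter> {\<omega> \<in> space M. V n \<omega> > l})"
    unfolding sum_distrib_left[symmetric]
  proof (subst finite_measure_finite_Union)
    show "(\<lambda>k. A k \<inter> {\<omega> \<in> space M. V n \<omega> > l}) ` {..n} \<subseteq> events" using sets.Int[OF Am Bm] by auto
    show "disjoint_family_on (\<lambda>k. A k \<inter> {\<omega> \<in> space M. V n \<omega> > l}) {..n}"
      using disj unfolding disjoint_family_on_def by blast
  qed simp_all
  also have "\<dots> \<le> 2 * \<P>(\<omega> in M. V n \<omega> > l)" using Bm by (intro mult_left_mono finite_measure_mono) auto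
  finally show ?thesis .
qed

text \<open>The sets \<open>{z. t i < u i * z}\<close> are upward closed, hence form a chain, and a finite union of a chain is one of its members.\<close>

lemma stdn_exceed_single:
  fixes t u :: "'i \<Rightarrow> real"
  assumes I: "finite I" "I \<noteq> {}" and u: "\<And>i. i \<in> I \<Longrightarrow> 0 \<le> u i"
  shows "\<exists>k\<in>I. {z. \<exists>i\<in>I. t i < u i * z} = {z :: real. t k < u k * z}"
  using assms
proof (induction I rule: finite_ne_induct)
  case (insert x F)
  then obtain k where k: "k \<in> F" "{z. \<exists>i\<in>F. t i < u i * z} = {z. t k < u k * z}" by auto
  have U: "{z. \<exists>i\<in>insert x F. t i < u i * z} = {z. t x < u x * z} \<union> {z. t k < u k * z}" using k(2) by auto
  have up: "t i < u i * y" if "t i < u i * z" "z \<le> y" "i \<in> insert x F" for i y z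
    using that insert.prems mult_left_mono[of z y "u i"] by (meson less_le_trans)
  have "{z. t x < u x * z} \<subseteq> {z. t k < u k * z} \<or> {z. t k < u k * z} \<subseteq> {z. t x < u x * z}"
  proof (rule ccontr)
    assume "\<not> ?thesis"
    then obtain y z where "t x < u x * y" "\<not> t k < u k * y" "t k < u k * z" "\<not> t x < u x * z" by auto
    then show False using up[of x y z] up[of k z y] k(1) by (cases "y \<le> z") auto
  qed
  then show ?case unfolding U using k(1) by (auto simp: Un_absorb1 Un_absorb2)
qed auto

text \<open>Condition on \<open>X\<close>. On the left, all coordinates are nondecreasing functions of one variable, so some coordinate is above \<open>l\<close>
precisely when one particular coordinate is; that coordinate has the same law on the right.\<close>

lemma gvec_column_le:
  assumes M: "prob_space M" and N: "prob_space N" and I: "finite I"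
    and X: "gvec M I X C" and D: "gvec N I Y D" and u: "\<And>i. i \<in> I \<Longrightarrow> 0 \<le> u i" "\<And>i. i \<in> I \<Longrightarrow> D i i = (u i)\<^sup>2"
  shows "\<P>(z in M \<Otimes>\<^sub>M stdn. \<exists>i\<in>I. X i (fst z) + u i * snd z > l)
    \<le> \<P>(z in M \<Otimes>\<^sub>M N. \<exists>i\<in>I. X i (fst z) + Y i (snd z) > l)"
proof (cases "I = {}")
  case False
  interpret M: prob_space M by fact
  interpret N: prob_space N by fact
  interpret S: prob_space stdn by (rule prob_stdn)
  interpret MN: pair_prob_space M N ..
  interpret MS: pair_prob_space M stdn ..
  have Xm: "X i \<in> borel_measurable M" if "i \<in> I" for i by (rule gvec_measurable[OF X I that])
  have Ym: "Y i \<in> borel_measurable N" if "i \<in> I" for i by (rule gvec_measurable[OF D I that])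
  let ?A = "{z \<in> space (M \<Otimes>\<^sub>M stdn). \<exists>i\<in>I. X i (fst z) + u i * snd z > l}"
  let ?B = "{z \<in> space (M \<Otimes>\<^sub>M N). \<exists>i\<in>I. X i (fst z) + Y i (snd z) > l}"
  have Am: "?A \<in> sets (M \<Otimes>\<^sub>M stdn)"
  proof (rule sets.sets_Collect_finite_Ex[OF _ I])
    fix i assume "i \<in> I"
    then have [measurable]: "X i \<in> borel_measurable M" by (rule Xm)
    show "{z \<in> space (M \<Otimes>\<^sub>M stdn). X i (fst z) + u i * snd z > l} \<in> sets (M \<Otimes>\<^sub>M stdn)" by measurable
  qed
  have Bm: "?B \<in> sets (M \<Otimes>\<^sub>M N)"
  proof (rule sets.sets_Collect_finite_Ex[OF _ I])
    fix i assume "i \<in> I"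
    then have [measurable]: "X i \<in> borel_measurable M" "Y i \<in> borel_measurable N" by (fact Xm, fact Ym)
    show "{z \<in> space (M \<Otimes>\<^sub>M N). X i (fst z) + Y i (snd z) > l} \<in> sets (M \<Otimes>\<^sub>M N)" by measurable
  qed
  have "emeasure (M \<Otimes>\<^sub>M stdn) ?A = (\<integral>\<^sup>+\<omega>. emeasure stdn (Pair \<omega> -` ?A) \<partial>M)"
    by (rule S.emeasure_pair_measure_alt[OF Am])
  also have "\<dots> \<le> (\<integral>\<^sup>+\<omega>. emeasure N (Pair \<omega> -` ?B) \<partial>M)"
  proof (rule nn_integral_mono)
    fix \<omega> assume w: "\<omega> \<in> space M"
    have "Pair \<omega> -` ?A = {z. \<exists>i\<in>I. l - X i \<omega> < u i * z}"
      using w by (auto simp: space_pair_measure algebra_simps)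
    also obtain k where k: "k \<in> I" "{z. \<exists>i\<in>I. l - X i \<omega> < u i * z} = {z. l - X k \<omega> < u k * z}"
      using stdn_exceed_single[where u=u and t="\<lambda>i. l - X i \<omega>", OF I False u(1)] by auto
    note k(2)
    finally have PA: "Pair \<omega> -` ?A = {z. l - X k \<omega> < u k * z}" .
    have "\<P>(\<omega>' in N. Y k \<omega>' \<in> {l - X k \<omega><..}) = measure stdn {z. sqrt (D k k) * z \<in> {l - X k \<omega><..}}"
      by (rule N.cgauss_prob[OF gvec_coord[OF D I k(1)]]) simp
    then have "measure stdn (Pair \<omega> -` ?A) = \<P>(\<omega>' in N. Y k \<omega>' > l - X k \<omega>)"
      unfolding PA using u k(1) by simp
    also have "\<dots> \<le> N.prob (Pair \<omega> -` ?B)"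
    proof (rule N.finite_measure_mono)
      show "{\<omega>' \<in> space N. Y k \<omega>' > l - X k \<omega>} \<subseteq> Pair \<omega> -` ?B"
        using w k(1) by (fastforce simp: space_pair_measure algebra_simps)
      show "Pair \<omega> -` ?B \<in> N.events" by (rule sets_Pair1[OF Bm])
    qed
    finally show "emeasure stdn (Pair \<omega> -` ?A) \<le> emeasure N (Pair \<omega> -` ?B)"
      by (simp add: S.emeasure_eq_measure N.emeasure_eq_measure)
  qed
  also have "\<dots> = emeasure (M \<Otimes>\<^sub>M N) ?B" by (rule N.emeasure_pair_measure_alt[OF Bm, symmetric])
  finally show ?thesis by (simp add: MS.emeasure_eq_measure MN.emeasure_eq_measure)
qed simp

section \<open>Slepian comparison\<close>

text \<open>Covariance matrices that can be realised from the vector at hand and independent normal variables. The cone need not contain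
all positive semidefinite matrices, but it contains those met in the comparison below.\<close>

definition cov_cone :: "'i set \<Rightarrow> ('i \<Rightarrow> 'i \<Rightarrow> real) \<Rightarrow> ('i \<Rightarrow> 'i \<Rightarrow> real) set" where
  "cov_cone I CX = {C. \<exists>a\<ge>0. \<exists>(n::nat) y. \<forall>i\<in>I. \<forall>j\<in>I. C i j = a * CX i j + (\<Sum>k<n. y k i * y k j)}"

lemma cone_scale: "0 \<le> a \<Longrightarrow> (\<lambda>i j. a * CX i j) \<in> cov_cone I CX"
  unfolding cov_cone_def by (intro CollectI exI[of _ a] conjI exI[of _ 0]) auto

lemma cone_cong: "C \<in> cov_cone I CX \<Longrightarrow> (\<And>i j. i \<in> I \<Longrightarrow> j \<in> I \<Longrightarrow> D i j = C i j) \<Longrightarrow> D \<in> cov_cone I CX"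
  unfolding cov_cone_def by fastforce

lemma cone_add_column:
  assumes "C \<in> cov_cone I CX" shows "(\<lambda>i j. C i j + u i * u j) \<in> cov_cone I CX"
proof -
  obtain a and n :: nat and y where a: "a \<ge> 0" "\<And>i j. i \<in> I \<Longrightarrow> j \<in> I \<Longrightarrow> C i j = a * CX i j + (\<Sum>k<n. y k i * y k j)"
    using assms unfolding cov_cone_def by blast
  show ?thesis
    unfolding cov_cone_def
    by (intro CollectI exI[of _ a] conjI a(1) exI[of _ "Suc n"] exI[of _ "\<lambda>k. if k = n then u else y k"]) (simp add: a(2))
qed

lemma cone_add_columns:
  assumes "finite K" "C \<in> cov_cone I CX" shows "(\<lambda>i j. C i j + (\<Sum>k\<in>K. u k i * u k j)) \<in> cov_cone I CX"
  using assms(1)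
proof (induction K rule: finite_induct)
  case (insert k K)
  have "(\<lambda>i j. (C i j + (\<Sum>k\<in>K. u k i * u k j)) + u k i * u k j) \<in> cov_cone I CX" by (rule cone_add_column[OF insert.IH])
  moreover have "(\<lambda>i j. C i j + (\<Sum>k\<in>insert k K. u k i * u k j)) = (\<lambda>i j. (C i j + (\<Sum>k\<in>K. u k i * u k j)) + u k i * u k j)"
    using insert.hyps by (simp add: add_ac)
  ultimately show ?case by simp
qed (use assms in simp)

locale gauss_cone = prob_space M for M :: "'a measure" +
  fixes I :: "'i set" and X :: "'i \<Rightarrow> 'a \<Rightarrow> real" and CX :: "'i \<Rightarrow> 'i \<Rightarrow> real"
  assumes I: "finite I" and X: "gvec M I X CX"
begin

abbreviation "\<Omega> \<equiv> M \<Otimes>\<^sub>M iidn"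

lemma prob_\<Omega>: "prob_space \<Omega>"
proof -
  interpret W: prob_space iidn by (rule prob_iidn)
  interpret P: pair_prob_space M iidn ..
  show ?thesis by unfold_locales
qed

lemma cone_realised:
  assumes "C \<in> cov_cone I CX" shows "\<exists>V. gvec \<Omega> I V C"
proof -
  obtain a and n :: nat and y where a: "a \<ge> 0" "\<And>i j. i \<in> I \<Longrightarrow> j \<in> I \<Longrightarrow> C i j = a * CX i j + (\<Sum>k<n. y k i * y k j)"
    using assms unfolding cov_cone_def by blast
  have "gvec \<Omega> I (\<lambda>i z. sqrt a * X i (fst z) + (\<Sum>k<n. y k i * snd z k)) (\<lambda>i j. (sqrt a)\<^sup>2 * CX i j + (\<Sum>k<n. y k i * y k j))"
    by (rule gvec_pair_add[OF prob_space_axioms prob_iidn gvec_scale[OF X] gvec_columns]) simp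
  then have "gvec \<Omega> I (\<lambda>i z. sqrt a * X i (fst z) + (\<Sum>k<n. y k i * snd z k)) C"
    by (rule gvec_cong) (simp add: a)
  then show ?thesis by blast
qed

text \<open>Any realisation of \<open>C\<close> gives the same value, see \<open>exceed_eq\<close>.\<close>

definition exceed :: "real \<Rightarrow> ('i \<Rightarrow> 'i \<Rightarrow> real) \<Rightarrow> real" where
  "exceed l C = \<P>(\<omega> in \<Omega>. \<exists>i\<in>I. (SOME V. gvec \<Omega> I V C) i \<omega> > l)"

lemma exceed_eq:
  assumes C: "C \<in> cov_cone I CX" and N: "prob_space N" and Y: "gvec N I Y C"
  shows "\<P>(\<omega> in N. \<exists>i\<in>I. Y i \<omega> > l) = exceed l C"
  unfolding exceed_def
  by (rule gvec_exceed[OF N prob_\<Omega> I Y]) (rule someI_ex[OF cone_realised[OF C]])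

lemma exceed_cong:
  assumes C: "C \<in> cov_cone I CX" and D: "\<And>i j. i \<in> I \<Longrightarrow> j \<in> I \<Longrightarrow> C i j = D i j"
  shows "exceed l C = exceed l D"
proof -
  obtain V where V: "gvec \<Omega> I V C" using cone_realised[OF C] by blast
  have D': "D \<in> cov_cone I CX" by (rule cone_cong[OF C]) (simp add: D)
  have "gvec \<Omega> I V D" by (rule gvec_cong[OF V D])
  then show ?thesis using exceed_eq[OF C prob_\<Omega> V] exceed_eq[OF D' prob_\<Omega>, of V] by simp
qed

text \<open>Changing signs in a nonnegative column keeps the variances, so that \<open>gvec_column_le\<close> applies.\<close>

lemma exceed_column:
  assumes C: "C \<in> cov_cone I CX" and u: "\<And>i. i \<in> I \<Longrightarrow> 0 \<le> u i" and uv: "\<And>i. i \<in> I \<Longrightarrow> (v i)\<^sup>2 = (u i)\<^sup>2"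
  shows "exceed l (\<lambda>i j. C i j + u i * u j) \<le> exceed l (\<lambda>i j. C i j + v i * v j)"
proof -
  obtain V where V: "gvec \<Omega> I V C" using cone_realised[OF C] by blast
  interpret S: prob_space stdn by (rule prob_stdn)
  interpret O: prob_space \<Omega> by (rule prob_\<Omega>)
  interpret P: pair_prob_space \<Omega> stdn ..
  have P: "prob_space (\<Omega> \<Otimes>\<^sub>M stdn)" by unfold_locales
  have "exceed l (\<lambda>i j. C i j + u i * u j) = \<P>(z in \<Omega> \<Otimes>\<^sub>M stdn. \<exists>i\<in>I. V i (fst z) + u i * snd z > l)"
    by (rule exceed_eq[symmetric, OF cone_add_column[OF C] P gvec_pair_add[OF prob_\<Omega> prob_stdn V gvec_column]])
  also have "\<dots> \<le> \<P>(z in \<Omega> \<Otimes>\<^sub>M stdn. \<exists>i\<in>I. V i (fst z) + v i * snd z > l)"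
    by (rule gvec_column_le[OF prob_\<Omega> prob_stdn I V gvec_column u]) (use uv in \<open>auto simp: power2_eq_square\<close>)
  also have "\<dots> = exceed l (\<lambda>i j. C i j + v i * v j)"
    by (rule exceed_eq[OF cone_add_column[OF C] P gvec_pair_add[OF prob_\<Omega> prob_stdn V gvec_column]])
  finally show ?thesis .
qed

lemma exceed_columns:
  assumes K: "finite K" and C: "C \<in> cov_cone I CX" and u: "\<And>k i. k \<in> K \<Longrightarrow> i \<in> I \<Longrightarrow> 0 \<le> u k i" and uv: "\<And>k i. k \<in> K \<Longrightarrow> i \<in> I \<Longrightarrow> (v k i)\<^sup>2 = (u k i)\<^sup>2"
  shows "exceed l (\<lambda>i j. C i j + (\<Sum>k\<in>K. u k i * u k j)) \<le> exceed l (\<lambda>i j. C i j + (\<Sum>k\<in>K. v k i * v k j))"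
  using K C u uv
proof (induction K arbitrary: C rule: finite_induct)
  case (insert k K)
  have 1: "(\<lambda>i j. C i j + (\<Sum>k\<in>insert k K. w k i * w k j)) = (\<lambda>i j. (C i j + w k i * w k j) + (\<Sum>k\<in>K. w k i * w k j))" for w :: "'b \<Rightarrow> 'i \<Rightarrow> real"
    using insert.hyps by (simp add: add_ac)
  have 2: "(\<lambda>i j. (C i j + s i j) + (\<Sum>k\<in>K. v k i * v k j)) = (\<lambda>i j. (C i j + (\<Sum>k\<in>K. v k i * v k j)) + s i j)" for s by (simp add: add_ac)
  have "exceed l (\<lambda>i j. (C i j + u k i * u k j) + (\<Sum>k\<in>K. u k i * u k j)) \<le> exceed l (\<lambda>i j. (C i j + u k i * u k j) + (\<Sum>k\<in>K. v k i * v k j))"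
    using insert.prems by (intro insert.IH cone_add_column) auto
  also have "\<dots> \<le> exceed l (\<lambda>i j. (C i j + v k i * v k j) + (\<Sum>k\<in>K. v k i * v k j))"
    unfolding 2 using insert by (intro exceed_column cone_add_columns) auto
  finally show ?case unfolding 1 .
qed simp

text \<open>Walk from \<open>CX\<close> to \<open>CY\<close> along the segment in \<open>N\<close> steps. With \<open>\<Delta> = CX - CY \<ge> 0\<close> and \<open>w = \<Delta>/4N\<close>, the matrices \<open>C k\<close> and
\<open>C (k + 1)\<close> arise from a common \<open>B k\<close> by adding \<open>w\<^sub>a\<^sub>b (e\<^sub>a \<plusminus> e\<^sub>b)(e\<^sub>a \<plusminus> e\<^sub>b)\<^sup>T\<close> over all pairs, with the plus and the minus sign
respectively. The matrix \<open>B k\<close> is the midpoint of the step with the diagonal diminished by the row sums of \<open>2w\<close>; for large \<open>N\<close>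
these are smaller than \<open>\<delta>\<close>.\<close>

lemma slepian_regularised:
  assumes K: "finite K" and sym: "\<And>i j. i \<in> I \<Longrightarrow> j \<in> I \<Longrightarrow> CX i j = CX j i"
    and CY: "\<And>i j. i \<in> I \<Longrightarrow> j \<in> I \<Longrightarrow> CY i j = (\<Sum>k\<in>K. y k i * y k j)"
    and diag: "\<And>i. i \<in> I \<Longrightarrow> CX i i = CY i i" and le: "\<And>i j. i \<in> I \<Longrightarrow> j \<in> I \<Longrightarrow> CY i j \<le> CX i j" and \<delta>: "\<delta> > 0"
  shows "exceed l (\<lambda>i j. CX i j + \<delta> * of_bool (i = j)) \<le> exceed l (\<lambda>i j. CY i j + \<delta> * of_bool (i = j))"
proof -
  define \<Delta> where "\<Delta> = (\<lambda>i j. CX i j - CY i j)"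
  have \<Delta>0: "0 \<le> \<Delta> i j" if "i \<in> I" "j \<in> I" for i j using le that by (simp add: \<Delta>_def)
  have \<Delta>d: "\<Delta> i i = 0" if "i \<in> I" for i using diag that by (simp add: \<Delta>_def)
  have \<Delta>s: "\<Delta> i j = \<Delta> j i" if "i \<in> I" "j \<in> I" for i j using sym that CY by (simp add: \<Delta>_def mult.commute)
  define S where "S = (\<Sum>i\<in>I. \<Sum>j\<in>I. \<Delta> i j)"
  have S: "(\<Sum>j\<in>I. \<Delta> i j) \<le> S" if "i \<in> I" for i
    unfolding S_def using that I \<Delta>0 by (intro member_le_sum) (auto intro!: sum_nonneg)
  obtain n :: nat where "S / (2 * \<delta>) < real n" using reals_Archimedean2 by blast
  define N where "N = Suc n"
  have N: "real N > 0" "S / (2 * real N) \<le> \<delta>"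
  proof -
    have "S / (2 * \<delta>) \<le> real N" using \<open>S / (2 * \<delta>) < real n\<close> by (simp add: N_def)
    then show "real N > 0" "S / (2 * real N) \<le> \<delta>" using \<delta> by (auto simp: N_def field_simps)
  qed
  \<comment> \<open>each unordered pair occurs twice in the sum over \<open>I \<times> I\<close>, hence \<open>4\<close> instead of \<open>2\<close>\<close>
  define w where "w = (\<lambda>a b. \<Delta> a b / (4 * real N))"
  define C where "C = (\<lambda>k i j. CX i j - real k / real N * \<Delta> i j + \<delta> * of_bool (i = j))"
  define B where "B = (\<lambda>k i j. CX i j - (real k + 1/2) / real N * \<Delta> i j + (\<delta> - 2 * (\<Sum>b\<in>I. w i b)) * of_bool (i = j))"
  define up where "up = (\<lambda>p i. sqrt (w (fst p) (snd p)) * (of_bool (i = fst p) + of_bool (i = snd p)))"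
  define um where "um = (\<lambda>p i. sqrt (w (fst p) (snd p)) * (of_bool (i = fst p) + (- 1) * of_bool (i = snd p)))"
  have w0: "0 \<le> w a b" if "a \<in> I" "b \<in> I" for a b using \<Delta>0[OF that] by (simp add: w_def)
  have ws: "w a b = w b a" if "a \<in> I" "b \<in> I" for a b using \<Delta>s[OF that] by (simp add: w_def)
  have pick: "(\<Sum>a\<in>I. of_bool (i = a) * f a) = f i" if "i \<in> I" for i and f :: "'i \<Rightarrow> real"
  proof -
    have "(\<Sum>a\<in>I. of_bool (i = a) * f a) = (\<Sum>a\<in>I. if i = a then f a else 0)" by (intro sum.cong) auto
    then show ?thesis using that I by simp
  qed
  have sums: "(\<Sum>p\<in>I \<times> I. (sqrt (w (fst p) (snd p)) * (of_bool (i = fst p) + e * of_bool (i = snd p))) * (sqrt (w (fst p) (snd p)) * (of_bool (j = fst p) + e * of_bool (j = snd p))))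
     = 2 * (\<Sum>b\<in>I. w i b) * of_bool (i = j) + 2 * e * w i j" if ij: "i \<in> I" "j \<in> I" and e: "e * e = 1" for i j and e :: real
  proof -
    have "(\<Sum>p\<in>I \<times> I. (sqrt (w (fst p) (snd p)) * (of_bool (i = fst p) + e * of_bool (i = snd p))) * (sqrt (w (fst p) (snd p)) * (of_bool (j = fst p) + e * of_bool (j = snd p))))
      = (\<Sum>a\<in>I. \<Sum>b\<in>I. of_bool (i = a) * (of_bool (i = j) * w a b) + of_bool (i = b) * (of_bool (i = j) * w a b)
          + (e * (of_bool (i = a) * (of_bool (j = b) * w a b)) + e * (of_bool (j = a) * (of_bool (i = b) * w a b))))"
      unfolding sum.cartesian_product
    proof (intro sum.cong refl, safe)
      fix a b assume "a \<in> I" "b \<in> I"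
      then have s: "sqrt (w a b) * sqrt (w a b) = w a b" using w0 by simp
      have "(sqrt (w a b) * (of_bool (i = a) + e * of_bool (i = b))) * (sqrt (w a b) * (of_bool (j = a) + e * of_bool (j = b)))
         = (sqrt (w a b) * sqrt (w a b)) * (of_bool (i = a) * of_bool (j = a) + e * e * (of_bool (i = b) * of_bool (j = b)) + e * (of_bool (i = a) * of_bool (j = b)) + e * (of_bool (j = a) * of_bool (i = b)))"
        by (simp only: algebra_simps)
      also have "\<dots> = of_bool (i = a) * (of_bool (i = j) * w a b) + of_bool (i = b) * (of_bool (i = j) * w a b)
          + (e * (of_bool (i = a) * (of_bool (j = b) * w a b)) + e * (of_bool (j = a) * (of_bool (i = b) * w a b)))"
        unfolding s e by (auto simp: algebra_simps)
      finally show "(sqrt (w (fst (a, b)) (snd (a, b))) * (of_bool (i = fst (a, b)) + e * of_bool (i = snd (a, b)))) * (sqrt (w (fst (a, b)) (snd (a, b))) * (of_bool (j = fst (a, b)) + e * of_bool (j = snd (a, b)))) =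
          of_bool (i = a) * (of_bool (i = j) * w a b) + of_bool (i = b) * (of_bool (i = j) * w a b) + (e * (of_bool (i = a) * (of_bool (j = b) * w a b)) + e * (of_bool (j = a) * (of_bool (i = b) * w a b)))"
        by simp
    qed
    also have "\<dots> = (\<Sum>b\<in>I. of_bool (i = j) * w i b) + (\<Sum>a\<in>I. of_bool (i = j) * w a i) + (e * w i j + e * w j i)"
      using ij by (simp only: sum.distrib sum_distrib_left[symmetric] pick)
    also have "(\<Sum>a\<in>I. of_bool (i = j) * w a i) = (\<Sum>b\<in>I. of_bool (i = j) * w i b)" using ij by (intro sum.cong) (auto simp: ws)
    also have "w j i = w i j" using ws ij by simp
    finally show ?thesis by (simp add: sum_distrib_left[symmetric])
  qed
  have Ck: "C k i j = B k i j + (\<Sum>p\<in>I \<times> I. up p i * up p j)" if "i \<in> I" "j \<in> I" for k i j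
    unfolding up_def using sums[OF that, of 1] N(1) by (simp add: C_def B_def w_def field_simps)
  have Ck': "C (Suc k) i j = B k i j + (\<Sum>p\<in>I \<times> I. um p i * um p j)" if "i \<in> I" "j \<in> I" for k i j
  proof -
    have e: "(\<Sum>p\<in>I \<times> I. um p i * um p j) = 2 * (\<Sum>b\<in>I. w i b) * of_bool (i = j) + 2 * (- 1) * w i j"
      unfolding um_def by (rule sums[OF that]) simp
    have "real (Suc k) / real N * \<Delta> i j = (real k + 1/2) / real N * \<Delta> i j + 2 * w i j"
      using N(1) by (simp add: w_def field_simps)
    then show ?thesis unfolding C_def B_def e by (simp add: algebra_simps)
  qed
  have Bc: "B k \<in> cov_cone I CX" if k: "k < N" for k
  proof -
    define s where "s = (real k + 1/2) / real N"
    have s: "0 \<le> s" "s \<le> 1" using k by (auto simp: s_def field_simps)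
    define r where "r = (\<lambda>i. \<delta> - 2 * (\<Sum>b\<in>I. w i b))"
    have r: "0 \<le> r i" if "i \<in> I" for i
    proof -
      have "2 * (\<Sum>b\<in>I. w i b) = (\<Sum>b\<in>I. \<Delta> i b) / (2 * real N)" by (simp add: w_def sum_divide_distrib[symmetric])
      also have "\<dots> \<le> S / (2 * real N)" using S[OF that] by (intro divide_right_mono) auto
      finally show ?thesis using N(2) by (simp add: r_def)
    qed
    have "(\<lambda>i j. (1 - s) * CX i j + (\<Sum>k\<in>K. (sqrt s * y k i) * (sqrt s * y k j)) + (\<Sum>a\<in>I. (sqrt (r a) * of_bool (i = a)) * (sqrt (r a) * of_bool (j = a)))) \<in> cov_cone I CX"
      using s by (intro cone_add_columns K I cone_scale) simp
    then show ?thesis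
    proof (rule cone_cong)
      fix i j assume ij: "i \<in> I" "j \<in> I"
      have "(\<Sum>k\<in>K. (sqrt s * y k i) * (sqrt s * y k j)) = s * CY i j"
        unfolding CY[OF ij] sum_distrib_left using s by (intro sum.cong refl) (simp add: mult.left_commute mult.assoc[symmetric])
      moreover have "(\<Sum>a\<in>I. (sqrt (r a) * of_bool (i = a)) * (sqrt (r a) * of_bool (j = a))) = (\<Sum>a\<in>I. of_bool (i = a) * (r a * of_bool (j = a)))"
        using r by (intro sum.cong refl) auto
      ultimately show "B k i j = (1 - s) * CX i j + (\<Sum>k\<in>K. (sqrt s * y k i) * (sqrt s * y k j)) + (\<Sum>a\<in>I. (sqrt (r a) * of_bool (i = a)) * (sqrt (r a) * of_bool (j = a)))"
        unfolding pick[OF ij(1)] B_def s_def[symmetric] \<Delta>_def by (auto simp: algebra_simps r_def)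
    qed
  qed
  have step: "exceed l (C k) \<le> exceed l (C (Suc k))" if k: "k < N" for k
  proof -
    have "exceed l (C k) = exceed l (\<lambda>i j. B k i j + (\<Sum>p\<in>I \<times> I. up p i * up p j))"
      using I by (intro exceed_cong[symmetric] cone_add_columns Bc[OF k]) (auto simp: Ck)
    also have "\<dots> \<le> exceed l (\<lambda>i j. B k i j + (\<Sum>p\<in>I \<times> I. um p i * um p j))"
    proof (rule exceed_columns[OF _ Bc[OF k]])
      fix p i assume p: "p \<in> I \<times> I" "i \<in> I"
      then show "0 \<le> up p i" using w0 by (auto simp: up_def)
      show "(um p i)\<^sup>2 = (up p i)\<^sup>2"
        using p \<Delta>d by (cases "fst p = snd p") (auto simp: um_def up_def w_def power2_eq_square of_bool_def)
    qed (use I in simp)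
    also have "\<dots> = exceed l (C (Suc k))"
      using I by (intro exceed_cong cone_add_columns Bc[OF k]) (auto simp: Ck')
    finally show ?thesis .
  qed
  have "exceed l (C 0) \<le> exceed l (C k)" if "k \<le> N" for k
    using that by (induction k) (use step order_trans in \<open>auto simp: Suc_le_eq\<close>)
  then have "exceed l (C 0) \<le> exceed l (C N)" by simp
  also have "C 0 = (\<lambda>i j. CX i j + \<delta> * of_bool (i = j))" by (simp add: C_def)
  also have "C N = (\<lambda>i j. CY i j + \<delta> * of_bool (i = j))" using N(1) by (simp add: C_def \<Delta>_def)
  finally show ?thesis .
qed

end

section \<open>Maxima of Gaussian vectors with nonnegatively correlated increments\<close>

lemma gtail_le_square: assumes "y > 0" shows "gtail y \<le> 2 / y\<^sup>2"
  using gtail_poly[of y 1] assms by simp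

lemma (in prob_space) exceed_perturb:
  fixes U V :: "'i \<Rightarrow> 'a \<Rightarrow> real"
  assumes I: "finite I" and U: "\<And>i. i \<in> I \<Longrightarrow> U i \<in> borel_measurable M" and V: "\<And>i. i \<in> I \<Longrightarrow> V i \<in> borel_measurable M"
  shows "\<P>(\<omega> in M. \<exists>i\<in>I. U i \<omega> > a) \<le> \<P>(\<omega> in M. \<exists>i\<in>I. V i \<omega> > a - \<eta>) + (\<Sum>i\<in>I. \<P>(\<omega> in M. U i \<omega> - V i \<omega> > \<eta>))"
proof -
  have s: "{\<omega> \<in> space M. V i \<omega> > a - \<eta>} \<in> events" "{\<omega> \<in> space M. U i \<omega> - V i \<omega> > \<eta>} \<in> events" if "i \<in> I" for i
  proof -
    have [measurable]: "U i \<in> borel_measurable M" "V i \<in> borel_measurable M" using U V that by auto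
    show "{\<omega> \<in> space M. V i \<omega> > a - \<eta>} \<in> events" by measurable
    show "{\<omega> \<in> space M. U i \<omega> - V i \<omega> > \<eta>} \<in> events" by measurable
  qed
  have 1: "{\<omega> \<in> space M. \<exists>i\<in>I. V i \<omega> > a - \<eta>} \<in> events" by (intro sets.sets_Collect_finite_Ex I s)
  have 2: "(\<Union>i\<in>I. {\<omega> \<in> space M. U i \<omega> - V i \<omega> > \<eta>}) \<in> events" using s(2) I by (intro sets.finite_UN) auto
  have "\<P>(\<omega> in M. \<exists>i\<in>I. U i \<omega> > a) \<le> prob ({\<omega> \<in> space M. \<exists>i\<in>I. V i \<omega> > a - \<eta>} \<union> (\<Union>i\<in>I. {\<omega> \<in> space M. U i \<omega> - V i \<omega> > \<eta>}))"
  proof (rule finite_measure_mono)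
    show "{\<omega> \<in> space M. \<exists>i\<in>I. U i \<omega> > a} \<subseteq> {\<omega> \<in> space M. \<exists>i\<in>I. V i \<omega> > a - \<eta>} \<union> (\<Union>i\<in>I. {\<omega> \<in> space M. U i \<omega> - V i \<omega> > \<eta>})"
    proof safe
      fix \<omega> i assume w: "\<omega> \<in> space M" "i \<in> I" "a < U i \<omega>" "\<omega> \<notin> (\<Union>i\<in>I. {\<omega> \<in> space M. U i \<omega> - V i \<omega> > \<eta>})"
      then have "U i \<omega> - V i \<omega> \<le> \<eta>" by (auto simp: not_less)
      then have "V i \<omega> > a - \<eta>" using w(3) by linarith
      then show "\<exists>i\<in>I. V i \<omega> > a - \<eta>" using w(2) by blast
    qed
  qed (use 1 2 in auto)
  also have "\<dots> \<le> \<P>(\<omega> in M. \<exists>i\<in>I. V i \<omega> > a - \<eta>) + prob (\<Union>i\<in>I. {\<omega> \<in> space M. U i \<omega> - V i \<omega> > \<eta>})"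
    by (rule measure_Un_le[OF 1 2])
  also have "prob (\<Union>i\<in>I. {\<omega> \<in> space M. U i \<omega> - V i \<omega> > \<eta>}) \<le> (\<Sum>i\<in>I. \<P>(\<omega> in M. U i \<omega> - V i \<omega> > \<eta>))"
    using s(2) I by (intro finite_measure_subadditive_finite) auto
  finally show ?thesis by simp
qed

lemma (in gauss_cone) cone_noise:
  assumes "C \<in> cov_cone I CX" "0 \<le> \<delta>" shows "(\<lambda>i j. C i j + \<delta> * of_bool (i = j)) \<in> cov_cone I CX"
proof (rule cone_cong)
  show "(\<lambda>i j. C i j + (\<Sum>a\<in>I. (sqrt \<delta> * of_bool (i = a)) * (sqrt \<delta> * of_bool (j = a)))) \<in> cov_cone I CX"
    by (intro cone_add_columns I assms)
  fix i j assume ij: "i \<in> I" "j \<in> I"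
  have "(\<Sum>a\<in>I. (sqrt \<delta> * of_bool (i = a)) * (sqrt \<delta> * of_bool (j = a))) = (\<Sum>a\<in>I. if a = i then \<delta> * of_bool (i = j) else 0)"
    using assms(2) by (intro sum.cong) auto
  also have "\<dots> = \<delta> * of_bool (i = j)" using ij I by simp
  finally show "C i j + \<delta> * of_bool (i = j) = C i j + (\<Sum>a\<in>I. (sqrt \<delta> * of_bool (i = a)) * (sqrt \<delta> * of_bool (j = a)))" by simp
qed

text \<open>The first condition of \<open>up\<close> says that the covariances dominate those of the vector with independent increments and the same
variances. Add independent noise of variance \<open>\<delta>\<close>, apply \<open>slepian_regularised\<close> and \<open>gvec_levy\<close>, and remove the noise, at the cost of
lowering the level by \<open>\<eta>\<close> twice.\<close>

lemma (in prob_space) gauss_max_le: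
  fixes X :: "nat \<Rightarrow> 'a \<Rightarrow> real"
  assumes X: "gvec M {..n} X C" and sym: "\<And>i j. i \<le> n \<Longrightarrow> j \<le> n \<Longrightarrow> C i j = C j i"
    and up: "\<And>i j. i \<le> j \<Longrightarrow> j \<le> n \<Longrightarrow> C i i \<le> C i j" "\<And>i j. i \<le> j \<Longrightarrow> j \<le> n \<Longrightarrow> C i i \<le> C j j"
    and l: "l > 0" and Cn: "C n n > 0"
  shows "\<P>(\<omega> in M. \<exists>i\<in>{..n}. X i \<omega> > l) \<le> 2 * gtail (l / sqrt (C n n))"
proof -
  interpret W: prob_space iidn by (rule prob_iidn)
  interpret gauss_cone M "{..n}" X C by unfold_locales (simp_all add: X)
  interpret P: pair_prob_space M iidn ..
  interpret Q: pair_prob_space iidn iidn ..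
  have PM: "prob_space (M \<Otimes>\<^sub>M iidn)" "prob_space (iidn \<Otimes>\<^sub>M iidn)" by unfold_locales
  define v where "v = (\<lambda>i. C i i)"
  define g where "g = (\<lambda>k. if k = 0 then v 0 else v k - v (k - 1))"
  define y where "y = (\<lambda>k i. of_bool (k \<le> i) * sqrt (g k))"
  define CY where "CY = (\<lambda>i j. v (min i j))"
  have v0: "0 \<le> v i" if "i \<le> n" for i
    using gvec_coord[OF X, of i] that by (simp add: cgauss_def v_def)
  have g0: "0 \<le> g k" if "k \<le> n" for k using that v0[of 0] up(2)[of "k - 1" k] by (simp add: g_def v_def)
  have gsum: "(\<Sum>k\<le>m. g k) = v m" for m by (induction m) (simp_all add: g_def)
  have CY: "CY i j = (\<Sum>k\<in>{..n}. y k i * y k j)" if ij: "i \<in> {..n}" "j \<in> {..n}" for i j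
  proof -
    have "(\<Sum>k\<in>{..n}. y k i * y k j) = (\<Sum>k\<in>{..n}. if k \<le> min i j then g k else 0)"
      using g0 by (intro sum.cong) (auto simp: y_def)
    also have "\<dots> = (\<Sum>k\<le>min i j. g k)" using ij by (intro sum.mono_neutral_cong_right) auto
    finally show ?thesis by (simp add: gsum CY_def)
  qed
  define Y where "Y = (\<lambda>i w. \<Sum>k\<in>{..n}. y k i * w k :: real)"
  have Yg: "gvec iidn {..n} Y CY"
    unfolding Y_def by (rule gvec_cong[OF gvec_columns]) (use CY in simp_all)
  have Yl: "\<P>(w in iidn. \<exists>i\<in>{..n}. Y i w > a) \<le> 2 * gtail (a / sqrt (C n n))" for a
  proof -
    have "\<P>(w in iidn. \<exists>i\<in>{..n}. Y i w > a) \<le> 2 * \<P>(w in iidn. Y n w > a)"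
      by (rule gvec_levy[OF prob_iidn Yg]) (simp add: CY_def)
    also have "\<P>(w in iidn. Y n w > a) = gtail (a / sqrt (CY n n))"
      using gvec_coord[OF Yg, of n] Cn by (intro W.cgauss_gt) (auto simp: CY_def v_def)
    finally show ?thesis by (simp add: CY_def v_def)
  qed
  have noise: "gvec (K \<Otimes>\<^sub>M iidn) {..n} (\<lambda>i z. c * Z i (fst z) + s * snd z i) (\<lambda>i j. c\<^sup>2 * D i j + s\<^sup>2 * of_bool (i = j))"
    if "prob_space K" "gvec K {..n} Z D" for K :: "'k measure" and Z D c s
    by (rule gvec_pair_add[OF that(1) prob_iidn gvec_scale[OF that(2)] gvec_scale[OF gvec_iid]]) simp
  have step: "\<P>(\<omega> in K. \<exists>i\<in>{..n}. Z i \<omega> > a)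
     \<le> \<P>(z in K \<Otimes>\<^sub>M iidn. \<exists>i\<in>{..n}. 1 * Z i (fst z) + sqrt \<delta> * snd z i > a - \<eta>) + real (n + 1) * gtail (\<eta> / sqrt \<delta>)"
    and step': "\<P>(z in K \<Otimes>\<^sub>M iidn. \<exists>i\<in>{..n}. 1 * Z i (fst z) + sqrt \<delta> * snd z i > a)
     \<le> \<P>(\<omega> in K. \<exists>i\<in>{..n}. Z i \<omega> > a - \<eta>) + real (n + 1) * gtail (\<eta> / sqrt \<delta>)"
    if K: "prob_space K" and Z: "gvec K {..n} Z D" and \<delta>: "\<delta> > 0" for K :: "'k measure" and Z D a \<eta> \<delta>
  proof -
    interpret K: prob_space K by fact
    interpret R: pair_prob_space K iidn ..
    have PR: "prob_space (K \<Otimes>\<^sub>M iidn)" by unfold_locales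
    have e: "\<P>(\<omega> in K. \<exists>i\<in>{..n}. Z i \<omega> > b) = \<P>(z in K \<Otimes>\<^sub>M iidn. \<exists>i\<in>{..n}. 1 * Z i (fst z) + 0 * snd z i > b)" for b
      by (rule gvec_exceed[OF K PR _ Z]) (use noise[OF K Z, of 1 0] in simp_all)
    have m: "(\<lambda>z. 1 * Z i (fst z) + s * snd z i) \<in> borel_measurable (K \<Otimes>\<^sub>M iidn)" if "i \<in> {..n}" for i s
      using gvec_measurable[OF noise[OF K Z, of 1 s] _ that] by simp
    have t: "\<P>(z in K \<Otimes>\<^sub>M iidn. (1 * Z i (fst z) + s * snd z i) - (1 * Z i (fst z) + s' * snd z i) > \<eta>) = gtail (\<eta> / sqrt \<delta>)"
      if i: "i \<in> {..n}" and s: "(s - s')\<^sup>2 = \<delta>" for i s s'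
    proof -
      have "cgauss (K \<Otimes>\<^sub>M iidn) (\<lambda>z. 0 * Z i (fst z) + (s - s') * snd z i) \<delta>"
        using gvec_coord[OF noise[OF K Z, of 0 "s - s'"] _ i] s by simp
      then have "\<P>(z in K \<Otimes>\<^sub>M iidn. 0 * Z i (fst z) + (s - s') * snd z i > \<eta>) = gtail (\<eta> / sqrt \<delta>)"
        by (rule R.cgauss_gt[OF _ \<delta>])
      then show ?thesis by (simp add: left_diff_distrib)
    qed
    have gen: "\<P>(z in K \<Otimes>\<^sub>M iidn. \<exists>i\<in>{..n}. 1 * Z i (fst z) + s * snd z i > a)
      \<le> \<P>(z in K \<Otimes>\<^sub>M iidn. \<exists>i\<in>{..n}. 1 * Z i (fst z) + s' * snd z i > a - \<eta>) + real (n + 1) * gtail (\<eta> / sqrt \<delta>)"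
      if s: "(s - s')\<^sup>2 = \<delta>" for s s'
    proof -
      have "\<P>(z in K \<Otimes>\<^sub>M iidn. \<exists>i\<in>{..n}. 1 * Z i (fst z) + s * snd z i > a)
        \<le> \<P>(z in K \<Otimes>\<^sub>M iidn. \<exists>i\<in>{..n}. 1 * Z i (fst z) + s' * snd z i > a - \<eta>)
          + (\<Sum>i\<in>{..n}. \<P>(z in K \<Otimes>\<^sub>M iidn. (1 * Z i (fst z) + s * snd z i) - (1 * Z i (fst z) + s' * snd z i) > \<eta>))"
        by (rule R.exceed_perturb[OF _ m m]) simp_all
      also have "\<dots> = \<P>(z in K \<Otimes>\<^sub>M iidn. \<exists>i\<in>{..n}. 1 * Z i (fst z) + s' * snd z i > a - \<eta>) + (\<Sum>i\<in>{..n}. gtail (\<eta> / sqrt \<delta>))"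
        by (simp only: t[OF _ s] cong: sum.cong)
      finally show ?thesis by simp
    qed
    show "\<P>(\<omega> in K. \<exists>i\<in>{..n}. Z i \<omega> > a)
     \<le> \<P>(z in K \<Otimes>\<^sub>M iidn. \<exists>i\<in>{..n}. 1 * Z i (fst z) + sqrt \<delta> * snd z i > a - \<eta>) + real (n + 1) * gtail (\<eta> / sqrt \<delta>)"
      unfolding e using \<delta> by (intro gen) simp
    show "\<P>(z in K \<Otimes>\<^sub>M iidn. \<exists>i\<in>{..n}. 1 * Z i (fst z) + sqrt \<delta> * snd z i > a)
     \<le> \<P>(\<omega> in K. \<exists>i\<in>{..n}. Z i \<omega> > a - \<eta>) + real (n + 1) * gtail (\<eta> / sqrt \<delta>)"
      unfolding e using \<delta> by (intro gen) simp
  qed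
  have bound: "\<P>(\<omega> in M. \<exists>i\<in>{..n}. X i \<omega> > l) \<le> 2 * gtail (l / sqrt (C n n) - 2 / sqrt (C n n) * \<eta>) + 4 * real (n + 1) * \<eta>" if \<eta>: "\<eta> > 0" for \<eta>
  proof -
    \<comment> \<open>small enough that noise of standard deviation \<open>\<surd>\<delta>\<close> rarely exceeds \<open>\<eta>\<close>\<close>
    define \<delta> where "\<delta> = \<eta> ^ 3"
    have \<delta>: "\<delta> > 0" using \<eta> by (simp add: \<delta>_def)
    have "gtail (\<eta> / sqrt \<delta>) \<le> 2 / (\<eta> / sqrt \<delta>)\<^sup>2" using \<eta> \<delta> by (intro gtail_le_square) simp
    also have "\<dots> = 2 * \<eta>" using \<eta> \<delta> by (simp add: power_divide \<delta>_def power2_eq_square power3_eq_cube)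
    finally have gt: "real (n + 1) * gtail (\<eta> / sqrt \<delta>) \<le> real (n + 1) * (2 * \<eta>)" by (rule mult_left_mono) simp
    have s2: "(sqrt \<delta>)\<^sup>2 = \<delta>" using \<delta> by simp
    have cX: "(\<lambda>i j. C i j + \<delta> * of_bool (i = j)) \<in> cov_cone {..n} C"
      using cone_noise[OF cone_scale[of 1 C "{..n}"], of \<delta>] \<delta> by simp
    have "(\<lambda>i j. 0 * C i j + (\<Sum>k\<in>{..n}. y k i * y k j)) \<in> cov_cone {..n} C" by (intro cone_add_columns cone_scale) simp_all
    then have "CY \<in> cov_cone {..n} C" by (rule cone_cong) (simp add: CY)
    then have cY: "(\<lambda>i j. CY i j + \<delta> * of_bool (i = j)) \<in> cov_cone {..n} C" using \<delta> by (intro cone_noise less_imp_le)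
    have "\<P>(\<omega> in M. \<exists>i\<in>{..n}. X i \<omega> > l) \<le> \<P>(z in M \<Otimes>\<^sub>M iidn. \<exists>i\<in>{..n}. 1 * X i (fst z) + sqrt \<delta> * snd z i > l - \<eta>) + real (n + 1) * gtail (\<eta> / sqrt \<delta>)"
      by (rule step[OF prob_space_axioms X \<delta>])
    also have "\<P>(z in M \<Otimes>\<^sub>M iidn. \<exists>i\<in>{..n}. 1 * X i (fst z) + sqrt \<delta> * snd z i > l - \<eta>) = exceed (l - \<eta>) (\<lambda>i j. C i j + \<delta> * of_bool (i = j))"
      by (rule exceed_eq[OF cX PM(1)]) (use noise[OF prob_space_axioms X, of 1 "sqrt \<delta>"] s2 in simp)
    finally have 1: "\<P>(\<omega> in M. \<exists>i\<in>{..n}. X i \<omega> > l) \<le> exceed (l - \<eta>) (\<lambda>i j. C i j + \<delta> * of_bool (i = j)) + real (n + 1) * gtail (\<eta> / sqrt \<delta>)" .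
    have 2: "exceed (l - \<eta>) (\<lambda>i j. C i j + \<delta> * of_bool (i = j)) \<le> exceed (l - \<eta>) (\<lambda>i j. CY i j + \<delta> * of_bool (i = j))"
    proof (rule slepian_regularised[OF _ _ CY _ _ \<delta>])
      fix i j assume ij: "i \<in> {..n}" "j \<in> {..n}"
      show "C i j = C j i" using ij by (intro sym) auto
      show "CY i j \<le> C i j"
        using up(1)[of i j] up(1)[of j i] sym[of i j] ij by (cases "i \<le> j") (auto simp: CY_def v_def min_def)
    qed (simp_all add: CY_def v_def)
    have "exceed (l - \<eta>) (\<lambda>i j. CY i j + \<delta> * of_bool (i = j)) = \<P>(z in iidn \<Otimes>\<^sub>M iidn. \<exists>i\<in>{..n}. 1 * Y i (fst z) + sqrt \<delta> * snd z i > l - \<eta>)"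
      by (rule exceed_eq[OF cY PM(2), symmetric]) (use noise[OF prob_iidn Yg, of 1 "sqrt \<delta>"] s2 in simp)
    also have "\<dots> \<le> \<P>(w in iidn. \<exists>i\<in>{..n}. Y i w > l - \<eta> - \<eta>) + real (n + 1) * gtail (\<eta> / sqrt \<delta>)"
      by (rule step'[OF prob_iidn Yg \<delta>])
    finally have 3: "exceed (l - \<eta>) (\<lambda>i j. CY i j + \<delta> * of_bool (i = j)) \<le> \<P>(w in iidn. \<exists>i\<in>{..n}. Y i w > l - \<eta> - \<eta>) + real (n + 1) * gtail (\<eta> / sqrt \<delta>)" .
    have "(l - \<eta> - \<eta>) / sqrt (C n n) = l / sqrt (C n n) - 2 / sqrt (C n n) * \<eta>" by (simp add: diff_divide_distrib)
    then have 4: "\<P>(w in iidn. \<exists>i\<in>{..n}. Y i w > l - \<eta> - \<eta>) \<le> 2 * gtail (l / sqrt (C n n) - 2 / sqrt (C n n) * \<eta>)"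
      using Yl[of "l - \<eta> - \<eta>"] by simp
    have "4 * real (n + 1) * \<eta> = real (n + 1) * (2 * \<eta>) + real (n + 1) * (2 * \<eta>)" by simp
    then show ?thesis using 1 2 3 4 gt by linarith
  qed
  show ?thesis
  proof (rule tendsto_lowerbound)
    have c: "0 < 2 / sqrt (C n n)" using Cn by simp
    have "filterlim (\<lambda>\<eta>. 2 / sqrt (C n n) * \<eta>) (at_right 0) (at_right 0)"
      using c filterlim_times_pos[of "\<lambda>x. x" 0 "at_right (0::real)" "2 / sqrt (C n n)"] by (simp add: filterlim_ident)
    then have "((\<lambda>\<eta>. gtail (l / sqrt (C n n) - 2 / sqrt (C n n) * \<eta>)) \<longlongrightarrow> gtail (l / sqrt (C n n))) (at_right 0)"
      using l Cn by (intro filterlim_compose[OF gtail_tendsto_left]) auto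
    then have "((\<lambda>\<eta>. 2 * gtail (l / sqrt (C n n) - 2 / sqrt (C n n) * \<eta>) + 4 * real (n + 1) * \<eta>) \<longlongrightarrow> 2 * gtail (l / sqrt (C n n)) + 4 * real (n + 1) * 0) (at_right 0)"
      by (intro tendsto_intros)
    then show "((\<lambda>\<eta>. 2 * gtail (l / sqrt (C n n) - 2 / sqrt (C n n) * \<eta>) + 4 * real (n + 1) * \<eta>) \<longlongrightarrow> 2 * gtail (l / sqrt (C n n))) (at_right 0)" by simp
    show "\<forall>\<^sub>F \<eta> in at_right 0. \<P>(\<omega> in M. \<exists>i\<in>{..n}. X i \<omega> > l) \<le> 2 * gtail (l / sqrt (C n n) - 2 / sqrt (C n n) * \<eta>) + 4 * real (n + 1) * \<eta>"
      unfolding eventually_at_right_field using bound by (intro exI[of _ 1]) auto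
  qed simp
qed

section \<open>The bounds for the integral process\<close>

text \<open>Twice the normal tail at \<open>a / \<surd>q\<close>, including the limiting values for \<open>q = 0\<close>.\<close>

definition tail_integral :: "real \<Rightarrow> real \<Rightarrow> real" where
  "tail_integral a q = (LBINT x = ereal a / ereal (sqrt q) .. \<infinity>. sqrt (2 / pi) * exp (- x\<^sup>2 / 2))"

lemma sqrt_two_pi: "sqrt (2 / pi) * sqrt (2 * pi) = 2"
  by (simp add: real_sqrt_mult[symmetric])

lemma tail_integral_pos: "q > 0 \<Longrightarrow> tail_integral a q = 2 * gtail (a / sqrt q)"
  unfolding tail_integral_def using LBINT_gauss[of "a / sqrt q" "sqrt (2 / pi)"] by (simp add: sqrt_two_pi)

lemma tail_integral_zero: "tail_integral a 0 = (if a > 0 then 0 else if a = 0 then 1 else 2)"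
proof -
  have z: "ereal a / ereal (sqrt 0) = (if a > 0 then \<infinity> else if a = 0 then 0 else - \<infinity>)" using ereal_divide_zero[of a] by simp
  show ?thesis
    unfolding tail_integral_def z
    using LBINT_gauss[of 0 "sqrt (2 / pi)"] LBINT_gauss_MInf[of "sqrt (2 / pi)"]
    by (auto simp: sqrt_two_pi gtail_0 zero_ereal_def)
qed

lemma tail_integral_nonneg: "0 \<le> q \<Longrightarrow> 0 \<le> tail_integral a q"
  by (cases "q = 0") (auto simp: tail_integral_zero tail_integral_pos)

lemma tail_integral_ge_1: "0 \<le> q \<Longrightarrow> a \<le> 0 \<Longrightarrow> 1 \<le> tail_integral a q"
  using gtail_half_le[of "a / sqrt q"] by (cases "q = 0") (auto simp: tail_integral_zero tail_integral_pos divide_nonpos_nonneg)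

definition ugrid :: "nat \<Rightarrow> nat \<Rightarrow> real" where "ugrid k i = real i / real (Suc k)"

lemma ugrid_01: "i \<le> Suc k \<Longrightarrow> ugrid k i \<in> {0..1}" by (simp add: ugrid_def)

lemma ugrid_near:
  assumes "t \<in> {0..1}" shows "\<exists>s\<in>ugrid k ` {..Suc k}. \<bar>t - s\<bar> \<le> 1 / real (Suc k)"
proof -
  define i where "i = nat \<lfloor>real (Suc k) * t\<rfloor>"
  have t: "0 \<le> real (Suc k) * t" "real (Suc k) * t \<le> real (Suc k)" using assms by (auto simp: mult_left_le)
  have i: "real i \<le> real (Suc k) * t" "real (Suc k) * t \<le> real i + 1" unfolding i_def using t by linarith+
  then have "i \<le> Suc k" using t by linarith
  moreover have "\<bar>t - ugrid k i\<bar> \<le> 1 / real (Suc k)"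
  proof -
    have "t - ugrid k i = (real (Suc k) * t - real i) / real (Suc k)" by (simp add: ugrid_def field_simps)
    then have "\<bar>t - ugrid k i\<bar> = \<bar>real (Suc k) * t - real i\<bar> / real (Suc k)" by (simp only: abs_divide abs_of_nat)
    also have "\<dots> \<le> 1 / real (Suc k)" using i by (intro divide_right_mono) linarith+
    finally show ?thesis .
  qed
  ultimately show ?thesis by blast
qed

context fbm
begin

lemma riesz_mono:
  assumes g: "g \<in> Lp_fun p" "g' \<in> Lp_fun p" "\<And>x. 0 \<le> g x" "\<And>x. g x \<le> g' x" and h: "h \<in> Lp_fun p" "h' \<in> Lp_fun p" "\<And>x. 0 \<le> h x" "\<And>x. h x \<le> h' x"
  shows "riesz \<alpha> g h \<le> riesz \<alpha> g' h'"
  unfolding riesz_def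
proof (rule integral_mono[OF riesz_integrable riesz_integrable])
  fix z :: "real \<times> real"
  have "g (fst z) * h (snd z) \<le> g' (fst z) * h' (snd z)"
    using g(3,4) h(3,4) order_trans by (intro mult_mono) blast+
  then show "g (fst z) * h (snd z) * \<bar>fst z - snd z\<bar> powr (\<alpha> - 1) \<le> g' (fst z) * h' (snd z) * \<bar>fst z - snd z\<bar> powr (\<alpha> - 1)"
    by (rule mult_right_mono) simp
qed (use g h in auto)

definition icov :: "(real \<Rightarrow> real) \<Rightarrow> real \<Rightarrow> real \<Rightarrow> real" where
  "icov g s t = \<kappa> * riesz \<alpha> (\<lambda>x. g x * indicator {0..s} x) (\<lambda>x. g x * indicator {0..t} x)"

lemma integral_gvec:
  assumes I: "finite I" and t: "\<And>i. i \<in> I \<Longrightarrow> 0 \<le> t i" and g: "borel_version h g"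
    and X: "\<And>s. 0 \<le> s \<Longrightarrow> has_fbm_integral M \<xi> \<alpha> h s (X s)"
  shows "gvec M I (\<lambda>i. X (t i)) (\<lambda>i j. icov g (t i) (t j))"
  unfolding gvec_def
proof
  fix b
  have L: "(\<lambda>x. g x * indicator {0..t i} x) \<in> Lp_fun p" for i using g by (intro Lp_fun_restrict) (auto simp: borel_version_def)
  have "cgauss M (\<lambda>\<omega>. \<Sum>i\<in>I. b i * X (t i) \<omega>) (\<kappa> * riesz \<alpha> (\<lambda>x. \<Sum>i\<in>I. b i * (g x * indicator {0..t i} x)) (\<lambda>x. \<Sum>i\<in>I. b i * (g x * indicator {0..t i} x)))"
    using I t X by (intro integral_family_gauss[where f="\<lambda>_. h" and t=t] borel_version_supp[OF g]) auto
  also have "riesz \<alpha> (\<lambda>x. \<Sum>i\<in>I. b i * (g x * indicator {0..t i} x)) (\<lambda>x. \<Sum>i\<in>I. b i * (g x * indicator {0..t i} x))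
     = (\<Sum>i\<in>I. \<Sum>j\<in>I. b i * b j * riesz \<alpha> (\<lambda>x. g x * indicator {0..t i} x) (\<lambda>x. g x * indicator {0..t j} x))"
    by (rule riesz_sum_sum[OF I L])
  also have "\<kappa> * \<dots> = (\<Sum>i\<in>I. \<Sum>j\<in>I. b i * b j * icov g (t i) (t j))"
    unfolding icov_def by (simp only: sum_distrib_left mult.left_commute)
  finally show "cgauss M (\<lambda>\<omega>. \<Sum>i\<in>I. b i * X (t i) \<omega>) (\<Sum>i\<in>I. \<Sum>j\<in>I. b i * b j * icov g (t i) (t j))" .
qed

text \<open>For a nonnegative integrand the Riesz form is monotone in both arguments, so the covariances satisfy the conditions of
\<open>gauss_max_le\<close>. The sign \<open>c\<close> serves to treat the negative of the integral as well.\<close>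

lemma grid_max_le:
  assumes g: "borel_version h g" "\<And>x. 0 \<le> g x" and X: "\<And>s. 0 \<le> s \<Longrightarrow> has_fbm_integral M \<xi> \<alpha> h s (X s)"
    and c: "c\<^sup>2 = 1" and a: "a > 0"
  shows "\<P>(\<omega> in M. \<exists>i\<in>{..Suc k}. c * X (ugrid k i) \<omega> > a) \<le> tail_integral a (fbm_q \<alpha> h 0 1)"
proof -
  let ?C = "\<lambda>i j. icov g (ugrid k i) (ugrid k j)"
  have L: "(\<lambda>x. g x * indicator {0..s} x) \<in> Lp_fun p" for s using g by (intro Lp_fun_restrict) (auto simp: borel_version_def)
  have [measurable]: "g \<in> borel_measurable borel" using g by (auto simp: borel_version_def Lp_fun_def)
  have u0: "0 \<le> ugrid k i" for i by (simp add: ugrid_def)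
  have "gvec M {..Suc k} (\<lambda>i \<omega>. c * X (ugrid k i) \<omega>) (\<lambda>i j. c\<^sup>2 * ?C i j)"
    using g X u0 by (intro gvec_scale integral_gvec) auto
  then have G: "gvec M {..Suc k} (\<lambda>i \<omega>. c * X (ugrid k i) \<omega>) ?C" unfolding c by simp
  have mono: "icov g s t \<le> icov g s' t'" if "s \<le> s'" "t \<le> t'" for s t s' t'
    unfolding icov_def using \<kappa>_nonneg that g(2)
    by (intro mult_left_mono riesz_mono L) (auto split: split_indicator)
  have um: "ugrid k i \<le> ugrid k j" if "i \<le> j" for i j using that by (simp add: ugrid_def divide_right_mono)
  have q: "fbm_q \<alpha> h 0 1 = ?C (Suc k) (Suc k)"
    using fbm_q_riesz[OF g(1), of 0 1] by (simp add: icov_def ugrid_def)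
  have q0: "0 \<le> ?C i i" if "i \<le> Suc k" for i
    using gvec_coord[OF G, of i] that by (simp add: cgauss_def)
  show ?thesis
  proof (cases "?C (Suc k) (Suc k) = 0")
    case True
    have "AE \<omega> in M. c * X (ugrid k i) \<omega> = 0" if i: "i \<in> {..Suc k}" for i
    proof -
      have "?C i i \<le> ?C (Suc k) (Suc k)" using i by (intro mono um) auto
      then have "?C i i = 0" using True q0[of i] i by simp
      then show ?thesis using gvec_coord[OF G _ i] by (intro cgauss_zero_AE) simp
    qed
    then have "AE \<omega> in M. \<forall>i\<in>{..Suc k}. c * X (ugrid k i) \<omega> = 0" by (intro AE_finite_allI) auto
    then have "AE \<omega> in M. \<not> (\<exists>i\<in>{..Suc k}. c * X (ugrid k i) \<omega> > a)" by eventually_elim (use a in auto)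
    then have "\<P>(\<omega> in M. \<exists>i\<in>{..Suc k}. c * X (ugrid k i) \<omega> > a) = 0" by (intro prob_eq_0_AE)
    then show ?thesis using tail_integral_nonneg[of "fbm_q \<alpha> h 0 1" a] q0[of "Suc k"] unfolding q by simp
  next
    case False
    then have pos: "?C (Suc k) (Suc k) > 0" using q0[of "Suc k"] by simp
    have "\<P>(\<omega> in M. \<exists>i\<in>{..Suc k}. c * X (ugrid k i) \<omega> > a) \<le> 2 * gtail (a / sqrt (?C (Suc k) (Suc k)))"
    proof (rule gauss_max_le[OF G])
      fix i j
      show "?C i j = ?C j i" unfolding icov_def by (subst riesz_commute) auto
    qed (use a pos mono um in auto)
    then show ?thesis unfolding q tail_integral_pos[OF pos] .
  qed
qed

lemma pos_neg_part:
  assumes g: "borel_version f g"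
  shows "borel_version (pos_part f) (pos_part g)" "borel_version (neg_part f) (neg_part g)"
proof -
  have gL: "g \<in> Lp_fun p" and ga: "AE x in lborel. g x = f x * indicator {0..} x" using g by (auto simp: borel_version_def)
  have [measurable]: "g \<in> borel_measurable borel" using gL by (auto simp: Lp_fun_def)
  have "(\<lambda>x. (1 / 2) * (\<bar>g x\<bar> + g x)) \<in> Lp_fun p" "(\<lambda>x. (1 / 2) * (\<bar>g x\<bar> - g x)) \<in> Lp_fun p"
  proof -
    have "Lpn p (\<lambda>x. \<bar>g x\<bar>) \<le> Lpn p g" using p_gt_1 by (intro Lpn_mono) auto
    then have "(\<lambda>x. \<bar>g x\<bar>) \<in> Lp_fun p" using gL by (auto simp: Lp_fun_def)
    then show "(\<lambda>x. (1 / 2) * (\<bar>g x\<bar> + g x)) \<in> Lp_fun p" "(\<lambda>x. (1 / 2) * (\<bar>g x\<bar> - g x)) \<in> Lp_fun p"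
      using gL p_gt_1 by (intro Lp_fun_cmult Lp_fun_add Lp_fun_diff; simp)+
  qed
  then have "pos_part g \<in> Lp_fun p" "neg_part g \<in> Lp_fun p" by (simp_all add: pos_part_def[abs_def] neg_part_def[abs_def])
  moreover have "AE x in lborel. pos_part g x = pos_part f x * indicator {0..} x" "AE x in lborel. neg_part g x = neg_part f x * indicator {0..} x"
    using ga by (eventually_elim, auto simp: pos_part_def neg_part_def split: split_indicator)+
  ultimately show "borel_version (pos_part f) (pos_part g)" "borel_version (neg_part f) (neg_part g)" by (auto simp: borel_version_def)
qed

text \<open>The three integrals are jointly Gaussian, and the variance of the combination is the Riesz form of the zero function.\<close>

lemma integral_pos_neg_AE:
  assumes g: "borel_version f g" and t: "0 \<le> t" and Y: "has_fbm_integral M \<xi> \<alpha> f t Y"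
    and U: "has_fbm_integral M \<xi> \<alpha> (pos_part f) t U" and W: "has_fbm_integral M \<xi> \<alpha> (neg_part f) t W"
  shows "AE \<omega> in M. Y \<omega> = U \<omega> - W \<omega>"
proof -
  let ?b = "\<lambda>i::nat. if i = 0 then 1 else if i = 1 then - 1 else 1 :: real"
  let ?f = "\<lambda>i::nat. if i = 0 then f else if i = 1 then pos_part f else neg_part f"
  let ?g = "\<lambda>i::nat. if i = 0 then g else if i = 1 then pos_part g else neg_part g"
  let ?X = "\<lambda>i::nat. if i = 0 then Y else if i = 1 then U else W"
  have "cgauss M (\<lambda>\<omega>. \<Sum>i\<in>{0,1,2}. ?b i * ?X i \<omega>) (\<kappa> * riesz \<alpha> (\<lambda>u. \<Sum>i\<in>{0,1,2}. ?b i * (?g i u * indicator {0..t} u)) (\<lambda>u. \<Sum>i\<in>{0,1,2}. ?b i * (?g i u * indicator {0..t} u)))"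
  proof (rule integral_family_gauss[where t="\<lambda>_. t" and f="?f"])
    fix i :: nat
    show "supp_version (?f i) t (\<lambda>u. ?g i u * indicator {0..t} u)"
      using borel_version_supp[OF g] borel_version_supp[OF pos_neg_part(1)[OF g]] borel_version_supp[OF pos_neg_part(2)[OF g]] by auto
    show "has_fbm_integral M \<xi> \<alpha> (?f i) t (?X i)" using Y U W by auto
  qed (use t in auto)
  moreover have "(\<lambda>u. \<Sum>i\<in>{0,1,2}. ?b i * (?g i u * indicator {0..t} u)) = (\<lambda>u. 0)"
  proof (rule ext)
    fix u
    have s3: "(\<Sum>i\<in>{0,1,2}. F i) = F 0 + (F 1 + F 2)" for F :: "nat \<Rightarrow> real" by simp
    have "(\<Sum>i\<in>{0,1,2}. ?b i * (?g i u * indicator {0..t} u)) = (g u - pos_part g u + neg_part g u) * indicator {0..t} u"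
      unfolding s3 by (simp add: algebra_simps)
    also have "g u - pos_part g u + neg_part g u = 0" by (simp add: pos_part_def neg_part_def field_simps)
    finally show "(\<Sum>i\<in>{0,1,2}. ?b i * (?g i u * indicator {0..t} u)) = 0" by simp
  qed
  ultimately have "cgauss M (\<lambda>\<omega>. \<Sum>i\<in>{0,1,2}. ?b i * ?X i \<omega>) 0" by (simp only: riesz_zero mult_zero_right)
  from cgauss_zero_AE[OF this] show ?thesis by eventually_elim simp
qed

text \<open>If \<open>\<lambda>r\<close> or \<open>\<lambda>(1-r)\<close> is not positive, the corresponding tail integral is at least \<open>1\<close> and there is nothing to prove.\<close>

lemma sup_bound_pos_neg:
  assumes g: "borel_version f g" and Y: "continuous_version M \<xi> \<alpha> f Y"
  shows "prob_le M (\<lambda>\<omega>. (SUP t\<in>{0..1}. Y t \<omega>) > lam)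
     (tail_integral (lam * r) (fbm_q \<alpha> (pos_part f) 0 1) + tail_integral (lam * (1 - r)) (fbm_q \<alpha> (neg_part f) 0 1))"
proof (rule sup_event[where G="\<lambda>k. ugrid k ` {..Suc k}" and e="\<lambda>k. 1 / real (Suc k)"])
  have Yi: "has_fbm_integral M \<xi> \<alpha> f t (Y t)" if "t \<in> {0..1}" for t using Y that by (auto simp: continuous_version_def)
  show "Y t \<in> borel_measurable M" if "t \<in> {0..1}" for t using Yi[OF that] by (simp add: has_fbm_integral_def)
  show "AE \<omega> in M. continuous_on {0..1} (\<lambda>t. Y t \<omega>)" using Y by (auto simp: continuous_version_def)
  show "finite (ugrid k ` {..Suc k})" for k by simp
  show "ugrid k ` {..Suc k} \<subseteq> {0..1}" for k using ugrid_01 by blast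
  show "\<exists>s\<in>ugrid k ` {..Suc k}. \<bar>t - s\<bar> \<le> 1 / real (Suc k)" if "t \<in> {0..1}" for k t by (rule ugrid_near[OF that])
  show "(\<lambda>k. 1 / real (Suc k)) \<longlonglongrightarrow> 0" by real_asymp
  fix k
  let ?qp = "fbm_q \<alpha> (pos_part f) 0 1" and ?qm = "fbm_q \<alpha> (neg_part f) 0 1"
  note gp = pos_neg_part(1)[OF g] and gm = pos_neg_part(2)[OF g]
  have p0: "0 \<le> pos_part g x" "0 \<le> neg_part g x" for x by (auto simp: pos_part_def neg_part_def)
  obtain U where U: "\<And>s. 0 \<le> s \<Longrightarrow> has_fbm_integral M \<xi> \<alpha> (pos_part f) s (U s)" using fbm_integral_ex[OF _ borel_version_supp[OF gp]] by metis
  obtain W where W: "\<And>s. 0 \<le> s \<Longrightarrow> has_fbm_integral M \<xi> \<alpha> (neg_part f) s (W s)" using fbm_integral_ex[OF _ borel_version_supp[OF gm]] by metis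
  have q: "0 \<le> ?qp" "0 \<le> ?qm" using point_gauss[OF gp _ U, of 1] point_gauss[OF gm _ W, of 1] by (auto simp: cgauss_def)
  let ?E = "{\<omega> \<in> space M. \<exists>s\<in>ugrid k ` {..Suc k}. Y s \<omega> > lam}"
  show "prob ?E \<le> tail_integral (lam * r) ?qp + tail_integral (lam * (1 - r)) ?qm"
  proof (cases "lam * r \<le> 0 \<or> lam * (1 - r) \<le> 0")
    case True
    then have "1 \<le> tail_integral (lam * r) ?qp + tail_integral (lam * (1 - r)) ?qm"
      using tail_integral_ge_1[OF q(1), of "lam * r"] tail_integral_ge_1[OF q(2), of "lam * (1 - r)"]
        tail_integral_nonneg[OF q(1), of "lam * r"] tail_integral_nonneg[OF q(2), of "lam * (1 - r)"] by auto
    then show ?thesis using prob_le_1[of ?E] by linarith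
  next
    case False
    then have a: "lam * r > 0" "lam * (1 - r) > 0" by auto
    let ?A = "{\<omega> \<in> space M. \<exists>i\<in>{..Suc k}. 1 * U (ugrid k i) \<omega> > lam * r}"
    let ?B = "{\<omega> \<in> space M. \<exists>i\<in>{..Suc k}. - 1 * W (ugrid k i) \<omega> > lam * (1 - r)}"
    have u0: "0 \<le> ugrid k i" for i by (simp add: ugrid_def)
    have Um [measurable]: "U (ugrid k i) \<in> borel_measurable M" and Wm [measurable]: "W (ugrid k i) \<in> borel_measurable M" for i
      using U[OF u0] W[OF u0] by (auto simp: has_fbm_integral_def)
    have "{\<omega> \<in> space M. 1 * U (ugrid k i) \<omega> > lam * r} \<in> events" for i by measurable
    then have A: "?A \<in> events" by (intro sets.sets_Collect_finite_Ex) simp_all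
    have "{\<omega> \<in> space M. - 1 * W (ugrid k i) \<omega> > lam * (1 - r)} \<in> events" for i by measurable
    then have B: "?B \<in> events" by (intro sets.sets_Collect_finite_Ex) simp_all
    have "AE \<omega> in M. \<forall>i\<in>{..Suc k}. Y (ugrid k i) \<omega> = U (ugrid k i) \<omega> - W (ugrid k i) \<omega>"
    proof (rule AE_finite_allI)
      fix i assume "i \<in> {..Suc k}"
      then have "ugrid k i \<in> {0..1}" using ugrid_01 by simp
      then show "AE \<omega> in M. Y (ugrid k i) \<omega> = U (ugrid k i) \<omega> - W (ugrid k i) \<omega>"
        by (intro integral_pos_neg_AE[OF g u0[of i]] U W Yi u0)
    qed simp
    then have "AE \<omega> in M. \<omega> \<in> ?E \<longrightarrow> \<omega> \<in> ?A \<union> ?B"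
    proof eventually_elim
      case (elim \<omega>)
      show ?case
      proof
        assume "\<omega> \<in> ?E"
        then obtain i where w: "\<omega> \<in> space M" and i: "i \<in> {..Suc k}" "Y (ugrid k i) \<omega> > lam" by auto
        have "Y (ugrid k i) \<omega> = U (ugrid k i) \<omega> - W (ugrid k i) \<omega>" using elim i(1) by blast
        moreover have "lam = lam * r + lam * (1 - r)" by (simp add: algebra_simps)
        ultimately have "U (ugrid k i) \<omega> - W (ugrid k i) \<omega> > lam * r + lam * (1 - r)" using i(2) by linarith
        then have "U (ugrid k i) \<omega> > lam * r \<or> - W (ugrid k i) \<omega> > lam * (1 - r)" by linarith
        then show "\<omega> \<in> ?A \<union> ?B" using w i(1) by auto
      qed
    qed
    then have "prob ?E \<le> prob (?A \<union> ?B)" using A B by (intro finite_measure_mono_AE) auto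
    also have "\<dots> \<le> prob ?A + prob ?B" by (rule measure_Un_le[OF A B])
    also have "\<dots> \<le> tail_integral (lam * r) ?qp + tail_integral (lam * (1 - r)) ?qm"
      by (intro add_mono grid_max_le[OF gp p0(1) U _ a(1)] grid_max_le[OF gm p0(2) W _ a(2)]) simp_all
    finally show ?thesis .
  qed
qed

lemma fbm_c_eq: "fbm_c \<alpha> f m = chain_const (fbm_q \<alpha> f) m"
  unfolding fbm_c_def chain_const_def ..

text \<open>By \<open>fbm_q_modulus\<close> the integrand in \<open>c\<close> is at most a multiple of \<open>exp (- x\<^sup>2 \<delta> L / 2)\<close> with \<open>\<delta> = \<alpha> - \<beta>\<close> and
\<open>L = log m\<close>, and already the bound
\<open>exp (- z) \<le> 1/z\<close> makes it integrable.\<close>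

lemma fbm_c_finite:
  assumes g: "borel_version f g" and \<beta>: "0 < \<beta>" "\<beta> < \<alpha>" and f: "in_Lp (2 / (1 + \<beta>)) {0..1} f" and m: "m \<ge> 2"
  shows "fbm_c \<alpha> f m < \<infinity>"
proof -
  obtain C where C: "C > 0" "\<And>s t. s \<in> {0..1} \<Longrightarrow> t \<in> {0..1} \<Longrightarrow> fbm_q \<alpha> f s t \<le> C * \<bar>s - t\<bar> powr (\<alpha> - \<beta>)"
    using fbm_q_modulus[OF g \<beta> f] by blast
  define \<delta> where "\<delta> = \<alpha> - \<beta>"
  have \<delta>: "\<delta> > 0" using \<beta> by (simp add: \<delta>_def)
  define L where "L = ln (real m)"
  have L: "L > 0" using m by (simp add: L_def)
  have "(SUP (s, t)\<in>{0..1} \<times> {0..1}. ennreal (sqrt (fbm_q \<alpha> f s t))) \<le> ennreal (sqrt C)"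
  proof (rule SUP_least, safe)
    fix s t :: real assume st: "s \<in> {0..1}" "t \<in> {0..1}"
    have "fbm_q \<alpha> f s t \<le> C * \<bar>s - t\<bar> powr (\<alpha> - \<beta>)" by (rule C(2)[OF st])
    also have "\<dots> \<le> C * 1" using C(1) \<delta> st by (intro mult_left_mono powr_le1) (auto simp: \<delta>_def)
    finally show "ennreal (sqrt (fbm_q \<alpha> f s t)) \<le> ennreal (sqrt C)" by (intro ennreal_leI) simp
  qed
  then have 1: "(SUP (s, t)\<in>{0..1} \<times> {0..1}. ennreal (sqrt (fbm_q \<alpha> f s t))) < \<infinity>" by (rule le_less_trans) simp
  have "(\<integral>\<^sup>+x\<in>{1..}. (SUP (s, t)\<in>{(s, t). s \<in> {0..1} \<and> t \<in> {0..1} \<and> \<bar>s - t\<bar> < real m powr (- (x\<^sup>2))}. ennreal (sqrt (fbm_q \<alpha> f s t))) \<partial>lborel)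
     \<le> (\<integral>\<^sup>+x. ennreal (sqrt C * (2 / (\<delta> * L))) * (ennreal (1 / x\<^sup>2) * indicator {1..} x) \<partial>lborel)"
  proof (rule nn_integral_mono)
    fix x :: real
    show "(SUP (s, t)\<in>{(s, t). s \<in> {0..1} \<and> t \<in> {0..1} \<and> \<bar>s - t\<bar> < real m powr (- (x\<^sup>2))}. ennreal (sqrt (fbm_q \<alpha> f s t))) * indicator {1..} x
      \<le> ennreal (sqrt C * (2 / (\<delta> * L))) * (ennreal (1 / x\<^sup>2) * indicator {1..} x)"
    proof (cases "1 \<le> x")
      case True
      have "(SUP (s, t)\<in>{(s, t). s \<in> {0..1} \<and> t \<in> {0..1} \<and> \<bar>s - t\<bar> < real m powr (- (x\<^sup>2))}. ennreal (sqrt (fbm_q \<alpha> f s t))) \<le> ennreal (sqrt C * (2 / (\<delta> * L)) * (1 / x\<^sup>2))"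
      proof (rule SUP_least, safe)
        fix s t :: real assume st: "s \<in> {0..1}" "t \<in> {0..1}" and d: "\<bar>s - t\<bar> < real m powr (- (x\<^sup>2))"
        have "fbm_q \<alpha> f s t \<le> C * \<bar>s - t\<bar> powr \<delta>" using C(2)[OF st] by (simp add: \<delta>_def)
        also have "\<dots> \<le> C * (real m powr (- (x\<^sup>2))) powr \<delta>" using C(1) \<delta> d by (intro mult_left_mono powr_mono2) auto
        also have "(real m powr (- (x\<^sup>2))) powr \<delta> = (exp (- (x\<^sup>2 * \<delta> * L / 2)))\<^sup>2"
          using m by (simp add: powr_powr powr_def L_def exp_double[symmetric] mult_ac)
        finally have "sqrt (fbm_q \<alpha> f s t) \<le> sqrt (C * (exp (- (x\<^sup>2 * \<delta> * L / 2)))\<^sup>2)" by (rule real_sqrt_le_mono)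
        also have "\<dots> = sqrt C * exp (- (x\<^sup>2 * \<delta> * L / 2))" by (simp add: real_sqrt_mult)
        also have "\<dots> \<le> sqrt C * (1 / (x\<^sup>2 * \<delta> * L / 2))"
        proof (rule mult_left_mono)
          have p: "0 < x\<^sup>2 * \<delta> * L / 2" using True \<delta> L by simp
          have "x\<^sup>2 * \<delta> * L / 2 \<le> exp (x\<^sup>2 * \<delta> * L / 2)" using exp_ge_add_one_self[of "x\<^sup>2 * \<delta> * L / 2"] by linarith
          then have "1 / exp (x\<^sup>2 * \<delta> * L / 2) \<le> 1 / (x\<^sup>2 * \<delta> * L / 2)" using p by (intro divide_left_mono) auto
          then show "exp (- (x\<^sup>2 * \<delta> * L / 2)) \<le> 1 / (x\<^sup>2 * \<delta> * L / 2)" by (simp add: exp_minus inverse_eq_divide)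
        qed (use C in simp)
        also have "\<dots> = sqrt C * (2 / (\<delta> * L)) * (1 / x\<^sup>2)" by (simp add: field_simps)
        finally show "ennreal (sqrt (fbm_q \<alpha> f s t)) \<le> ennreal (sqrt C * (2 / (\<delta> * L)) * (1 / x\<^sup>2))" by (rule ennreal_leI)
      qed
      also have "\<dots> = ennreal (sqrt C * (2 / (\<delta> * L))) * ennreal (1 / x\<^sup>2)" using C \<delta> L by (intro ennreal_mult) auto
      finally show ?thesis using True by simp
    qed simp
  qed
  also have "\<dots> = ennreal (sqrt C * (2 / (\<delta> * L))) * (\<integral>\<^sup>+x. ennreal (1 / x\<^sup>2) * indicator {1..} x \<partial>lborel)"
    by (rule nn_integral_cmult) simp
  also have "\<dots> < \<infinity>" using nn_integral_inverse_square[of 1] by (simp add: ennreal_mult_less_top)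
  finally have 2: "(\<integral>\<^sup>+x\<in>{1..}. (SUP (s, t)\<in>{(s, t). s \<in> {0..1} \<and> t \<in> {0..1} \<and> \<bar>s - t\<bar> < real m powr (- (x\<^sup>2))}. ennreal (sqrt (fbm_q \<alpha> f s t))) \<partial>lborel) < \<infinity>" .
  show ?thesis unfolding fbm_c_def using 1 2 by (simp add: ennreal_mult_less_top)
qed

lemma abs_sup_bound:
  assumes g: "borel_version f g" and \<beta>: "0 < \<beta>" "\<beta> < \<alpha>" and f: "in_Lp (2 / (1 + \<beta>)) {0..1} f" and m: "m \<ge> 2"
    and Y: "continuous_version M \<xi> \<alpha> f Y" and lam: "lam > 0"
  shows "prob_le M (\<lambda>\<omega>. (SUP t\<in>{0..1}. \<bar>Y t \<omega>\<bar>) > lam)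
     (LBINT x = ereal lam / enn2ereal (fbm_c \<alpha> f m) .. \<infinity>. 5 / 2 * (real m)\<^sup>2 * exp (- x\<^sup>2 / 2))"
proof -
  have Yi: "has_fbm_integral M \<xi> \<alpha> f t (Y t)" if "t \<in> {0..1}" for t using Y that by (auto simp: continuous_version_def)
  interpret C: gauss_chain M Y "fbm_q \<alpha> f" m
  proof unfold_locales
    show "chain_const (fbm_q \<alpha> f) m < \<infinity>" using fbm_c_finite[OF g \<beta> f m] by (simp add: fbm_c_eq)
  qed (auto intro!: incr_gauss[OF g] point_gauss[OF g] Yi m)
  show ?thesis unfolding fbm_c_eq using Y lam by (intro C.abs_sup_tail) (auto simp: continuous_version_def)
qed

end

theorem mainTheorem6:
  fixes M :: "'a measure" and \<xi> :: "real \<Rightarrow> 'a \<Rightarrow> real"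
    and \<alpha> \<beta> :: real and f :: "real \<Rightarrow> real"
  assumes "prob_space M"
    and "0 < \<alpha>" and "\<alpha> < 1"
    and "fractional_brownian_motion M \<alpha> \<xi>"
    and "in_Lp (2 / (1 + \<alpha>)) {0..} f"
    and "0 < \<beta>" and "\<beta> < \<alpha>"
    and "in_Lp (2 / (1 + \<beta>)) {0..1} f"
  shows "(\<exists>Y. continuous_version M \<xi> \<alpha> f Y) \<and>
    (\<forall>Y. continuous_version M \<xi> \<alpha> f Y \<longrightarrow>
       (\<forall>r lam :: real.
          prob_le M (\<lambda>\<omega>. (SUP t\<in>{0..1}. Y t \<omega>) > lam)
            ((LBINT x = ereal (lam * r) / ereal (sqrt (fbm_q \<alpha> (pos_part f) 0 1)) .. \<infinity>.
                sqrt (2 / pi) * exp (- x\<^sup>2 / 2)) +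
             (LBINT x = ereal (lam * (1 - r)) / ereal (sqrt (fbm_q \<alpha> (neg_part f) 0 1)) .. \<infinity>.
                sqrt (2 / pi) * exp (- x\<^sup>2 / 2)))) \<and>
       (\<forall>m :: nat. m \<ge> 2 \<longrightarrow>
          fbm_c \<alpha> f m < \<infinity> \<and>
          (\<forall>lam :: real. lam \<ge> sqrt (1 + ln (real m ^ 4)) \<longrightarrow>
             prob_le M (\<lambda>\<omega>. (SUP t\<in>{0..1}. \<bar>Y t \<omega>\<bar>) > lam)
               (LBINT x = ereal lam / enn2ereal (fbm_c \<alpha> f m) .. \<infinity>.
                  5 / 2 * (real m)\<^sup>2 * exp (- x\<^sup>2 / 2)))))"
proof -
  interpret P: prob_space M by fact
  interpret fbm M \<alpha> "2 / (1 + \<alpha>)" \<xi>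
    using assms by unfold_locales auto
  obtain g where g: "borel_version f g" using borel_version_ex assms(5) by blast
  have lam: "0 < lam" if "m \<ge> 2" "lam \<ge> sqrt (1 + ln (real m ^ 4))" for m :: nat and lam :: real
  proof -
    have "0 \<le> ln (real m ^ 4)" using that(1) by (intro ln_ge_zero one_le_power) simp
    then have "0 < sqrt (1 + ln (real m ^ 4))" by simp
    then show ?thesis using that(2) by linarith
  qed
  show ?thesis
    using continuous_version_ex[OF g assms(6,7,8)] sup_bound_pos_neg[OF g, unfolded tail_integral_def]
      fbm_c_finite[OF g assms(6,7,8)] abs_sup_bound[OF g assms(6,7,8)] lam
    by blast
qed

end
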